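(* JavaScript regex matching without lower-bounded quantifiers and without lookarounds is OptP-complete. That is, $\mathrm{JSREGMATCH}_{\mathcal R}$ is OptP-complete (under metric reductions) when $\mathcal R$ is the set of all JavaScript regexes without lower-bounded quantifiers and without lookarounds.
   Context: **Regexes.** Fix a finite alphabet $\Sigma$ (of the JavaScript characters) with a designated subset of word characters. JavaScript regexes without lookarounds are generated by: empty regex $\varepsilon$; character descriptor $cd\subseteq\Sigma$ (a single character $c$ stands for $\{c\}$); disjunction $r_1|r_2$; sequence $r_1r_2$; capture group $({}_g\,r)$ with group identifier $g$ (each identifier is used by at most one capture group of a regex); backreference $\backslash g$; quantifier $r\{min,\Delta,\kappa\}$ with $min\in\mathbb N$ the minimum number of repetitions, $\Delta\in\mathbb N\cup\{\infty\}$ the difference between maximum and minimum, and $\kappa=\top$ (greedy) or $\bot$ (lazy), the star being $r*=r\{0,\infty,\top\}$; anchors ^, $\$$, $\backslash b$, $\backslash B$. A quantifier is *lower-bounded* if $min\neq0$. **Semantics (ECMAScript backtracking semantics, no flags).** Fix a string $s=s_0\cdots s_{|s|-1}$ over $\Sigma$. A group map $\gamma$ assigns to each group identifier "undefined", "opened at $a$", or a closed range $(a,b)$, $a\le b$; $\emptyset$ is everywhere undefined. An action is a regex, $\mathrm{Aclose}\,g$, or $\mathrm{Acheck}\,k$ ($k$ a position). For a list of actions $l$, position $0\le p\le|s|$ and group map $\gamma$, the ordered list of results (leaves of the backtracking tree, highest priority first) $L(l,p,\gamma)$ is given by the following rules, where $\mathbin{+\!+}$ is list concatenation and $\gamma\setminus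 r$ is $\gamma$ with all groups occurring in $r$ made undefined: - $L([],p,\gamma)=[(p,\gamma)]$. - $L(\mathrm{Acheck}\,k::l,p,\gamma)=L(l,p,\gamma)$ if $p>k$, else $[]$. - $L(\mathrm{Aclose}\,g::l,p,\gamma)=L(l,p,\gamma[g\mapsto(a,p)])$, where $g$ is opened at $a$ in $\gamma$. - $L(\varepsilon::l,p,\gamma)=L(l,p,\gamma)$. - $L(cd::l,p,\gamma)=L(l,p+1,\gamma)$ if $p<|s|$ and $s_p\in cd$, else $[]$. - $L((r_1|r_2)::l,p,\gamma)=L(r_1::l,p,\gamma)\mathbin{+\!+}L(r_2::l,p,\gamma)$. - $L(r_1r_2::l,p,\gamma)=L(r_1::r_2::l,p,\gamma)$. - $L(r\{0,0,\kappa\}::l,p,\gamma)=L(l,p,\gamma)$. - For $\Delta>0$, with $I=L(r::\mathrm{Acheck}\,p::r\{0,\Delta-1,\kappa\}::l,p,\gamma\setminus r)$ (where $\infty-1=\infty$) and $S=L(l,p,\gamma)$: $L(r\{0,\Delta,\top\}::l,p,\gamma)=I\mathbin{+\!+}S$ and $L(r\{0,\Delta,\bot\}::l,p,\gamma)=S\mathbin{+\!+}I$. - $L(({}_g\,r)::l,p,\gamma)=L(r::\mathrm{Aclose}\,g::l,p,\gamma[g\mapsto\text{opened at }p])$. - Anchors: $L(l,p,\gamma)$ if the anchor is satisfied at $p$, else $[]$; ^ is satisfied iff $p=0$, $\$$ iff $p=|s|$, $\backslash b$ iff exactly one of "$p>0$ and $s_{p-1}$ is a word character", "$p<|s|$ and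 $s_p$ is a word character" holds, $\backslash B$ iff $\backslash b$ is not. - $L(\backslash g::l,p,\gamma)$: if $\gamma(g)$ is not a closed range, $L(l,p,\gamma)$; if $\gamma(g)=(a,b)$ and $w=s_a\cdots s_{b-1}$, then $L(l,p+|w|,\gamma)$ if $w$ occurs in $s$ at position $p$, else $[]$. **Problem.** $\mathrm{JSREGMATCH}_{\mathcal R}$ is: given $r\in\mathcal R$ and a string $s$, compute the highest-priority match of $r$ on $s$, if it exists: for the least starting position $0\le k\le|s|$ with $L([r],k,\emptyset)\ne[]$, the answer is $k$ together with the first element $(p,\gamma)$ of that list (end position and group map); if there is no such $k$, the answer is "no match". **Instance size.** $r$ is given by its syntax tree (numbers $\Delta$ and group identifiers in binary; regex parsing is out of scope); complexity is measured in $|s|$ and the size of $r$ (and the bit lengths of those numbers), where $|\varepsilon|=|cd|=|\text{anchor}|=|\backslash g|=1$, $|r_1|r_2|=|r_1r_2|=1+|r_1|+|r_2|$, $|r\{0,\Delta,\kappa\}|=3+|r|$, $|({}_g\,r)|=2+|r|$. **OptP.** OptP is the class of optimization problems that can be solved by taking a nondeterministic Turing machine that runs in polynomial time and outputs a binary number on each accepting branch, and returning the minimal (or maximal) number output over all accepting branches. For the matching problem, solving it this way means that the optimal output encodes (determines, by a polynomial-time decoding) the answer, namely the highest-priority match or "no match". A *metric reduction* from $f$ to $g$ (functions from words to $\mathbb N$) is a pair of polynomial-time computable functions $(T_1,T_2)$ with $f(x)=T_2(x,g(T_1(x)))$ for all $x$; for $g$ the matching problem, answers are encoded as natural numbers in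 a standard polynomial-time way. A problem is OptP-hard if every problem in OptP metrically reduces to it, and OptP-complete if moreover it is in OptP. *)

theory Defs
  imports
    Complex_Main
    "HOL-Library.Extended_Nat"
    "HOL-Computational_Algebra.Polynomial"
begin

section \<open>JavaScript regexes without lookarounds\<close>

text \<open>The alphabet is an arbitrary finite type \<open>'c\<close> of characters; class \<open>enum\<close> is only used to
  write characters and character sets down as bit strings.\<close>

datatype anchor = Input_Start | Input_End | Word_Boundary | Non_Word_Boundary

datatype 'c regex =
    Empty
  | Char_Descr "'c set"
  | Disj "'c regex" "'c regex"
  | Sequ "'c regex" "'c regex"
  | Group nat "'c regex"
  | Backref nat
  | Quant nat enat bool "'c regex"  \<comment> \<open>minimum, maximum - minimum, greedy?, body\<close>
  | Anchor anchor

fun groups :: "'c regex \<Rightarrow> nat list" where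
  "groups Empty = []"
| "groups (Char_Descr A) = []"
| "groups (Disj r1 r2) = groups r1 @ groups r2"
| "groups (Sequ r1 r2) = groups r1 @ groups r2"
| "groups (Group g r) = g # groups r"
| "groups (Backref g) = []"
| "groups (Quant m d k r) = groups r"
| "groups (Anchor a) = []"

fun lower_bounded_free :: "'c regex \<Rightarrow> bool" where
  "lower_bounded_free Empty = True"
| "lower_bounded_free (Char_Descr A) = True"
| "lower_bounded_free (Disj r1 r2) = (lower_bounded_free r1 \<and> lower_bounded_free r2)"
| "lower_bounded_free (Sequ r1 r2) = (lower_bounded_free r1 \<and> lower_bounded_free r2)"
| "lower_bounded_free (Group g r) = lower_bounded_free r"
| "lower_bounded_free (Backref g) = True"
| "lower_bounded_free (Quant m d k r) = (m = 0 \<and> lower_bounded_free r)"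
| "lower_bounded_free (Anchor a) = True"

definition js_regexes :: "'c regex set" where
  "js_regexes = {r. distinct (groups r)}"

definition js_regexes_no_lower_bound :: "'c regex set" where
  "js_regexes_no_lower_bound = {r \<in> js_regexes. lower_bounded_free r}"


section \<open>Backtracking semantics\<close>

datatype group_status = Undefd | Opened nat | Closed nat nat

type_synonym group_map = "nat \<Rightarrow> group_status"

definition reset_groups :: "group_map \<Rightarrow> 'c regex \<Rightarrow> group_map" where
  "reset_groups \<gamma> r = (\<lambda>g. if g \<in> set (groups r) then Undefd else \<gamma> g)"

definition word_boundary :: "'c set \<Rightarrow> 'c list \<Rightarrow> nat \<Rightarrow> bool" where
  "word_boundary W s p \<longleftrightarrow> (p > 0 \<and> s ! (p - 1) \<in> W) \<noteq> (p < length s \<and> s ! p \<in> W)"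

fun anchor_sat :: "'c set \<Rightarrow> 'c list \<Rightarrow> anchor \<Rightarrow> nat \<Rightarrow> bool" where
  "anchor_sat W s Input_Start p \<longleftrightarrow> p = 0"
| "anchor_sat W s Input_End p \<longleftrightarrow> p = length s"
| "anchor_sat W s Word_Boundary p \<longleftrightarrow> word_boundary W s p"
| "anchor_sat W s Non_Word_Boundary p \<longleftrightarrow> \<not> word_boundary W s p"

definition occurs_at :: "'c list \<Rightarrow> 'c list \<Rightarrow> nat \<Rightarrow> bool" where
  "occurs_at w s p \<longleftrightarrow> p + length w \<le> length s \<and> take (length w) (drop p s) = w"

datatype 'c action = Areg "'c regex" | Aclose nat | Acheck nat

text \<open>A termination measure for the backtracking semantics: \<open>d\<close> bounds the number of characters
  that can still be consumed, and \<open>N\<close> is the largest reachable position.\<close>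

fun regex_weight :: "'c regex \<Rightarrow> nat \<Rightarrow> nat" where
  "regex_weight Empty d = 1"
| "regex_weight (Char_Descr A) d = 1"
| "regex_weight (Disj r1 r2) d = 1 + regex_weight r1 d + regex_weight r2 d"
| "regex_weight (Sequ r1 r2) d = 1 + regex_weight r1 d + regex_weight r2 d"
| "regex_weight (Group g r) d = 2 + regex_weight r d"
| "regex_weight (Backref g) d = 1"
| "regex_weight (Quant m \<Delta> k r) d =
     m * (1 + regex_weight r d) + 1 + (\<Sum>i\<le>d. 2 + regex_weight r i)"
| "regex_weight (Anchor a) d = 1"

fun actions_weight :: "nat \<Rightarrow> 'c action list \<Rightarrow> nat \<Rightarrow> nat" where
  "actions_weight N [] d = 0"
| "actions_weight N (Areg r # l) d = regex_weight r d + actions_weight N l d"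
| "actions_weight N (Aclose g # l) d = 1 + actions_weight N l d"
| "actions_weight N (Acheck k # l) d =
     1 + (if k < N then actions_weight N l (min d (N - k - 1)) else 0)"

lemma regex_weight_mono: "d \<le> d' \<Longrightarrow> regex_weight r d \<le> regex_weight r d'"
proof (induction r)
  case (Quant m \<Delta> k r)
  have "(\<Sum>i\<le>d. 2 + regex_weight r i) \<le> (\<Sum>i\<le>d'. 2 + regex_weight r i)"
    using Quant.prems by (intro sum_mono2) auto
  then show ?case
    using Quant by (auto intro!: add_mono mult_le_mono2)
qed (auto intro: add_mono)

lemma actions_weight_mono: "d \<le> d' \<Longrightarrow> actions_weight N l d \<le> actions_weight N l d'"
  by (induction N l d arbitrary: d' rule: actions_weight.induct)
     (auto intro!: add_mono regex_weight_mono min.mono)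

lemma regex_weight_pos: "0 < regex_weight r d"
  by (cases r) auto

lemma actions_weight_iterate:
  "regex_weight r d
     + actions_weight N (Acheck (N - d) # Areg (Quant 0 \<Delta>' k r) # l) d
   < actions_weight N (Areg (Quant 0 \<Delta> k r) # l) d" if "d \<le> N"
proof (cases d)
  case 0
  then show ?thesis by simp
next
  case (Suc e)
  have "actions_weight N l e \<le> actions_weight N l (Suc e)"
    by (rule actions_weight_mono) simp
  moreover have "N - (N - Suc e) - 1 = e" "N - Suc e < N"
    using that Suc by auto
  ultimately show ?thesis
    using Suc by (simp add: min_def)
qed

text \<open>\<open>leaves W s l p \<gamma>\<close> is the list L(l, p, \<gamma>) for the input string \<open>s\<close> and the word characters
  \<open>W\<close>.  Two cases are never reached from a single regex in \<open>js_regexes_no_lower_bound\<close>: closing a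
  group that is not open, and quantifiers with a positive minimum, for which we use the ECMAScript
  rule (mandatory iterations are not subject to the progress check).\<close>

function (sequential) leaves ::
  "'c set \<Rightarrow> 'c list \<Rightarrow> 'c action list \<Rightarrow> nat \<Rightarrow> group_map \<Rightarrow> (nat \<times> group_map) list" where
  "leaves W s [] p \<gamma> = [(p, \<gamma>)]"
| "leaves W s (Acheck k # l) p \<gamma> = (if p > k then leaves W s l p \<gamma> else [])"
| "leaves W s (Aclose g # l) p \<gamma> =
     (case \<gamma> g of Opened a \<Rightarrow> leaves W s l p (\<gamma>(g := Closed a p)) | _ \<Rightarrow> [])"
| "leaves W s (Areg Empty # l) p \<gamma> = leaves W s l p \<gamma>"
| "leaves W s (Areg (Char_Descr A) # l) p \<gamma> =
     (if p < length s \<and> s ! p \<in> A then leaves W s l (p + 1) \<gamma> else [])"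
| "leaves W s (Areg (Disj r1 r2) # l) p \<gamma> =
     leaves W s (Areg r1 # l) p \<gamma> @ leaves W s (Areg r2 # l) p \<gamma>"
| "leaves W s (Areg (Sequ r1 r2) # l) p \<gamma> = leaves W s (Areg r1 # Areg r2 # l) p \<gamma>"
| "leaves W s (Areg (Quant 0 \<Delta> greedy r) # l) p \<gamma> =
     (if \<Delta> = 0 then leaves W s l p \<gamma>
      else
        let iterate = leaves W s (Areg r # Acheck p # Areg (Quant 0 (\<Delta> - 1) greedy r) # l) p
                        (reset_groups \<gamma> r);
            skip = leaves W s l p \<gamma>
        in if greedy then iterate @ skip else skip @ iterate)"
| "leaves W s (Areg (Quant (Suc m) \<Delta> greedy r) # l) p \<gamma> =
     leaves W s (Areg r # Areg (Quant m \<Delta> greedy r) # l) p (reset_groups \<gamma> r)"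
| "leaves W s (Areg (Group g r) # l) p \<gamma> =
     leaves W s (Areg r # Aclose g # l) p (\<gamma>(g := Opened p))"
| "leaves W s (Areg (Anchor a) # l) p \<gamma> =
     (if anchor_sat W s a p then leaves W s l p \<gamma> else [])"
| "leaves W s (Areg (Backref g) # l) p \<gamma> =
     (case \<gamma> g of
        Closed a b \<Rightarrow>
          (let w = take (b - a) (drop a s)
           in if occurs_at w s p then leaves W s l (p + length w) \<gamma> else [])
      | _ \<Rightarrow> leaves W s l p \<gamma>)"
  by pat_completeness auto

termination
proof (relation "measure (\<lambda>(W, s, l, p, \<gamma>).
    actions_weight (max p (length s)) l (max p (length s) - p))", goal_cases)
  case (2 W s k l p \<gamma>)
  then show ?case
    by (auto simp: min_def)
next
  case (5 W s A l p \<gamma>)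
  have "actions_weight (length s) l (length s - Suc p) \<le> actions_weight (length s) l (length s - p)"
    by (rule actions_weight_mono) simp
  then show ?case
    using 5 by (simp add: max_def less_Suc_eq_le)
next
  case (10 W s \<Delta> greedy r l p \<gamma>)
  show ?case
    using actions_weight_iterate[of "max p (length s) - p" "max p (length s)" r "\<Delta> - 1" greedy l \<Delta>]
    by (simp add: max_def split: if_splits)
next
  case (17 W s g l p \<gamma> a b w)
  then show ?case
    using actions_weight_mono[of "length s - (p + length w)" "length s - p" "length s" l]
    by (auto simp: occurs_at_def max_def less_Suc_eq_le)
qed (auto simp: regex_weight_pos less_Suc_eq_le intro: actions_weight_mono)

definition js_match :: "'c set \<Rightarrow> 'c regex \<Rightarrow> 'c list \<Rightarrow> (nat \<times> nat \<times> group_map) option" where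
  "js_match W r s =
     (let matches_at = (\<lambda>k. leaves W s [Areg r] k (\<lambda>_. Undefd))
      in if \<exists>k\<le>length s. matches_at k \<noteq> []
         then let k = (LEAST k. matches_at k \<noteq> [])
              in Some (k, hd (matches_at k))
         else None)"


section \<open>Words and numbers\<close>

text \<open>Words are bit strings; binary numerals are written with the most significant bit first.\<close>

type_synonym word = "bool list"

fun bin :: "nat \<Rightarrow> word" where
  "bin n = (if n = 0 then [] else bin (n div 2) @ [odd n])"

declare bin.simps [simp del]

definition bin_val :: "word \<Rightarrow> nat" where
  "bin_val w = horner_sum of_bool 2 (rev w)"

lemma bin_val_bin: "bin_val (bin n) = n"
proof (induction n rule: bin.induct)
  case (1 n)
  show ?case
  proof (cases "n = 0")
    case True
    then show ?thesis by (simp add: bin.simps bin_val_def)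
  next
    case False
    then have "bin_val (bin n) = of_bool (odd n) + 2 * bin_val (bin (n div 2))"
      by (subst bin.simps) (simp add: bin_val_def)
    also have "\<dots> = n"
      using 1 False by simp
    finally show ?thesis .
  qed
qed


section \<open>The encoding of instances and answers\<close>

text \<open>Every code below is prefix-free.  Each character takes a constant number of bits, since the
  alphabet is fixed, and a number \<open>n\<close> takes \<open>2 * length (bin n) + 1\<close> bits.\<close>

definition enc_nat :: "nat \<Rightarrow> word" where
  "enc_nat n = concat (map (\<lambda>b. [True, b]) (bin n)) @ [False]"

fun enc_enat :: "enat \<Rightarrow> word" where
  "enc_enat (enat n) = False # enc_nat n"
| "enc_enat \<infinity> = [True]"

definition enc_charset :: "'c::enum set \<Rightarrow> word" where
  "enc_charset A = map (\<lambda>c. c \<in> A) Enum.enum"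

fun enc_anchor :: "anchor \<Rightarrow> word" where
  "enc_anchor Input_Start = [False, False]"
| "enc_anchor Input_End = [False, True]"
| "enc_anchor Word_Boundary = [True, False]"
| "enc_anchor Non_Word_Boundary = [True, True]"

fun enc_regex :: "'c::enum regex \<Rightarrow> word" where
  "enc_regex Empty = [False, False, False]"
| "enc_regex (Char_Descr A) = [False, False, True] @ enc_charset A"
| "enc_regex (Disj r1 r2) = [False, True, False] @ enc_regex r1 @ enc_regex r2"
| "enc_regex (Sequ r1 r2) = [False, True, True] @ enc_regex r1 @ enc_regex r2"
| "enc_regex (Group g r) = [True, False, False] @ enc_nat g @ enc_regex r"
| "enc_regex (Backref g) = [True, False, True] @ enc_nat g"
| "enc_regex (Quant m \<Delta> greedy r) =
     [True, True, False] @ enc_nat m @ enc_enat \<Delta> @ [greedy] @ enc_regex r"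
| "enc_regex (Anchor a) = [True, True, True] @ enc_anchor a"

definition enc_string :: "'c::enum list \<Rightarrow> word" where
  "enc_string s = concat (map (\<lambda>c. enc_charset {c}) s)"

definition enc_instance :: "'c::enum regex \<Rightarrow> 'c list \<Rightarrow> word" where
  "enc_instance r s = enc_regex r @ enc_string s"

lemma enc_nat_inj: "enc_nat m @ u = enc_nat n @ v \<longleftrightarrow> m = n \<and> u = v"
proof -
  have *: "concat (map (\<lambda>b. [True, b]) xs) @ False # u = concat (map (\<lambda>b. [True, b]) ys) @ False # v
      \<longleftrightarrow> xs = ys \<and> u = v" for xs ys
  proof (induction xs arbitrary: ys)
    case Nil
    then show ?case by (cases ys) auto
  next
    case (Cons x xs)
    then show ?case by (cases ys) auto
  qed
  show ?thesis
    using *[of "bin m" "bin n"] bin_val_bin by (auto simp: enc_nat_def) metis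
qed

lemma enc_enat_inj: "enc_enat m @ u = enc_enat n @ v \<longleftrightarrow> m = n \<and> u = v"
  by (cases m; cases n) (auto simp: enc_nat_inj)

lemma length_enc_charset: "length (enc_charset (A :: 'c::enum set)) = card (UNIV :: 'c set)"
  by (simp add: enc_charset_def card_UNIV_length_enum)

lemma enc_charset_inj:
  fixes A B :: "'c::enum set"
  shows "enc_charset A @ u = enc_charset B @ v \<longleftrightarrow> A = B \<and> u = v"
proof -
  have "enc_charset A = enc_charset B \<longleftrightarrow> A = B"
    by (auto simp: enc_charset_def enum_UNIV)
  then show ?thesis
    by (simp add: length_enc_charset append_eq_append_conv)
qed

lemma enc_anchor_inj: "enc_anchor a @ u = enc_anchor b @ v \<longleftrightarrow> a = b \<and> u = v"
  by (cases a; cases b) auto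

lemma enc_regex_inj: "enc_regex r @ u = enc_regex r' @ v \<longleftrightarrow> r = r' \<and> u = v"
proof (induction r arbitrary: r' u v)
  case Empty
  then show ?case by (cases r') auto
next
  case (Char_Descr A)
  then show ?case by (cases r') (auto simp: enc_charset_inj)
next
  case (Disj r1 r2)
  then show ?case by (cases r') auto
next
  case (Sequ r1 r2)
  then show ?case by (cases r') auto
next
  case (Group g r)
  then show ?case by (cases r') (auto simp: enc_nat_inj)
next
  case (Backref g)
  then show ?case by (cases r') (auto simp: enc_nat_inj)
next
  case (Quant m \<Delta> greedy r)
  then show ?case by (cases r') (auto simp: enc_nat_inj enc_enat_inj)
next
  case (Anchor a)
  then show ?case by (cases r') (auto simp: enc_anchor_inj)
qed

lemma enc_string_inj: "enc_string s = enc_string s' \<longleftrightarrow> s = s'"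
proof (induction s arbitrary: s')
  case Nil
  have "enc_charset {c} \<noteq> []" for c :: 'a
    using length_enc_charset[of "{c}"] by (metis card_eq_0_iff empty_not_UNIV finite list.size(3))
  then show ?case by (cases s') (auto simp: enc_string_def)
next
  case (Cons c s)
  have "enc_charset {c} \<noteq> []"
    using length_enc_charset[of "{c}"] by (metis card_eq_0_iff empty_not_UNIV finite list.size(3))
  then show ?case
    using Cons by (cases s') (auto simp: enc_string_def enc_charset_inj)
qed

lemma enc_instance_inj: "enc_instance r s = enc_instance r' s' \<longleftrightarrow> r = r' \<and> s = s'"
  by (simp add: enc_instance_def enc_regex_inj enc_string_inj)

text \<open>The length of a code is, up to constant factors, the size of the instance together with the
  bit lengths of the numbers that occur in it.\<close>

fun regex_size :: "'c regex \<Rightarrow> nat" where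
  "regex_size Empty = 1"
| "regex_size (Char_Descr A) = 1"
| "regex_size (Disj r1 r2) = 1 + regex_size r1 + regex_size r2"
| "regex_size (Sequ r1 r2) = 1 + regex_size r1 + regex_size r2"
| "regex_size (Group g r) = 2 + regex_size r"
| "regex_size (Backref g) = 1"
| "regex_size (Quant m \<Delta> greedy r) = 3 + regex_size r"
| "regex_size (Anchor a) = 1"

fun number_bits :: "'c regex \<Rightarrow> nat" where
  "number_bits (Disj r1 r2) = number_bits r1 + number_bits r2"
| "number_bits (Sequ r1 r2) = number_bits r1 + number_bits r2"
| "number_bits (Group g r) = length (bin g) + number_bits r"
| "number_bits (Backref g) = length (bin g)"
| "number_bits (Quant m \<Delta> greedy r) =
     length (bin m) + (case \<Delta> of enat n \<Rightarrow> length (bin n) | \<infinity> \<Rightarrow> 0) + number_bits r"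
| "number_bits _ = 0"

lemma length_enc_nat: "length (enc_nat n) = 2 * length (bin n) + 1"
proof -
  have "length (concat (map (\<lambda>b. [True, b]) xs)) = 2 * length xs" for xs :: "bool list"
    by (induction xs) auto
  then show ?thesis by (simp add: enc_nat_def)
qed

lemma length_enc_string:
  fixes s :: "'c::enum list"
  shows "length (enc_string s) = card (UNIV :: 'c set) * length s"
  by (induction s) (auto simp: enc_string_def length_enc_charset)

lemma length_enc_regex:
  fixes r :: "'c::enum regex"
  shows "regex_size r + number_bits r \<le> length (enc_regex r)"
    and "length (enc_regex r) \<le> card (UNIV :: 'c set) * regex_size r + 8 * regex_size r + 2 * number_bits r"
proof (induction r)
  case (Quant m \<Delta> greedy r)
  {
    case 1
    then show ?case using Quant(1) by (cases \<Delta>) (auto simp: length_enc_nat)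
  next
    case 2
    then show ?case using Quant(2) by (cases \<Delta>) (auto simp: length_enc_nat algebra_simps)
  }
next
  case (Anchor a)
  {
    case 1
    then show ?case by (cases a) auto
  next
    case 2
    then show ?case by (cases a) auto
  }
qed (auto simp: length_enc_nat length_enc_charset algebra_simps)

lemma length_enc_instance:
  fixes r :: "'c::enum regex"
  shows "regex_size r + number_bits r + length s \<le> length (enc_instance r s)"
    and "length (enc_instance r s)
      \<le> (card (UNIV :: 'c set) + 8) * (regex_size r + number_bits r + length s)"
proof -
  have "card (UNIV :: 'c set) \<ge> 1"
    by (simp add: Suc_le_eq card_gt_0_iff)
  then have "length s \<le> card (UNIV :: 'c set) * length s"
    by simp
  then show "regex_size r + number_bits r + length s \<le> length (enc_instance r s)"
    using length_enc_regex(1)[of r]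
    unfolding enc_instance_def length_append length_enc_string by linarith
  show "length (enc_instance r s)
      \<le> (card (UNIV :: 'c set) + 8) * (regex_size r + number_bits r + length s)"
    using length_enc_regex(2)[of r] by (simp add: enc_instance_def length_enc_string algebra_simps)
qed

text \<open>Answers: \<open>0\<close> stands for "no match", and a match is the binary numeral of a word starting with
  \<open>1\<close> that lists the start and end positions and the status of each group of \<open>r\<close> (all other groups
  are undefined in the final group map).\<close>

fun enc_status :: "group_status \<Rightarrow> word" where
  "enc_status Undefd = [False, False]"
| "enc_status (Opened a) = [False, True] @ enc_nat a"
| "enc_status (Closed a b) = [True] @ enc_nat a @ enc_nat b"

fun enc_answer :: "'c regex \<Rightarrow> (nat \<times> nat \<times> group_map) option \<Rightarrow> nat" where
  "enc_answer r None = 0"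
| "enc_answer r (Some (k, p, \<gamma>)) =
     bin_val ([True] @ enc_nat k @ enc_nat p @
              concat (map (\<lambda>g. enc_nat g @ enc_status (\<gamma> g)) (groups r)))"

lemma bin_bin_val: "bin (bin_val (True # u)) = True # u"
proof (induction u rule: rev_induct)
  case Nil
  show ?case by (simp add: bin_val_def bin.simps)
next
  case (snoc b u)
  have *: "bin_val (True # u @ [b]) = of_bool b + 2 * bin_val (True # u)"
    by (simp add: bin_val_def)
  have "bin_val (True # u) \<noteq> 0"
    using snoc by (metis bin.simps list.distinct(1))
  then have "bin (bin_val (True # u @ [b])) = bin (bin_val (True # u)) @ [b]"
    by (subst bin.simps) (auto simp: *)
  then show ?case using snoc by simp
qed

lemma enc_status_inj: "enc_status x @ u = enc_status y @ v \<longleftrightarrow> x = y \<and> u = v"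
  by (cases x; cases y) (auto simp: enc_nat_inj)

lemma enc_answer_inj:
  "enc_answer r (Some (k, p, \<gamma>)) = enc_answer r (Some (k', p', \<gamma>')) \<longleftrightarrow>
     k = k' \<and> p = p' \<and> (\<forall>g \<in> set (groups r). \<gamma> g = \<gamma>' g)"
proof -
  have "concat (map (\<lambda>g. enc_nat g @ enc_status (\<gamma> g)) gs) =
        concat (map (\<lambda>g. enc_nat g @ enc_status (\<gamma>' g)) gs)
      \<longleftrightarrow> (\<forall>g \<in> set gs. \<gamma> g = \<gamma>' g)" for gs
    by (induction gs) (auto simp: enc_status_inj)
  moreover have "bin_val (True # u) = bin_val (True # v) \<longleftrightarrow> u = v" for u v
    by (metis bin_bin_val list.inject)
  ultimately show ?thesis
    by (simp add: enc_nat_inj)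
qed

lemma enc_answer_Some_neq_0: "enc_answer r (Some (k, p, \<gamma>)) \<noteq> 0"
proof
  assume "enc_answer r (Some (k, p, \<gamma>)) = 0"
  then have "bin (bin_val (True # enc_nat k @ enc_nat p @
      concat (map (\<lambda>g. enc_nat g @ enc_status (\<gamma> g)) (groups r)))) = []"
    by (simp add: bin.simps)
  then show False by (simp add: bin_bin_val)
qed

text \<open>The matching problem as a function on words.  Words that encode no instance get the answer
  "no match".\<close>

definition jsregmatch :: "'c::enum set \<Rightarrow> 'c regex set \<Rightarrow> word \<Rightarrow> nat" where
  "jsregmatch W R w =
     (if \<exists>r\<in>R. \<exists>s. w = enc_instance r s
      then THE n. \<exists>r\<in>R. \<exists>s. w = enc_instance r s \<and> n = enc_answer r (js_match W r s)
      else 0)"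

lemma jsregmatch_enc_instance:
  "r \<in> R \<Longrightarrow> jsregmatch W R (enc_instance r s) = enc_answer r (js_match W r s)"
  by (auto simp: jsregmatch_def enc_instance_inj)


section \<open>Multi-tape nondeterministic Turing machines\<close>

text \<open>States and tape symbols are natural numbers; finiteness of the instruction set makes the
  state set and the tape alphabet finite.  Tapes are infinite in both directions.  An instruction
  \<open>(q, as, q', bs, ms)\<close> is applicable in state \<open>q\<close> when the scanned symbols are \<open>as\<close>; it writes
  \<open>bs\<close>, performs the head moves \<open>ms\<close> and goes to state \<open>q'\<close>.\<close>

datatype move = Move_Left | Stay | Move_Right

type_synonym instruction = "nat \<times> nat list \<times> nat \<times> nat list \<times> move list"

datatype ntm =
  NTM (num_tapes: nat) (start_state: nat) (accept_state: nat) (instrs: "instruction set")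

definition wf_ntm :: "ntm \<Rightarrow> bool" where
  "wf_ntm M \<longleftrightarrow> num_tapes M > 0 \<and> finite (instrs M) \<and>
     (\<forall>(q, as, q', bs, ms) \<in> instrs M.
        length as = num_tapes M \<and> length bs = num_tapes M \<and> length ms = num_tapes M)"

definition deterministic :: "ntm \<Rightarrow> bool" where
  "deterministic M \<longleftrightarrow>
     (\<forall>q as x y. (q, as, x) \<in> instrs M \<longrightarrow> (q, as, y) \<in> instrs M \<longrightarrow> x = y)"

type_synonym tape = "(int \<Rightarrow> nat) \<times> int"  \<comment> \<open>cell contents, head position\<close>

type_synonym config = "nat \<times> tape list"

definition blank :: nat where
  "blank = 0"

definition bit_symbol :: "bool \<Rightarrow> nat" where
  "bit_symbol b = (if b then 2 else 1)"

fun move_offset :: "move \<Rightarrow> int" where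
  "move_offset Move_Left = - 1"
| "move_offset Stay = 0"
| "move_offset Move_Right = 1"

fun read_tape :: "tape \<Rightarrow> nat" where
  "read_tape (t, h) = t h"

fun update_tape :: "tape \<times> nat \<times> move \<Rightarrow> tape" where
  "update_tape ((t, h), b, m) = (t(h := b), h + move_offset m)"

definition tm_step :: "ntm \<Rightarrow> config \<Rightarrow> config \<Rightarrow> bool" where
  "tm_step M c c' \<longleftrightarrow>
     (\<exists>bs ms. (fst c, map read_tape (snd c), fst c', bs, ms) \<in> instrs M \<and>
        snd c' = map update_tape (zip (snd c) (zip bs ms)))"

definition input_tape :: "word \<Rightarrow> tape" where
  "input_tape w =
     (\<lambda>i. if 0 \<le> i \<and> i < int (length w) then bit_symbol (w ! nat i) else blank, 0)"

text \<open>The input words are written on the first tapes, all other tapes are blank.\<close>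

definition initial_config :: "ntm \<Rightarrow> word list \<Rightarrow> config" where
  "initial_config M ws =
     (start_state M,
      map (\<lambda>j. input_tape (if j < length ws then ws ! j else [])) [0..<num_tapes M])"

definition tm_reaches :: "ntm \<Rightarrow> word list \<Rightarrow> nat \<Rightarrow> config \<Rightarrow> bool" where
  "tm_reaches M ws t c \<longleftrightarrow> (tm_step M ^^ t) (initial_config M ws) c"

definition accepting :: "ntm \<Rightarrow> config \<Rightarrow> bool" where
  "accepting M c \<longleftrightarrow> fst c = accept_state M \<and> (\<nexists>c'. tm_step M c c')"

text \<open>The output is the bit string on the last tape from cell 0 up to the first blank.\<close>

definition has_output :: "config \<Rightarrow> word \<Rightarrow> bool" where
  "has_output c w \<longleftrightarrow>
     (\<forall>i<length w. fst (last (snd c)) (int i) = bit_symbol (w ! i)) \<and>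
     fst (last (snd c)) (int (length w)) = blank"


section \<open>Polynomial-time functions, OptP and metric reductions\<close>

definition total_length :: "word list \<Rightarrow> nat" where
  "total_length ws = sum_list (map length ws)"

text \<open>Polynomial-time computability of a function on objects that are presented to the machine as
  tuples of words by \<open>inp\<close>, one word per tape, and whose values are written as words by \<open>out\<close>.\<close>

definition poly_time_computable ::
  "('i \<Rightarrow> word list) \<Rightarrow> ('o \<Rightarrow> word) \<Rightarrow> ('i \<Rightarrow> 'o) \<Rightarrow> bool" where
  "poly_time_computable inp out f \<longleftrightarrow>
     (\<exists>M (p :: nat poly). wf_ntm M \<and> deterministic M \<and>
        (\<forall>x. \<exists>t c. t \<le> poly p (total_length (inp x)) \<and> tm_reaches M (inp x) t c \<and>
             accepting M c \<and> has_output c (out (f x))))"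

definition poly_time_ntm :: "ntm \<Rightarrow> bool" where
  "poly_time_ntm M \<longleftrightarrow> wf_ntm M \<and>
     (\<exists>p :: nat poly. \<forall>x t c. tm_reaches M [x] t c \<longrightarrow> t \<le> poly p (length x))"

definition ntm_outputs :: "ntm \<Rightarrow> word \<Rightarrow> nat set" where
  "ntm_outputs M x =
     {bin_val w | w. \<exists>t c. tm_reaches M [x] t c \<and> accepting M c \<and> has_output c w}"

text \<open>OptP as a class of functions from words to numbers; every instance must have an accepting
  branch, as otherwise there is no optimum.\<close>

definition OptP :: "(word \<Rightarrow> nat) set" where
  "OptP = {f. \<exists>M. poly_time_ntm M \<and>
     (\<forall>x t c. tm_reaches M [x] t c \<longrightarrow> accepting M c \<longrightarrow> (\<exists>w. has_output c w)) \<and>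
     ((\<forall>x. f x \<in> ntm_outputs M x \<and> (\<forall>v \<in> ntm_outputs M x. f x \<le> v)) \<or>
      (\<forall>x. f x \<in> ntm_outputs M x \<and> (\<forall>v \<in> ntm_outputs M x. v \<le> f x)))}"

text \<open>A problem whose answers are not themselves optimal values is solved in OptP when the optimal
  value determines the answer by a polynomial-time decoding.\<close>

definition solvable_in_OptP :: "(word \<Rightarrow> nat) \<Rightarrow> bool" where
  "solvable_in_OptP g \<longleftrightarrow>
     (\<exists>h \<in> OptP. \<exists>D. poly_time_computable (\<lambda>n. [bin n]) bin D \<and> (\<forall>x. g x = D (h x)))"

definition metric_reduction ::
  "(word \<Rightarrow> nat) \<Rightarrow> (word \<Rightarrow> nat) \<Rightarrow> (word \<Rightarrow> word) \<Rightarrow> (word \<Rightarrow> nat \<Rightarrow> nat) \<Rightarrow> bool" where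
  "metric_reduction f g T1 T2 \<longleftrightarrow>
     poly_time_computable (\<lambda>x. [x]) (\<lambda>y. y) T1 \<and>
     poly_time_computable (\<lambda>(x, n). [x, bin n]) bin (\<lambda>(x, n). T2 x n) \<and>
     (\<forall>x. f x = T2 x (g (T1 x)))"

definition metrically_reducible :: "(word \<Rightarrow> nat) \<Rightarrow> (word \<Rightarrow> nat) \<Rightarrow> bool" where
  "metrically_reducible f g \<longleftrightarrow> (\<exists>T1 T2. metric_reduction f g T1 T2)"

definition OptP_hard :: "(word \<Rightarrow> nat) \<Rightarrow> bool" where
  "OptP_hard g \<longleftrightarrow> (\<forall>f \<in> OptP. metrically_reducible f g)"

definition OptP_complete :: "(word \<Rightarrow> nat) \<Rightarrow> bool" where
  "OptP_complete g \<longleftrightarrow> solvable_in_OptP g \<and> OptP_hard g"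

end

(* Hardness: by the Cook-Levin construction, the accepting runs of an OptP machine are the solutions
   of a constraint satisfaction problem whose first variables are the bits of the output.  A regex
   over one character chooses a value for each variable by a disjunction of capture groups, and checks
   a constraint by a disjunction of sequences of backreferences: on a string of equal characters a
   backreference consumes a character iff its group was captured, and the string is so long that every
   backreference has to consume one.  The first match then yields the lexicographically optimal output.

   Membership: the machine guesses the start position and the choices at the branching nodes of the
   backtracking tree, as a word in which a larger number means a higher priority.  Every branch has
   polynomial length, because an iteration that consumes nothing fails its progress check; so between
   two characters each quantifier on the action list starts at most one iteration.  A successful guess
   is output with the match that it leads to, and an unsuccessful one yields 0.

   Polynomial-time computability is obtained from closure properties of the functions that are computed
   by a small stack language, whose programs are compiled to multi-tape machines. *)

theory Submission
  imports Defs
begin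

section \<open>Stack programs and their compilation to Turing machines\<close>

text \<open>Polynomial time has to be established down to single Turing steps, which dictates the
  toolkit. Data of all types are binary trees on one work stack, and a function counts as feasible
  (\<open>fp\<close>) only together with a polynomial bound on the size of its values: this is what
  survives composition, whereas iteration also demands a bound on every intermediate value. Many
  estimates below exist only to supply such bounds.

  In the reduction, minimising and maximising differ only in the value of an output bit that is
  tried first. A tableau has a fixed number of rows, hence accepting configurations are made to
  idle.

  For membership the guessed word must have a length that depends on the input alone. Therefore the
  start position becomes a number of leading zeros, bits left over by a short branch are free, and
  all outputs are padded to a common length, so that comparing numbers is comparing words. The
  decoder sees the optimum but not the instance, so the output must be readable without it.\<close>

type_synonym store = "nat \<Rightarrow> nat list"

definition scan :: "nat list \<Rightarrow> nat" where
  "scan xs = (case xs of [] \<Rightarrow> blank | x # _ \<Rightarrow> x)"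

text \<open>The head of tape 6 stands behind the symbols written so far, so it always reads a blank;
  a stack is read at its top, and an empty stack reads as a blank.\<close>

definition scans :: "store \<Rightarrow> nat list" where
  "scans \<sigma> = map (\<lambda>i. if i < 6 then scan (\<sigma> i) else blank) [0..<7]"

text \<open>Tapes \<open>0\<close> to \<open>5\<close> are used as stacks that grow to the left, with the head on the top symbol,
  so that an input tape is a stack as it stands.  Tape \<open>6\<close> only receives the output.\<close>

datatype prog =
    Pop nat
  | Push nat nat
  | Emit nat
  | Guess nat
  | Seq prog prog (infixr ";;" 60)
  | Ite "nat list \<Rightarrow> bool" prog prog
  | While "nat list \<Rightarrow> bool" prog

text \<open>Number of states taken up by the compiled code. Pushing takes two of them, since a
  machine step writes before it moves while a push has to move left onto a fresh cell first.\<close>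

fun prog_len :: "prog \<Rightarrow> nat" where
  "prog_len (Pop i) = 1"
| "prog_len (Push i s) = 2"
| "prog_len (Emit s) = 1"
| "prog_len (Guess i) = 2"
| "prog_len (P ;; Q) = prog_len P + prog_len Q"
| "prog_len (Ite b P Q) = 1 + prog_len P + prog_len Q"
| "prog_len (While b P) = 1 + prog_len P"

fun wf_prog :: "prog \<Rightarrow> bool" where
  "wf_prog (Pop i) \<longleftrightarrow> i < 6"
| "wf_prog (Push i s) \<longleftrightarrow> i < 6 \<and> s \<in> {1, 2}"
| "wf_prog (Emit s) \<longleftrightarrow> s \<in> {1, 2}"
| "wf_prog (Guess i) \<longleftrightarrow> i < 6"
| "wf_prog (P ;; Q) \<longleftrightarrow> wf_prog P \<and> wf_prog Q"
| "wf_prog (Ite b P Q) \<longleftrightarrow> wf_prog P \<and> wf_prog Q"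
| "wf_prog (While b P) \<longleftrightarrow> wf_prog P"

fun guess_free :: "prog \<Rightarrow> bool" where
  "guess_free (Guess i) \<longleftrightarrow> False"
| "guess_free (P ;; Q) \<longleftrightarrow> guess_free P \<and> guess_free Q"
| "guess_free (Ite b P Q) \<longleftrightarrow> guess_free P \<and> guess_free Q"
| "guess_free (While b P) \<longleftrightarrow> guess_free P"
| "guess_free _ \<longleftrightarrow> True"

definition symbol_vectors :: "nat list set" where
  "symbol_vectors = {as. set as \<subseteq> {0, 1, 2} \<and> length as = 7}"

definition write_instrs :: "nat \<Rightarrow> nat \<Rightarrow> nat \<Rightarrow> (nat \<Rightarrow> nat) \<Rightarrow> move \<Rightarrow> instruction set" where
  "write_instrs a e i f m =
     (\<lambda>as. (a, as, e, as[i := f (as ! i)], (replicate 7 Stay)[i := m])) ` symbol_vectors"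

definition jump_instrs :: "nat \<Rightarrow> nat \<Rightarrow> (nat list \<Rightarrow> bool) \<Rightarrow> instruction set" where
  "jump_instrs a e b = (\<lambda>as. (a, as, e, as, replicate 7 Stay)) ` {as \<in> symbol_vectors. b as}"

text \<open>The code is entered in state \<open>a\<close> and left into state \<open>e\<close>.
  Keeping the exit a free parameter lets the body of a loop return to its test and the branches of a
  conditional meet without further jumps.\<close>

fun comp :: "prog \<Rightarrow> nat \<Rightarrow> nat \<Rightarrow> instruction set" where
  "comp (Pop i) a e = write_instrs a e i (\<lambda>_. 0) Move_Right"
| "comp (Push i s) a e =
     write_instrs a (a + 1) i id Move_Left \<union> write_instrs (a + 1) e i (\<lambda>_. s) Stay"
| "comp (Emit s) a e = write_instrs a e 6 (\<lambda>_. s) Move_Right"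
| "comp (Guess i) a e =
     write_instrs a (a + 1) i id Move_Left \<union>
     (write_instrs (a + 1) e i (\<lambda>_. 1) Stay \<union> write_instrs (a + 1) e i (\<lambda>_. 2) Stay)"
| "comp (P ;; Q) a e = comp P a (a + prog_len P) \<union> comp Q (a + prog_len P) e"
| "comp (Ite b P Q) a e =
     (jump_instrs a (a + 1) b \<union> jump_instrs a (a + 1 + prog_len P) (\<lambda>as. \<not> b as)) \<union>
     (comp P (a + 1) e \<union> comp Q (a + 1 + prog_len P) e)"
| "comp (While b P) a e =
     (jump_instrs a (a + 1) b \<union> jump_instrs a e (\<lambda>as. \<not> b as)) \<union> comp P (a + 1) a"

text \<open>The number is an upper bound on the machine steps, not their count: the last rule allows
  rounding up, which keeps the later time estimates simple. \<open>Guess\<close> has no rule, since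
  the only guessing loop is analysed on the level of the machine.\<close>

inductive exec :: "prog \<Rightarrow> store \<Rightarrow> nat \<Rightarrow> store \<Rightarrow> bool" where
  exec_Pop: "i < 6 \<Longrightarrow> exec (Pop i) \<sigma> 1 (\<sigma>(i := tl (\<sigma> i)))"
| exec_Push: "i < 6 \<Longrightarrow> s \<in> {1, 2} \<Longrightarrow> exec (Push i s) \<sigma> 2 (\<sigma>(i := s # \<sigma> i))"
| exec_Emit: "s \<in> {1, 2} \<Longrightarrow> exec (Emit s) \<sigma> 1 (\<sigma>(6 := \<sigma> 6 @ [s]))"
| exec_Seq: "exec P \<sigma> t \<sigma>' \<Longrightarrow> exec Q \<sigma>' u \<sigma>'' \<Longrightarrow> exec (P ;; Q) \<sigma> (t + u) \<sigma>''"
| exec_Ite_True: "b (scans \<sigma>) \<Longrightarrow> exec P \<sigma> t \<sigma>' \<Longrightarrow> exec (Ite b P Q) \<sigma> (Suc t) \<sigma>'"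
| exec_Ite_False: "\<not> b (scans \<sigma>) \<Longrightarrow> exec Q \<sigma> t \<sigma>' \<Longrightarrow> exec (Ite b P Q) \<sigma> (Suc t) \<sigma>'"
| exec_While_True: "b (scans \<sigma>) \<Longrightarrow> exec P \<sigma> t \<sigma>' \<Longrightarrow> exec (While b P) \<sigma>' u \<sigma>'' \<Longrightarrow>
    exec (While b P) \<sigma> (Suc (t + u)) \<sigma>''"
| exec_While_False: "\<not> b (scans \<sigma>) \<Longrightarrow> exec (While b P) \<sigma> 1 \<sigma>"
| exec_mono: "exec P \<sigma> t \<sigma>' \<Longrightarrow> t \<le> u \<Longrightarrow> exec P \<sigma> u \<sigma>'"

subsection \<open>Shape of the compiled code\<close>

lemma finite_symbol_vectors: "finite symbol_vectors"
  unfolding symbol_vectors_def by (rule finite_lists_length_eq) simp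

lemma finite_comp: "finite (comp P a e)"
  by (induction P arbitrary: a e)
     (auto simp: write_instrs_def jump_instrs_def finite_symbol_vectors)

lemma prog_len_pos: "0 < prog_len P"
  by (induction P) auto

text \<open>Subprograms own disjoint ranges of states; determinism and the splitting of blocks below
  both rest on this.\<close>

lemma comp_range: "ins \<in> comp P a e \<Longrightarrow> a \<le> fst ins \<and> fst ins < a + prog_len P"
proof (induction P arbitrary: a e)
  case (Seq P Q)
  then show ?case using prog_len_pos[of P] prog_len_pos[of Q] by fastforce
next
  case (Ite b P Q)
  then show ?case using prog_len_pos[of P] prog_len_pos[of Q]
    by (fastforce simp: jump_instrs_def)
next
  case (While b P)
  then show ?case by (fastforce simp: jump_instrs_def)
qed (auto simp: write_instrs_def jump_instrs_def)

lemma comp_lengths: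
  "(q, as, q', bs, ms) \<in> comp P a e \<Longrightarrow> length as = 7 \<and> length bs = 7 \<and> length ms = 7"
  by (induction P arbitrary: a e) (auto simp: write_instrs_def jump_instrs_def symbol_vectors_def)

text \<open>Subprograms have disjoint states, the two jumps of a branching state have complementary
  conditions, and only \<open>Guess\<close> writes two alternatives from the same state.\<close>

lemma comp_functional:
  "guess_free P \<Longrightarrow> (q, as, x) \<in> comp P a e \<Longrightarrow> (q, as, y) \<in> comp P a e \<Longrightarrow> x = y"
proof (induction P arbitrary: a e)
  case (Seq P Q)
  then show ?case
    using comp_range[of "(q, as, x)"] comp_range[of "(q, as, y)"]
    by (fastforce simp del: split_paired_All)
next
  case (Ite b P Q)
  show ?case
  proof (cases "q = a")
    case True
    then have "(q, as, z) \<notin> comp P (a + 1) e" "(q, as, z) \<notin> comp Q (a + 1 + prog_len P) e" for z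
      using comp_range[of "(q, as, z)"] by fastforce+
    then show ?thesis using Ite by (auto simp: jump_instrs_def)
  next
    case False
    then have *: "(q, as, z) \<in> comp P (a + 1) e \<or> (q, as, z) \<in> comp Q (a + 1 + prog_len P) e"
      if "z \<in> {x, y}" for z
      using Ite that by (auto simp: jump_instrs_def)
    have "\<not> ((q, as, z) \<in> comp P (a + 1) e \<and> (q, as, z') \<in> comp Q (a + 1 + prog_len P) e)" for z z'
      using comp_range[of "(q, as, z)" P "a + 1" e] comp_range[of "(q, as, z')" Q "a + 1 + prog_len P" e]
      by auto
    moreover have "guess_free P" "guess_free Q" using Ite.prems by auto
    ultimately show ?thesis
      using *[of x] *[of y] Ite.IH(1)[of "a + 1" e] Ite.IH(2)[of "a + 1 + prog_len P" e] by blast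
  qed
next
  case (While b P)
  show ?case
  proof (cases "q = a")
    case True
    then have "(q, as, z) \<notin> comp P (a + 1) a" for z
      using comp_range[of "(q, as, z)"] by fastforce
    then show ?thesis using While by (auto simp: jump_instrs_def)
  next
    case False
    then show ?thesis using While by (auto simp: jump_instrs_def)
  qed
qed (auto simp: write_instrs_def jump_instrs_def)

text \<open>An equivalence rather than an inclusion: no foreign instruction starts in the range, so
  the next configuration is unique and not merely possible.\<close>

definition block :: "ntm \<Rightarrow> prog \<Rightarrow> nat \<Rightarrow> nat \<Rightarrow> bool" where
  "block M P a e \<longleftrightarrow>
     (\<forall>ins. ins \<in> instrs M \<and> a \<le> fst ins \<and> fst ins < a + prog_len P \<longleftrightarrow> ins \<in> comp P a e)"

lemma block_Seq:
  assumes "block M (P ;; Q) a e"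
  shows "block M P a (a + prog_len P)" "block M Q (a + prog_len P) e"
proof -
  show "block M P a (a + prog_len P)"
    unfolding block_def
  proof
    fix ins
    show "ins \<in> instrs M \<and> a \<le> fst ins \<and> fst ins < a + prog_len P \<longleftrightarrow> ins \<in> comp P a (a + prog_len P)"
      using assms[unfolded block_def, rule_format, of ins] comp_range[of ins P a "a + prog_len P"]
        comp_range[of ins Q "a + prog_len P" e] by auto
  qed
  show "block M Q (a + prog_len P) e"
    unfolding block_def
  proof
    fix ins
    show "ins \<in> instrs M \<and> a + prog_len P \<le> fst ins \<and> fst ins < a + prog_len P + prog_len Q \<longleftrightarrow>
        ins \<in> comp Q (a + prog_len P) e"
      using assms[unfolded block_def, rule_format, of ins] comp_range[of ins P a "a + prog_len P"]
        comp_range[of ins Q "a + prog_len P" e] by auto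
  qed
qed

lemma block_Ite:
  assumes "block M (Ite b P Q) a e"
  shows "block M P (a + 1) e" "block M Q (a + 1 + prog_len P) e"
proof -
  have jump: "ins \<in> jump_instrs a e' b' \<Longrightarrow> fst ins = a" for ins e' b'
    by (auto simp: jump_instrs_def)
  show "block M P (a + 1) e"
    unfolding block_def
  proof
    fix ins
    show "ins \<in> instrs M \<and> a + 1 \<le> fst ins \<and> fst ins < a + 1 + prog_len P \<longleftrightarrow> ins \<in> comp P (a + 1) e"
      using assms[unfolded block_def, rule_format, of ins] comp_range[of ins P "a + 1" e]
        comp_range[of ins Q "a + 1 + prog_len P" e] jump[of ins "a + 1" b] jump[of ins "a + 1 + prog_len P" "\<lambda>as. \<not> b as"] by auto
  qed
  show "block M Q (a + 1 + prog_len P) e"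
    unfolding block_def
  proof
    fix ins
    show "ins \<in> instrs M \<and> a + 1 + prog_len P \<le> fst ins \<and> fst ins < a + 1 + prog_len P + prog_len Q
        \<longleftrightarrow> ins \<in> comp Q (a + 1 + prog_len P) e"
      using assms[unfolded block_def, rule_format, of ins] comp_range[of ins P "a + 1" e]
        comp_range[of ins Q "a + 1 + prog_len P" e] jump[of ins "a + 1" b] jump[of ins "a + 1 + prog_len P" "\<lambda>as. \<not> b as"] by auto
  qed
qed

lemma block_While:
  assumes "block M (While b P) a e"
  shows "block M P (a + 1) a"
  unfolding block_def
proof
  fix ins
  have jump: "ins \<in> jump_instrs a e' b' \<Longrightarrow> fst ins = a" for e' b'
    by (auto simp: jump_instrs_def)
  show "ins \<in> instrs M \<and> a + 1 \<le> fst ins \<and> fst ins < a + 1 + prog_len P \<longleftrightarrow> ins \<in> comp P (a + 1) a"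
    using assms[unfolded block_def, rule_format, of ins] comp_range[of ins P "a + 1" a]
      jump[of "a + 1" b] jump[of e "\<lambda>as. \<not> b as"] by auto
qed

subsection \<open>Correctness of the compilation\<close>

definition cells :: "int \<Rightarrow> nat list \<Rightarrow> int \<Rightarrow> nat" where
  "cells h xs = (\<lambda>j. if h \<le> j \<and> j < h + int (length xs) then xs ! nat (j - h) else blank)"

text \<open>A stack may start anywhere on its tape, so growing to the left requires no shifting; the
  output tape is anchored at cell 0, where the output is read. No stack contains a blank, hence a
  scanned blank means that the stack is empty.\<close>

definition rep :: "store \<Rightarrow> tape list \<Rightarrow> bool" where
  "rep \<sigma> ts \<longleftrightarrow> length ts = 7 \<and> (\<forall>i<6. \<exists>h. ts ! i = (cells h (\<sigma> i), h)) \<and>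
     ts ! 6 = (cells 0 (\<sigma> 6), int (length (\<sigma> 6))) \<and> (\<forall>i<7. set (\<sigma> i) \<subseteq> {1, 2})"

text \<open>Stronger than \<open>tm_step\<close>: for nondeterministic machines all branches have to
  be bounded, so the deterministic phases must be known to have no alternatives.\<close>

definition unique_step :: "ntm \<Rightarrow> config \<Rightarrow> config \<Rightarrow> bool" where
  "unique_step M c c' \<longleftrightarrow> (\<forall>d. tm_step M c d \<longleftrightarrow> d = c')"

lemma read_cells: "cells h xs h = scan xs"
  by (cases xs) (auto simp: cells_def scan_def)

lemma rep_reads:
  assumes "rep \<sigma> ts"
  shows "map read_tape ts = scans \<sigma>" "scans \<sigma> \<in> symbol_vectors"
proof -
  have "read_tape (ts ! i) = scans \<sigma> ! i" if "i < 7" for i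
  proof (cases "i < 6")
    case True
    then obtain h where "ts ! i = (cells h (\<sigma> i), h)" using assms by (auto simp: rep_def)
    then show ?thesis using True by (simp add: scans_def read_cells)
  next
    case False
    with that have "i = 6" by simp
    with assms show ?thesis by (simp add: rep_def scans_def cells_def)
  qed
  then show "map read_tape ts = scans \<sigma>"
    using assms by (auto intro!: nth_equalityI simp: rep_def scans_def)
  have sc: "scan (\<sigma> i) \<in> {0, 1, 2}" if "i < 7" for i
  proof -
    have "set (\<sigma> i) \<subseteq> {1, 2}" using assms that by (auto simp: rep_def)
    then show ?thesis by (cases "\<sigma> i") (auto simp: scan_def blank_def)
  qed
  have "(if i < 6 then scan (\<sigma> i) else blank) \<in> {0, 1, 2}" for i
    using sc[of i] by (simp add: blank_def)
  then have "set (scans \<sigma>) \<subseteq> {0, 1, 2}"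
    unfolding scans_def set_map by (intro image_subsetI)
  moreover have "length (scans \<sigma>) = 7"
    by (simp add: scans_def)
  ultimately show "scans \<sigma> \<in> symbol_vectors"
    unfolding symbol_vectors_def by blast
qed

lemma update_tape_stay: "update_tape (t, read_tape t, Stay) = t"
  by (cases t) simp

lemma zip_update:
  assumes "length ts = 7" "i < 7"
  shows "map update_tape (zip ts (zip ((map read_tape ts)[i := x]) ((replicate 7 Stay)[i := m]))) =
    ts[i := update_tape (ts ! i, x, m)]"
  using assms by (intro nth_equalityI) (auto simp: nth_list_update update_tape_stay)

text \<open>The set \<open>F\<close> of write functions is a singleton for ordinary instructions and
  has two members for a guess, so both cases share this description of the successors.\<close>

lemma step_write:
  assumes "\<And>ins. ins \<in> instrs M \<and> fst ins = a \<longleftrightarrow> ins \<in> (\<Union>f\<in>F. write_instrs a e i f m)"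
    and "map read_tape ts \<in> symbol_vectors" and "i < 7"
  shows "tm_step M (a, ts) d \<longleftrightarrow> (\<exists>f\<in>F. d = (e, ts[i := update_tape (ts ! i, f (read_tape (ts ! i)), m)]))"
proof -
  have len: "length ts = 7" using assms(2) by (simp add: symbol_vectors_def)
  have "tm_step M (a, ts) d \<longleftrightarrow> (\<exists>bs ms. (a, map read_tape ts, fst d, bs, ms) \<in> (\<Union>f\<in>F. write_instrs a e i f m)
      \<and> snd d = map update_tape (zip ts (zip bs ms)))"
    using assms(1) unfolding tm_step_def by (metis fst_conv snd_conv)
  also have "\<dots> \<longleftrightarrow> (\<exists>f\<in>F. fst d = e \<and> snd d = map update_tape (zip ts
      (zip ((map read_tape ts)[i := f (map read_tape ts ! i)]) ((replicate 7 Stay)[i := m]))))"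
    using assms(2) by (auto simp: write_instrs_def)
  also have "\<dots> \<longleftrightarrow> (\<exists>f\<in>F. d = (e, ts[i := update_tape (ts ! i, f (read_tape (ts ! i)), m)]))"
    unfolding zip_update[OF len assms(3)] using len assms(3) by (cases d) auto
  finally show ?thesis .
qed

lemma unique_step_write:
  assumes "block M P a0 e0" and "a0 \<le> a" "a < a0 + prog_len P"
    and "\<And>ins. ins \<in> comp P a0 e0 \<and> fst ins = a \<longleftrightarrow> ins \<in> write_instrs a e i f m"
    and "map read_tape ts \<in> symbol_vectors" and "i < 7"
  shows "unique_step M (a, ts) (e, ts[i := update_tape (ts ! i, f (read_tape (ts ! i)), m)])"
proof -
  have "ins \<in> instrs M \<and> fst ins = a \<longleftrightarrow> ins \<in> (\<Union>f\<in>{f}. write_instrs a e i f m)" for ins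
    using assms(1)[unfolded block_def, rule_format, of ins] assms(2-3) assms(4)[of ins] by auto
  from step_write[OF this assms(5,6)] show ?thesis by (simp add: unique_step_def)
qed

lemma step_jump:
  assumes "\<And>ins. ins \<in> instrs M \<and> fst ins = a \<longleftrightarrow>
      ins \<in> jump_instrs a e b \<union> jump_instrs a e' (\<lambda>as. \<not> b as)"
    and "rep \<sigma> ts"
  shows "unique_step M (a, ts) (if b (scans \<sigma>) then e else e', ts)"
proof -
  have len: "length ts = 7" using assms by (simp add: rep_def)
  have stay: "map update_tape (zip ts (zip (map read_tape ts) (replicate 7 Stay))) = ts"
    using len by (intro nth_equalityI) (auto simp: update_tape_stay)
  show ?thesis
    unfolding unique_step_def
  proof
    fix d
    have "tm_step M (a, ts) d \<longleftrightarrow>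
      (\<exists>bs ms. (a, scans \<sigma>, fst d, bs, ms) \<in> jump_instrs a e b \<union> jump_instrs a e' (\<lambda>as. \<not> b as) \<and>
        snd d = map update_tape (zip ts (zip bs ms)))"
      using assms(1) rep_reads[OF assms(2)] unfolding tm_step_def by (metis fst_conv snd_conv)
    also have "\<dots> \<longleftrightarrow> d = (if b (scans \<sigma>) then e else e', ts)"
      using rep_reads[OF assms(2)] stay by (cases d) (auto simp: jump_instrs_def image_iff)
    finally show "tm_step M (a, ts) d \<longleftrightarrow> d = (if b (scans \<sigma>) then e else e', ts)" .
  qed
qed

lemma cells_pop: "(cells h xs)(h := blank) = cells (h + 1) (tl xs)"
proof
  fix j
  show "((cells h xs)(h := blank)) j = cells (h + 1) (tl xs) j"
    by (cases xs) (auto simp: cells_def nth_Cons' intro!: arg_cong[of _ _ "(!) _"])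
qed

lemma cells_push: "(cells h xs)(h - 1 := s) = cells (h - 1) (s # xs)"
  by (auto simp: cells_def fun_eq_iff nth_Cons' intro: arg_cong[of _ _ "\<lambda>i. xs ! i"])

lemma cells_emit: "(cells 0 xs)(int (length xs) := s) = cells 0 (xs @ [s])"
  by (auto simp: cells_def fun_eq_iff nth_append)

lemma rep_upd:
  assumes "rep \<sigma> ts" "i < 6" "set xs \<subseteq> {1, 2}"
  shows "rep (\<sigma>(i := xs)) (ts[i := (cells h xs, h)])"
  using assms unfolding rep_def by (auto simp: nth_list_update)

lemma symbol_vectors_update:
  "as \<in> symbol_vectors \<Longrightarrow> x \<in> {0, 1, 2} \<Longrightarrow> as[i := x] \<in> symbol_vectors"
  using set_update_subset_insert[of as i x] by (auto simp: symbol_vectors_def)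

lemma rep_symbols: "rep \<sigma> ts \<Longrightarrow> i < 7 \<Longrightarrow> set (\<sigma> i) \<subseteq> {1, 2}"
  by (simp add: rep_def)

lemma run_Pop:
  assumes "block M (Pop i) a e" "rep \<sigma> ts" "i < 6"
  shows "\<exists>ts'. rep (\<sigma>(i := tl (\<sigma> i))) ts' \<and> unique_step M (a, ts) (e, ts')"
proof -
  obtain h where h: "ts ! i = (cells h (\<sigma> i), h)" using assms by (auto simp: rep_def)
  have "unique_step M (a, ts) (e, ts[i := update_tape (ts ! i, 0, Move_Right)])"
    using assms rep_reads[OF assms(2)]
    by (intro unique_step_write[OF assms(1), where f = "\<lambda>_. 0"]) (auto simp: write_instrs_def)
  moreover have "update_tape (ts ! i, 0, Move_Right) = (cells (h + 1) (tl (\<sigma> i)), h + 1)"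
    using cells_pop[of h "\<sigma> i"] by (simp add: h blank_def)
  moreover have "set (tl (\<sigma> i)) \<subseteq> {1, 2}"
    using rep_symbols[OF assms(2), of i] assms(3) by (cases "\<sigma> i") auto
  ultimately show ?thesis using rep_upd[OF assms(2,3)] by metis
qed

lemma run_Emit:
  assumes "block M (Emit s) a e" "rep \<sigma> ts" "s \<in> {1, 2}"
  shows "\<exists>ts'. rep (\<sigma>(6 := \<sigma> 6 @ [s])) ts' \<and> unique_step M (a, ts) (e, ts')"
proof -
  have "unique_step M (a, ts) (e, ts[6 := update_tape (ts ! 6, s, Move_Right)])"
    using assms rep_reads[OF assms(2)]
    by (intro unique_step_write[OF assms(1), where f = "\<lambda>_. s"]) (auto simp: write_instrs_def)
  moreover have "update_tape (ts ! 6, s, Move_Right) = (cells 0 (\<sigma> 6 @ [s]), int (length (\<sigma> 6 @ [s])))"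
    using assms(2) cells_emit[of "\<sigma> 6" s] by (simp add: rep_def)
  moreover have "rep (\<sigma>(6 := \<sigma> 6 @ [s]))
      (ts[6 := (cells 0 (\<sigma> 6 @ [s]), int (length (\<sigma> 6 @ [s])))])"
    using assms(2,3) by (auto simp: rep_def nth_list_update)
  ultimately show ?thesis by metis
qed

text \<open>The half step common to pushing and guessing: the cell left of a stack is blank, so the
  intermediate configuration again reads a legal symbol vector.\<close>

lemma run_move_left:
  assumes "rep \<sigma> ts" "i < 6"
  obtains h where "update_tape (ts ! i, read_tape (ts ! i), Move_Left) = (cells h (\<sigma> i), h - 1)"
    "map read_tape (ts[i := (cells h (\<sigma> i), h - 1)]) \<in> symbol_vectors"
    "\<And>s. s \<in> {1, 2} \<Longrightarrow> rep (\<sigma>(i := s # \<sigma> i))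
      (ts[i := (cells h (\<sigma> i), h - 1), i := update_tape ((cells h (\<sigma> i), h - 1), s, Stay)])"
proof -
  obtain h where h: "ts ! i = (cells h (\<sigma> i), h)" using assms by (auto simp: rep_def)
  show thesis
  proof
    show "update_tape (ts ! i, read_tape (ts ! i), Move_Left) = (cells h (\<sigma> i), h - 1)"
      by (simp add: h)
    have "cells h (\<sigma> i) (h - 1) = 0" by (simp add: cells_def blank_def)
    then show "map read_tape (ts[i := (cells h (\<sigma> i), h - 1)]) \<in> symbol_vectors"
      using rep_reads[OF assms(1)] by (simp add: map_update symbol_vectors_update)
    fix s :: nat
    assume "s \<in> {1, 2}"
    then show "rep (\<sigma>(i := s # \<sigma> i))
        (ts[i := (cells h (\<sigma> i), h - 1), i := update_tape ((cells h (\<sigma> i), h - 1), s, Stay)])"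
      using rep_upd[OF assms, of "s # \<sigma> i" "h - 1"] rep_symbols[OF assms(1), of i] assms(2)
      by (simp add: cells_push)
  qed
qed

lemma run_Push:
  assumes "block M (Push i s) a e" "rep \<sigma> ts" "i < 6" "s \<in> {1, 2}"
  shows "\<exists>ts'. rep (\<sigma>(i := s # \<sigma> i)) ts' \<and> (unique_step M ^^ 2) (a, ts) (e, ts')"
proof -
  have len: "length ts = 7" using assms(2) by (simp add: rep_def)
  obtain h where h: "update_tape (ts ! i, read_tape (ts ! i), Move_Left) = (cells h (\<sigma> i), h - 1)"
    "map read_tape (ts[i := (cells h (\<sigma> i), h - 1)]) \<in> symbol_vectors"
    "rep (\<sigma>(i := s # \<sigma> i))
      (ts[i := (cells h (\<sigma> i), h - 1), i := update_tape ((cells h (\<sigma> i), h - 1), s, Stay)])"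
    using run_move_left[OF assms(2,3)] assms(4) by metis
  have "ins \<in> comp (Push i s) a e \<and> fst ins = a \<longleftrightarrow> ins \<in> write_instrs a (a + 1) i id Move_Left" for ins
    by (cases ins) (auto simp: write_instrs_def)
  from unique_step_write[OF assms(1) _ _ this, of ts] rep_reads[OF assms(2)] assms(3)
  have 1: "unique_step M (a, ts) (a + 1, ts[i := (cells h (\<sigma> i), h - 1)])"
    by (simp add: h(1))
  have "ins \<in> comp (Push i s) a e \<and> fst ins = a + 1 \<longleftrightarrow> ins \<in> write_instrs (a + 1) e i (\<lambda>_. s) Stay" for ins
    by (cases ins) (auto simp: write_instrs_def)
  from unique_step_write[OF assms(1) _ _ this h(2)] assms(3) len
  have "unique_step M (a + 1, ts[i := (cells h (\<sigma> i), h - 1)])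
      (e, ts[i := (cells h (\<sigma> i), h - 1), i := update_tape ((cells h (\<sigma> i), h - 1), s, Stay)])"
    by simp
  with 1 h(3) show ?thesis by (auto simp: numeral_2_eq_2)
qed

lemma run_jump:
  assumes "block M P a e" "rep \<sigma> ts"
    and "\<And>ins. ins \<in> comp P a e \<and> fst ins = a \<longleftrightarrow>
      ins \<in> jump_instrs a e1 b \<union> jump_instrs a e2 (\<lambda>as. \<not> b as)"
  shows "unique_step M (a, ts) (if b (scans \<sigma>) then e1 else e2, ts)"
proof (rule step_jump[OF _ assms(2)])
  fix ins
  show "ins \<in> instrs M \<and> fst ins = a \<longleftrightarrow> ins \<in> jump_instrs a e1 b \<union> jump_instrs a e2 (\<lambda>as. \<not> b as)"
    using assms(1)[unfolded block_def, rule_format, of ins] assms(3)[of ins] prog_len_pos[of P] by auto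
qed

lemma run_jump_Ite:
  assumes "block M (Ite b P Q) a e" "rep \<sigma> ts"
  shows "unique_step M (a, ts) (if b (scans \<sigma>) then a + 1 else a + 1 + prog_len P, ts)"
proof (rule run_jump[OF assms])
  fix ins
  show "ins \<in> comp (Ite b P Q) a e \<and> fst ins = a \<longleftrightarrow> ins \<in> jump_instrs a (a + 1) b \<union>
      jump_instrs a (a + 1 + prog_len P) (\<lambda>as. \<not> b as)"
    using comp_range[of ins P "a + 1" e] comp_range[of ins Q "a + 1 + prog_len P" e]
    by (auto simp: jump_instrs_def)
qed

lemma run_jump_While:
  assumes "block M (While b P) a e" "rep \<sigma> ts"
  shows "unique_step M (a, ts) (if b (scans \<sigma>) then a + 1 else e, ts)"
proof (rule run_jump[OF assms])
  fix ins
  show "ins \<in> comp (While b P) a e \<and> fst ins = a \<longleftrightarrow> ins \<in> jump_instrs a (a + 1) b \<union>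
      jump_instrs a e (\<lambda>as. \<not> b as)"
    using comp_range[of ins P "a + 1" a] by (auto simp: jump_instrs_def)
qed

lemma relpowp_add: "(R ^^ m) a b \<Longrightarrow> (R ^^ n) b c \<Longrightarrow> (R ^^ (m + n)) a c"
  by (auto simp: relpowp_add relcompp_apply)

text \<open>Induction on the derivation. The loop case works because the body exits into the state
  of the test, which is where the induction hypothesis for the remaining iterations starts.\<close>

lemma exec_run:
  assumes "exec P \<sigma> t \<sigma>'" "block M P a e" "rep \<sigma> ts"
  shows "\<exists>u ts'. u \<le> t \<and> rep \<sigma>' ts' \<and> (unique_step M ^^ u) (a, ts) (e, ts')"
  using assms
proof (induction arbitrary: a e ts rule: exec.induct)
  case (exec_Pop i \<sigma>)
  obtain ts' where ts': "rep (\<sigma>(i := tl (\<sigma> i))) ts'" "unique_step M (a, ts) (e, ts')"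
    using run_Pop[OF exec_Pop.prems exec_Pop.hyps] by blast
  show ?case
    by (intro exI[of _ "1 :: nat"] exI[of _ ts'] conjI ts'(1)) (use ts'(2) in \<open>simp_all add: eq_OO\<close>)
next
  case (exec_Push i s \<sigma>)
  obtain ts' where ts': "rep (\<sigma>(i := s # \<sigma> i)) ts'" "(unique_step M ^^ 2) (a, ts) (e, ts')"
    using run_Push[OF exec_Push.prems exec_Push.hyps] by blast
  show ?case
    by (intro exI[of _ "2 :: nat"] exI[of _ ts'] conjI ts' order_refl)
next
  case (exec_Emit s \<sigma>)
  obtain ts' where ts': "rep (\<sigma>(6 := \<sigma> 6 @ [s])) ts'" "unique_step M (a, ts) (e, ts')"
    using run_Emit[OF exec_Emit.prems exec_Emit.hyps] by blast
  show ?case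
    by (intro exI[of _ "1 :: nat"] exI[of _ ts'] conjI ts'(1)) (use ts'(2) in \<open>simp_all add: eq_OO\<close>)
next
  case (exec_Seq P \<sigma> t \<sigma>' Q u \<sigma>'')
  obtain v ts' where 2: "v \<le> t" "rep \<sigma>' ts'"
      "(unique_step M ^^ v) (a, ts) (a + prog_len P, ts')"
    using exec_Seq.IH(1)[OF block_Seq(1)[OF exec_Seq.prems(1)] exec_Seq.prems(2)] by blast
  obtain w ts'' where 3: "w \<le> u" "rep \<sigma>'' ts''"
      "(unique_step M ^^ w) (a + prog_len P, ts') (e, ts'')"
    using exec_Seq.IH(2)[OF block_Seq(2)[OF exec_Seq.prems(1)] 2(2)] by blast
  show ?case
    using 2 3 relpowp_add[OF 2(3) 3(3)] by (intro exI[of _ "v + w"] exI[of _ ts'']) auto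
next
  case (exec_Ite_True b \<sigma> P t \<sigma>' Q)
  have 1: "unique_step M (a, ts) (a + 1, ts)"
    using run_jump_Ite[OF exec_Ite_True.prems] exec_Ite_True.hyps by simp
  obtain v ts' where 2: "v \<le> t" "rep \<sigma>' ts'" "(unique_step M ^^ v) (a + 1, ts) (e, ts')"
    using exec_Ite_True.IH[OF block_Ite(1)[OF exec_Ite_True.prems(1)] exec_Ite_True.prems(2)]
    by blast
  show ?case
    using 2 relpowp_Suc_I2[of "unique_step M", OF 1 2(3)]
    by (intro exI[of _ "Suc v"] exI[of _ ts']) auto
next
  case (exec_Ite_False b \<sigma> Q t \<sigma>' P)
  have 1: "unique_step M (a, ts) (a + 1 + prog_len P, ts)"
    using run_jump_Ite[OF exec_Ite_False.prems] exec_Ite_False.hyps by simp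
  obtain v ts' where 2: "v \<le> t" "rep \<sigma>' ts'"
      "(unique_step M ^^ v) (a + 1 + prog_len P, ts) (e, ts')"
    using exec_Ite_False.IH[OF block_Ite(2)[OF exec_Ite_False.prems(1)] exec_Ite_False.prems(2)]
    by blast
  show ?case
    using 2 relpowp_Suc_I2[of "unique_step M", OF 1 2(3)]
    by (intro exI[of _ "Suc v"] exI[of _ ts']) auto
next
  case (exec_While_True b \<sigma> P t \<sigma>' u \<sigma>'')
  have 1: "unique_step M (a, ts) (a + 1, ts)"
    using run_jump_While[OF exec_While_True.prems] exec_While_True.hyps by simp
  obtain v ts' where 2: "v \<le> t" "rep \<sigma>' ts'" "(unique_step M ^^ v) (a + 1, ts) (a, ts')"
    using exec_While_True.IH(1)[OF block_While[OF exec_While_True.prems(1)] exec_While_True.prems(2)]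
    by blast
  obtain w ts'' where 3: "w \<le> u" "rep \<sigma>'' ts''" "(unique_step M ^^ w) (a, ts') (e, ts'')"
    using exec_While_True.IH(2)[OF exec_While_True.prems(1) 2(2)] by blast
  have "(unique_step M ^^ Suc (v + w)) (a, ts) (e, ts'')"
    by (rule relpowp_Suc_I2[of "unique_step M", OF 1 relpowp_add[OF 2(3) 3(3)]])
  with 2 3 show ?case by (intro exI[of _ "Suc (v + w)"] exI[of _ ts'']) auto
next
  case (exec_While_False b \<sigma> P)
  then show ?case
    using run_jump_While[OF exec_While_False.prems]
    by (intro exI[of _ 1] exI[of _ ts]) auto
next
  case (exec_mono P \<sigma> t \<sigma>' u)
  obtain v ts' where "v \<le> t" "rep \<sigma>' ts'" "(unique_step M ^^ v) (a, ts) (e, ts')"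
    using exec_mono.IH[OF exec_mono.prems] by blast
  with exec_mono.hyps(2) show ?case by (intro exI[of _ v] exI[of _ ts']) simp
qed

lemma unique_step_imp_step: "(unique_step M ^^ u) c d \<Longrightarrow> (tm_step M ^^ u) c d"
  by (erule relpowp_mono[rotated]) (metis unique_step_def)

section \<open>Binary trees on the work stack\<close>

datatype tree = Leaf | Node tree tree

text \<open>Prefix notation with 2 for an inner node and 1 for a leaf. It is self-delimiting, so
  trees can lie on a stack without separators.\<close>

fun flat :: "tree \<Rightarrow> nat list" where
  "flat Leaf = [1]"
| "flat (Node a b) = 2 # flat a @ flat b"

fun tsize :: "tree \<Rightarrow> nat" where
  "tsize Leaf = 1"
| "tsize (Node a b) = Suc (tsize a + tsize b)"

lemma length_flat [simp]: "length (flat t) = tsize t"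
  by (induction t) auto

lemma tsize_pos: "Suc 0 \<le> tsize t"
  by (cases t) auto

lemma flat_neq_Nil [simp]: "flat t \<noteq> []"
  by (cases t) auto

text \<open>The stacks in order: two inputs, the work stack, three auxiliary stacks, and the
  output.\<close>

definition store_of :: "nat list \<Rightarrow> nat list \<Rightarrow> nat list \<Rightarrow> nat list \<Rightarrow> nat list \<Rightarrow> nat list \<Rightarrow> nat list \<Rightarrow> store" where
  "store_of i j s a b c out = (\<lambda>k. if k = 0 then i else if k = 1 then j else if k = 2 then s
     else if k = 3 then a else if k = 4 then b else if k = 5 then c else if k = 6 then out else [])"

lemma store_of_apply [simp]:
  "store_of i j s a b c out 0 = i" "store_of i j s a b c out (Suc 0) = j"
  "store_of i j s a b c out 2 = s" "store_of i j s a b c out 3 = a"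
  "store_of i j s a b c out 4 = b" "store_of i j s a b c out 5 = c"
  "store_of i j s a b c out 6 = out"
  by (simp_all add: store_of_def)

lemma store_of_update [simp]:
  "(store_of i j s a b c out)(0 := x) = store_of x j s a b c out"
  "(store_of i j s a b c out)(Suc 0 := x) = store_of i x s a b c out"
  "(store_of i j s a b c out)(2 := x) = store_of i j x a b c out"
  "(store_of i j s a b c out)(3 := x) = store_of i j s x b c out"
  "(store_of i j s a b c out)(4 := x) = store_of i j s a x c out"
  "(store_of i j s a b c out)(5 := x) = store_of i j s a b x out"
  "(store_of i j s a b c out)(6 := x) = store_of i j s a b c x"
  by (simp_all add: store_of_def fun_eq_iff)

lemma nth_scans: "i < 6 \<Longrightarrow> scans \<sigma> ! i = scan (\<sigma> i)"
  unfolding scans_def by (subst nth_map) (auto simp: nth_upt simp del: upt_rec_numeral)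

lemma scans_nth [simp]:
  "scans \<sigma> ! 0 = scan (\<sigma> 0)" "scans \<sigma> ! Suc 0 = scan (\<sigma> 1)" "scans \<sigma> ! 2 = scan (\<sigma> 2)"
  "scans \<sigma> ! 3 = scan (\<sigma> 3)" "scans \<sigma> ! 4 = scan (\<sigma> 4)" "scans \<sigma> ! 5 = scan (\<sigma> 5)"
  by (simp_all add: nth_scans)

lemma scan_simps [simp]: "scan [] = 0" "scan (x # xs) = x"
  by (simp_all add: scan_def blank_def)

lemma flat_symbols: "set (flat t) \<subseteq> {1, 2}"
  by (induction t) auto

lemma flat_append_inj: "flat s @ u = flat t @ v \<longleftrightarrow> s = t \<and> u = v"
proof (induction s arbitrary: t u v)
  case Leaf
  then show ?case by (cases t) auto
next
  case (Node s1 s2)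
  then show ?case by (cases t) auto
qed

lemma flat_inj: "flat s = flat t \<longleftrightarrow> s = t"
  using flat_append_inj[of s "[]" t "[]"] by simp

lemma exec_SeqI: "exec P \<sigma> t \<sigma>' \<Longrightarrow> exec Q \<sigma>' u \<sigma>'' \<Longrightarrow> t + u \<le> v \<Longrightarrow> exec (P ;; Q) \<sigma> v \<sigma>''"
  using exec_Seq exec_mono by blast

lemma exec_PopI: "i < 6 \<Longrightarrow> \<sigma>' = \<sigma>(i := tl (\<sigma> i)) \<Longrightarrow> 1 \<le> t \<Longrightarrow> exec (Pop i) \<sigma> t \<sigma>'"
  using exec_Pop exec_mono by blast

lemma exec_PushI: "i < 6 \<Longrightarrow> s = 1 \<or> s = 2 \<Longrightarrow> \<sigma>' = \<sigma>(i := s # \<sigma> i) \<Longrightarrow> 2 \<le> t \<Longrightarrow> exec (Push i s) \<sigma> t \<sigma>'"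
  using exec_Push exec_mono by blast

lemma exec_IteI:
  assumes "b (scans \<sigma>) \<Longrightarrow> exec P \<sigma> t \<sigma>'" "\<not> b (scans \<sigma>) \<Longrightarrow> exec Q \<sigma> t \<sigma>'" "Suc t \<le> u"
  shows "exec (Ite b P Q) \<sigma> u \<sigma>'"
proof (cases "b (scans \<sigma>)")
  case True
  then show ?thesis using exec_mono[OF exec_Ite_True[of b \<sigma> P t \<sigma>' Q]] assms by simp
next
  case False
  then show ?thesis using exec_mono[OF exec_Ite_False[of b \<sigma> Q t \<sigma>' P]] assms by simp
qed

lemma exec_WhileI:
  "b (scans \<sigma>) \<Longrightarrow> exec P \<sigma> t \<sigma>' \<Longrightarrow> exec (While b P) \<sigma>' u \<sigma>'' \<Longrightarrow> Suc (t + u) \<le> v \<Longrightarrow>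
    exec (While b P) \<sigma> v \<sigma>''"
  using exec_While_True exec_mono by blast

lemma exec_While_endI: "\<not> b (scans \<sigma>) \<Longrightarrow> 1 \<le> t \<Longrightarrow> exec (While b P) \<sigma> t \<sigma>"
  using exec_While_False exec_mono by blast

subsection \<open>Moving trees and symbol strings between the stacks\<close>

definition move_symbol :: "nat \<Rightarrow> nat \<Rightarrow> prog" where
  "move_symbol d e = Ite (\<lambda>v. v ! d = 1) (Push e 1) (Push e 2) ;; Pop d"

lemma exec_move_symbol:
  assumes "d < 6" "e < 6" "d \<noteq> e" "\<sigma> d = x # xs" "x = 1 \<or> x = 2" "4 \<le> t"
  shows "exec (move_symbol d e) \<sigma> t (\<sigma>(e := x # \<sigma> e, d := xs))"
proof -
  have "scans \<sigma> ! d = x" using assms by (simp add: nth_scans)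
  then have "exec (Ite (\<lambda>v. v ! d = 1) (Push e 1) (Push e 2)) \<sigma> 3 (\<sigma>(e := x # \<sigma> e))"
    using assms by (intro exec_IteI[where t = 2]) (auto intro!: exec_PushI)
  moreover have "exec (Pop d) (\<sigma>(e := x # \<sigma> e)) 1 (\<sigma>(e := x # \<sigma> e, d := xs))"
    using assms by (intro exec_PopI) auto
  ultimately show ?thesis
    unfolding move_symbol_def using assms by (auto intro: exec_SeqI)
qed

definition move_string :: "nat \<Rightarrow> nat \<Rightarrow> prog" where
  "move_string d e = While (\<lambda>v. v ! d \<noteq> 0) (move_symbol d e)"

lemma exec_move_string:
  assumes "d < 6" "e < 6" "d \<noteq> e" "\<sigma> d = xs" "set xs \<subseteq> {1, 2}" "5 * length xs + 1 \<le> t"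
  shows "exec (move_string d e) \<sigma> t (\<sigma>(e := rev xs @ \<sigma> e, d := []))"
  using assms
proof (induction xs arbitrary: \<sigma> t)
  case Nil
  then have "\<sigma>(d := []) = \<sigma>" by auto
  moreover have "scans \<sigma> ! d = 0" using Nil by (simp add: nth_scans)
  ultimately show ?case
    using Nil unfolding move_string_def by (auto intro!: exec_While_endI)
next
  case (Cons x xs)
  have c: "scans \<sigma> ! d \<noteq> 0" using Cons.prems by (auto simp: nth_scans)
  have step: "exec (move_symbol d e) \<sigma> 4 (\<sigma>(e := x # \<sigma> e, d := xs))"
    using Cons.prems by (intro exec_move_symbol) auto
  have eq: "(\<sigma>(e := x # \<sigma> e, d := xs))(e := rev xs @ (\<sigma>(e := x # \<sigma> e, d := xs)) e, d := []) =
      \<sigma>(e := rev (x # xs) @ \<sigma> e, d := [])"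
    using Cons.prems(3) by (auto simp: fun_eq_iff)
  have "exec (move_string d e) (\<sigma>(e := x # \<sigma> e, d := xs)) (5 * length xs + 1)
      ((\<sigma>(e := x # \<sigma> e, d := xs))(e := rev xs @ (\<sigma>(e := x # \<sigma> e, d := xs)) e, d := []))"
    using Cons.prems by (intro Cons.IH) auto
  then show ?case
    unfolding eq move_string_def
    by (rule exec_WhileI[where b = "\<lambda>v. v ! d \<noteq> 0", OF c step]) (use Cons.prems(6) in simp)
qed

definition flush :: "nat \<Rightarrow> prog" where
  "flush d = While (\<lambda>v. v ! d \<noteq> 0) (Pop d)"

lemma exec_flush:
  assumes "d < 6" "\<sigma> d = xs" "set xs \<subseteq> {1, 2}" "2 * length xs + 1 \<le> t"
  shows "exec (flush d) \<sigma> t (\<sigma>(d := []))"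
  using assms
proof (induction xs arbitrary: \<sigma> t)
  case Nil
  then have "\<sigma>(d := []) = \<sigma>" by auto
  moreover have "scans \<sigma> ! d = 0" using Nil by (simp add: nth_scans)
  ultimately show ?case
    using Nil unfolding flush_def by (auto intro!: exec_While_endI)
next
  case (Cons x xs)
  have c: "scans \<sigma> ! d \<noteq> 0" using Cons.prems by (auto simp: nth_scans)
  have step: "exec (Pop d) \<sigma> 1 (\<sigma>(d := xs))"
    using Cons.prems by (intro exec_PopI) auto
  have "exec (flush d) (\<sigma>(d := xs)) (2 * length xs + 1) ((\<sigma>(d := xs))(d := []))"
    using Cons.prems by (intro Cons.IH) auto
  then show ?case
    unfolding flush_def fun_upd_upd
    by (rule exec_WhileI[where b = "\<lambda>v. v ! d \<noteq> 0", OF c step]) (use Cons.prems in simp)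
qed

text \<open>Stack \<open>5\<close> counts in unary the trees that remain to be read.\<close>

definition move_tree_loop :: "nat \<Rightarrow> prog" where
  "move_tree_loop d = While (\<lambda>v. v ! 5 \<noteq> 0)
     (Ite (\<lambda>v. v ! 2 = 2) (Pop 2 ;; Push d 2 ;; Push 5 1) (Pop 2 ;; Push d 1 ;; Pop 5))"

definition move_tree :: "nat \<Rightarrow> prog" where
  "move_tree d = Push 5 1 ;; move_tree_loop d"

text \<open>Stated with the remaining run of the loop as a premise: after the first subtree the same
  loop goes on with the second one, so reading one tree is not a complete execution. Each symbol
  costs at most 7 steps: two tests, and at most five for popping and pushing.\<close>

lemma exec_move_tree_loop:
  assumes "d \<in> {3, 4}" "\<sigma> 2 = flat t @ r" "\<sigma> 5 = 1 # cs"
    and "exec (move_tree_loop d) (\<sigma>(2 := r, d := rev (flat t) @ \<sigma> d, 5 := cs)) u \<sigma>'"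
    and "u + 7 * tsize t \<le> v"
  shows "exec (move_tree_loop d) \<sigma> v \<sigma>'"
  using assms
proof (induction t arbitrary: \<sigma> r cs u v)
  case Leaf
  have "exec (Pop 2 ;; Push d 1 ;; Pop 5) \<sigma> (1 + (2 + 1)) ((\<sigma>(2 := tl (\<sigma> 2)))
      (d := 1 # (\<sigma>(2 := tl (\<sigma> 2))) d, 5 := tl ((\<sigma>(2 := tl (\<sigma> 2), d := 1 # (\<sigma>(2 := tl (\<sigma> 2))) d)) 5)))"
    using Leaf.prems(1) by (intro exec_Seq[OF exec_Pop exec_Seq[OF exec_Push exec_Pop]]) auto
  then have "exec (Pop 2 ;; Push d 1 ;; Pop 5) \<sigma> 4 (\<sigma>(2 := r, d := 1 # \<sigma> d, 5 := cs))"
    using Leaf.prems(1-3) by (auto simp: fun_upd_other)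
  then have 1: "exec (Ite (\<lambda>v. v ! 2 = 2) (Pop 2 ;; Push d 2 ;; Push 5 1) (Pop 2 ;; Push d 1 ;; Pop 5))
      \<sigma> 5 (\<sigma>(2 := r, d := 1 # \<sigma> d, 5 := cs))"
    using Leaf.prems by (intro exec_IteI[where t = 4]) auto
  have c: "scans \<sigma> ! 5 \<noteq> 0" using Leaf.prems by simp
  have "exec (move_tree_loop d) (\<sigma>(2 := r, d := 1 # \<sigma> d, 5 := cs)) u \<sigma>'"
    using Leaf.prems(4) by (simp del: fun_upd_apply)
  then show ?case
    unfolding move_tree_loop_def
    by (rule exec_WhileI[where b = "\<lambda>v. v ! 5 \<noteq> 0", OF c 1]) (use Leaf.prems in simp)
next
  case (Node a b)
  \<comment> \<open>The stores after the node symbol, when two subtrees are due, and after the first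
    of them.\<close>
  define \<sigma>1 where "\<sigma>1 = \<sigma>(2 := flat a @ flat b @ r, d := 2 # \<sigma> d, 5 := 1 # 1 # cs)"
  define \<sigma>2 where "\<sigma>2 = \<sigma>1(2 := flat b @ r, d := rev (flat a) @ \<sigma>1 d, 5 := 1 # cs)"
  have "exec (Pop 2 ;; Push d 2 ;; Push 5 1) \<sigma> (1 + (2 + 2)) ((\<sigma>(2 := tl (\<sigma> 2)))
      (d := 2 # (\<sigma>(2 := tl (\<sigma> 2))) d, 5 := 1 # ((\<sigma>(2 := tl (\<sigma> 2), d := 2 # (\<sigma>(2 := tl (\<sigma> 2))) d)) 5)))"
    using Node.prems(1) by (intro exec_Seq[OF exec_Pop exec_Seq[OF exec_Push exec_Push]]) auto
  then have "exec (Pop 2 ;; Push d 2 ;; Push 5 1) \<sigma> 5 \<sigma>1"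
    using Node.prems(1-3) unfolding \<sigma>1_def by (auto simp: fun_upd_other)
  then have 1: "exec (Ite (\<lambda>v. v ! 2 = 2) (Pop 2 ;; Push d 2 ;; Push 5 1) (Pop 2 ;; Push d 1 ;; Pop 5))
      \<sigma> 6 \<sigma>1"
    using Node.prems by (intro exec_IteI[where t = 5]) auto
  have "\<sigma>2(2 := r, d := rev (flat b) @ \<sigma>2 d, 5 := cs) = \<sigma>(2 := r, d := rev (flat (Node a b)) @ \<sigma> d, 5 := cs)"
    using Node.prems(1) unfolding \<sigma>2_def \<sigma>1_def by (auto simp: fun_eq_iff)
  with Node.prems(4) have "exec (move_tree_loop d) (\<sigma>2(2 := r, d := rev (flat b) @ \<sigma>2 d, 5 := cs)) u \<sigma>'"
    by (simp only:)
  then have "exec (move_tree_loop d) \<sigma>2 (u + 7 * tsize b) \<sigma>'"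
    by (rule Node.IH(2)[rotated 3]) (use Node.prems(1) in \<open>auto simp: \<sigma>2_def\<close>)
  then have "exec (move_tree_loop d) \<sigma>1 (u + 7 * tsize b + 7 * tsize a) \<sigma>'"
    unfolding \<sigma>2_def
    by (rule Node.IH(1)[rotated 3]) (use Node.prems(1) in \<open>auto simp: \<sigma>1_def\<close>)
  moreover have c: "scans \<sigma> ! 5 \<noteq> 0" using Node.prems by simp
  moreover have "Suc (6 + (u + 7 * tsize b + 7 * tsize a)) \<le> v"
    using Node.prems(5) unfolding tsize.simps by presburger
  ultimately show ?case
    unfolding move_tree_loop_def
    by (blast intro: exec_WhileI[where b = "\<lambda>v. v ! 5 \<noteq> 0", OF c 1])
qed

lemma exec_move_tree:
  assumes "d \<in> {3, 4}" "\<sigma> 2 = flat t @ r" "\<sigma> 5 = []" "7 * tsize t + 3 \<le> v"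
  shows "exec (move_tree d) \<sigma> v (\<sigma>(2 := r, d := rev (flat t) @ \<sigma> d))"
proof -
  have eq: "\<sigma>(2 := r, d := rev (flat t) @ \<sigma> d) =
      (\<sigma>(5 := [1]))(2 := r, d := rev (flat t) @ (\<sigma>(5 := [1])) d, 5 := [])"
    using assms by (auto simp: fun_eq_iff)
  have "exec (move_tree_loop d) (\<sigma>(2 := r, d := rev (flat t) @ \<sigma> d)) 1 (\<sigma>(2 := r, d := rev (flat t) @ \<sigma> d))"
    using assms unfolding move_tree_loop_def by (intro exec_While_endI) auto
  then have 2: "exec (move_tree_loop d) (\<sigma>(5 := [1])) (1 + 7 * tsize t) (\<sigma>(2 := r, d := rev (flat t) @ \<sigma> d))"
    unfolding eq by (rule exec_move_tree_loop[rotated 3]) (use assms in auto)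
  have 1: "exec (Push 5 1) \<sigma> 2 (\<sigma>(5 := [1]))"
    by (rule exec_PushI) (use assms in auto)
  show ?thesis
    unfolding move_tree_def by (rule exec_SeqI[OF 1 2]) (use assms(4) in simp)
qed

subsection \<open>Stack operations on trees\<close>

definition t_drop :: prog where
  "t_drop = move_tree 3 ;; flush 3"

text \<open>Reading is destructive, so the tree is parked reversed on stack 3 and copied to stack 4
  on the way back; the copy passes through stack 3 once more to restore its orientation.\<close>

definition t_dup :: prog where
  "t_dup = move_tree 3 ;; While (\<lambda>v. v ! 3 \<noteq> 0) (Ite (\<lambda>v. v ! 3 = 1) (Push 4 1) (Push 4 2) ;; move_symbol 3 2) ;;
     move_string 4 3 ;; move_string 3 2"

definition t_swap :: prog where
  "t_swap = move_tree 3 ;; move_tree 4 ;; move_string 3 2 ;; move_string 4 2"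

text \<open>The language has no empty program; a loop that is never entered takes its place.\<close>

definition t_skip :: prog where
  "t_skip = While (\<lambda>_. False) (Pop 2)"

definition t_hd :: prog where
  "t_hd = Ite (\<lambda>v. v ! 2 = 2) (Pop 2 ;; move_tree 3 ;; move_tree 4 ;; flush 4 ;; move_string 3 2) t_skip"

definition t_tl :: prog where
  "t_tl = Ite (\<lambda>v. v ! 2 = 2) (Pop 2 ;; t_drop) t_skip"

text \<open>Compares the reversed codes on stacks 3 and 4; the trees are equal iff both stacks run
  empty together. What is pushed at the end is the code of a Boolean.\<close>

definition t_eq :: prog where
  "t_eq = move_tree 3 ;; move_tree 4 ;; While (\<lambda>v. v ! 3 = v ! 4 \<and> v ! 3 \<noteq> 0) (Pop 3 ;; Pop 4) ;;
     Ite (\<lambda>v. v ! 3 = 0 \<and> v ! 4 = 0) (Push 2 1 ;; Push 2 1 ;; Push 2 2)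
       (flush 3 ;; flush 4 ;; Push 2 1)"

fun t_hd_fun :: "tree \<Rightarrow> tree" where
  "t_hd_fun Leaf = Leaf" | "t_hd_fun (Node a b) = a"

fun t_tl_fun :: "tree \<Rightarrow> tree" where
  "t_tl_fun Leaf = Leaf" | "t_tl_fun (Node a b) = b"

abbreviation work_store :: "nat list \<Rightarrow> nat list \<Rightarrow> nat list \<Rightarrow> nat list \<Rightarrow> store" where
  "work_store i j s out \<equiv> store_of i j s [] [] [] out"

lemma rev_flat_symbols: "set (rev (flat t)) \<subseteq> {1, 2}"
  using flat_symbols[of t] by simp

text \<open>The factors 100 and 110 here and below are coarse round bounds; only linearity in the
  sizes of the trees matters.\<close>

lemma exec_t_drop:
  "100 * tsize t \<le> v \<Longrightarrow> exec t_drop (work_store i j (flat t @ r) out) v (work_store i j r out)"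
  unfolding t_drop_def
  apply (rule exec_SeqI[where t = "10 * tsize t" and u = "10 * tsize t"])
    apply (rule exec_move_tree[where t = t and r = r])
       apply (use tsize_pos[of t] in simp_all)
  using exec_flush[of 3 "store_of i j r (rev (flat t)) [] [] out" "rev (flat t)" "10 * tsize t"]
    tsize_pos[of t] rev_flat_symbols[of t]
  by simp

lemma exec_t_swap:
  "100 * tsize s + 100 * tsize t \<le> v \<Longrightarrow>
    exec t_swap (work_store i j (flat s @ flat t @ r) out) v (work_store i j (flat t @ flat s @ r) out)"
  unfolding t_swap_def
  apply (rule exec_SeqI[where t = "10 * tsize s"
        and u = "50 * tsize s + 50 * tsize t"])
    apply (rule exec_move_tree[where t = s and r = "flat t @ r"])
       apply (use tsize_pos[of s] tsize_pos[of t] in simp_all)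
  apply (rule exec_SeqI[where t = "10 * tsize t"
        and u = "40 * tsize s + 40 * tsize t"])
    apply (rule exec_move_tree[where t = t and r = "r"])
       apply (use tsize_pos[of s] tsize_pos[of t] in simp_all)
  apply (rule exec_SeqI[where t = "10 * tsize s"
        and u = "20 * tsize s + 20 * tsize t"])
    apply (rule exec_move_string[where xs = "rev (flat s)"])
         apply (use tsize_pos[of s] tsize_pos[of t] flat_symbols[of s] in simp_all)
  using exec_move_string[where d = 4 and e = 2 and xs = "rev (flat t)" and
     \<sigma> = "store_of i j (flat s @ r) [] (rev (flat t)) [] out"] flat_symbols[of t]
  by simp

lemma exec_t_skip: "1 \<le> v \<Longrightarrow> exec t_skip \<sigma> v \<sigma>"
  unfolding t_skip_def by (rule exec_While_endI) auto

lemma exec_t_hd: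
  assumes "100 * tsize t \<le> v"
  shows "exec t_hd (work_store i j (flat t @ r) out) v (work_store i j (flat (t_hd_fun t) @ r) out)"
proof (cases t)
  case Leaf
  then show ?thesis using assms unfolding t_hd_def
    by (intro exec_IteI[where t = 1]) (auto intro: exec_t_skip)
next
  case (Node x y)
  let ?n = "tsize x + tsize y"
  have "exec (Pop 2 ;; move_tree 3 ;; move_tree 4 ;; flush 4 ;; move_string 3 2)
     (work_store i j (2 # flat x @ flat y @ r) out) (70 * ?n) (work_store i j (flat x @ r) out)"
    apply (rule exec_SeqI[where t = 1 and u = "60 * ?n"])
      apply (rule exec_PopI)
        apply (use tsize_pos[of x] tsize_pos[of y] in simp_all)
    apply (rule exec_SeqI[where t = "10 * ?n" and u = "50 * ?n"])
      apply (rule exec_move_tree[where t = x and r = "flat y @ r"])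
         apply (use tsize_pos[of x] tsize_pos[of y] in simp_all)
    apply (rule exec_SeqI[where t = "10 * ?n" and u = "40 * ?n"])
      apply (rule exec_move_tree[where t = y and r = "r"])
         apply (use tsize_pos[of x] tsize_pos[of y] in simp_all)
    apply (rule exec_SeqI[where t = "10 * ?n" and u = "30 * ?n"])
      apply (rule exec_flush[where xs = "rev (flat y)"])
         apply (use tsize_pos[of x] tsize_pos[of y] flat_symbols[of y] in simp_all)
    using exec_move_string[where d = 3 and e = 2 and xs = "rev (flat x)" and
       \<sigma> = "store_of i j r (rev (flat x)) [] [] out"] flat_symbols[of x]
    by simp
  then show ?thesis
    using assms Node unfolding t_hd_def
    by (intro exec_IteI[where t = "70 * ?n"]) auto
qed

lemma exec_t_tl:
  assumes "110 * tsize t \<le> v"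
  shows "exec t_tl (work_store i j (flat t @ r) out) v (work_store i j (flat (t_tl_fun t) @ r) out)"
proof (cases t)
  case Leaf
  then show ?thesis using assms unfolding t_tl_def
    by (intro exec_IteI[where t = 1]) (auto intro: exec_t_skip)
next
  case (Node x y)
  let ?n = "tsize x"
  have "exec (Pop 2 ;; t_drop)
     (work_store i j (2 # flat x @ flat y @ r) out) (105 * ?n) (work_store i j (flat y @ r) out)"
    apply (rule exec_SeqI[where t = 1 and u = "100 * ?n"])
      apply (rule exec_PopI)
        apply (use tsize_pos[of x] in simp_all)
    apply (rule exec_t_drop)
    apply simp
    done
  then show ?thesis
    using assms Node unfolding t_tl_def
    by (intro exec_IteI[where t = "105 * ?n"]) auto
qed

lemma exec_copy_string:
  assumes "set xs \<subseteq> {1, 2}" "8 * length xs + 1 \<le> v"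
  shows "exec (While (\<lambda>v. v ! 3 \<noteq> 0) (Ite (\<lambda>v. v ! 3 = 1) (Push 4 1) (Push 4 2) ;; move_symbol 3 2))
    (store_of i j s xs b c out) v (store_of i j (rev xs @ s) [] (rev xs @ b) c out)"
  using assms
proof (induction xs arbitrary: s b v)
  case Nil
  then show ?case by (auto intro!: exec_While_endI)
next
  case (Cons x xs)
  have 1: "exec (Ite (\<lambda>v. v ! 3 = 1) (Push 4 1) (Push 4 2)) (store_of i j s (x # xs) b c out) 3
      (store_of i j s (x # xs) (x # b) c out)"
    using Cons.prems by (intro exec_IteI[where t = 2]) (auto intro!: exec_PushI)
  have "exec (move_symbol 3 2) (store_of i j s (x # xs) (x # b) c out) 4
      (store_of i j (x # s) xs (x # b) c out)"
    using Cons.prems exec_move_symbol[of 3 2 "store_of i j s (x # xs) (x # b) c out" x xs 4] by auto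
  with 1 have "exec (Ite (\<lambda>v. v ! 3 = 1) (Push 4 1) (Push 4 2) ;; move_symbol 3 2)
      (store_of i j s (x # xs) b c out) 7 (store_of i j (x # s) xs (x # b) c out)"
    by (rule exec_SeqI) simp
  note step = this
  have c: "scans (store_of i j s (x # xs) b c out) ! 3 \<noteq> 0" using Cons.prems by auto
  have "exec (While (\<lambda>v. v ! 3 \<noteq> 0) (Ite (\<lambda>v. v ! 3 = 1) (Push 4 1) (Push 4 2) ;; move_symbol 3 2))
    (store_of i j (x # s) xs (x # b) c out) (8 * length xs + 1)
    (store_of i j (rev xs @ x # s) [] (rev xs @ x # b) c out)"
    using Cons by auto
  then have "exec (While (\<lambda>v. v ! 3 \<noteq> 0) (Ite (\<lambda>v. v ! 3 = 1) (Push 4 1) (Push 4 2) ;; move_symbol 3 2))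
    (store_of i j s (x # xs) b c out) v (store_of i j (rev xs @ x # s) [] (rev xs @ x # b) c out)"
    by (rule exec_WhileI[where b = "\<lambda>v. v ! 3 \<noteq> 0", OF c step]) (use Cons.prems in simp)
  then show ?case by simp
qed

lemma exec_t_dup:
  assumes "100 * tsize t \<le> v"
  shows "exec t_dup (work_store i j (flat t @ r) out) v (work_store i j (flat t @ flat t @ r) out)"
proof -
  let ?n = "tsize t"
  have 1: "exec (move_tree 3) (work_store i j (flat t @ r) out) (10 * ?n)
      (store_of i j r (rev (flat t)) [] [] out)"
    using exec_move_tree[of 3 "work_store i j (flat t @ r) out" t r "10 * ?n"] tsize_pos[of t] by simp
  have 2: "exec (While (\<lambda>v. v ! 3 \<noteq> 0) (Ite (\<lambda>v. v ! 3 = 1) (Push 4 1) (Push 4 2) ;; move_symbol 3 2))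
      (store_of i j r (rev (flat t)) [] [] out) (10 * ?n) (store_of i j (flat t @ r) [] (flat t) [] out)"
    using exec_copy_string[of "rev (flat t)" "10 * ?n" i j r "[]" "[]" out] tsize_pos[of t] flat_symbols[of t]
    by simp
  have 3: "exec (move_string 4 3) (store_of i j (flat t @ r) [] (flat t) [] out) (10 * ?n)
      (store_of i j (flat t @ r) (rev (flat t)) [] [] out)"
    using exec_move_string[of 4 3 "store_of i j (flat t @ r) [] (flat t) [] out" "flat t" "10 * ?n"]
      tsize_pos[of t] flat_symbols[of t] by simp
  have 4: "exec (move_string 3 2) (store_of i j (flat t @ r) (rev (flat t)) [] [] out) (10 * ?n)
      (work_store i j (flat t @ flat t @ r) out)"
    using exec_move_string[of 3 2 "store_of i j (flat t @ r) (rev (flat t)) [] [] out" "rev (flat t)" "10 * ?n"]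
      tsize_pos[of t] flat_symbols[of t] by simp
  show ?thesis
    unfolding t_dup_def
    by (rule exec_SeqI[OF 1 exec_SeqI[OF 2 exec_SeqI[OF 3 4 order_refl] order_refl]]) (use assms in simp)
qed

text \<open>The loop strips the common prefix, so both remainders are empty exactly if the strings
  are equal. Nonempty remainders have to be flushed afterwards, hence the bounds on them.\<close>

lemma exec_compare:
  assumes "set xs \<subseteq> {1, 2}" "set ys \<subseteq> {1, 2}" "3 * length xs + 1 \<le> v"
  shows "\<exists>xs' ys'. exec (While (\<lambda>v. v ! 3 = v ! 4 \<and> v ! 3 \<noteq> 0) (Pop 3 ;; Pop 4))
      (store_of i j s xs ys c out) v (store_of i j s xs' ys' c out) \<and>
    (xs = ys \<longleftrightarrow> xs' = [] \<and> ys' = []) \<and> set xs' \<subseteq> {1, 2} \<and> set ys' \<subseteq> {1, 2} \<and>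
    length xs' \<le> length xs \<and> length ys' \<le> length ys"
  using assms
proof (induction xs arbitrary: ys v)
  case Nil
  then show ?case
    by (intro exI[of _ "[]"] exI[of _ ys]) (auto intro!: exec_While_endI)
next
  case (Cons x xs)
  show ?case
  proof (cases "scan ys = x")
    case True
    then obtain zs where ys: "ys = x # zs" using Cons.prems by (cases ys) auto
    obtain xs' ys' where *: "exec (While (\<lambda>v. v ! 3 = v ! 4 \<and> v ! 3 \<noteq> 0) (Pop 3 ;; Pop 4))
      (store_of i j s xs zs c out) (3 * length xs + 1) (store_of i j s xs' ys' c out)"
      "xs = zs \<longleftrightarrow> xs' = [] \<and> ys' = []" "set xs' \<subseteq> {1, 2}" "set ys' \<subseteq> {1, 2}"
      "length xs' \<le> length xs" "length ys' \<le> length zs"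
      using Cons.IH[of zs "3 * length xs + 1"] Cons.prems ys by auto
    have "exec (Pop 3 ;; Pop 4) (store_of i j s (x # xs) (x # zs) c out) 2 (store_of i j s xs zs c out)"
      by (auto intro!: exec_SeqI[where t = 1 and u = 1] exec_PopI)
    note step = this
    have "exec (While (\<lambda>v. v ! 3 = v ! 4 \<and> v ! 3 \<noteq> 0) (Pop 3 ;; Pop 4))
      (store_of i j s (x # xs) ys c out) v (store_of i j s xs' ys' c out)"
      unfolding ys
      by (rule exec_WhileI[where b = "\<lambda>v. v ! 3 = v ! 4 \<and> v ! 3 \<noteq> 0", OF _ step *(1)])
        (use Cons.prems in auto)
    then show ?thesis
      using * ys by (intro exI[of _ xs'] exI[of _ ys']) auto
  next
    case False
    then show ?thesis using Cons.prems
      by (intro exI[of _ "x # xs"] exI[of _ ys]) (auto intro!: exec_While_endI)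
  qed
qed

lemma exec_t_eq:
  assumes "100 * tsize s + 100 * tsize t \<le> v"
  shows "exec t_eq (work_store i j (flat s @ flat t @ r) out) v
    (work_store i j (flat (if s = t then Node Leaf Leaf else Leaf) @ r) out)"
proof -
  let ?n = "tsize s + tsize t"
  let ?end = "work_store i j (flat (if s = t then Node Leaf Leaf else Leaf) @ r) out"
  have pos: "Suc 0 \<le> tsize s" "Suc 0 \<le> tsize t" by (rule tsize_pos)+
  have 1: "exec (move_tree 3) (work_store i j (flat s @ flat t @ r) out) (10 * ?n)
      (store_of i j (flat t @ r) (rev (flat s)) [] [] out)"
    using exec_move_tree[of 3 "work_store i j (flat s @ flat t @ r) out" s "flat t @ r" "10 * ?n"] pos by simp
  have 2: "exec (move_tree 4) (store_of i j (flat t @ r) (rev (flat s)) [] [] out) (10 * ?n)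
      (store_of i j r (rev (flat s)) (rev (flat t)) [] out)"
    using exec_move_tree[of 4 "store_of i j (flat t @ r) (rev (flat s)) [] [] out" t r "10 * ?n"] pos by simp
  obtain xs ys where 3: "exec (While (\<lambda>v. v ! 3 = v ! 4 \<and> v ! 3 \<noteq> 0) (Pop 3 ;; Pop 4))
      (store_of i j r (rev (flat s)) (rev (flat t)) [] out) (10 * ?n) (store_of i j r xs ys [] out)"
    and c: "s = t \<longleftrightarrow> xs = [] \<and> ys = []" "set xs \<subseteq> {1, 2}" "set ys \<subseteq> {1, 2}"
    "length xs \<le> tsize s" "length ys \<le> tsize t"
    using exec_compare[of "rev (flat s)" "rev (flat t)" "10 * ?n" i j r "[]" out] flat_symbols[of s]
      flat_symbols[of t] pos by (auto simp: flat_inj)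
  have "exec (flush 3) (store_of i j r xs ys [] out) (10 * ?n) (store_of i j r [] ys [] out)"
    using exec_flush[of 3 "store_of i j r xs ys [] out" xs "10 * ?n"] c pos by simp
  moreover have "exec (flush 4) (store_of i j r [] ys [] out) (10 * ?n) (work_store i j r out)"
    using exec_flush[of 4 "store_of i j r [] ys [] out" ys "10 * ?n"] c pos by simp
  moreover have "exec (Push 2 1) (work_store i j r out) 2 (work_store i j (1 # r) out)"
    by (rule exec_PushI) auto
  ultimately have ne: "exec (flush 3 ;; flush 4 ;; Push 2 1) (store_of i j r xs ys [] out) (22 * ?n)
      (work_store i j (1 # r) out)"
    using pos by (intro exec_SeqI[of "flush 3" _ "10 * ?n" _ _ "12 * ?n"] exec_SeqI[of "flush 4" _ "10 * ?n" _ _ 2]) simp_all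
  have "exec (Push 2 1 ;; Push 2 1 ;; Push 2 2) (work_store i j r out) 6 (work_store i j (2 # 1 # 1 # r) out)"
    by (rule exec_SeqI[OF exec_PushI exec_SeqI[OF exec_PushI exec_PushI]]) (auto intro: order_refl)
  then have eq: "exec (Push 2 1 ;; Push 2 1 ;; Push 2 2) (work_store i j r out) (22 * ?n) (work_store i j (2 # 1 # 1 # r) out)"
    by (rule exec_mono) (use pos in simp)
  have scan0: "scan zs = 0 \<longleftrightarrow> zs = []" if "set zs \<subseteq> {1, 2}" for zs
    using that by (cases zs) auto
  have 4: "exec (Ite (\<lambda>v. v ! 3 = 0 \<and> v ! 4 = 0) (Push 2 1 ;; Push 2 1 ;; Push 2 2) (flush 3 ;; flush 4 ;; Push 2 1))
      (store_of i j r xs ys [] out) (30 * ?n) ?end"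
  proof (rule exec_IteI[where t = "22 * ?n"])
    assume "scans (store_of i j r xs ys [] out) ! 3 = 0 \<and> scans (store_of i j r xs ys [] out) ! 4 = 0"
    then have "xs = []" "ys = []" using scan0 c by auto
    then show "exec (Push 2 1 ;; Push 2 1 ;; Push 2 2) (store_of i j r xs ys [] out) (22 * ?n) ?end"
      using eq c(1) by simp
  next
    assume "\<not> (scans (store_of i j r xs ys [] out) ! 3 = 0 \<and> scans (store_of i j r xs ys [] out) ! 4 = 0)"
    then have "s \<noteq> t" using c(1) by auto
    then show "exec (flush 3 ;; flush 4 ;; Push 2 1) (store_of i j r xs ys [] out) (22 * ?n) ?end"
      using ne by simp
  qed (use pos in simp)
  show ?thesis
    unfolding t_eq_def
    by (rule exec_SeqI[OF 1 exec_SeqI[OF 2 exec_SeqI[OF 3 4 order_refl] order_refl]]) (use assms in simp)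
qed

section \<open>Polynomial-time functions on coded data\<close>

text \<open>Injectivity makes equality decidable by comparing codes. Different types may share
  codes, which is exploited below.\<close>

class codable =
  fixes code :: "'a \<Rightarrow> tree"
  assumes code_inj: "code x = code y \<Longrightarrow> x = y"

lemma code_eq_iff [simp]: "code x = code y \<longleftrightarrow> x = y"
  using code_inj by blast

definition csize :: "'a::codable \<Rightarrow> nat" where
  "csize x = tsize (code x)"

lemma csize_pos: "Suc 0 \<le> csize x"
  unfolding csize_def by (rule tsize_pos)

instantiation tree :: codable
begin
definition "code_tree (t :: tree) = t"
instance by standard (simp add: code_tree_def)
end

instantiation unit :: codable
begin
definition "code_unit (u :: unit) = Leaf"
instance by standard simp
end

instantiation bool :: codable
begin
definition "code_bool b = (if b then Node Leaf Leaf else Leaf)"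
instance by standard (simp add: code_bool_def split: if_splits)
end

text \<open>Numbers are coded in unary; binary numerals are treated as words.\<close>

instantiation nat :: codable
begin
primrec code_nat :: "nat \<Rightarrow> tree" where
  "code_nat 0 = Leaf"
| "code_nat (Suc n) = Node Leaf (code_nat n)"
instance
proof
  fix m n :: nat
  show "code m = code n \<Longrightarrow> m = n"
  proof (induction m arbitrary: n)
    case 0
    then show ?case by (cases n) auto
  next
    case (Suc m)
    then show ?case by (cases n) auto
  qed
qed
end

instantiation prod :: (codable, codable) codable
begin
primrec code_prod :: "'a \<times> 'b \<Rightarrow> tree" where
  "code_prod (a, b) = Node (code a) (code b)"
instance by standard auto
end

instantiation list :: (codable) codable
begin
primrec code_list :: "'a list \<Rightarrow> tree" where
  "code_list [] = Leaf"
| "code_list (x # xs) = Node (code x) (code_list xs)"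
instance
proof
  fix xs ys :: "'a list"
  show "code xs = code ys \<Longrightarrow> xs = ys"
  proof (induction xs arbitrary: ys)
    case Nil
    then show ?case by (cases ys) auto
  next
    case (Cons x xs)
    then show ?case by (cases ys) auto
  qed
qed
end

lemma csize_simps [simp]:
  "csize (a, b) = Suc (csize a + csize b)"
  "csize [] = 1"
  "csize (x # xs) = Suc (csize x + csize xs)"
  "csize (n :: nat) = Suc (2 * n)"
  by (simp_all add: csize_def, induction n) auto

lemma csize_bool: "csize (b :: bool) \<le> 3"
  by (simp add: csize_def code_bool_def)

lemma csize_append: "csize (xs @ ys) + 1 = csize xs + csize ys"
  by (induction xs) auto

lemma csize_rev [simp]: "csize (rev xs) = csize xs"
proof (induction xs)
  case (Cons x xs)
  then show ?case using csize_append[of "rev xs" "[x]"] by simp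
qed simp

lemma length_le_csize: "length xs \<le> csize xs"
  by (induction xs) auto

section \<open>Polynomial bounds and the class of feasible functions\<close>

definition pbound :: "(nat \<Rightarrow> nat) \<Rightarrow> bool" where
  "pbound T \<longleftrightarrow> (\<exists>p :: nat poly. \<forall>n. T n \<le> poly p n)"

lemma poly_mono_nat: "m \<le> n \<Longrightarrow> poly p m \<le> poly (p :: nat poly) n"
  by (induction p) (auto intro: add_mono mult_le_mono)

lemma pbound_poly: "pbound (poly p)"
  by (auto simp: pbound_def)

lemma pbound_const: "pbound (\<lambda>_. c)"
  unfolding pbound_def by (rule exI[of _ "[:c:]"]) simp

lemma pbound_id: "pbound (\<lambda>n. n)"
  unfolding pbound_def by (rule exI[of _ "[:0, 1:]"]) simp

lemma pbound_add:
  assumes "pbound S" "pbound T"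
  shows "pbound (\<lambda>n. S n + T n)"
proof -
  obtain p q where "\<And>n. S n \<le> poly p n" "\<And>n. T n \<le> poly q n"
    using assms by (auto simp: pbound_def)
  then show ?thesis unfolding pbound_def by (intro exI[of _ "p + q"]) (auto intro: add_mono)
qed

lemma pbound_mult:
  assumes "pbound S" "pbound T"
  shows "pbound (\<lambda>n. S n * T n)"
proof -
  obtain p q where "\<And>n. S n \<le> poly p n" "\<And>n. T n \<le> poly q n"
    using assms by (auto simp: pbound_def)
  then show ?thesis unfolding pbound_def by (intro exI[of _ "p * q"]) (auto intro: mult_le_mono)
qed

text \<open>Polynomials over the naturals are monotone, hence upper bounds can be substituted into
  each other.\<close>

lemma pbound_comp:
  assumes "pbound S" "pbound T"
  shows "pbound (\<lambda>n. S (T n))"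
proof -
  obtain p q where "\<And>n. S n \<le> poly p n" "\<And>n. T n \<le> poly q n"
    using assms by (auto simp: pbound_def)
  then have "S (T n) \<le> poly (pcompose p q) n" for n
    unfolding poly_pcompose by (meson order_trans poly_mono_nat)
  then show ?thesis unfolding pbound_def by blast
qed

lemma pbound_Suc: "pbound T \<Longrightarrow> pbound (\<lambda>n. Suc (T n))"
  using pbound_add[OF _ pbound_const[of 1]] by simp

lemma pbound_Suc_id: "pbound Suc"
  using pbound_Suc[OF pbound_id] by simp

lemmas pbound_intros = pbound_poly pbound_const pbound_id pbound_Suc_id pbound_Suc pbound_add pbound_mult

text \<open>The argument on top of the work stack is replaced by the value, while everything below
  it, the inputs and the output stay as they are; so programs can be nested. The bound on the size
  of values keeps the time of a composition polynomial.\<close>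

definition fp :: "('a::codable \<Rightarrow> 'b::codable) \<Rightarrow> bool" where
  "fp f \<longleftrightarrow> (\<exists>P (p :: nat poly). wf_prog P \<and> guess_free P \<and>
     (\<forall>x i j r out. exec P (work_store i j (flat (code x) @ r) out) (poly p (csize x))
        (work_store i j (flat (code (f x)) @ r) out)) \<and>
     (\<forall>x. csize (f x) \<le> poly p (csize x)))"

lemma fpI:
  assumes "wf_prog P" "guess_free P" "pbound T"
    and "\<And>x i j r out. exec P (work_store i j (flat (code x) @ r) out) (T (csize x))
        (work_store i j (flat (code (f x)) @ r) out)"
    and "\<And>x. csize (f x) \<le> T (csize x)"
  shows "fp f"
proof -
  obtain p :: "nat poly" where p: "\<And>n. T n \<le> poly p n" using assms(3) by (auto simp: pbound_def)
  have "\<forall>x i j r out. exec P (work_store i j (flat (code x) @ r) out) (poly p (csize x))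
        (work_store i j (flat (code (f x)) @ r) out)"
    by (intro allI exec_mono[OF assms(4) p])
  moreover have "\<forall>x. csize (f x) \<le> poly p (csize x)"
    using order_trans[OF assms(5) p] by blast
  ultimately show ?thesis
    unfolding fp_def using assms(1,2) by blast
qed

text \<open>Replaces the polynomial by a monotone \<open>T\<close> and the exact size by any upper
  bound \<open>n\<close>, the form in which the times of subprograms are estimated.\<close>

lemma fpE:
  assumes "fp f"
  obtains P T where "wf_prog P" "guess_free P" "pbound T" "mono T"
    "\<And>x i j r out n. csize x \<le> n \<Longrightarrow> exec P (work_store i j (flat (code x) @ r) out) (T n)
        (work_store i j (flat (code (f x)) @ r) out)"
    "\<And>x. csize (f x) \<le> T (csize x)"
proof -
  obtain P and p :: "nat poly" where P: "wf_prog P" "guess_free P"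
    "\<And>x i j r out. exec P (work_store i j (flat (code x) @ r) out) (poly p (csize x))
        (work_store i j (flat (code (f x)) @ r) out)"
    "\<And>x. csize (f x) \<le> poly p (csize x)"
    using assms unfolding fp_def by blast
  show thesis
  proof (rule that[of P "poly p"])
    show "exec P (work_store i j (flat (code x) @ r) out) (poly p n)
        (work_store i j (flat (code (f x)) @ r) out)" if "csize x \<le> n" for x i j r out n
      by (rule exec_mono[OF P(3) poly_mono_nat[OF that]])
  qed (use P in \<open>auto simp: pbound_poly mono_def intro: poly_mono_nat\<close>)
qed

lemma fp_csize:
  assumes "fp f"
  obtains T where "pbound T" "mono T" "\<And>x. csize (f x) \<le> T (csize x)"
  using fpE[OF assms] by metis

text \<open>Only codes matter. A nonempty list is coded like the pair of its head and tail and a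
  number like a list of units, so operations carry over from one type to another.\<close>

lemma fp_cong_code: "fp f \<Longrightarrow> (\<And>x. code (g x) = code (f x)) \<Longrightarrow> fp g"
  unfolding fp_def csize_def by simp

lemma fp_id: "fp (\<lambda>x. x)"
  by (rule fpI[of t_skip "\<lambda>n. n + 1"])
     (auto simp: t_skip_def intro!: exec_While_endI pbound_intros)

lemma fp_comp:
  assumes "fp g" "fp f"
  shows "fp (\<lambda>x. f (g x))"
proof -
  obtain P S where P: "wf_prog P" "guess_free P" "pbound S" "mono S"
    "\<And>x i j r out n. csize x \<le> n \<Longrightarrow> exec P (work_store i j (flat (code x) @ r) out) (S n)
        (work_store i j (flat (code (f x)) @ r) out)"
    "\<And>x. csize (f x) \<le> S (csize x)" using fpE[OF assms(2)] by metis
  obtain Q T where Q: "wf_prog Q" "guess_free Q" "pbound T" "mono T"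
    "\<And>x i j r out n. csize x \<le> n \<Longrightarrow> exec Q (work_store i j (flat (code x) @ r) out) (T n)
        (work_store i j (flat (code (g x)) @ r) out)"
    "\<And>x. csize (g x) \<le> T (csize x)" using fpE[OF assms(1)] by metis
  show ?thesis
  proof (rule fpI[of "Q ;; P" "\<lambda>n. T n + S (T n)"])
    show "wf_prog (Q ;; P)" "guess_free (Q ;; P)" "pbound (\<lambda>n. T n + S (T n))"
      using P Q by (auto intro: pbound_intros pbound_comp)
    fix x i j r out
    show "exec (Q ;; P) (work_store i j (flat (code x) @ r) out) (T (csize x) + S (T (csize x)))
        (work_store i j (flat (code (f (g x))) @ r) out)"
      by (rule exec_Seq[OF Q(5)[OF order_refl] P(5)[OF Q(6)]])
    have "csize (f (g x)) \<le> S (csize (g x))" by (rule P)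
    also have "\<dots> \<le> S (T (csize x))" using Q(6) P(4) by (auto simp: mono_def)
    finally show "csize (f (g x)) \<le> T (csize x) + S (T (csize x))" by simp
  qed
qed

lemma wf_t [simp]:
  "wf_prog t_dup" "wf_prog t_swap" "wf_prog t_drop" "wf_prog t_hd" "wf_prog t_tl" "wf_prog t_eq" "wf_prog t_skip"
  "guess_free t_dup" "guess_free t_swap" "guess_free t_drop" "guess_free t_hd" "guess_free t_tl"
  "guess_free t_eq" "guess_free t_skip"
  by (simp_all add: t_dup_def t_swap_def t_drop_def t_hd_def t_tl_def t_eq_def t_skip_def
      move_tree_def move_tree_loop_def move_string_def move_symbol_def flush_def)

text \<open>The argument is duplicated so that each function gets its own copy; the swaps bring the
  second copy to the top and then the two values into order.\<close>

definition p_both :: "prog \<Rightarrow> prog \<Rightarrow> prog" where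
  "p_both F G = t_dup ;; F ;; t_swap ;; G ;; t_swap"

lemma fp_both:
  assumes "fp f" "fp g"
  obtains F T where "wf_prog F" "guess_free F" "pbound T" "mono T"
    "\<And>x i j r out. exec F (work_store i j (flat (code x) @ r) out) (T (csize x))
      (work_store i j (flat (code (f x)) @ flat (code (g x)) @ r) out)"
    "\<And>x. csize (f x) \<le> T (csize x)" "\<And>x. csize (g x) \<le> T (csize x)"
proof -
  obtain P S where P: "wf_prog P" "guess_free P" "pbound S" "mono S"
    "\<And>x i j r out n. csize x \<le> n \<Longrightarrow> exec P (work_store i j (flat (code x) @ r) out) (S n)
        (work_store i j (flat (code (f x)) @ r) out)"
    "\<And>x. csize (f x) \<le> S (csize x)" using fpE[OF assms(1)] by metis
  obtain Q T where Q: "wf_prog Q" "guess_free Q" "pbound T" "mono T"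
    "\<And>x i j r out n. csize x \<le> n \<Longrightarrow> exec Q (work_store i j (flat (code x) @ r) out) (T n)
        (work_store i j (flat (code (g x)) @ r) out)"
    "\<And>x. csize (g x) \<le> T (csize x)" using fpE[OF assms(2)] by metis
  define U where "U n = 200 * n + 300 * S n + 200 * T n" for n
  show thesis
  proof (rule that[of "p_both P Q" U])
    show "wf_prog (p_both P Q)" "guess_free (p_both P Q)"
      using P Q by (auto simp: p_both_def)
    show "pbound U" using P Q unfolding U_def by (auto intro!: pbound_intros)
    show "mono U" unfolding U_def using P(4) Q(4) by (auto simp: mono_def intro!: add_mono mult_le_mono2)
    fix x
    show "csize (f x) \<le> U (csize x)" using P(6)[of x] by (simp add: U_def)
    show "csize (g x) \<le> U (csize x)" using Q(6)[of x] by (simp add: U_def)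
    fix i j r out
    have 1: "exec t_dup (work_store i j (flat (code x) @ r) out) (100 * csize x)
        (work_store i j (flat (code x) @ flat (code x) @ r) out)"
      by (rule exec_t_dup) (simp add: csize_def)
    have 2: "exec t_swap (work_store i j (flat (code (f x)) @ flat (code x) @ r) out)
        (100 * csize (f x) + 100 * csize x) (work_store i j (flat (code x) @ flat (code (f x)) @ r) out)"
      by (rule exec_t_swap) (simp add: csize_def)
    have 3: "exec t_swap (work_store i j (flat (code (g x)) @ flat (code (f x)) @ r) out)
        (100 * csize (g x) + 100 * csize (f x)) (work_store i j (flat (code (f x)) @ flat (code (g x)) @ r) out)"
      by (rule exec_t_swap) (simp add: csize_def)
    show "exec (p_both P Q) (work_store i j (flat (code x) @ r) out) (U (csize x))
      (work_store i j (flat (code (f x)) @ flat (code (g x)) @ r) out)"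
      unfolding p_both_def
      by (rule exec_mono[OF exec_Seq[OF 1 exec_Seq[OF P(5)[OF order_refl] exec_Seq[OF 2
              exec_Seq[OF Q(5)[OF order_refl] 3]]]]])
        (use P(6)[of x] Q(6)[of x] in \<open>simp add: U_def\<close>)
  qed
qed

lemma fp_Pair:
  assumes "fp f" "fp g"
  shows "fp (\<lambda>x. (f x, g x))"
proof -
  obtain F T where F: "wf_prog F" "guess_free F" "pbound T" "mono T"
    "\<And>x i j r out. exec F (work_store i j (flat (code x) @ r) out) (T (csize x))
      (work_store i j (flat (code (f x)) @ flat (code (g x)) @ r) out)"
    "\<And>x. csize (f x) \<le> T (csize x)" "\<And>x. csize (g x) \<le> T (csize x)"
    using fp_both[OF assms] by metis
  show ?thesis
  proof (rule fpI[of "F ;; Push 2 2" "\<lambda>n. 2 * T n + 2"])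
    fix x i j r out
    have "exec (Push 2 2) (work_store i j (flat (code (f x)) @ flat (code (g x)) @ r) out) 2
        (work_store i j (flat (code (f x, g x)) @ r) out)"
      by (rule exec_PushI) auto
    from exec_Seq[OF F(5) this] show "exec (F ;; Push 2 2) (work_store i j (flat (code x) @ r) out)
        (2 * T (csize x) + 2) (work_store i j (flat (code (f x, g x)) @ r) out)"
      by (rule exec_mono) simp
    show "csize (f x, g x) \<le> 2 * T (csize x) + 2" using F(6)[of x] F(7)[of x] by simp
  qed (use F in \<open>auto intro!: pbound_intros\<close>)
qed

lemma fp_fst: "fp f \<Longrightarrow> fp (\<lambda>x. fst (f x))"
proof (rule fp_comp[of f fst], assumption)
  show "fp (fst :: 'b \<times> 'c \<Rightarrow> 'b)"
  proof (rule fpI[of t_hd "\<lambda>n. 100 * n"])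
    fix x :: "'b \<times> 'c" and i j r out
    show "exec t_hd (work_store i j (flat (code x) @ r) out) (100 * csize x)
        (work_store i j (flat (code (fst x)) @ r) out)"
      using exec_t_hd[of "code x" "100 * csize x"] by (cases x) (simp add: csize_def)
    show "csize (fst x) \<le> 100 * csize x" by (cases x) simp
  qed (auto intro!: pbound_intros)
qed

lemma fp_snd: "fp f \<Longrightarrow> fp (\<lambda>x. snd (f x))"
proof (rule fp_comp[of f snd], assumption)
  show "fp (snd :: 'b \<times> 'c \<Rightarrow> 'c)"
  proof (rule fpI[of t_tl "\<lambda>n. 110 * n"])
    fix x :: "'b \<times> 'c" and i j r out
    show "exec t_tl (work_store i j (flat (code x) @ r) out) (110 * csize x)
        (work_store i j (flat (code (snd x)) @ r) out)"
      using exec_t_tl[of "code x" "110 * csize x"] by (cases x) (simp add: csize_def)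
    show "csize (snd x) \<le> 110 * csize x" by (cases x) simp
  qed (auto intro!: pbound_intros)
qed

lemma fp_tl: "fp f \<Longrightarrow> fp (\<lambda>x. tl (f x))"
proof (rule fp_comp[of f tl], assumption)
  show "fp (tl :: 'b list \<Rightarrow> 'b list)"
  proof (rule fpI[of t_tl "\<lambda>n. 110 * n"])
    fix x :: "'b list" and i j r out
    show "exec t_tl (work_store i j (flat (code x) @ r) out) (110 * csize x)
        (work_store i j (flat (code (tl x)) @ r) out)"
      using exec_t_tl[of "code x" "110 * csize x"] by (cases x) (simp_all add: csize_def)
    show "csize (tl x) \<le> 110 * csize x" by (cases x) simp_all
  qed (auto intro!: pbound_intros)
qed

lemma fp_eq:
  assumes "fp f" "fp g"
  shows "fp (\<lambda>x. f x = g x)"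
proof -
  obtain F T where F: "wf_prog F" "guess_free F" "pbound T" "mono T"
    "\<And>x i j r out. exec F (work_store i j (flat (code x) @ r) out) (T (csize x))
      (work_store i j (flat (code (f x)) @ flat (code (g x)) @ r) out)"
    "\<And>x. csize (f x) \<le> T (csize x)" "\<And>x. csize (g x) \<le> T (csize x)"
    using fp_both[OF assms] by metis
  show ?thesis
  proof (rule fpI[of "F ;; t_eq" "\<lambda>n. 201 * T n + 3"])
    fix x i j r out
    have "exec t_eq (work_store i j (flat (code (f x)) @ flat (code (g x)) @ r) out) (100 * csize (f x) + 100 * csize (g x))
        (work_store i j (flat (code (f x = g x)) @ r) out)"
      using exec_t_eq[of "code (f x)" "code (g x)" "100 * csize (f x) + 100 * csize (g x)"]
      by (simp add: csize_def code_bool_def)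
    from exec_Seq[OF F(5) this] show "exec (F ;; t_eq) (work_store i j (flat (code x) @ r) out)
        (201 * T (csize x) + 3) (work_store i j (flat (code (f x = g x)) @ r) out)"
      by (rule exec_mono) (use F(6)[of x] F(7)[of x] in simp)
    show "csize (f x = g x) \<le> 201 * T (csize x) + 3" using csize_bool[of "f x = g x"] by simp
  qed (use F in \<open>auto intro!: pbound_intros\<close>)
qed

fun p_push :: "nat list \<Rightarrow> prog" where
  "p_push [] = t_skip"
| "p_push (x # xs) = p_push xs ;; Push 2 x"

lemma exec_p_push:
  "set xs \<subseteq> {1, 2} \<Longrightarrow> exec (p_push xs) (work_store i j r out) (1 + 2 * length xs) (work_store i j (xs @ r) out)"
proof (induction xs)
  case Nil
  then show ?case by (simp add: exec_t_skip)
next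
  case (Cons x xs)
  have "exec (Push 2 x) (work_store i j (xs @ r) out) 2 (work_store i j (x # xs @ r) out)"
    by (rule exec_PushI) (use Cons in auto)
  then have "exec (p_push xs ;; Push 2 x) (work_store i j r out) (1 + 2 * length xs + 2) (work_store i j (x # xs @ r) out)"
    using Cons by (intro exec_Seq) auto
  then show ?case by simp
qed

lemma wf_p_push: "set xs \<subseteq> {1, 2} \<Longrightarrow> wf_prog (p_push xs) \<and> guess_free (p_push xs)"
  by (induction xs) auto

lemma fp_const: "fp (\<lambda>_. c)"
proof (rule fpI[of "t_drop ;; p_push (flat (code c))" "\<lambda>n. 100 * n + (1 + 2 * csize c)"])
  show "wf_prog (t_drop ;; p_push (flat (code c)))" "guess_free (t_drop ;; p_push (flat (code c)))"
    using wf_p_push[OF flat_symbols] by auto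
  fix x :: 'a and i j r out
  have "exec (p_push (flat (code c))) (work_store i j r out) (1 + 2 * csize c)
      (work_store i j (flat (code c) @ r) out)"
    using exec_p_push[OF flat_symbols, of "code c"] by (simp add: csize_def)
  then show "exec (t_drop ;; p_push (flat (code c))) (work_store i j (flat (code x) @ r) out)
      (100 * csize x + (1 + 2 * csize c)) (work_store i j (flat (code c) @ r) out)"
    by (rule exec_Seq[OF exec_t_drop, rotated]) (simp add: csize_def)
qed (auto intro!: pbound_intros)

text \<open>Removes the three symbols 2, 1, 1 that code \<open>True\<close>.\<close>

definition pops :: prog where
  "pops = Pop 2 ;; Pop 2 ;; Pop 2"

lemma fp_If:
  fixes b :: "'a::codable \<Rightarrow> bool"
  assumes "fp b" "fp f" "fp g"
  shows "fp (\<lambda>x. if b x then f x else g x)"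
proof -
  obtain B T where B: "wf_prog B" "guess_free B" "pbound T" "mono T"
    "\<And>x i j r out. exec B (work_store i j (flat (code x) @ r) out) (T (csize x))
      (work_store i j (flat (code (b x)) @ flat (code x) @ r) out)"
    "\<And>x. csize (b x) \<le> T (csize x)" "\<And>x :: 'a. csize x \<le> T (csize x)"
    by (rule fp_both[OF assms(1) fp_id]) (rule that; assumption)
  obtain F U where F: "wf_prog F" "guess_free F" "pbound U" "mono U"
    "\<And>x i j r out n. csize x \<le> n \<Longrightarrow> exec F (work_store i j (flat (code x) @ r) out) (U n)
        (work_store i j (flat (code (f x)) @ r) out)"
    "\<And>x. csize (f x) \<le> U (csize x)" using fpE[OF assms(2)] by metis
  obtain G V where G: "wf_prog G" "guess_free G" "pbound V" "mono V"
    "\<And>x i j r out n. csize x \<le> n \<Longrightarrow> exec G (work_store i j (flat (code x) @ r) out) (V n)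
        (work_store i j (flat (code (g x)) @ r) out)"
    "\<And>x. csize (g x) \<le> V (csize x)" using fpE[OF assms(3)] by metis
  show ?thesis
  proof (rule fpI[of "B ;; Ite (\<lambda>v. v ! 2 = 2) (pops ;; F) (Pop 2 ;; G)" "\<lambda>n. T n + U n + V n + 4"])
    fix x i j r out
    let ?h = "if b x then f x else g x"
    have "exec (Ite (\<lambda>v. v ! 2 = 2) (pops ;; F) (Pop 2 ;; G)) (work_store i j (flat (code (b x)) @ flat (code x) @ r) out)
        (Suc (3 + U (csize x) + V (csize x))) (work_store i j (flat (code ?h) @ r) out)"
    proof (cases "b x")
      case True
      have "exec pops (work_store i j (2 # 1 # 1 # flat (code x) @ r) out) (1 + (1 + 1))
          (work_store i j (flat (code x) @ r) out)"
        unfolding pops_def by (rule exec_Seq[OF exec_PopI exec_Seq[OF exec_PopI exec_PopI]]) auto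
      from exec_mono[OF exec_Seq[OF this F(5)[OF order_refl]], of "3 + U (csize x)"] True
      have "exec (pops ;; F) (work_store i j (flat (code (b x)) @ flat (code x) @ r) out)
          (3 + U (csize x)) (work_store i j (flat (code ?h) @ r) out)"
        by (simp add: code_bool_def)
      then have "exec (pops ;; F) (work_store i j (flat (code (b x)) @ flat (code x) @ r) out)
          (3 + U (csize x) + V (csize x)) (work_store i j (flat (code ?h) @ r) out)"
        by (rule exec_mono) simp
      then show ?thesis
        by (rule exec_Ite_True[rotated]) (use True in \<open>simp add: code_bool_def\<close>)
    next
      case False
      have "exec (Pop 2) (work_store i j (1 # flat (code x) @ r) out) 1
          (work_store i j (flat (code x) @ r) out)"
        by (rule exec_PopI) auto
      from exec_Seq[OF this G(5)[OF order_refl]] False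
      have "exec (Pop 2 ;; G) (work_store i j (flat (code (b x)) @ flat (code x) @ r) out)
          (1 + V (csize x)) (work_store i j (flat (code ?h) @ r) out)"
        by (simp add: code_bool_def)
      then have "exec (Pop 2 ;; G) (work_store i j (flat (code (b x)) @ flat (code x) @ r) out)
          (3 + U (csize x) + V (csize x)) (work_store i j (flat (code ?h) @ r) out)"
        by (rule exec_mono) simp
      then show ?thesis
        by (rule exec_Ite_False[rotated]) (use False in \<open>simp add: code_bool_def\<close>)
    qed
    from exec_Seq[OF B(5) this]
    show "exec (B ;; Ite (\<lambda>v. v ! 2 = 2) (pops ;; F) (Pop 2 ;; G)) (work_store i j (flat (code x) @ r) out)
        (T (csize x) + U (csize x) + V (csize x) + 4) (work_store i j (flat (code ?h) @ r) out)"
      by (rule exec_mono) simp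
    show "csize ?h \<le> T (csize x) + U (csize x) + V (csize x) + 4"
      using F(6)[of x] G(6)[of x] by simp
  qed (use B F G in \<open>auto simp: pops_def intro!: pbound_intros\<close>)
qed

text \<open>A nonempty list already is the pair of its head and tail, so exchanging it with the
  argument and pushing one node symbol yields the triple that the branch expects.\<close>

lemma fp_case_list:
  fixes l :: "'a::codable \<Rightarrow> 'b::codable list"
  assumes "fp l" "fp g" "fp (\<lambda>z. h (fst z) (fst (snd z)) (snd (snd z)))"
  shows "fp (\<lambda>x. case l x of [] \<Rightarrow> g x | y # ys \<Rightarrow> h x y ys)"
proof -
  obtain B T where B: "wf_prog B" "guess_free B" "pbound T" "mono T"
    "\<And>x i j r out. exec B (work_store i j (flat (code x) @ r) out) (T (csize x))
      (work_store i j (flat (code (l x)) @ flat (code x) @ r) out)"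
    "\<And>x. csize (l x) \<le> T (csize x)" "\<And>x :: 'a. csize x \<le> T (csize x)"
    by (rule fp_both[OF assms(1) fp_id]) (rule that; assumption)
  obtain F U where F: "wf_prog F" "guess_free F" "pbound U" "mono U"
    "\<And>z i j r out n. csize z \<le> n \<Longrightarrow> exec F (work_store i j (flat (code z) @ r) out) (U n)
        (work_store i j (flat (code (h (fst z) (fst (snd z)) (snd (snd z)))) @ r) out)"
    "\<And>z. csize (h (fst z) (fst (snd z)) (snd (snd z))) \<le> U (csize z)" using fpE[OF assms(3)] by metis
  obtain G V where G: "wf_prog G" "guess_free G" "pbound V" "mono V"
    "\<And>x i j r out n. csize x \<le> n \<Longrightarrow> exec G (work_store i j (flat (code x) @ r) out) (V n)
        (work_store i j (flat (code (g x)) @ r) out)"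
    "\<And>x. csize (g x) \<le> V (csize x)" using fpE[OF assms(2)] by metis
  define C where "C n = 2 * T n + 1" for n
  define K where "K n = 100 * C n + 2 + U (C n) + V n + 1" for n
  show ?thesis
  proof (rule fpI[of "B ;; Ite (\<lambda>v. v ! 2 = 2) (t_swap ;; Push 2 2 ;; F) (Pop 2 ;; G)" "\<lambda>n. T n + Suc (K n)"])
    fix x i j r out
    let ?h = "case l x of [] \<Rightarrow> g x | y # ys \<Rightarrow> h x y ys"
    have sz: "csize (x, y, ys) \<le> C (csize x)" if "l x = y # ys" for y ys
      using B(6)[of x] B(7)[of x] that by (simp add: C_def)
    have "exec (Ite (\<lambda>v. v ! 2 = 2) (t_swap ;; Push 2 2 ;; F) (Pop 2 ;; G))
        (work_store i j (flat (code (l x)) @ flat (code x) @ r) out)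
        (Suc (K (csize x))) (work_store i j (flat (code ?h) @ r) out)"
    proof (cases "l x")
      case (Cons y ys)
      have 1: "exec t_swap (work_store i j (flat (code (l x)) @ flat (code x) @ r) out)
         (100 * C (csize x)) (work_store i j (flat (code x) @ flat (code (y # ys)) @ r) out)"
        unfolding Cons by (rule exec_t_swap) (use sz[OF Cons] in \<open>simp add: csize_def[symmetric]\<close>)
      have 2: "exec (Push 2 2) (work_store i j (flat (code x) @ flat (code (y # ys)) @ r) out)
         2 (work_store i j (flat (code (x, y, ys)) @ r) out)"
        by (rule exec_PushI) auto
      have "exec F (work_store i j (flat (code (x, y, ys)) @ r) out) (U (C (csize x)))
          (work_store i j (flat (code ?h) @ r) out)"
        using F(5)[OF sz[OF Cons]] by (simp add: Cons)
      from exec_mono[OF exec_Seq[OF 1 exec_Seq[OF 2 this]], of "K (csize x)"]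
      have "exec (t_swap ;; Push 2 2 ;; F) (work_store i j (flat (code (l x)) @ flat (code x) @ r) out)
          (K (csize x)) (work_store i j (flat (code ?h) @ r) out)"
        by (simp add: K_def)
      then show ?thesis
        by (rule exec_Ite_True[rotated]) (simp add: Cons)
    next
      case Nil
      have "exec (Pop 2) (work_store i j (flat (code (l x)) @ flat (code x) @ r) out) 1
          (work_store i j (flat (code x) @ r) out)"
        by (rule exec_PopI) (auto simp: Nil)
      from exec_mono[OF exec_Seq[OF this G(5)[OF order_refl]], of "K (csize x)"]
      have "exec (Pop 2 ;; G) (work_store i j (flat (code (l x)) @ flat (code x) @ r) out)
          (K (csize x)) (work_store i j (flat (code ?h) @ r) out)"
        by (simp add: Nil K_def)
      then show ?thesis
        by (rule exec_Ite_False[rotated]) (simp add: Nil)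
    qed
    from exec_Seq[OF B(5) this]
    show "exec (B ;; Ite (\<lambda>v. v ! 2 = 2) (t_swap ;; Push 2 2 ;; F) (Pop 2 ;; G)) (work_store i j (flat (code x) @ r) out)
        (T (csize x) + Suc (K (csize x))) (work_store i j (flat (code ?h) @ r) out)" .
    have "csize ?h \<le> K (csize x)"
    proof (cases "l x")
      case Nil
      then show ?thesis using G(6)[of x] by (simp add: K_def)
    next
      case (Cons y ys)
      have "csize ?h \<le> U (csize (x, y, ys))" using F(6)[of "(x, y, ys)"] by (simp add: Cons)
      also have "\<dots> \<le> U (C (csize x))" using F(4) sz[OF Cons] by (auto simp: mono_def)
      finally show ?thesis by (simp add: K_def)
    qed
    then show "csize ?h \<le> T (csize x) + Suc (K (csize x))" by simp
  next
    have "pbound K" unfolding K_def C_def using B F G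
      by (auto intro!: pbound_intros pbound_comp[where S = U])
    then show "pbound (\<lambda>n. T n + Suc (K n))"
      using B pbound_add[OF _ pbound_add[OF \<open>pbound K\<close> pbound_const[of 1]]] by auto
  qed (use B F G in auto)
qed

section \<open>Bounded iteration\<close>

lemma exec_funpow_loop:
  fixes ys :: "'b::codable list" and F :: "'s::codable \<Rightarrow> 's"
  assumes P: "\<And>z i j r out. csize z \<le> B \<Longrightarrow> exec P (work_store i j (flat (code z) @ r) out) T
        (work_store i j (flat (code (F z)) @ r) out)"
    and "\<And>k. k \<le> length ys \<Longrightarrow> csize ((F ^^ k) s) \<le> B" "csize ys \<le> B"
  shows "exec (While (\<lambda>v. v ! 2 = 2) (t_tl ;; t_swap ;; P ;; t_swap))
    (work_store i j (flat (code ys) @ flat (code s) @ r) out) (1 + length ys * (1 + 600 * B + T))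
    (work_store i j (flat (code ([] :: 'b list)) @ flat (code ((F ^^ length ys) s)) @ r) out)"
  using assms(2,3)
proof (induction ys arbitrary: s)
  case Nil
  show ?case by simp (rule exec_While_endI; simp)
next
  case (Cons y ys)
  have s: "csize s \<le> B" "csize (F s) \<le> B"
    using Cons.prems(1)[of 0] Cons.prems(1)[of 1] by auto
  have c: "scans (work_store i j (flat (code (y # ys)) @ flat (code s) @ r) out) ! 2 = 2"
    by simp
  have 1: "exec t_tl (work_store i j (flat (code (y # ys)) @ flat (code s) @ r) out) (110 * B)
      (work_store i j (flat (code ys) @ flat (code s) @ r) out)"
    using exec_t_tl[of "code (y # ys)" "110 * B"] Cons.prems(2) by (simp add: csize_def)
  have 2: "exec t_swap (work_store i j (flat (code ys) @ flat (code s) @ r) out) (200 * B)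
      (work_store i j (flat (code s) @ flat (code ys) @ r) out)"
    by (rule exec_t_swap) (use Cons.prems(2) s in \<open>simp add: csize_def[symmetric]\<close>)
  have 3: "exec t_swap (work_store i j (flat (code (F s)) @ flat (code ys) @ r) out) (200 * B)
      (work_store i j (flat (code ys) @ flat (code (F s)) @ r) out)"
    by (rule exec_t_swap) (use Cons.prems(2) s in \<open>simp add: csize_def[symmetric]\<close>)
  note body = exec_Seq[OF 1 exec_Seq[OF 2 exec_Seq[OF P[OF s(1)] 3]]]
  have "csize ((F ^^ k) (F s)) \<le> B" if "k \<le> length ys" for k
    using Cons.prems(1)[of "Suc k"] that by (simp add: funpow_swap1)
  from Cons.IH[OF this] Cons.prems(2)
  have rest: "exec (While (\<lambda>v. v ! 2 = 2) (t_tl ;; t_swap ;; P ;; t_swap))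
    (work_store i j (flat (code ys) @ flat (code (F s)) @ r) out) (1 + length ys * (1 + 600 * B + T))
    (work_store i j (flat (code ([] :: 'b list)) @ flat (code ((F ^^ length (y # ys)) s)) @ r) out)"
    by (simp add: funpow_swap1)
  show ?case
    by (rule exec_WhileI[where b = "\<lambda>v. v ! 2 = 2", OF c body rest]) simp
qed

text \<open>Iterating a feasible function may square the size in each round, so a polynomial bound
  on all intermediate values is required. The number of rounds is the length of a list, which is
  consumed as a unary counter.\<close>

lemma fp_funpow_length:
  fixes F :: "'s::codable \<Rightarrow> 's" and l :: "'a::codable \<Rightarrow> 'b::codable list"
  assumes "fp F" "fp l" "fp s" "pbound q"
    and bound: "\<And>x k. k \<le> length (l x) \<Longrightarrow> csize ((F ^^ k) (s x)) \<le> q (csize x)"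
  shows "fp (\<lambda>x. (F ^^ length (l x)) (s x))"
proof -
  obtain A T where A: "wf_prog A" "guess_free A" "pbound T" "mono T"
    "\<And>x i j r out. exec A (work_store i j (flat (code x) @ r) out) (T (csize x))
      (work_store i j (flat (code (l x)) @ flat (code (s x)) @ r) out)"
    "\<And>x. csize (l x) \<le> T (csize x)" "\<And>x. csize (s x) \<le> T (csize x)"
    using fp_both[OF assms(2,3)] by metis
  obtain P U where P: "wf_prog P" "guess_free P" "pbound U" "mono U"
    "\<And>x i j r out n. csize x \<le> n \<Longrightarrow> exec P (work_store i j (flat (code x) @ r) out) (U n)
        (work_store i j (flat (code (F x)) @ r) out)"
    "\<And>x. csize (F x) \<le> U (csize x)" using fpE[OF assms(1)] by metis
  define B where "B n = T n + q n" for n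
  define K where "K n = T n * (1 + 600 * B n + U (B n))" for n
  show ?thesis
  proof (rule fpI[of "A ;; While (\<lambda>v. v ! 2 = 2) (t_tl ;; t_swap ;; P ;; t_swap) ;; Pop 2"
        "\<lambda>n. q n + T n + (1 + K n) + 1"])
    fix x i j r out
    let ?end = "flat (code ((F ^^ length (l x)) (s x)))"
    have len: "length (l x) \<le> T (csize x)"
      using length_le_csize[of "l x"] A(6)[of x] by simp
    have "exec (While (\<lambda>v. v ! 2 = 2) (t_tl ;; t_swap ;; P ;; t_swap))
      (work_store i j (flat (code (l x)) @ flat (code (s x)) @ r) out)
      (1 + length (l x) * (1 + 600 * B (csize x) + U (B (csize x))))
      (work_store i j (flat (code ([] :: 'b list)) @ ?end @ r) out)"
    proof (rule exec_funpow_loop)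
      show "csize ((F ^^ k) (s x)) \<le> B (csize x)" if "k \<le> length (l x)" for k
        using bound[OF that] by (simp add: B_def)
      show "csize (l x) \<le> B (csize x)" using A(6)[of x] by (simp add: B_def)
    qed (rule P(5))
    moreover have "1 + length (l x) * (1 + 600 * B (csize x) + U (B (csize x))) \<le> 1 + K (csize x)"
      unfolding K_def by (intro add_left_mono mult_le_mono1 len)
    ultimately have "exec (While (\<lambda>v. v ! 2 = 2) (t_tl ;; t_swap ;; P ;; t_swap))
      (work_store i j (flat (code (l x)) @ flat (code (s x)) @ r) out)
      (1 + K (csize x)) (work_store i j (flat (code ([] :: 'b list)) @ ?end @ r) out)"
      by (rule exec_mono)
    then have 2: "exec (While (\<lambda>v. v ! 2 = 2) (t_tl ;; t_swap ;; P ;; t_swap))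
      (work_store i j (flat (code (l x)) @ flat (code (s x)) @ r) out)
      (1 + K (csize x)) (work_store i j (1 # ?end @ r) out)"
      by simp
    have 3: "exec (Pop 2) (work_store i j (1 # ?end @ r) out) 1 (work_store i j (?end @ r) out)"
      by (rule exec_PopI) auto
    show "exec (A ;; While (\<lambda>v. v ! 2 = 2) (t_tl ;; t_swap ;; P ;; t_swap) ;; Pop 2)
       (work_store i j (flat (code x) @ r) out) (q (csize x) + T (csize x) + (1 + K (csize x)) + 1)
       (work_store i j (?end @ r) out)"
      by (rule exec_mono[OF exec_Seq[OF A(5) exec_Seq[OF 2 3]]]) simp
    show "csize ((F ^^ length (l x)) (s x)) \<le> q (csize x) + T (csize x) + (1 + K (csize x)) + 1"
      using bound[of "length (l x)" x] by simp
  next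
    have "pbound B" unfolding B_def using A assms by (auto intro!: pbound_intros)
    moreover have "pbound (\<lambda>n. U (B n))" using pbound_comp[OF P(3) \<open>pbound B\<close>] .
    ultimately show "pbound (\<lambda>n. q n + T n + (1 + K n) + 1)"
      unfolding K_def using A assms by (auto intro!: pbound_intros)
  qed (use A P in auto)
qed

subsection \<open>Closure properties\<close>

lemma fp_True_False: "fp (\<lambda>_. True)" "fp (\<lambda>_. False)"
  by (rule fp_const)+

lemma fp_not: "fp f \<Longrightarrow> fp (\<lambda>x. \<not> f x)"
  by (rule fp_cong_code[OF fp_If[OF _ fp_True_False(2,1)]]) auto

lemma fp_conj: "fp f \<Longrightarrow> fp g \<Longrightarrow> fp (\<lambda>x. f x \<and> g x)"
  by (rule fp_cong_code[OF fp_If[of f g, OF _ _ fp_True_False(2)]]) auto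

lemma fp_disj: "fp f \<Longrightarrow> fp g \<Longrightarrow> fp (\<lambda>x. f x \<or> g x)"
  by (rule fp_cong_code[OF fp_If[of f _ g, OF _ fp_True_False(1)]]) auto

lemma fp_imp: "fp f \<Longrightarrow> fp g \<Longrightarrow> fp (\<lambda>x. f x \<longrightarrow> g x)"
  by (rule fp_cong_code[OF fp_If[of f g, OF _ _ fp_True_False(1)]]) auto

lemma fp_Let: "fp f \<Longrightarrow> fp (\<lambda>z. h (fst z) (snd z)) \<Longrightarrow> fp (\<lambda>x. let y = f x in h x y)"
  using fp_comp[OF fp_Pair[OF fp_id], of f "\<lambda>z. h (fst z) (snd z)"] by (simp add: Let_def)

lemma fp_case_prod:
  "fp f \<Longrightarrow> fp (\<lambda>z. h (fst z) (fst (snd z)) (snd (snd z))) \<Longrightarrow> fp (\<lambda>x. case f x of (a, b) \<Rightarrow> h x a b)"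
  using fp_comp[OF fp_Pair[OF fp_id], of f "\<lambda>z. h (fst z) (fst (snd z)) (snd (snd z))"]
  by (simp add: case_prod_beta)

lemma fp_Cons: "fp f \<Longrightarrow> fp g \<Longrightarrow> fp (\<lambda>x. f x # g x)"
  by (rule fp_cong_code[OF fp_Pair[of f g]]) auto

lemmas fp_basic = fp_const fp_id fp_Pair fp_fst fp_snd fp_If fp_eq fp_not fp_conj fp_disj fp_imp
  fp_Let fp_case_prod fp_Cons fp_tl fp_case_list

lemma mono_le: "mono (T :: nat \<Rightarrow> nat) \<Longrightarrow> a \<le> b \<Longrightarrow> T a \<le> T b"
  by (auto simp: mono_def)

text \<open>The iterated state carries the environment and the unread part of the list next to the
  accumulator, since an iterated function sees only its own argument.\<close>

lemma fp_foldl: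
  fixes l :: "'a::codable \<Rightarrow> 'b::codable list"
  assumes "fp (\<lambda>z. h (fst z) (fst (snd z)) (snd (snd z)))" "fp i" "fp l" "pbound q"
    and bound: "\<And>x k. k \<le> length (l x) \<Longrightarrow> csize (foldl (h x) (i x) (take k (l x))) \<le> q (csize x)"
  shows "fp (\<lambda>x. foldl (h x) (i x) (l x))"
proof -
  define F where "F z = (case fst (snd z) of [] \<Rightarrow> z | y # ys \<Rightarrow> (fst z, ys, h (fst z) (snd (snd z)) y))"
    for z :: "'a \<times> 'b list \<times> 'c"
  have "fp (\<lambda>w :: ('a \<times> 'b list \<times> 'c) \<times> 'b \<times> 'b list.
      h (fst (fst w)) (snd (snd (fst w))) (fst (snd w)))"
    using fp_comp[OF _ assms(1), of "\<lambda>w :: ('a \<times> 'b list \<times> 'c) \<times> 'b \<times> 'b list.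
      (fst (fst w), snd (snd (fst w)), fst (snd w))"] by (simp add: fp_basic)
  then have F: "fp F" unfolding F_def by (intro fp_basic)
  have iter: "(F ^^ k) (x, l x, i x) = (x, drop k (l x), foldl (h x) (i x) (take k (l x)))"
    if "k \<le> length (l x)" for x k
    using that
  proof (induction k)
    case (Suc k)
    then have "drop k (l x) = l x ! k # drop (Suc k) (l x)" by (simp add: Cons_nth_drop_Suc)
    then show ?case using Suc by (simp add: F_def take_Suc_conv_app_nth)
  qed simp
  obtain T where T: "pbound T" "mono T" "\<And>x. csize (l x) \<le> T (csize x)"
    using fp_csize[OF assms(3)] by metis
  have drop_le: "csize (drop k xs) \<le> csize xs" for k and xs :: "'b list"
    using csize_append[of "take k xs" "drop k xs"] csize_pos[of "take k xs"] by simp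
  have "fp (\<lambda>x. (F ^^ length (l x)) (x, l x, i x))"
  proof (rule fp_funpow_length[OF F assms(3)])
    show "pbound (\<lambda>n. n + T n + q n + 2)" using T assms by (intro pbound_intros)
    fix x k
    assume "k \<le> length (l x)"
    then show "csize ((F ^^ k) (x, l x, i x)) \<le> csize x + T (csize x) + q (csize x) + 2"
      using iter[of k x] bound[of k x] T(3)[of x] drop_le[of k "l x"] by simp
  qed (use assms in \<open>intro fp_basic\<close>)
  from fp_snd[OF fp_snd[OF this]] show ?thesis
    by (simp add: iter)
qed

text \<open>The usual way to meet the size condition: each step adds an amount that does not depend
  on the accumulator, so the total growth is at most the length of the list times one
  polynomial.\<close>

lemma fp_foldl_additive:
  fixes l :: "'a::codable \<Rightarrow> 'b::codable list"
  assumes "fp (\<lambda>z. h (fst z) (fst (snd z)) (snd (snd z)))" "fp i" "fp l" "pbound q" "mono q"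
    and step: "\<And>x a y. csize (h x a y) \<le> csize a + q (csize x + csize y)"
  shows "fp (\<lambda>x. foldl (h x) (i x) (l x))"
proof -
  obtain T where T: "pbound T" "mono T" "\<And>x. csize (l x) \<le> T (csize x)"
    using fp_csize[OF assms(3)] by metis
  obtain U where U: "pbound U" "mono U" "\<And>x. csize (i x) \<le> U (csize x)"
    using fp_csize[OF assms(2)] by metis
  have *: "csize (foldl (h x) (i x) ys) \<le> csize (i x) + length ys * q (csize x + csize ys)" for x ys
  proof (induction ys rule: rev_induct)
    case (snoc y ys)
    have le: "csize ys \<le> csize (ys @ [y])" "csize y \<le> csize (ys @ [y])"
      using csize_append[of ys "[y]"] by auto
    have "csize (foldl (h x) (i x) (ys @ [y])) \<le> csize (foldl (h x) (i x) ys) + q (csize x + csize y)"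
      using step by simp
    also have "\<dots> \<le> csize (i x) + length ys * q (csize x + csize ys) + q (csize x + csize y)"
      using snoc by simp
    also have "\<dots> \<le> csize (i x) + length ys * q (csize x + csize (ys @ [y])) + q (csize x + csize (ys @ [y]))"
      using le by (intro add_mono mult_le_mono2 mono_le[OF \<open>mono q\<close>]) auto
    finally show ?case by simp
  qed simp
  show ?thesis
  proof (rule fp_foldl[OF assms(1-3)])
    show "pbound (\<lambda>n. U n + T n * q (n + T n))"
      using T U assms by (intro pbound_intros pbound_comp[OF \<open>pbound q\<close>])
    fix x k
    assume "k \<le> length (l x)"
    have le: "csize (take k (l x)) \<le> T (csize x)"
      using csize_append[of "take k (l x)" "drop k (l x)"] csize_pos[of "drop k (l x)"] T(3)[of x] by simp
    have "csize (foldl (h x) (i x) (take k (l x))) \<le>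
        csize (i x) + length (take k (l x)) * q (csize x + csize (take k (l x)))" by (rule *)
    also have "\<dots> \<le> U (csize x) + T (csize x) * q (csize x + T (csize x))"
      using le length_le_csize[of "take k (l x)"]
      by (intro add_mono mult_le_mono mono_le[OF \<open>mono q\<close>] U) auto
    finally show "csize (foldl (h x) (i x) (take k (l x))) \<le> U (csize x) + T (csize x) * q (csize x + T (csize x))" .
  qed
qed

lemma fp_rev:
  assumes "fp l"
  shows "fp (\<lambda>x. rev (l x))"
proof -
  have "fp (\<lambda>x. foldl (\<lambda>a y. y # a) [] (l x))"
    by (rule fp_foldl_additive[where q = "\<lambda>n. Suc n"]) (auto intro!: fp_basic assms pbound_intros monoI)
  moreover have "foldl (\<lambda>a y. y # a) a xs = rev xs @ a" for a xs :: "'b list"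
    by (induction xs arbitrary: a) auto
  ultimately show ?thesis by simp
qed

lemma fp_append:
  assumes "fp k" "fp l"
  shows "fp (\<lambda>x. k x @ l x)"
proof -
  have "fp (\<lambda>x. foldl (\<lambda>a y. y # a) (l x) (rev (k x)))"
    by (rule fp_foldl_additive[where q = "\<lambda>n. Suc n"]) (auto intro!: fp_basic fp_rev assms pbound_intros monoI)
  moreover have "foldl (\<lambda>a y. y # a) a (rev xs) = xs @ a" for a xs :: "'b list"
    by (induction xs) auto
  ultimately show ?thesis by simp
qed

text \<open>Prepending is the elementary operation, so the values are collected in reverse order and
  turned round at the end.\<close>

lemma fp_map:
  assumes "fp (\<lambda>z. h (fst z) (snd z))" "fp l"
  shows "fp (\<lambda>x. map (h x) (l x))"
proof -
  obtain T where T: "pbound T" "mono T" "\<And>z. csize (h (fst z) (snd z)) \<le> T (csize z)"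
    using fp_csize[OF assms(1)] by metis
  have h: "csize (h x y) \<le> T (Suc (csize x + csize y))" for x y
    using T(3)[of "(x, y)"] by simp
  have 1: "fp (\<lambda>z. h (fst z) (snd (snd z)))"
    using fp_comp[OF _ assms(1), of "\<lambda>z. (fst z, snd (snd z))"] by (simp add: fp_basic)
  have "fp (\<lambda>x. foldl (\<lambda>a y. h x y # a) [] (l x))"
  proof (rule fp_foldl_additive[where q = "\<lambda>n. Suc (T (Suc n))"])
    show "pbound (\<lambda>n. Suc (T (Suc n)))"
      by (intro pbound_intros pbound_comp[OF T(1)])
    show "mono (\<lambda>n. Suc (T (Suc n)))" using T(2) by (auto simp: mono_def)
  qed (use h in \<open>auto intro!: fp_basic 1 assms\<close>)
  moreover have "foldl (\<lambda>a y. h x y # a) a xs = rev (map (h x) xs) @ a" for x a xs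
    by (induction xs arbitrary: a) auto
  ultimately show ?thesis using fp_rev by fastforce
qed

lemma fp_concat:
  assumes "fp l"
  shows "fp (\<lambda>x. concat (l x))"
proof -
  have "fp (\<lambda>x. foldl (@) [] (l x))"
  proof (rule fp_foldl_additive[where q = "\<lambda>n. n"])
    show "csize (a @ y) \<le> csize a + (csize x + csize y)" for a y :: "'b list" and x :: 'a
      using csize_append[of a y] by simp
  qed (auto intro!: fp_basic fp_append assms pbound_intros monoI)
  moreover have "foldl (@) a xs = a @ concat xs" for a and xs :: "'b list list"
    by (induction xs arbitrary: a) auto
  ultimately show ?thesis by simp
qed

lemma fp_filter:
  assumes "fp (\<lambda>z. h (fst z) (snd z))" "fp l"
  shows "fp (\<lambda>x. filter (h x) (l x))"
proof -
  have "fp (\<lambda>x. concat (map (\<lambda>y. if h x y then [y] else []) (l x)))"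
    by (intro fp_concat fp_map fp_basic assms)
  moreover have "concat (map (\<lambda>y. if P y then [y] else []) xs) = filter P xs" for P and xs :: "'b list"
    by (induction xs) auto
  ultimately show ?thesis by simp
qed

lemma fp_ball:
  assumes "fp (\<lambda>z. h (fst z) (snd z))" "fp l"
  shows "fp (\<lambda>x. \<forall>y\<in>set (l x). h x y)"
proof -
  have "fp (\<lambda>x. filter (\<lambda>y. \<not> h x y) (l x) = [])"
    by (intro fp_filter fp_basic assms)
  then show ?thesis by (simp add: filter_empty_conv)
qed

lemma fp_bex:
  assumes "fp (\<lambda>z. h (fst z) (snd z))" "fp l"
  shows "fp (\<lambda>x. \<exists>y\<in>set (l x). h x y)"
proof -
  have "fp (\<lambda>x. \<not> (\<forall>y\<in>set (l x). \<not> h x y))"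
    by (intro fp_ball fp_basic assms)
  then show ?thesis by simp
qed

lemma fp_member:
  assumes "fp f" "fp l"
  shows "fp (\<lambda>x. f x \<in> set (l x))"
proof -
  have "fp (\<lambda>x. \<exists>y\<in>set (l x). y = f x)"
    by (intro fp_bex fp_basic fp_comp[OF _ assms(1)] assms(2))
  then show ?thesis by simp
qed

section \<open>Arithmetic on unary numbers and list indices\<close>

lemma code_replicate: "code (replicate n ()) = code n"
  by (induction n) (auto simp: code_unit_def)

lemma code_length: "code (length xs) = code (map (\<lambda>_. ()) xs)"
  by (induction xs) (auto simp: code_unit_def)

lemma fp_length: "fp l \<Longrightarrow> fp (\<lambda>x. length (l x))"
  by (rule fp_cong_code[OF fp_map[OF fp_const[of "()"]]]) (auto simp: code_length)

lemma fp_units: "fp f \<Longrightarrow> fp (\<lambda>x. replicate (f x) ())"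
  by (rule fp_cong_code) (auto simp: code_replicate)

lemma fp_of_units: "fp (\<lambda>x. replicate (f x) ()) \<Longrightarrow> fp f"
  by (rule fp_cong_code[of "\<lambda>x. replicate (f x) ()" f]) (auto simp: code_replicate)

lemma fp_replicate:
  assumes "fp n" "fp f"
  shows "fp (\<lambda>x. replicate (n x) (f x))"
proof -
  have "fp (\<lambda>x. map (\<lambda>_. f x) (replicate (n x) ()))"
    by (intro fp_map fp_units fp_comp[OF _ assms(2)] fp_basic assms)
  then show ?thesis by (simp add: map_replicate)
qed

lemma fp_Suc: "fp f \<Longrightarrow> fp (\<lambda>x. Suc (f x))"
  by (rule fp_of_units) (auto intro: fp_Cons fp_const fp_units)

lemma fp_plus: "fp f \<Longrightarrow> fp g \<Longrightarrow> fp (\<lambda>x. f x + g x)" for f g :: "_ \<Rightarrow> nat"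
  by (rule fp_of_units) (auto simp: replicate_add intro: fp_append fp_units)

lemma fp_times:
  fixes f g :: "_ \<Rightarrow> nat"
  assumes "fp f" "fp g"
  shows "fp (\<lambda>x. f x * g x)"
proof -
  have "fp (\<lambda>x. length (concat (map (\<lambda>_. replicate (g x) ()) (replicate (f x) ()))))"
    by (intro fp_length fp_concat fp_map fp_units fp_comp[OF _ assms(2)] fp_basic assms)
  then show ?thesis by (simp add: length_concat sum_list_replicate map_replicate_const)
qed

lemma fp_drop:
  fixes l :: "'a::codable \<Rightarrow> 'b::codable list"
  assumes "fp n" "fp l"
  shows "fp (\<lambda>x. drop (n x) (l x))"
proof -
  obtain T where T: "pbound T" "mono T" "\<And>x. csize (l x) \<le> T (csize x)"
    using fp_csize[OF assms(2)] by metis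
  have eq: "(tl ^^ k) xs = drop k xs" for k and xs :: "'b list"
    by (induction k) (auto simp: drop_Suc tl_drop)
  have "fp (\<lambda>x. (tl ^^ length (replicate (n x) ())) (l x))"
  proof (rule fp_funpow_length[where q = T])
    show "csize ((tl ^^ k) (l x)) \<le> T (csize x)" for x k
      using csize_append[of "take k (l x)" "drop k (l x)"] csize_pos[of "take k (l x)"] T(3)[of x]
      by (simp add: eq)
  qed (auto intro: fp_units fp_tl fp_id assms T)
  then show ?thesis by (simp add: eq)
qed

text \<open>Taking is dropping from the reversed list; the number to drop is the length of what
  \<open>drop\<close> leaves over, which also covers a count beyond the end.\<close>

lemma fp_take:
  fixes l :: "'a::codable \<Rightarrow> 'b::codable list"
  assumes "fp n" "fp l"
  shows "fp (\<lambda>x. take (n x) (l x))"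
proof -
  have "fp (\<lambda>x. length (drop (n x) (l x)))" by (intro fp_length fp_drop assms)
  then have "fp (\<lambda>x. rev (drop (length (drop (n x) (l x))) (rev (l x))))"
    by (intro fp_rev fp_drop assms)
  moreover have "rev (drop (length (drop k xs)) (rev xs)) = take k xs" for k and xs :: "'b list"
    by (cases "k \<le> length xs") (auto simp: drop_rev)
  ultimately show ?thesis by simp
qed

lemma fp_minus:
  fixes f g :: "_ \<Rightarrow> nat"
  assumes "fp f" "fp g"
  shows "fp (\<lambda>x. f x - g x)"
proof -
  have "fp (\<lambda>x. length (drop (g x) (replicate (f x) ())))"
    by (intro fp_length fp_drop fp_units assms)
  then show ?thesis by simp
qed

lemma fp_le:
  fixes f g :: "_ \<Rightarrow> nat"
  assumes "fp f" "fp g"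
  shows "fp (\<lambda>x. f x \<le> g x)"
proof -
  have "fp (\<lambda>x. f x - g x = 0)" by (intro fp_minus fp_eq fp_const assms)
  then show ?thesis by simp
qed

lemma fp_less:
  fixes f g :: "_ \<Rightarrow> nat"
  assumes "fp f" "fp g"
  shows "fp (\<lambda>x. f x < g x)"
  using fp_not[OF fp_le[OF assms(2,1)]] by (simp add: not_le)

text \<open>Each element appended is the current length of the list. The elements are in unary, so
  the list has quadratic size.\<close>

lemma fp_upt0:
  assumes "fp n"
  shows "fp (\<lambda>x. [0..<n x])"
proof -
  have eq: "foldl (\<lambda>a _. a @ [length a]) [] ys = [0..<length ys]" for ys :: "unit list"
    by (induction ys rule: rev_induct) auto
  obtain T where T: "pbound T" "mono T" "\<And>x. csize (n x) \<le> T (csize x)"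
    using fp_csize[OF assms] by metis
  have size: "csize [0..<k] \<le> 1 + k * (2 * k + 2)" for k
  proof (induction k)
    case (Suc k)
    have "csize [0..<Suc k] = csize [0..<k] + (2 * k + 2)"
      using csize_append[of "[0..<k]" "[k]"] by simp
    also have "\<dots> \<le> 1 + k * (2 * k + 2) + (2 * k + 2)" using Suc by simp
    also have "\<dots> \<le> 1 + Suc k * (2 * Suc k + 2)" by simp
    finally show ?case .
  qed simp
  have "fp (\<lambda>x. foldl (\<lambda>a _. a @ [length a]) [] (replicate (n x) ()))"
  proof (rule fp_foldl)
    show "pbound (\<lambda>m. 1 + T m * (2 * T m + 2))" by (intro pbound_intros T)
    fix x k
    assume "k \<le> length (replicate (n x) ())"
    then have k: "k \<le> T (csize x)" using T(3)[of x] by simp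
    have "csize [0..<k] \<le> 1 + k * (2 * k + 2)" by (rule size)
    also have "\<dots> \<le> 1 + T (csize x) * (2 * T (csize x) + 2)"
      using k by (intro add_mono mult_le_mono) auto
    finally show "csize (foldl (\<lambda>a _. a @ [length a]) [] (take k (replicate (n x) ()))) \<le>
        1 + T (csize x) * (2 * T (csize x) + 2)"
      using \<open>k \<le> length _\<close> by (simp add: eq min_def del: take_replicate)
  qed (intro fp_append fp_basic fp_length fp_units assms)+
  then show ?thesis by (simp add: eq)
qed

lemma fp_upt:
  assumes "fp m" "fp n"
  shows "fp (\<lambda>x. [m x..<n x])"
proof -
  have "fp (\<lambda>x. map (\<lambda>i. i + m x) [0..<n x - m x])"
    by (intro fp_map fp_plus fp_upt0 fp_minus fp_comp[OF _ assms(1)] fp_basic assms)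
  moreover have "map (\<lambda>i. i + k) [0..<l - k] = [k..<l]" for k l
    by (cases "k \<le> l") (auto simp: map_add_upt)
  ultimately show ?thesis by simp
qed

lemma fp_poly: "fp f \<Longrightarrow> fp (\<lambda>x. poly p (f x))" for p :: "nat poly"
  by (induction p) (auto intro!: fp_const fp_plus fp_times)

lemma fp_nth_default:
  assumes "fp l" "fp n" "fp d"
  shows "fp (\<lambda>x. case drop (n x) (l x) of [] \<Rightarrow> d x | y # _ \<Rightarrow> y)"
  by (intro fp_case_list fp_drop fp_basic assms)

lemma fp_dropWhile:
  assumes "fp (\<lambda>z. h (fst z) (snd z))" "fp l"
  shows "fp (\<lambda>x. dropWhile (h x) (l x))"
proof -
  have eq: "foldl (\<lambda>a y. if a = [] \<and> P y then [] else a @ [y]) [] ys = dropWhile P ys"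
    for P and ys :: "'b list"
  proof (induction ys rule: rev_induct)
    case (snoc y ys)
    then show ?case by (cases "\<forall>z\<in>set ys. P z") (auto simp: dropWhile_append)
  qed simp
  have 1: "fp (\<lambda>z. h (fst z) (snd (snd z)))"
    using fp_comp[OF _ assms(1), of "\<lambda>z. (fst z, snd (snd z))"] by (simp add: fp_basic)
  have "fp (\<lambda>x. foldl (\<lambda>a y. if a = [] \<and> h x y then [] else a @ [y]) [] (l x))"
  proof (rule fp_foldl_additive[where q = "\<lambda>n. Suc n"])
    show "csize (if a = [] \<and> h x y then [] else a @ [y]) \<le> csize a + Suc (csize x + csize y)"
      for a x and y :: 'b
      using csize_append[of a "[y]"] by simp
  qed (auto intro!: fp_basic fp_append 1 assms pbound_intros monoI)
  then show ?thesis by (simp add: eq)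
qed

lemmas fp_intros = fp_basic fp_rev fp_append fp_map fp_concat fp_filter fp_ball fp_bex fp_member
  fp_length fp_replicate fp_Suc fp_plus fp_times fp_minus fp_le fp_less fp_drop fp_take fp_upt fp_poly
  fp_dropWhile

text \<open>The parity flag is toggled with each unit, and the quotient grows whenever the flag
  flips back.\<close>

lemma fp_half:
  fixes f :: "'a::codable \<Rightarrow> nat"
  assumes "fp f"
  shows "fp (\<lambda>x. f x div 2)" "fp (\<lambda>x. odd (f x))"
proof -
  have eq: "foldl (\<lambda>a _. if snd a then (Suc (fst a), False) else (fst a, True)) (0, False) ys =
      (length ys div 2, odd (length ys))" for ys :: "unit list"
    by (induction ys rule: rev_induct) auto
  have "fp (\<lambda>x. foldl (\<lambda>a _. if snd a then (Suc (fst a), False) else (fst a, True)) (0, False)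
      (replicate (f x) ()))"
  proof (rule fp_foldl_additive[where q = "\<lambda>n. n + 10"])
    show "csize (if snd a then (Suc (fst a), False) else (fst a, True)) \<le> csize a + (csize x + csize y + 10)"
      for a and x :: 'a and y :: unit
      by (cases a) (auto simp: csize_bool intro: le_trans[OF csize_bool])
  qed (auto intro!: fp_intros assms pbound_intros monoI)
  then have "fp (\<lambda>x. (f x div 2, odd (f x)))" by (simp add: eq)
  from fp_fst[OF this] fp_snd[OF this] show "fp (\<lambda>x. f x div 2)" "fp (\<lambda>x. odd (f x))" by simp_all
qed

lemma bin_0 [simp]: "bin 0 = []"
  by (subst bin.simps) simp

lemma bin_pos: "0 < n \<Longrightarrow> bin n = bin (n div 2) @ [odd n]"
  by (subst bin.simps) simp

lemma length_bin: "length (bin n) \<le> n"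
proof (induction n rule: bin.induct)
  case (1 n)
  then show ?case by (cases "n = 0") (auto simp: bin_pos[of n])
qed

text \<open>Feasible because the argument is in unary: as many halvings as the number itself are
  affordable, and surplus rounds do nothing at 0.\<close>

lemma fp_bin:
  assumes "fp f"
  shows "fp (\<lambda>x. bin (f x))"
proof -
  define F :: "nat \<times> word \<Rightarrow> nat \<times> word" where
    "F z = (if fst z = 0 then z else (fst z div 2, odd (fst z) # snd z))" for z
  have F: "fp F" unfolding F_def by (intro fp_basic fp_half)
  \<comment> \<open>The digits still hidden in the quotient, followed by those already split off,
    always form the same word.\<close>
  have inv: "bin (fst ((F ^^ k) z)) @ snd ((F ^^ k) z) = bin (fst z) @ snd z" for k z
  proof (induction k)
    case (Suc k)
    have "bin (fst (F s)) @ snd (F s) = bin (fst s) @ snd s" for s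
      by (cases "fst s = 0") (auto simp: F_def bin_pos[of "fst s"])
    then show ?case using Suc by simp
  qed simp
  have small: "fst ((F ^^ k) z) \<le> fst z - k" for k z
    by (induction k) (auto simp: F_def)
  obtain T where T: "pbound T" "mono T" "\<And>x. csize (f x) \<le> T (csize x)"
    using fp_csize[OF assms] by metis
  have "fp (\<lambda>x. (F ^^ length (replicate (f x) ())) (f x, []))"
  proof (rule fp_funpow_length[OF F])
    show "pbound (\<lambda>n. 6 * T n + 6)" by (intro pbound_intros T)
    fix x k
    have w: "csize w \<le> 1 + 4 * length w" for w :: word
    proof (induction w)
      case (Cons b w)
      then show ?case using csize_bool[of b] by simp
    qed simp
    have "length (snd ((F ^^ k) (f x, []))) \<le> f x"
      using arg_cong[OF inv[of k "(f x, [])"], of length] length_bin[of "f x"] by simp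
    then have "csize (snd ((F ^^ k) (f x, []))) \<le> 1 + 4 * f x"
      using w[of "snd ((F ^^ k) (f x, []))"] by simp
    moreover have "csize (f x) \<le> T (csize x)" by (rule T)
    ultimately show "csize ((F ^^ k) (f x, [])) \<le> 6 * T (csize x) + 6"
      using small[of k "(f x, [])"] by (cases "(F ^^ k) (f x, [])") simp
  qed (intro fp_intros assms)+
  from fp_snd[OF this] have "fp (\<lambda>x. snd ((F ^^ f x) (f x, [])))" by simp
  moreover have "snd ((F ^^ m) (m, [])) = bin m" for m
    using inv[of m "(m, [])"] small[of m "(m, [])"] by simp
  ultimately show ?thesis by simp
qed

section \<open>From closure properties to Turing machines\<close>

text \<open>Consing the popped bits builds a list from its end, so stack 3 has to present the word
  with its last bit on top. The pushed blocks are a node symbol followed by the code of the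
  bit.\<close>

definition build :: prog where
  "build = Push 2 1 ;; While (\<lambda>v. v ! 3 \<noteq> 0)
     (Ite (\<lambda>v. v ! 3 = 1) (p_push [2, 1]) (p_push [2, 2, 1, 1]) ;; Pop 3)"

definition unload :: prog where
  "unload = While (\<lambda>v. v ! 2 = 2)
     (Pop 2 ;; Ite (\<lambda>v. v ! 2 = 1) (Pop 2 ;; Emit 1) (pops ;; Emit 2))"

lemma bit_symbol_cases: "bit_symbol b = 1 \<or> bit_symbol b = 2"
  by (simp add: bit_symbol_def)

lemma bit_symbols: "set (map bit_symbol w) \<subseteq> {1, 2}"
  using bit_symbol_cases by auto

lemma exec_build_loop:
  "exec (While (\<lambda>v. v ! 3 \<noteq> 0) (Ite (\<lambda>v. v ! 3 = 1) (p_push [2, 1]) (p_push [2, 2, 1, 1]) ;; Pop 3))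
    (store_of i j (flat (code w) @ r) (map bit_symbol xs) b c out) (12 * length xs + 1)
    (store_of i j (flat (code (rev xs @ w)) @ r) [] b c out)"
proof (induction xs arbitrary: w)
  case Nil
  show ?case by simp (rule exec_While_endI; simp)
next
  case (Cons x xs)
  let ?\<sigma> = "\<lambda>s. store_of i j s (map bit_symbol (x # xs)) b c out"
  have c: "scans (?\<sigma> (flat (code w) @ r)) ! 3 \<noteq> 0"
    using bit_symbol_cases[of x] by auto
  have push: "exec (p_push ys) (?\<sigma> s) (1 + 2 * length ys) (?\<sigma> (ys @ s))" if "set ys \<subseteq> {1, 2}" for ys s
    using that
  proof (induction ys)
    case (Cons y ys)
    have "exec (Push 2 y) (?\<sigma> (ys @ s)) 2 (?\<sigma> (y # ys @ s))"
      by (rule exec_PushI) (use Cons.prems in auto)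
    then show ?case using exec_Seq[OF Cons.IH] Cons.prems by fastforce
  qed (simp add: exec_t_skip)
  have 1: "exec (Ite (\<lambda>v. v ! 3 = 1) (p_push [2, 1]) (p_push [2, 2, 1, 1])) (?\<sigma> (flat (code w) @ r)) 10
      (?\<sigma> (flat (code (x # w)) @ r))"
  proof (rule exec_IteI[where t = 9])
    assume "scans (?\<sigma> (flat (code w) @ r)) ! 3 = 1"
    then have "\<not> x" by (simp add: bit_symbol_def split: if_splits)
    then show "exec (p_push [2, 1]) (?\<sigma> (flat (code w) @ r)) 9 (?\<sigma> (flat (code (x # w)) @ r))"
      using exec_mono[OF push[of "[2, 1]" "flat (code w) @ r"], of 9] by (simp add: code_bool_def)
  next
    assume "\<not> scans (?\<sigma> (flat (code w) @ r)) ! 3 = 1"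
    then have "x" by (simp add: bit_symbol_def split: if_splits)
    then show "exec (p_push [2, 2, 1, 1]) (?\<sigma> (flat (code w) @ r)) 9 (?\<sigma> (flat (code (x # w)) @ r))"
      using exec_mono[OF push[of "[2, 2, 1, 1]" "flat (code w) @ r"], of 9] by (simp add: code_bool_def)
  qed simp
  have 2: "exec (Pop 3) (?\<sigma> (flat (code (x # w)) @ r)) 1
      (store_of i j (flat (code (x # w)) @ r) (map bit_symbol xs) b c out)"
    by (rule exec_PopI) auto
  have "exec (While (\<lambda>v. v ! 3 \<noteq> 0) (Ite (\<lambda>v. v ! 3 = 1) (p_push [2, 1]) (p_push [2, 2, 1, 1]) ;; Pop 3))
    (?\<sigma> (flat (code w) @ r)) (12 * length (x # xs) + 1)
    (store_of i j (flat (code (rev xs @ x # w)) @ r) [] b c out)"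
    by (rule exec_WhileI[where b = "\<lambda>v. v ! 3 \<noteq> 0", OF c exec_Seq[OF 1 2] Cons.IH]) simp
  then show ?case by simp
qed

lemma exec_build:
  "exec build (store_of i j r (map bit_symbol xs) b c out) (12 * length xs + 3)
    (store_of i j (flat (code (rev xs)) @ r) [] b c out)"
proof -
  have "exec (Push 2 1) (store_of i j r (map bit_symbol xs) b c out) 2
    (store_of i j (flat (code ([] :: word)) @ r) (map bit_symbol xs) b c out)"
    by (rule exec_PushI) auto
  from exec_mono[OF exec_Seq[OF this exec_build_loop[of i j "[]"]], of "12 * length xs + 3"]
  show ?thesis unfolding build_def by simp
qed

lemma exec_unload:
  "exec unload (work_store i j (flat (code w) @ r) out) (7 * length w + 1)
    (work_store i j (1 # r) (out @ map bit_symbol w))"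
proof (induction w arbitrary: out)
  case Nil
  show ?case unfolding unload_def by simp (rule exec_While_endI; simp)
next
  case (Cons x w)
  have c: "scans (work_store i j (flat (code (x # w)) @ r) out) ! 2 = 2" by simp
  have 1: "exec (Pop 2) (work_store i j (flat (code (x # w)) @ r) out) 1
      (work_store i j (flat (code x) @ flat (code w) @ r) out)"
    by (rule exec_PopI) auto
  have emit: "exec (Emit s) (work_store i j (flat (code w) @ r) out) 1
      (work_store i j (flat (code w) @ r) (out @ [s]))" if "s \<in> {1, 2}" for s
    using exec_Emit[OF that, of "work_store i j (flat (code w) @ r) out"] by simp
  have 2: "exec (Ite (\<lambda>v. v ! 2 = 1) (Pop 2 ;; Emit 1) (pops ;; Emit 2))
      (work_store i j (flat (code x) @ flat (code w) @ r) out) 5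
      (work_store i j (flat (code w) @ r) (out @ [bit_symbol x]))"
  proof (rule exec_IteI[where t = 4])
    assume "scans (work_store i j (flat (code x) @ flat (code w) @ r) out) ! 2 = 1"
    then have x: "\<not> x" by (auto simp: code_bool_def split: if_splits)
    have "exec (Pop 2) (work_store i j (flat (code x) @ flat (code w) @ r) out) 1
      (work_store i j (flat (code w) @ r) out)"
      by (rule exec_PopI) (auto simp: x code_bool_def)
    from exec_mono[OF exec_Seq[OF this emit[of 1]], of 4]
    show "exec (Pop 2 ;; Emit 1) (work_store i j (flat (code x) @ flat (code w) @ r) out) 4
      (work_store i j (flat (code w) @ r) (out @ [bit_symbol x]))"
      by (simp add: x bit_symbol_def)
  next
    assume "\<not> scans (work_store i j (flat (code x) @ flat (code w) @ r) out) ! 2 = 1"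
    then have x: "x" by (auto simp: code_bool_def split: if_splits)
    have "exec pops (work_store i j (flat (code x) @ flat (code w) @ r) out) (1 + (1 + 1))
      (work_store i j (flat (code w) @ r) out)"
      unfolding pops_def by (rule exec_Seq[OF exec_PopI exec_Seq[OF exec_PopI exec_PopI]])
        (auto simp: x code_bool_def)
    from exec_mono[OF exec_Seq[OF this emit[of 2]], of 4]
    show "exec (pops ;; Emit 2) (work_store i j (flat (code x) @ flat (code w) @ r) out) 4
      (work_store i j (flat (code w) @ r) (out @ [bit_symbol x]))"
      by (simp add: x bit_symbol_def)
  qed simp
  have "exec unload (work_store i j (flat (code (x # w)) @ r) out) (7 * length (x # w) + 1)
    (work_store i j (1 # r) ((out @ [bit_symbol x]) @ map bit_symbol w))"
    unfolding unload_def
    by (rule exec_WhileI[where b = "\<lambda>v. v ! 2 = 2", OF c exec_Seq[OF 1 2] Cons.IH[unfolded unload_def]]) simp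
  then show ?case by simp
qed

definition load :: "nat \<Rightarrow> prog" where
  "load k = move_string k 3 ;; build"

lemma exec_load_0:
  "exec (load 0) (work_store (map bit_symbol w) j r out) (17 * length w + 4) (work_store [] j (flat (code w) @ r) out)"
proof -
  have "exec (move_string 0 3) (work_store (map bit_symbol w) j r out) (5 * length w + 1)
      (store_of [] j r (map bit_symbol (rev w)) [] [] out)"
    using exec_move_string[of 0 3 "work_store (map bit_symbol w) j r out" "map bit_symbol w" "5 * length w + 1"]
      bit_symbols[of w] by (simp add: rev_map)
  from exec_mono[OF exec_Seq[OF this exec_build], of "17 * length w + 4"] show ?thesis
    by (simp add: load_def)
qed

lemma exec_load_1:
  "exec (load 1) (work_store i (map bit_symbol w) r out) (17 * length w + 4) (work_store i [] (flat (code w) @ r) out)"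
proof -
  have "exec (move_string 1 3) (work_store i (map bit_symbol w) r out) (5 * length w + 1)
      (store_of i [] r (map bit_symbol (rev w)) [] [] out)"
    using exec_move_string[of 1 3 "work_store i (map bit_symbol w) r out" "map bit_symbol w" "5 * length w + 1"]
      bit_symbols[of w] by (simp add: rev_map)
  from exec_mono[OF exec_Seq[OF this exec_build], of "17 * length w + 4"] show ?thesis
    by (simp add: load_def)
qed

lemma wf_load [simp]: "k < 6 \<Longrightarrow> wf_prog (load k)" "guess_free (load k)"
  "wf_prog unload" "guess_free unload" "wf_prog build" "guess_free build"
  by (simp_all add: load_def move_string_def move_symbol_def build_def unload_def pops_def)

lemma length_le_csize_word: "length w \<le> csize w" and csize_word: "csize w \<le> 1 + 4 * length w" for w :: word
proof -
  show "length w \<le> csize w" by (rule length_le_csize)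
  show "csize w \<le> 1 + 4 * length w"
  proof (induction w)
    case (Cons b w)
    then show ?case using csize_bool[of b] by simp
  qed simp
qed

text \<open>The exit state \<open>prog_len P\<close> lies outside the code and has no instructions,
  so reaching it means halting in the accepting state.\<close>

definition machine :: "prog \<Rightarrow> ntm" where
  "machine P = NTM 7 0 (prog_len P) (comp P 0 (prog_len P))"

lemma wf_machine: "wf_ntm (machine P)"
  unfolding wf_ntm_def machine_def using finite_comp comp_lengths by fastforce

lemma deterministic_machine: "guess_free P \<Longrightarrow> deterministic (machine P)"
  unfolding deterministic_def machine_def using comp_functional by simp

lemma block_machine: "block (machine P) P 0 (prog_len P)"
  unfolding block_def machine_def using comp_range[of _ P 0 "prog_len P"] by auto

lemma stuck_machine: "\<not> tm_step (machine P) (prog_len P, ts) d"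
  unfolding tm_step_def machine_def using comp_range[of _ P 0 "prog_len P"] by fastforce

lemma accepting_machine: "accepting (machine P) (prog_len P, ts)"
  unfolding accepting_def using stuck_machine by (simp add: machine_def)

lemma input_tape_cells: "input_tape w = (cells 0 (map bit_symbol w), 0)"
  by (auto simp: input_tape_def cells_def fun_eq_iff)

lemma rep_initial:
  assumes "ws = [u] \<and> v = [] \<or> ws = [u, v]"
  shows "rep (work_store (map bit_symbol u) (map bit_symbol v) [] []) (snd (initial_config (machine P) ws))"
proof -
  let ?w = "\<lambda>k. if k < length ws then ws ! k else []"
  let ?\<sigma> = "work_store (map bit_symbol u) (map bit_symbol v) [] []"
  have ts: "snd (initial_config (machine P) ws) = map (\<lambda>k. input_tape (?w k)) [0..<7]"
    by (simp add: initial_config_def machine_def)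
  have \<sigma>: "?\<sigma> k = map bit_symbol (?w k)" for k
    using assms by (auto simp: store_of_def nth_Cons')
  have "map (\<lambda>k. input_tape (?w k)) [0..<7] ! k = (cells 0 (?\<sigma> k), 0)" if "k < 7" for k
    using that unfolding \<sigma> by (simp add: input_tape_cells nth_upt del: upt_rec_numeral)
  moreover have "set (?\<sigma> k) \<subseteq> {1, 2}" for k
    unfolding \<sigma> by (rule bit_symbols)
  moreover have "?\<sigma> 6 = []" by simp
  ultimately show ?thesis
    unfolding ts rep_def by (auto simp del: upt_rec_numeral)
qed

lemma initial_state: "initial_config (machine P) ws = (0, snd (initial_config (machine P) ws))"
  by (simp add: initial_config_def machine_def)

lemma rep_output:
  assumes "rep \<sigma> ts" "\<sigma> 6 = map bit_symbol w"
  shows "has_output (q, ts) w"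
proof -
  have len: "length ts = 7" using assms by (simp add: rep_def)
  then have "ts \<noteq> []" by auto
  moreover from this len have "last ts = ts ! 6" by (simp add: last_conv_nth)
  ultimately show ?thesis using assms by (auto simp: has_output_def rep_def cells_def)
qed

text \<open>Covers one and two input words at once: a missing second word is an empty second tape.
  Outputs are compared as words, so a numeric result must be delivered as its canonical
  numeral.\<close>

theorem poly_time_computable_fp:
  assumes F: "fp (F :: word \<times> word \<Rightarrow> word)"
    and inp: "\<And>z. inp z = [u z] \<and> v z = [] \<or> inp z = [u z, v z]"
    and out: "\<And>z. out (f z) = F (u z, v z)"
  shows "poly_time_computable inp out f"
proof -
  obtain P T where P: "wf_prog P" "guess_free P" "pbound T" "mono T"
    "\<And>x i j r out n. csize x \<le> n \<Longrightarrow> exec P (work_store i j (flat (code x) @ r) out) (T n)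
        (work_store i j (flat (code (F x)) @ r) out)"
    "\<And>x. csize (F x) \<le> T (csize x)" using fpE[OF F] by metis
  \<comment> \<open>The second word is loaded first so that the first one ends on top; the node
    symbol then turns them into a pair.\<close>
  define Q where "Q = load 1 ;; load 0 ;; Push 2 2 ;; P ;; unload"
  define U where "U n = 8 * T (4 * n + 3) + 17 * n + 11" for n
  have "pbound (\<lambda>n. T (4 * n + 3))"
    by (rule pbound_comp[OF P(3)]) (intro pbound_intros)
  then have "pbound U" unfolding U_def
    by (intro pbound_intros)
  then obtain p :: "nat poly" where p: "\<And>n. U n \<le> poly p n" by (auto simp: pbound_def)
  have run: "\<exists>t c. t \<le> poly p (total_length (inp z)) \<and> tm_reaches (machine Q) (inp z) t c \<and>
      accepting (machine Q) c \<and> has_output c (out (f z))" for z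
  proof -
    let ?u = "u z" and ?v = "v z"
    have len: "total_length (inp z) = length ?u + length ?v"
      using inp[of z] by (auto simp: total_length_def)
    let ?n = "length ?u + length ?v"
    have sz: "csize (?u, ?v) \<le> 4 * ?n + 3"
      using csize_word[of ?u] csize_word[of ?v] by simp
    have 1: "exec (Push 2 2) (work_store [] [] (flat (code ?u) @ flat (code ?v) @ []) []) 2
        (work_store [] [] (flat (code (?u, ?v)) @ []) [])"
      by (rule exec_PushI) auto
    have 2: "exec unload (work_store [] [] (flat (code (F (?u, ?v))) @ []) []) (7 * T (4 * ?n + 3) + 1)
        (work_store [] [] (1 # []) ([] @ map bit_symbol (F (?u, ?v))))"
    proof (rule exec_mono[OF exec_unload])
      have "length (F (?u, ?v)) \<le> T (csize (?u, ?v))"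
        using P(6) length_le_csize_word order_trans by blast
      also have "\<dots> \<le> T (4 * ?n + 3)" by (rule mono_le[OF P(4) sz])
      finally show "7 * length (F (?u, ?v)) + 1 \<le> 7 * T (4 * ?n + 3) + 1" by simp
    qed
    have "exec Q (work_store (map bit_symbol ?u) (map bit_symbol ?v) [] []) (U ?n)
        (work_store [] [] (1 # []) ([] @ map bit_symbol (F (?u, ?v))))"
      unfolding Q_def
      by (rule exec_mono[OF exec_Seq[OF exec_load_1 exec_Seq[OF exec_load_0 exec_Seq[OF 1
              exec_Seq[OF P(5)[OF sz] 2]]]]]) (simp add: U_def)
    from exec_run[OF this block_machine rep_initial[OF inp, of z]] obtain t ts
      where t: "t \<le> U ?n" "rep (work_store [] [] (1 # []) ([] @ map bit_symbol (F (?u, ?v)))) ts"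
        "(unique_step (machine Q) ^^ t) (initial_config (machine Q) (inp z)) (prog_len Q, ts)"
      unfolding initial_state[symmetric] by blast
    have "has_output (prog_len Q, ts) (out (f z))"
      by (rule rep_output[OF t(2)]) (simp add: out)
    moreover have "t \<le> poly p (total_length (inp z))"
      unfolding len using t(1) p order_trans by blast
    ultimately show ?thesis
      using unique_step_imp_step[OF t(3)] accepting_machine unfolding tm_reaches_def by blast
  qed
  have "guess_free Q" using P by (simp add: Q_def)
  then show ?thesis
    unfolding poly_time_computable_def using run wf_machine deterministic_machine by blast
qed

subsection \<open>Guessing\<close>

text \<open>\<open>exec\<close> follows a single run, whereas an OptP machine must be bounded on all
  branches: here every branch halts within \<open>n\<close> steps, in a configuration satisfying
  \<open>Q\<close>.\<close>

inductive all_runs :: "ntm \<Rightarrow> (config \<Rightarrow> bool) \<Rightarrow> nat \<Rightarrow> config \<Rightarrow> bool" for M Q where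
  stop: "(\<And>d. \<not> tm_step M c d) \<Longrightarrow> Q c \<Longrightarrow> all_runs M Q n c"
| step: "tm_step M c d0 \<Longrightarrow> (\<And>d. tm_step M c d \<Longrightarrow> all_runs M Q n d) \<Longrightarrow> all_runs M Q (Suc n) c"

lemma all_runs_reach:
  "all_runs M Q n c \<Longrightarrow> (tm_step M ^^ t) c d \<Longrightarrow> t \<le> n \<and> ((\<nexists>e. tm_step M d e) \<longrightarrow> Q d)"
proof (induction arbitrary: t rule: all_runs.induct)
  case (stop c n)
  show ?case
  proof (cases t)
    case 0
    then show ?thesis using stop by auto
  next
    case (Suc s)
    then show ?thesis
      using stop relpowp_Suc_D2[of s "tm_step M" c d] by blast
  qed
next
  case (step c d0 n)
  show ?case
  proof (cases t)
    case 0
    then have "c = d" using step.prems by simp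
    then show ?thesis using step.hyps(1) 0 by blast
  next
    case (Suc s)
    then obtain c' where "tm_step M c c'" "(tm_step M ^^ s) c' d"
      using step.prems relpowp_Suc_D2[of s "tm_step M" c d] by blast
    then show ?thesis using step.IH Suc by auto
  qed
qed

lemma all_runs_mono: "all_runs M Q n c \<Longrightarrow> n \<le> m \<Longrightarrow> all_runs M Q m c"
proof (induction arbitrary: m rule: all_runs.induct)
  case (stop c n)
  then show ?case by (blast intro: all_runs.stop)
next
  case (step c d0 n)
  then obtain k where "m = Suc k" "n \<le> k" by (cases m) auto
  then show ?case using step by (blast intro: all_runs.step)
qed

lemma all_runs_unique: "(unique_step M ^^ u) c c' \<Longrightarrow> all_runs M Q n c' \<Longrightarrow> all_runs M Q (u + n) c"
proof (induction u arbitrary: c)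
  case (Suc u)
  then obtain d where d: "unique_step M c d" "(unique_step M ^^ u) d c'"
    using relpowp_Suc_D2[of u "unique_step M" c c'] by blast
  have step: "tm_step M c e \<longleftrightarrow> e = d" for e
    using d(1) unfolding unique_step_def by blast
  have "all_runs M Q (u + n) d" using Suc d(2) by blast
  moreover have "all_runs M Q (Suc (u + n)) c" if "all_runs M Q (u + n) d"
  proof (rule all_runs.step[of M c d])
    show "tm_step M c d" using step by blast
    show "all_runs M Q (u + n) e" if "tm_step M c e" for e
      using step[of e] \<open>all_runs M Q (u + n) d\<close> that by simp
  qed
  ultimately show ?case by simp
qed simp

lemma run_Guess:
  assumes "block M (Guess i) a e" "rep \<sigma> ts" "i < 6"
  obtains c where "unique_step M (a, ts) c" "\<And>d. tm_step M c d \<Longrightarrow>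
      \<exists>s ts'. s \<in> {1, 2} \<and> d = (e, ts') \<and> rep (\<sigma>(i := s # \<sigma> i)) ts'"
    "\<And>s. s \<in> {1, 2} \<Longrightarrow> \<exists>ts'. tm_step M c (e, ts') \<and> rep (\<sigma>(i := s # \<sigma> i)) ts'"
proof -
  have len: "length ts = 7" using assms(2) by (simp add: rep_def)
  obtain h where h: "update_tape (ts ! i, read_tape (ts ! i), Move_Left) = (cells h (\<sigma> i), h - 1)"
    "map read_tape (ts[i := (cells h (\<sigma> i), h - 1)]) \<in> symbol_vectors"
    "\<And>s. s \<in> {1, 2} \<Longrightarrow> rep (\<sigma>(i := s # \<sigma> i))
      (ts[i := (cells h (\<sigma> i), h - 1), i := update_tape ((cells h (\<sigma> i), h - 1), s, Stay)])"
    using run_move_left[OF assms(2,3)] by metis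
  let ?ts = "ts[i := (cells h (\<sigma> i), h - 1)]"
  have "ins \<in> comp (Guess i) a e \<and> fst ins = a \<longleftrightarrow> ins \<in> write_instrs a (a + 1) i id Move_Left" for ins
    by (cases ins) (auto simp: write_instrs_def)
  from unique_step_write[OF assms(1) _ _ this, of ts] rep_reads[OF assms(2)] assms(3)
  have 1: "unique_step M (a, ts) (a + 1, ?ts)"
    by (simp add: h(1))
  have "ins \<in> instrs M \<and> fst ins = a + 1 \<longleftrightarrow>
      ins \<in> (\<Union>f\<in>{\<lambda>_. 1, \<lambda>_. 2}. write_instrs (a + 1) e i f Stay)" for ins
    using assms(1)[unfolded block_def, rule_format, of ins]
    by (cases ins) (auto simp: write_instrs_def)
  from step_write[OF this h(2)] assms(3) len
  have 2: "tm_step M (a + 1, ?ts) d \<longleftrightarrow>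
      (\<exists>s\<in>{1, 2}. d = (e, ?ts[i := update_tape ((cells h (\<sigma> i), h - 1), s, Stay)]))" for d
    by (simp del: update_tape.simps)
  show thesis
    by (rule that[OF 1]) (use 2 h(3) in blast)+
qed

text \<open>The pops remove the symbols 2, 1 that one unit of the counter occupies on the work
  stack.\<close>

definition guess_body :: prog where
  "guess_body = Pop 2 ;; Pop 2 ;; Guess 3"

definition guess_loop :: prog where
  "guess_loop = While (\<lambda>v. v ! 2 = 2) guess_body"

lemma guess_loop_step:
  assumes blk: "block M guess_loop a e" and rep: "rep (store_of i j (flat (code (Suc k)) @ r) xs b c out) ts"
  obtains d where "(unique_step M ^^ 4) (a, ts) d" "\<And>d'. tm_step M d d' \<Longrightarrow>
      \<exists>s ts'. d' = (a, ts') \<and> rep (store_of i j (flat (code k) @ r) (bit_symbol s # xs) b c out) ts'"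
    "\<And>s. \<exists>ts'. tm_step M d (a, ts') \<and> rep (store_of i j (flat (code k) @ r) (bit_symbol s # xs) b c out) ts'"
proof -
  note blk1 = block_While[OF blk[unfolded guess_loop_def], unfolded guess_body_def]
  have 0: "unique_step M (a, ts) (a + 1, ts)"
    using run_jump_While[OF blk[unfolded guess_loop_def] rep] by simp
  obtain ts1 where 1: "rep (store_of i j (1 # flat (code k) @ r) xs b c out) ts1"
      "unique_step M (a + 1, ts) (a + 1 + 1, ts1)"
    using run_Pop[OF block_Seq(1)[OF blk1] rep] by auto
  obtain ts2 where 2: "rep (store_of i j (flat (code k) @ r) xs b c out) ts2"
      "unique_step M (a + 1 + 1, ts1) (a + 1 + 1 + 1, ts2)"
    using run_Pop[OF block_Seq(1)[OF block_Seq(2)[OF blk1]]] 1(1) by fastforce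
  have blk3: "block M (Guess 3) (a + 1 + 1 + 1) a"
    using block_Seq(2)[OF block_Seq(2)[OF blk1]] by simp
  obtain d where 3: "unique_step M (a + 1 + 1 + 1, ts2) d" "\<And>d'. tm_step M d d' \<Longrightarrow>
      \<exists>s ts'. s \<in> {1, 2} \<and> d' = (a, ts') \<and> rep (store_of i j (flat (code k) @ r) (s # xs) b c out) ts'"
    "\<And>s. s \<in> {1, 2} \<Longrightarrow> \<exists>ts'. tm_step M d (a, ts') \<and> rep (store_of i j (flat (code k) @ r) (s # xs) b c out) ts'"
    by (rule run_Guess[OF blk3 2(1)]) (auto simp del: split_paired_All)
  show thesis
  proof
    show "(unique_step M ^^ 4) (a, ts) d"
      using 0 1(2) 2(2) 3(1) by (auto simp: eval_nat_numeral)
    fix d' assume "tm_step M d d'"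
    from 3(2)[OF this] obtain s ts' where s: "s \<in> {1, 2}" "d' = (a, ts')"
      "rep (store_of i j (flat (code k) @ r) (s # xs) b c out) ts'" by blast
    then have "s = bit_symbol (s = 2)" by (auto simp: bit_symbol_def)
    then show "\<exists>s ts'. d' = (a, ts') \<and> rep (store_of i j (flat (code k) @ r) (bit_symbol s # xs) b c out) ts'"
      using s by metis
  next
    fix s
    show "\<exists>ts'. tm_step M d (a, ts') \<and> rep (store_of i j (flat (code k) @ r) (bit_symbol s # xs) b c out) ts'"
      using 3(3)[of "bit_symbol s"] bit_symbol_cases[of s] by auto
  qed
qed

lemma guess_loop_end:
  assumes "block M guess_loop a e" "rep (store_of i j (flat (code (0 :: nat)) @ r) xs b c out) ts"
  shows "unique_step M (a, ts) (e, ts)"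
  using run_jump_While[OF assms(1)[unfolded guess_loop_def] assms(2)] by simp

text \<open>Five steps per bit: the test, two pops, the move to the left and the guess itself; one
  more step leaves the loop.\<close>

lemma all_runs_guess:
  assumes blk: "block M guess_loop a e"
    and fin: "\<And>w ts'. length w = k \<Longrightarrow>
      rep (store_of i j (flat (code (0 :: nat)) @ r) (map bit_symbol w @ xs) b c out) ts' \<Longrightarrow> all_runs M Q n (e, ts')"
    and "rep (store_of i j (flat (code k) @ r) xs b c out) ts"
  shows "all_runs M Q (5 * k + 1 + n) (a, ts)"
  using assms(2,3)
proof (induction k arbitrary: xs ts)
  case 0
  have "unique_step M (a, ts) (e, ts)" by (rule guess_loop_end[OF blk 0(2)])
  then show ?case
    using all_runs_unique[of 1 M "(a, ts)" "(e, ts)" Q n] 0(1)[of "[]"] 0(2) by (simp add: eq_OO)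
next
  case (Suc k)
  obtain d where d: "(unique_step M ^^ 4) (a, ts) d" "\<And>d'. tm_step M d d' \<Longrightarrow>
      \<exists>s ts'. d' = (a, ts') \<and> rep (store_of i j (flat (code k) @ r) (bit_symbol s # xs) b c out) ts'"
    "\<And>s. \<exists>ts'. tm_step M d (a, ts') \<and> rep (store_of i j (flat (code k) @ r) (bit_symbol s # xs) b c out) ts'"
    using guess_loop_step[OF blk Suc.prems(2)] by metis
  have "all_runs M Q (5 * k + 1 + n) d'" if step: "tm_step M d d'" for d'
  proof -
    obtain s ts' where s: "d' = (a, ts')" "rep (store_of i j (flat (code k) @ r) (bit_symbol s # xs) b c out) ts'"
      using d(2)[OF step] by blast
    have "all_runs M Q n (e, ts'')" if "length w = k"
      "rep (store_of i j (flat (code (0 :: nat)) @ r) (map bit_symbol w @ bit_symbol s # xs) b c out) ts''" for w ts''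
      using Suc.prems(1)[of "w @ [s]" ts''] that by simp
    from Suc.IH[OF this s(2)] show ?thesis by (simp add: s(1))
  qed
  moreover obtain d0 where "tm_step M d d0" using d(3) by blast
  ultimately have "all_runs M Q (Suc (5 * k + 1 + n)) d" by (blast intro: all_runs.step)
  from all_runs_unique[OF d(1) this] show ?case by (simp add: add_ac)
qed

lemma exists_run_guess:
  assumes blk: "block M guess_loop a e" and "rep (store_of i j (flat (code k) @ r) xs b c out) ts"
    and "length w = k"
  shows "\<exists>t ts'. rep (store_of i j (flat (code (0 :: nat)) @ r) (map bit_symbol w @ xs) b c out) ts' \<and>
     (tm_step M ^^ t) (a, ts) (e, ts')"
  using assms(2,3)
proof (induction k arbitrary: xs ts w)
  case 0
  have "unique_step M (a, ts) (e, ts)" by (rule guess_loop_end[OF blk 0(1)])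
  then have "(tm_step M ^^ 1) (a, ts) (e, ts)" using unique_step_imp_step[of 1 M] by (simp add: eq_OO)
  then show ?case using 0 by fastforce
next
  case (Suc k)
  then obtain v s where w: "w = v @ [s]" "length v = k" by (cases w rule: rev_cases) auto
  obtain d where d: "(unique_step M ^^ 4) (a, ts) d"
    "\<exists>ts'. tm_step M d (a, ts') \<and> rep (store_of i j (flat (code k) @ r) (bit_symbol s # xs) b c out) ts'"
    using guess_loop_step[OF blk Suc.prems(1)] by metis
  then obtain ts1 where 1: "tm_step M d (a, ts1)"
    "rep (store_of i j (flat (code k) @ r) (bit_symbol s # xs) b c out) ts1" by blast
  obtain t ts' where 2: "rep (store_of i j (flat (code (0 :: nat)) @ r) (map bit_symbol v @ bit_symbol s # xs) b c out) ts'"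
     "(tm_step M ^^ t) (a, ts1) (e, ts')"
    using Suc.IH[OF 1(2) w(2)] by blast
  have "(tm_step M ^^ (4 + Suc t)) (a, ts) (e, ts')"
    using relpowp_add[OF unique_step_imp_step[OF d(1)] relpowp_Suc_I2[of "tm_step M", OF 1(1) 2(2)]] .
  then show ?case using 2(1) by (auto simp: w)
qed

text \<open>A blank ends the output and no bit is written as a blank, so the length is determined,
  and then the bits.\<close>

lemma has_output_unique:
  assumes "has_output c w" "has_output c w'"
  shows "w = w'"
proof -
  have *: "length v \<le> length v'" if "has_output c v" "has_output c v'" for v v'
  proof (rule ccontr)
    assume "\<not> length v \<le> length v'"
    then have "bit_symbol (v ! length v') = blank"
      using that unfolding has_output_def by (metis not_le)
    then show False by (simp add: bit_symbol_def blank_def split: if_splits)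
  qed
  then have len: "length w = length w'" using assms by (meson antisym)
  show ?thesis
  proof (rule nth_equalityI[OF len])
    fix i assume "i < length w"
    then have "bit_symbol (w ! i) = bit_symbol (w' ! i)"
      using assms len unfolding has_output_def by metis
    then show "w ! i = w' ! i" by (auto simp: bit_symbol_def split: if_splits)
  qed
qed

text \<open>A guess-and-check normal form: a word of a length computable from the input is guessed,
  everything else is deterministic, and \<open>h\<close> is the maximum over all guesses. It reduces
  membership to closure properties and a statement about words.\<close>

theorem OptP_guess_max:
  fixes V :: "word \<times> word \<Rightarrow> word" and B :: "word \<Rightarrow> nat"
  assumes V: "fp V" and B: "fp B"
    and h: "\<And>x. h x \<in> (\<lambda>c. bin_val (V (x, c))) ` {c. length c = B x}"
      "\<And>x c. length c = B x \<Longrightarrow> bin_val (V (x, c)) \<le> h x"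
  shows "h \<in> OptP"
proof -
  obtain A S where A: "wf_prog A" "guess_free A" "pbound S" "mono S"
    "\<And>x i j r out. exec A (work_store i j (flat (code x) @ r) out) (S (csize x))
      (work_store i j (flat (code (B x)) @ flat (code x) @ r) out)"
    "\<And>x. csize (B x) \<le> S (csize x)"
    "\<And>x :: word. csize x \<le> S (csize x)"
    by (rule fp_both[OF B fp_id]) (rule that; assumption)
  obtain P T where P: "wf_prog P" "guess_free P" "pbound T" "mono T"
    "\<And>x i j r out n. csize x \<le> n \<Longrightarrow> exec P (work_store i j (flat (code x) @ r) out) (T n)
        (work_store i j (flat (code (V x)) @ r) out)"
    "\<And>x. csize (V x) \<le> T (csize x)" using fpE[OF V] by metis
  define P1 where "P1 = load 0 ;; A"
  define P3 where "P3 = Pop 2 ;; build ;; t_swap ;; Push 2 2 ;; P ;; unload"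
  define M where "M = machine (P1 ;; guess_loop ;; P3)"
  let ?l1 = "prog_len P1" and ?l2 = "prog_len P1 + prog_len guess_loop" and
    ?e = "prog_len (P1 ;; guess_loop ;; P3)"
  have blk: "block M (P1 ;; guess_loop ;; P3) 0 ?e" unfolding M_def by (rule block_machine)
  have blk1: "block M P1 0 ?l1" using block_Seq(1)[OF blk] by simp
  have blk2: "block M guess_loop ?l1 ?l2"
    using block_Seq(1)[OF block_Seq(2)[OF blk]] by simp
  have blk3: "block M P3 ?l2 ?e"
    using block_Seq(2)[OF block_Seq(2)[OF blk]] by simp
  define N where "N n = n + 4 * S n + 3" for n
  define K1 where "K1 n = 17 * n + 4 + S n" for n
  define K3 where "K3 n = 12 * S n + 6 + 200 * N n + 8 * T (N n) + 1" for n
  define K where "K n = K1 n + (5 * S n + 1 + K3 n)" for n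
  have phase1: "\<exists>u ts. u \<le> K1 (csize x) \<and> rep (work_store [] [] (flat (code (B x)) @ flat (code x) @ []) []) ts \<and>
      (unique_step M ^^ u) (initial_config M [x]) (?l1, ts)" for x
  proof -
    have "exec P1 (work_store (map bit_symbol x) (map bit_symbol []) [] []) (K1 (csize x))
      (work_store [] [] (flat (code (B x)) @ flat (code x) @ []) [])"
      unfolding P1_def
      using exec_mono[OF exec_Seq[OF exec_load_0[of x "[]" "[]" "[]"] A(5)[of "[]" "[]" x "[]"]], of "K1 (csize x)"]
        length_le_csize_word[of x] by (simp add: K1_def)
    from exec_run[OF this blk1 rep_initial[of "[x]" x "[]" "P1 ;; guess_loop ;; P3"]] show ?thesis
      using initial_state[of "P1 ;; guess_loop ;; P3" "[x]"] by (auto simp: M_def)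
  qed
  \<comment> \<open>The guessed bits arrive in reverse order, which is harmless because all words of
    the given length are guessed.\<close>
  have phase3: "\<exists>u ts'. u \<le> K3 (csize x) \<and> (unique_step M ^^ u) (?l2, ts) (?e, ts') \<and>
      has_output (?e, ts') (V (x, rev c))"
    if c: "length c = B x" "rep (store_of [] [] (flat (code (0 :: nat)) @ flat (code x)) (map bit_symbol c) [] [] []) ts" for x c ts
  proof -
    have lenc: "length c \<le> S (csize x)" using A(6)[of x] c(1) by simp
    have sz: "csize (x, rev c) \<le> N (csize x)"
      using csize_word[of c] lenc by (simp add: N_def)
    have 1: "exec (Pop 2) (store_of [] [] (flat (code (0 :: nat)) @ flat (code x)) (map bit_symbol c) [] [] []) 1
        (store_of [] [] (flat (code x)) (map bit_symbol c) [] [] [])"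
      by (rule exec_PopI) auto
    have 2: "exec build (store_of [] [] (flat (code x)) (map bit_symbol c) [] [] []) (12 * S (csize x) + 3)
        (work_store [] [] (flat (code (rev c)) @ flat (code x) @ []) [])"
      using exec_mono[OF exec_build[of "[]" "[]" "flat (code x)" c "[]" "[]" "[]"], of "12 * S (csize x) + 3"] lenc by simp
    have 3: "exec t_swap (work_store [] [] (flat (code (rev c)) @ flat (code x) @ []) []) (200 * N (csize x))
        (work_store [] [] (flat (code x) @ flat (code (rev c)) @ []) [])"
      by (rule exec_t_swap) (use sz in \<open>simp add: csize_def[symmetric]\<close>)
    have 4: "exec (Push 2 2) (work_store [] [] (flat (code x) @ flat (code (rev c)) @ []) []) 2
        (work_store [] [] (flat (code (x, rev c)) @ []) [])"
      by (rule exec_PushI) auto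
    have 5: "exec unload (work_store [] [] (flat (code (V (x, rev c))) @ []) []) (7 * T (N (csize x)) + 1)
        (work_store [] [] (1 # []) ([] @ map bit_symbol (V (x, rev c))))"
    proof (rule exec_mono[OF exec_unload])
      have "length (V (x, rev c)) \<le> T (csize (x, rev c))"
        using P(6) length_le_csize_word order_trans by blast
      also have "\<dots> \<le> T (N (csize x))" by (rule mono_le[OF P(4) sz])
      finally show "7 * length (V (x, rev c)) + 1 \<le> 7 * T (N (csize x)) + 1" by simp
    qed
    have "exec P3 (store_of [] [] (flat (code (0 :: nat)) @ flat (code x)) (map bit_symbol c) [] [] []) (K3 (csize x))
        (work_store [] [] (1 # []) ([] @ map bit_symbol (V (x, rev c))))"
      unfolding P3_def
      by (rule exec_mono[OF exec_Seq[OF 1 exec_Seq[OF 2 exec_Seq[OF 3 exec_Seq[OF 4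
              exec_Seq[OF P(5)[OF sz] 5]]]]]]) (simp add: K3_def)
    from exec_run[OF this blk3 c(2)] show ?thesis using rep_output by fastforce
  qed
  define good where "good x c \<longleftrightarrow> (\<exists>w. length w = B x \<and> has_output c (V (x, w)))" for x and c :: config
  have stuck: "\<not> tm_step M (?e, ts) d" for ts d
    unfolding M_def by (rule stuck_machine)
  have all: "all_runs M (good x) (K (csize x)) (initial_config M [x])" for x
  proof -
    obtain u ts where 1: "u \<le> K1 (csize x)" "rep (work_store [] [] (flat (code (B x)) @ flat (code x) @ []) []) ts"
      "(unique_step M ^^ u) (initial_config M [x]) (?l1, ts)" using phase1 by blast
    have "all_runs M (good x) (5 * B x + 1 + K3 (csize x)) (?l1, ts)"
    proof (rule all_runs_guess[OF blk2])
      show "rep (work_store [] [] (flat (code (B x)) @ flat (code x)) []) ts" using 1 by simp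
      fix w ts'
      assume w: "length w = B x"
        "rep (store_of [] [] (flat (code (0 :: nat)) @ flat (code x)) (map bit_symbol w @ []) [] [] []) ts'"
      obtain v ts'' where v: "v \<le> K3 (csize x)" "(unique_step M ^^ v) (?l2, ts') (?e, ts'')"
        "has_output (?e, ts'') (V (x, rev w))"
        using phase3[of w x ts'] w by auto
      have "all_runs M (good x) 0 (?e, ts'')"
        by (rule all_runs.stop[OF stuck]) (use v w in \<open>auto simp: good_def intro!: exI[of _ "rev w"]\<close>)
      from all_runs_mono[OF all_runs_unique[OF v(2) this]] v(1)
      show "all_runs M (good x) (K3 (csize x)) (?l2, ts')" by simp
    qed
    from all_runs_mono[OF all_runs_unique[OF 1(3) this], of "K (csize x)"] 1(1) A(6)[of x]
    show ?thesis by (simp add: K_def)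
  qed
  have some: "\<exists>t c. tm_reaches M [x] t c \<and> accepting M c \<and> has_output c (V (x, w))" if w: "length w = B x" for x w
  proof -
    obtain u ts where "rep (work_store [] [] (flat (code (B x)) @ flat (code x) @ []) []) ts"
      and u: "(unique_step M ^^ u) (initial_config M [x]) (?l1, ts)" using phase1[of x] by blast
    then have 1: "rep (work_store [] [] (flat (code (B x)) @ flat (code x)) []) ts"
      "(unique_step M ^^ u) (initial_config M [x]) (?l1, ts)" by simp_all
    obtain t ts' where 2: "rep (store_of [] [] (flat (code (0 :: nat)) @ flat (code x)) (map bit_symbol (rev w)) [] [] []) ts'"
      "(tm_step M ^^ t) (?l1, ts) (?l2, ts')"
      using exists_run_guess[OF blk2 1(1), of "rev w"] w by auto
    obtain v ts'' where v: "(unique_step M ^^ v) (?l2, ts') (?e, ts'')"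
        "has_output (?e, ts'') (V (x, w))"
      using phase3[OF _ 2(1)] w by auto
    have "tm_reaches M [x] (u + (t + v)) (?e, ts'')"
      unfolding tm_reaches_def
      using relpowp_add[OF unique_step_imp_step[OF 1(2)] relpowp_add[OF 2(2) unique_step_imp_step[OF v(1)]]] .
    moreover have "accepting M (?e, ts'')" unfolding M_def by (rule accepting_machine)
    ultimately show ?thesis using v(2) by blast
  qed
  have outs: "ntm_outputs M x = (\<lambda>c. bin_val (V (x, c))) ` {c. length c = B x}" for x
  proof (intro equalityI subsetI)
    fix n assume "n \<in> ntm_outputs M x"
    then obtain w t c where w: "n = bin_val w" "tm_reaches M [x] t c" "accepting M c" "has_output c w"
      by (auto simp: ntm_outputs_def)
    then have "good x c"
      using all_runs_reach[OF all] unfolding tm_reaches_def accepting_def by blast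
    then obtain v where "length v = B x" "has_output c (V (x, v))" by (auto simp: good_def)
    then show "n \<in> (\<lambda>c. bin_val (V (x, c))) ` {c. length c = B x}"
      using has_output_unique[OF w(4)] w(1) by auto
  next
    fix n assume "n \<in> (\<lambda>c. bin_val (V (x, c))) ` {c. length c = B x}"
    then show "n \<in> ntm_outputs M x" using some by (auto simp: ntm_outputs_def)
  qed
  have "pbound N" unfolding N_def by (intro pbound_intros A(3))
  moreover from this have "pbound (\<lambda>n. T (N n))" by (rule pbound_comp[OF P(3)])
  ultimately have "pbound K" unfolding K_def K1_def K3_def
    by (intro pbound_intros A(3))
  then have "pbound (\<lambda>n. K (1 + 4 * n))" by (rule pbound_comp) (intro pbound_intros)
  then obtain p :: "nat poly" where p: "\<And>n. K (1 + 4 * n) \<le> poly p n" by (auto simp: pbound_def)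
  have "mono T" "mono S" by fact+
  then have "mono N" unfolding N_def by (auto simp: mono_def intro!: add_mono)
  then have "mono K" unfolding K_def K1_def K3_def using \<open>mono T\<close> \<open>mono S\<close>
    by (auto simp: mono_def intro!: add_mono mult_le_mono2)
  have time: "t \<le> poly p (length x)" if "tm_reaches M [x] t c" for x t c
  proof -
    have "t \<le> K (csize x)" using all_runs_reach[OF all] that unfolding tm_reaches_def by blast
    also have "\<dots> \<le> K (1 + 4 * length x)" by (rule mono_le[OF \<open>mono K\<close> csize_word])
    also have "\<dots> \<le> poly p (length x)" by (rule p)
    finally show ?thesis .
  qed
  have "poly_time_ntm M"
    unfolding poly_time_ntm_def
  proof (intro conjI exI[of _ p] allI impI)
    show "wf_ntm M" unfolding M_def by (rule wf_machine)
  qed (rule time)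
  moreover have "\<exists>w. has_output c w" if "tm_reaches M [x] t c" "accepting M c" for x t c
    using all_runs_reach[OF all] that unfolding tm_reaches_def accepting_def good_def by blast
  moreover have "h x \<in> ntm_outputs M x \<and> (\<forall>v\<in>ntm_outputs M x. v \<le> h x)" for x
    unfolding outs using h by auto
  ultimately show ?thesis
    unfolding OptP_def by blast
qed

section \<open>Constraint satisfaction as regex matching\<close>

text \<open>Unary blocks, each closed by a 0, so that lists of numbers are coded
  injectively.\<close>

definition key_word :: "nat list \<Rightarrow> word" where
  "key_word ks = concat (map (\<lambda>n. replicate n True @ [False]) ks)"

text \<open>Group identifiers have to be numbers. With a leading 1 the key word is the binary
  numeral, so the reduction writes identifiers down without any arithmetic.\<close>

definition gid :: "nat list \<Rightarrow> nat" where
  "gid ks = bin_val (True # key_word ks)"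

lemma bin_gid: "bin (gid ks) = True # key_word ks"
  unfolding gid_def by (rule bin_bin_val)

lemma key_word_inj: "key_word ks = key_word ls \<longleftrightarrow> ks = ls"
proof -
  have *: "replicate m True @ False # u = replicate n True @ False # v \<longleftrightarrow> m = n \<and> u = v" for m n u v
  proof (induction m arbitrary: n)
    case 0
    then show ?case by (cases n) auto
  next
    case (Suc m)
    then show ?case by (cases n) auto
  qed
  show ?thesis
  proof (induction ks arbitrary: ls)
    case Nil
    then show ?case by (cases ls) (auto simp: key_word_def)
  next
    case (Cons k ks)
    then show ?case by (cases ls) (auto simp: key_word_def *)
  qed
qed

lemma gid_inj [simp]: "gid ks = gid ls \<longleftrightarrow> ks = ls"
  by (metis bin_gid key_word_inj list.inject)

definition any_char :: "'c regex" where "any_char = Char_Descr UNIV"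
definition no_char :: "'c regex" where "no_char = Char_Descr {}"

text \<open>On a string of equal characters a backreference to a group that captured one character
  consumes one character, and a backreference to an undefined group consumes nothing.  The string
  is so long that the end is reached only if every backreference that is passed consumes.\<close>

definition var_regex :: "nat list list \<Rightarrow> 'c regex" where
  "var_regex D = foldr Disj (map (\<lambda>k. Group (gid k) any_char) D) no_char"

text \<open>Padding every cube to \<open>J\<close> items makes a satisfied constraint consume
  exactly \<open>J\<close> characters, whichever cube is used.\<close>

definition cube_items :: "nat \<Rightarrow> nat list list \<Rightarrow> 'c regex list" where
  "cube_items J c = map (\<lambda>k. Backref (gid k)) c @ replicate (J - length c) any_char"

definition constraint_regex :: "nat \<Rightarrow> nat list list list \<Rightarrow> 'c regex" where
  "constraint_regex J cubes = foldr Disj (map (\<lambda>c. foldr Sequ (cube_items J c) Empty) cubes) no_char"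

text \<open>The anchors leave 0 as the only start position and demand that the whole string is
  consumed.\<close>

definition csp_regex :: "nat \<Rightarrow> nat list list list \<Rightarrow> nat list list list list \<Rightarrow> 'c regex" where
  "csp_regex J vars cs = Sequ (Anchor Input_Start)
     (foldr Sequ (map var_regex vars @ map (constraint_regex J) cs) (Anchor Input_End))"

definition csp_length :: "nat \<Rightarrow> nat list list list \<Rightarrow> nat list list list list \<Rightarrow> nat" where
  "csp_length J vars cs = length vars + J * length cs"

definition keys_sat :: "nat list list list list \<Rightarrow> nat list list \<Rightarrow> bool" where
  "keys_sat cs ks \<longleftrightarrow> (\<forall>cubes\<in>set cs. \<exists>c\<in>set cubes. set c \<subseteq> set ks)"

section \<open>Leaves of the constraint regex\<close>

lemma leaves_Disj_list:
  "leaves W s (Areg (foldr Disj rs no_char) # l) p \<gamma> = concat (map (\<lambda>r. leaves W s (Areg r # l) p \<gamma>) rs)"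
  by (induction rs) (auto simp: no_char_def)

fun capture :: "group_map \<Rightarrow> nat \<Rightarrow> nat list list \<Rightarrow> group_map" where
  "capture \<gamma> p [] = \<gamma>"
| "capture \<gamma> p (k # ks) = capture (\<gamma>(gid k := Closed p (Suc p))) (Suc p) ks"

definition unit_captures :: "nat \<Rightarrow> group_map \<Rightarrow> bool" where
  "unit_captures N \<gamma> \<longleftrightarrow> (\<forall>g. \<gamma> g = Undefd \<or> (\<exists>a<N. \<gamma> g = Closed a (Suc a)))"

lemma unit_captures_capture: "unit_captures N \<gamma> \<Longrightarrow> p + length ks \<le> N \<Longrightarrow> unit_captures N (capture \<gamma> p ks)"
proof (induction ks arbitrary: \<gamma> p)
  case (Cons k ks)
  have "unit_captures N (\<gamma>(gid k := Closed p (Suc p)))"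
    using Cons.prems by (auto simp: unit_captures_def)
  then show ?case using Cons.IH[of "\<gamma>(gid k := Closed p (Suc p))" "Suc p"] Cons.prems
    by (simp del: fun_upd_apply)
qed simp

lemma concat_map_concat: "concat (map g (concat (map h xs))) = concat (map (\<lambda>x. concat (map g (h x))) xs)"
  by (induction xs) auto

lemma capture_undefined: "capture \<gamma> p ks (gid k) = Undefd \<longleftrightarrow> k \<notin> set ks \<and> \<gamma> (gid k) = Undefd"
  by (induction ks arbitrary: \<gamma> p) auto

lemma leaves_var:
  assumes "p < length s"
  shows "leaves W s (Areg (var_regex D) # l) p \<gamma> =
    concat (map (\<lambda>k. leaves W s l (Suc p) (\<gamma>(gid k := Closed p (Suc p)))) D)"
proof -
  have "leaves W s (Areg (Group (gid k) any_char) # l) p \<gamma> = leaves W s l (Suc p) (\<gamma>(gid k := Closed p (Suc p)))" for k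
    using assms by (simp add: any_char_def)
  then show ?thesis unfolding var_regex_def leaves_Disj_list by (simp add: comp_def)
qed

text \<open>\<open>product_lists\<close> enumerates the choices in the order in which backtracking
  tries them, which makes priority lexicographic.\<close>

lemma leaves_vars:
  assumes "p + length vars \<le> length s"
  shows "leaves W s [Areg (foldr Sequ (map var_regex vars @ rs) r0)] p \<gamma> =
    concat (map (\<lambda>ks. leaves W s [Areg (foldr Sequ rs r0)] (p + length vars) (capture \<gamma> p ks)) (product_lists vars))"
  using assms
proof (induction vars arbitrary: p \<gamma>)
  case (Cons D vars)
  have "leaves W s [Areg (foldr Sequ (map var_regex (D # vars) @ rs) r0)] p \<gamma> =
    concat (map (\<lambda>k. leaves W s [Areg (foldr Sequ (map var_regex vars @ rs) r0)] (Suc p) (\<gamma>(gid k := Closed p (Suc p)))) D)"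
    using Cons.prems by (simp add: leaves_var)
  also have "\<dots> = concat (map (\<lambda>k. concat (map (\<lambda>ks. leaves W s [Areg (foldr Sequ rs r0)] (Suc p + length vars)
      (capture (\<gamma>(gid k := Closed p (Suc p))) (Suc p) ks)) (product_lists vars))) D)"
    using Cons.prems by (subst Cons.IH) auto
  also have "\<dots> = concat (map (\<lambda>ks. leaves W s [Areg (foldr Sequ rs r0)] (p + length (D # vars)) (capture \<gamma> p ks)) (product_lists (D # vars)))"
    by (simp add: concat_map_concat comp_def)
  finally show ?case .
qed simp

context
  fixes c0 :: 'c and N :: nat and W :: "'c set" and s :: "'c list"
  defines "s \<equiv> replicate N c0"
begin

lemma leaves_backref:
  assumes "unit_captures N \<gamma>"
  shows "leaves W s (Areg (Backref g) # l) p \<gamma> =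
    (if \<gamma> g = Undefd then leaves W s l p \<gamma> else if p < N then leaves W s l (Suc p) \<gamma> else [])"
proof (cases "\<gamma> g = Undefd")
  case False
  then obtain a where "a < N" "\<gamma> g = Closed a (Suc a)" using assms by (auto simp: unit_captures_def)
  then show ?thesis by (auto simp: s_def occurs_at_def min_def Let_def)
qed simp

lemma leaves_any_chars:
  "p \<le> N \<Longrightarrow> leaves W s (Areg (foldr Sequ (replicate m any_char) Empty) # l) p \<gamma> =
    (if p + m \<le> N then leaves W s l (p + m) \<gamma> else [])"
  by (induction m arbitrary: p) (auto simp: any_char_def s_def simp del: foldr_replicate)

lemma leaves_cube:
  assumes "unit_captures N \<gamma>" "p \<le> N" "length c \<le> J"
  shows "leaves W s (Areg (foldr Sequ (cube_items J c) Empty) # l) p \<gamma> =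
    (let q = p + length (filter (\<lambda>k. \<gamma> (gid k) \<noteq> Undefd) c) + (J - length c)
     in if q \<le> N then leaves W s l q \<gamma> else [])"
proof -
  have "leaves W s (Areg (foldr Sequ (map (\<lambda>k. Backref (gid k)) c @ replicate m any_char) Empty) # l) p \<gamma> =
    (let q = p + length (filter (\<lambda>k. \<gamma> (gid k) \<noteq> Undefd) c) + m
     in if q \<le> N then leaves W s l q \<gamma> else [])" for m
    using assms(2)
  proof (induction c arbitrary: p)
    case Nil
    then show ?case by (simp add: leaves_any_chars Let_def del: foldr_replicate)
  next
    case (Cons k c)
    let ?r = "foldr Sequ (map (\<lambda>k. Backref (gid k)) c @ replicate m any_char) Empty"
    have "leaves W s (Areg (foldr Sequ (map (\<lambda>k. Backref (gid k)) (k # c) @ replicate m any_char) Empty) # l) p \<gamma> =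
        leaves W s (Areg (Backref (gid k)) # Areg ?r # l) p \<gamma>"
      by (simp only: list.map append_Cons foldr.simps comp_apply leaves.simps(7))
    also have "\<dots> = (if \<gamma> (gid k) = Undefd then leaves W s (Areg ?r # l) p \<gamma>
        else if p < N then leaves W s (Areg ?r # l) (Suc p) \<gamma> else [])"
      by (rule leaves_backref[OF assms(1)])
    finally show ?case using Cons by (auto simp: Let_def simp del: foldr_append foldr_replicate)
  qed
  then show ?thesis by (simp add: cube_items_def)
qed

text \<open>No constraint consumes more than \<open>J\<close> characters, so a deficit at one of
  them can never be made up later, and the end is reached only without any deficit. Checking
  captures nothing, so all leaves have the same group map.\<close>

lemma leaves_constraints:
  assumes "unit_captures N \<gamma>" "p + J * length cs \<le> N" "\<forall>cubes\<in>set cs. \<forall>c\<in>set cubes. length c \<le> J"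
  shows "set (leaves W s [Areg (foldr Sequ (map (constraint_regex J) cs) (Anchor Input_End))] p \<gamma>) \<subseteq> {(N, \<gamma>)} \<and>
    (leaves W s [Areg (foldr Sequ (map (constraint_regex J) cs) (Anchor Input_End))] p \<gamma> \<noteq> [] \<longleftrightarrow>
      p + J * length cs = N \<and> (\<forall>cubes\<in>set cs. \<exists>c\<in>set cubes. \<forall>k\<in>set c. \<gamma> (gid k) \<noteq> Undefd))"
  using assms(2,3)
proof (induction cs arbitrary: p)
  case Nil
  then show ?case by (simp add: s_def)
next
  case (Cons cubes cs)
  let ?rest = "\<lambda>q. leaves W s [Areg (foldr Sequ (map (constraint_regex J) cs) (Anchor Input_End))] q \<gamma>"
  let ?q = "\<lambda>c. p + length (filter (\<lambda>k. \<gamma> (gid k) \<noteq> Undefd) c) + (J - length c)"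
  have eq: "leaves W s [Areg (foldr Sequ (map (constraint_regex J) (cubes # cs)) (Anchor Input_End))] p \<gamma> =
      concat (map (\<lambda>c. ?rest (?q c)) cubes)"
  proof -
    have "?q c \<le> N" if "c \<in> set cubes" for c
    proof -
      have "length c \<le> J" "p + J \<le> N" using Cons.prems that by auto
      then show ?thesis using length_filter_le[of "\<lambda>k. \<gamma> (gid k) \<noteq> Undefd" c] by linarith
    qed
    then have "map (\<lambda>c. leaves W s (Areg (foldr Sequ (cube_items J c) Empty) #
        [Areg (foldr Sequ (map (constraint_regex J) cs) (Anchor Input_End))]) p \<gamma>) cubes =
        map (\<lambda>c. ?rest (?q c)) cubes"
      using Cons.prems by (intro map_cong refl, subst leaves_cube[OF assms(1)]) (auto simp: Let_def)
    moreover have "leaves W s [Areg (foldr Sequ (map (constraint_regex J) (cubes # cs)) (Anchor Input_End))] p \<gamma> =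
        concat (map (\<lambda>c. leaves W s (Areg (foldr Sequ (cube_items J c) Empty) #
        [Areg (foldr Sequ (map (constraint_regex J) cs) (Anchor Input_End))]) p \<gamma>) cubes)"
      by (simp only: list.map foldr.simps comp_apply leaves.simps(7) constraint_regex_def
          leaves_Disj_list map_map comp_def)
    ultimately show ?thesis by (simp only:)
  qed
  have q: "?q c \<le> p + J" "?q c = p + J \<longleftrightarrow> (\<forall>k\<in>set c. \<gamma> (gid k) \<noteq> Undefd)" if "c \<in> set cubes" for c
  proof -
    have len: "length c \<le> J" using Cons.prems that by auto
    show "?q c \<le> p + J" using length_filter_le[of "\<lambda>k. \<gamma> (gid k) \<noteq> Undefd" c] len by linarith
    have "length (filter (\<lambda>k. \<gamma> (gid k) \<noteq> Undefd) c) = length c \<longleftrightarrow> (\<forall>k\<in>set c. \<gamma> (gid k) \<noteq> Undefd)"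
      using length_filter_less[of _ c "\<lambda>k. \<gamma> (gid k) \<noteq> Undefd"] by (auto simp: filter_id_conv)
    then show "?q c = p + J \<longleftrightarrow> (\<forall>k\<in>set c. \<gamma> (gid k) \<noteq> Undefd)"
      using len length_filter_le[of "\<lambda>k. \<gamma> (gid k) \<noteq> Undefd" c] by linarith
  qed
  have IH: "set (?rest (?q c)) \<subseteq> {(N, \<gamma>)}" "?rest (?q c) \<noteq> [] \<longleftrightarrow> ?q c + J * length cs = N \<and>
      (\<forall>cubes\<in>set cs. \<exists>c\<in>set cubes. \<forall>k\<in>set c. \<gamma> (gid k) \<noteq> Undefd)" if "c \<in> set cubes" for c
    using Cons.IH[of "?q c"] Cons.prems q(1)[OF that] by auto
  have "?rest (?q c) \<noteq> [] \<longleftrightarrow> p + J * length (cubes # cs) = N \<and> (\<forall>k\<in>set c. \<gamma> (gid k) \<noteq> Undefd) \<and>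
      (\<forall>cubes\<in>set cs. \<exists>c\<in>set cubes. \<forall>k\<in>set c. \<gamma> (gid k) \<noteq> Undefd)" if "c \<in> set cubes" for c
    unfolding IH(2)[OF that] q(2)[OF that, symmetric] using q(1)[OF that] Cons.prems(1) by auto
  then show ?case
    unfolding eq using IH(1) by fastforce
qed

lemma csp_match:
  assumes N: "N = csp_length J vars cs"
    and J: "\<forall>cubes\<in>set cs. \<forall>c\<in>set cubes. length c \<le> J"
    and sol: "find (keys_sat cs) (product_lists vars) = Some ks"
  shows "js_match W (csp_regex J vars cs) s = Some (0, N, capture (\<lambda>_. Undefd) 0 ks)"
proof -
  let ?m = "\<lambda>k. leaves W s [Areg (csp_regex J vars cs)] k (\<lambda>_. Undefd)"
  let ?X = "\<lambda>ks. leaves W s [Areg (foldr Sequ (map (constraint_regex J) cs) (Anchor Input_End))]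
      (length vars) (capture (\<lambda>_. Undefd) 0 ks)"
  have m0: "?m 0 = concat (map ?X (product_lists vars))"
    using leaves_vars[of 0 vars s W "map (constraint_regex J) cs" "Anchor Input_End" "\<lambda>_. Undefd"] N
    by (simp add: csp_regex_def csp_length_def s_def)
  have X: "set (?X ks) \<subseteq> {(N, capture (\<lambda>_. Undefd) 0 ks)}" "?X ks \<noteq> [] \<longleftrightarrow> keys_sat cs ks"
    if "ks \<in> set (product_lists vars)" for ks
  proof -
    have "length ks = length vars" using that in_set_product_lists_length by blast
    then have "unit_captures N (capture (\<lambda>_. Undefd) 0 ks)"
      using N by (intro unit_captures_capture) (auto simp: unit_captures_def csp_length_def)
    note * = leaves_constraints[OF this, of "length vars" J cs]
    have "keys_sat cs ks \<longleftrightarrow> (\<forall>cubes\<in>set cs. \<exists>c\<in>set cubes. \<forall>k\<in>set c. capture (\<lambda>_. Undefd) 0 ks (gid k) \<noteq> Undefd)"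
      by (simp add: keys_sat_def capture_undefined subset_eq)
    then show "set (?X ks) \<subseteq> {(N, capture (\<lambda>_. Undefd) 0 ks)}" "?X ks \<noteq> [] \<longleftrightarrow> keys_sat cs ks"
      using * J N unfolding csp_length_def by blast+
  qed
  \<comment> \<open>Choices that violate a constraint contribute no leaf, so the list begins with
    the leaves of the first solution.\<close>
  have first: "\<exists>zs. concat (map f xs) = f k @ zs" if "find P xs = Some k" "\<And>x. x \<in> set xs \<Longrightarrow> f x \<noteq> [] \<longleftrightarrow> P x"
    for P k and xs :: "nat list list list" and f :: "nat list list \<Rightarrow> (nat \<times> group_map) list"
    using that
  proof (induction xs)
    case (Cons a xs)
    show ?case
    proof (cases "P a")
      case False
      then have "f a = []" using Cons.prems(2)[of a] by simp
      then show ?thesis using Cons False by simp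
    qed (use Cons.prems in auto)
  qed simp
  obtain zs where zs: "?m 0 = ?X ks @ zs"
    using first[OF sol, of ?X] X(2) unfolding m0 by blast
  have ks: "ks \<in> set (product_lists vars)" "keys_sat cs ks"
    using sol by (auto simp: find_Some_iff)
  then have ne: "?X ks \<noteq> []" using X(2) by blast
  then have "?m 0 \<noteq> []" unfolding zs by simp
  moreover have "hd (?m 0) = (N, capture (\<lambda>_. Undefd) 0 ks)"
    unfolding zs using ne X(1)[OF ks(1)] by (cases "?X ks") auto
  moreover have "(LEAST k. ?m k \<noteq> []) = 0"
    using \<open>?m 0 \<noteq> []\<close> by (intro Least_equality) auto
  ultimately show ?thesis
    unfolding js_match_def Let_def by auto
qed

end

section \<open>The constraint regex as an admissible instance\<close>

lemma groups_foldr: "groups (foldr Disj rs no_char) = concat (map groups rs)"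
  "groups (foldr Sequ rs r0) = concat (map groups rs) @ groups r0"
  by (induction rs) (auto simp: no_char_def)

lemma lower_bounded_free_foldr:
  "lower_bounded_free (foldr Disj rs no_char) \<longleftrightarrow> (\<forall>r\<in>set rs. lower_bounded_free r)"
  "lower_bounded_free (foldr Sequ rs r0) \<longleftrightarrow> (\<forall>r\<in>set rs. lower_bounded_free r) \<and> lower_bounded_free r0"
  by (induction rs) (auto simp: no_char_def)

lemma groups_var_regex: "groups (var_regex D) = map gid D"
  by (induction D) (auto simp: var_regex_def groups_foldr any_char_def no_char_def)

lemma groups_constraint_regex: "groups (constraint_regex J cubes) = []"
  by (auto simp: constraint_regex_def groups_foldr cube_items_def any_char_def simp del: foldr_replicate)

lemma groups_csp_regex: "groups (csp_regex J vars cs) = map gid (concat vars)"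
  by (simp add: csp_regex_def groups_foldr comp_def map_concat concat_eq_Nil_conv
      groups_var_regex groups_constraint_regex)

lemma csp_regex_in:
  assumes "distinct (concat vars)"
  shows "csp_regex J vars cs \<in> js_regexes_no_lower_bound"
proof -
  have "inj_on gid A" for A by (simp add: inj_on_def)
  then have "distinct (groups (csp_regex J vars cs))"
    using assms by (simp add: groups_csp_regex distinct_map)
  moreover have "lower_bounded_free (csp_regex J vars cs)"
    by (auto simp: csp_regex_def var_regex_def constraint_regex_def cube_items_def any_char_def
        lower_bounded_free_foldr simp del: foldr_replicate)
  ultimately show ?thesis by (simp add: js_regexes_no_lower_bound_def js_regexes_def)
qed


subsection \<open>Assignments\<close>

type_synonym var_domains = "(nat list \<times> nat list) list"
type_synonym constraints = "(nat list \<times> nat) list list list"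

definition var_keys :: "nat list \<times> nat list \<Rightarrow> nat list list" where
  "var_keys vD = map (\<lambda>a. fst vD @ [a]) (snd vD)"

definition selection :: "(nat list \<Rightarrow> nat) \<Rightarrow> var_domains \<Rightarrow> nat list list" where
  "selection f vs = map (\<lambda>vD. fst vD @ [f (fst vD)]) vs"

definition in_domains :: "(nat list \<Rightarrow> nat) \<Rightarrow> var_domains \<Rightarrow> bool" where
  "in_domains f vs \<longleftrightarrow> (\<forall>vD\<in>set vs. f (fst vD) \<in> set (snd vD))"

definition holds :: "(nat list \<Rightarrow> nat) \<Rightarrow> constraints \<Rightarrow> bool" where
  "holds f cs \<longleftrightarrow> (\<forall>c\<in>set cs. \<exists>cube\<in>set c. \<forall>va\<in>set cube. f (fst va) = snd va)"

definition constraint_keys :: "constraints \<Rightarrow> nat list list list list" where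
  "constraint_keys cs = map (map (map (\<lambda>va. fst va @ [snd va]))) cs"

lemma mem_selection: "v @ [a] \<in> set (selection f vs) \<longleftrightarrow> v \<in> fst ` set vs \<and> f v = a"
  by (auto simp: selection_def)

lemma keys_sat_selection:
  assumes "\<forall>c\<in>set cs. \<forall>cube\<in>set c. \<forall>va\<in>set cube. fst va \<in> fst ` set vs"
  shows "keys_sat (constraint_keys cs) (selection f vs) \<longleftrightarrow> holds f cs"
  using assms by (simp add: keys_sat_def constraint_keys_def holds_def subset_eq mem_selection)

lemma product_lists_selection:
  "in_domains f vs \<Longrightarrow> selection f vs \<in> set (product_lists (map var_keys vs))"
  by (induction vs) (auto simp: selection_def in_domains_def var_keys_def)

text \<open>Distinct variable names turn a choice of keys into a function of the variables.\<close>

lemma product_lists_selectionE: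
  assumes "ks \<in> set (product_lists (map var_keys vs))" "distinct (map fst vs)"
  obtains f where "ks = selection f vs" "in_domains f vs"
  using assms
proof (induction vs arbitrary: ks thesis)
  case Nil
  then show ?case by (simp add: selection_def in_domains_def)
next
  case (Cons vD vs)
  then obtain a ks' where a: "a \<in> set (snd vD)" "ks = (fst vD @ [a]) # ks'"
    "ks' \<in> set (product_lists (map var_keys vs))" by (auto simp: var_keys_def[of vD])
  then obtain f where f: "ks' = selection f vs" "in_domains f vs" using Cons by auto
  have "fst x \<noteq> fst vD" if "x \<in> set vs" for x
    using Cons.prems(3) that by (metis distinct.simps(2) image_eqI list.map(2) list.set_map)
  then show ?case
    using Cons.prems(1)[of "f(fst vD := a)"] a f
    by (auto simp: selection_def in_domains_def)
qed

section \<open>Lexicographic order and binary value\<close>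

lemma bin_val_Cons: "bin_val (b # w) = of_bool b * 2 ^ length w + bin_val w"
  by (simp add: bin_val_def horner_sum_append)

lemma bin_val_less: "bin_val w < 2 ^ length w"
  unfolding bin_val_def using horner_sum_of_bool_2_less[of "rev w", where ?'a = nat] by simp

text \<open>Complementing the bits reverses the numeric order, which reduces minimisation to
  maximisation.\<close>

lemma bin_val_not: "bin_val (map Not w) + bin_val w + 1 = 2 ^ length w"
  by (induction w) (auto simp: bin_val_Cons, simp add: bin_val_def)

lemma bin_val_Nil [simp]: "bin_val [] = 0"
  by (simp add: bin_val_def)

lemma bin_val_leading_False: "bin_val (replicate m False @ w) = bin_val w"
  by (induction m) (auto simp: bin_val_Cons)

text \<open>\<open>g l\<close> is tried before \<open>h l\<close>. At the first place where another
  solution differs, it must have the second value there, for otherwise it would have been found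
  earlier; and the weight lost at that bit exceeds what all later bits can regain.\<close>

lemma bin_val_map_first:
  fixes g h :: "nat \<Rightarrow> 'k"
  assumes "find P (product_lists (map (\<lambda>l. [g l, h l]) ls @ rest)) = Some ks"
    and "ks' \<in> set (product_lists (map (\<lambda>l. [g l, h l]) ls @ rest))" "P ks'"
    and "\<And>l. l \<in> set ls \<Longrightarrow> g l \<noteq> h l"
  shows "bin_val (map2 (\<lambda>l k. k = g l) ls ks') \<le> bin_val (map2 (\<lambda>l k. k = g l) ls ks)"
  using assms
proof (induction ls arbitrary: P ks ks')
  case (Cons l ls)
  let ?X = "product_lists (map (\<lambda>l. [g l, h l]) ls @ rest)"
  have find_append: "find Q (xs @ ys) = (case find Q xs of None \<Rightarrow> find Q ys | Some x \<Rightarrow> Some x)"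
    for Q and xs ys :: "'k list list"
    by (induction xs) auto
  have find_map: "find Q (map (Cons x) xs) = map_option (Cons x) (find (\<lambda>ys. Q (x # ys)) xs)"
    for Q x and xs :: "'k list list"
    by (induction xs) auto
  have X: "product_lists (map (\<lambda>l. [g l, h l]) (l # ls) @ rest) = map (Cons (g l)) ?X @ map (Cons (h l)) ?X"
    by simp
  have len: "length ks1 = length ls + length rest" if "ks1 \<in> set ?X" for ks1
    using in_set_product_lists_length[OF that] by simp
  obtain k' ks1' where ks': "ks' = k' # ks1'" "ks1' \<in> set ?X" "k' = g l \<or> k' = h l"
    using Cons.prems(2) unfolding X by auto
  have len': "length (map2 (\<lambda>l k. k = g l) ls ks1') = length ls" using len[OF ks'(2)] by simp
  show ?case
  proof (cases "find (\<lambda>ys. P (g l # ys)) ?X")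
    case None
    then have *: "\<not> P (g l # ys)" if "ys \<in> set ?X" for ys using that by (auto simp: find_None_iff)
    from None Cons.prems(1) obtain ks1 where ks: "ks = h l # ks1" "find (\<lambda>ys. P (h l # ys)) ?X = Some ks1"
      unfolding X by (auto simp: find_append find_map)
    have "k' = h l" using * ks' Cons.prems(3) by auto
    then have "bin_val (map2 (\<lambda>l k. k = g l) ls ks1') \<le> bin_val (map2 (\<lambda>l k. k = g l) ls ks1)"
      using Cons.IH[OF ks(2) ks'(2)] Cons.prems(3,4) ks'(1) by auto
    moreover have "g l \<noteq> h l" using Cons.prems(4) by simp
    ultimately show ?thesis using \<open>k' = h l\<close> by (simp add: ks ks' bin_val_Cons)
  next
    case (Some ks1)
    then have ks: "ks = g l # ks1" using Cons.prems(1) unfolding X by (auto simp: find_append find_map)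
    have "ks1 \<in> set ?X" using Some by (auto simp: find_Some_iff)
    then have len1: "length (map2 (\<lambda>l k. k = g l) ls ks1) = length ls" using len by simp
    show ?thesis
    proof (cases "k' = g l")
      case True
      then have "bin_val (map2 (\<lambda>l k. k = g l) ls ks1') \<le> bin_val (map2 (\<lambda>l k. k = g l) ls ks1)"
        using Cons.IH[OF Some ks'(2)] Cons.prems(3,4) ks'(1) by auto
      then show ?thesis using True len1 len' by (simp add: ks ks' bin_val_Cons)
    next
      case False
      then show ?thesis
        using bin_val_less[of "map2 (\<lambda>l k. k = g l) ls ks1'"] len1 len' by (simp add: ks ks' bin_val_Cons)
    qed
  qed
qed simp

definition objective_vars :: "bool \<Rightarrow> nat list \<Rightarrow> var_domains" where
  "objective_vars mx ls = map (\<lambda>l. ([0, l], if mx then [1, 0] else [0, 1])) ls"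

definition objective :: "nat list \<Rightarrow> (nat list \<Rightarrow> nat) \<Rightarrow> nat" where
  "objective ls f = bin_val (map (\<lambda>l. f [0, l] = 1) ls)"

lemma csp_optimum:
  assumes vs: "vs = objective_vars mx ls @ rest"
    and dist: "distinct (map fst vs)"
    and scope: "\<forall>c\<in>set cs. \<forall>cube\<in>set c. \<forall>va\<in>set cube. fst va \<in> fst ` set vs"
    and J: "\<forall>c\<in>set cs. \<forall>cube\<in>set c. length cube \<le> J"
    and ex: "in_domains f0 vs" "holds f0 cs"
    and N: "N = csp_length J (map var_keys vs) (constraint_keys cs)"
  shows "\<exists>f \<gamma>. in_domains f vs \<and> holds f cs \<and>
    js_match W (csp_regex J (map var_keys vs) (constraint_keys cs)) (replicate N c0) = Some (0, N, \<gamma>) \<and>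
    (\<forall>v\<in>fst ` set vs. \<forall>a. \<gamma> (gid (v @ [a])) = Undefd \<longleftrightarrow> f v \<noteq> a) \<and>
    (\<forall>g. \<gamma> g = Undefd \<or> (\<exists>a. \<gamma> g = Closed a (Suc a))) \<and>
    (\<forall>f'. in_domains f' vs \<longrightarrow> holds f' cs \<longrightarrow>
      (if mx then objective ls f' \<le> objective ls f else objective ls f \<le> objective ls f'))"
proof -
  let ?P = "keys_sat (constraint_keys cs)" and ?X = "product_lists (map var_keys vs)"
  have "selection f0 vs \<in> set ?X" "?P (selection f0 vs)"
    using ex product_lists_selection keys_sat_selection[OF scope] by auto
  then have "find ?P ?X \<noteq> None" by (auto simp: find_None_iff)
  then obtain ks where ks: "find ?P ?X = Some ks" by auto
  then have "ks \<in> set ?X" "?P ks" by (auto simp: find_Some_iff)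
  then obtain f where f: "ks = selection f vs" "in_domains f vs"
    using product_lists_selectionE dist by metis
  have hf: "holds f cs" using \<open>?P ks\<close> f keys_sat_selection[OF scope] by simp
  let ?\<gamma> = "capture (\<lambda>_. Undefd) 0 ks"
  have match: "js_match W (csp_regex J (map var_keys vs) (constraint_keys cs)) (replicate N c0) = Some (0, N, ?\<gamma>)"
    by (rule csp_match[OF N _ ks]) (use J in \<open>auto simp: constraint_keys_def\<close>)
  have \<gamma>1: "?\<gamma> (gid (v @ [a])) = Undefd \<longleftrightarrow> f v \<noteq> a" if "v \<in> fst ` set vs" for v a
    using that by (simp add: capture_undefined f(1) mem_selection)
  have "unit_captures (length ks) ?\<gamma>"
    by (rule unit_captures_capture) (auto simp: unit_captures_def)
  then have \<gamma>2: "?\<gamma> g = Undefd \<or> (\<exists>a. ?\<gamma> g = Closed a (Suc a))" for g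
    by (auto simp: unit_captures_def)
  \<comment> \<open>The value of an objective bit that is tried first, and the other one.\<close>
  define a b where "a = (if mx then 1 else 0 :: nat)" and "b = (if mx then 0 else 1 :: nat)"
  have keys: "map var_keys vs = map (\<lambda>l. [[0, l, a], [0, l, b]]) ls @ map var_keys rest"
    by (auto simp: vs objective_vars_def var_keys_def a_def b_def)
  have bits: "map2 (\<lambda>l k. k = [0, l, a]) ls (selection g vs) = map (\<lambda>l. g [0, l] = a) ls" for g
  proof -
    have "selection g vs = map (\<lambda>l. [0, l, g [0, l]]) ls @ selection g rest"
      by (auto simp: selection_def vs objective_vars_def)
    moreover have "map2 (\<lambda>l k. k = [0, l, a]) ls (map (\<lambda>l. [0, l, g [0, l]]) ls @ zs) =
        map (\<lambda>l. g [0, l] = a) ls" for zs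
      by (induction ls) auto
    ultimately show ?thesis by simp
  qed
  have opt: "if mx then objective ls f' \<le> objective ls f else objective ls f \<le> objective ls f'"
    if f': "in_domains f' vs" "holds f' cs" for f'
  proof -
    have "bin_val (map (\<lambda>l. f' [0, l] = a) ls) \<le> bin_val (map (\<lambda>l. f [0, l] = a) ls)"
      using bin_val_map_first[of ?P "\<lambda>l. [0, l, a]" "\<lambda>l. [0, l, b]" ls "map var_keys rest" ks "selection f' vs"]
        ks f' product_lists_selection[OF f'(1)] keys_sat_selection[OF scope, of f']
      unfolding keys[symmetric] f(1) bits by (auto simp: a_def b_def)
    \<comment> \<open>When minimising, the preferred bit is 0, so the comparison just obtained
      concerns the complemented words.\<close>
    moreover have flip: "map (\<lambda>l. g [0, l] = 0) ls = map Not (map (\<lambda>l. g [0, l] = 1) ls)"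
      if "in_domains g vs" for g
    proof -
      have "g [0, l] = 0 \<or> g [0, l] = 1" if "l \<in> set ls" for l
      proof -
        have "([0, l], if mx then [1, 0] else [0, 1]) \<in> set vs"
          using that by (auto simp: vs objective_vars_def)
        then have "g [0, l] \<in> set (if mx then [1, 0] else [0, 1])"
          using \<open>in_domains g vs\<close> unfolding in_domains_def by fastforce
        then show ?thesis by (auto split: if_splits)
      qed
      then show ?thesis by auto
    qed
    ultimately show ?thesis
      using flip[OF f'(1)] flip[OF f(2)] bin_val_not[of "map (\<lambda>l. f' [0, l] = 1) ls"]
        bin_val_not[of "map (\<lambda>l. f [0, l] = 1) ls"]
      by (auto simp: objective_def a_def simp del: map_map split: if_splits)
  qed
  show ?thesis
    using f(2) hf match \<gamma>1 \<gamma>2 opt by blast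
qed

section \<open>Computation tableaux as constraint satisfaction problems\<close>

text \<open>Variables: \<open>[0, l]\<close> is the bit of weight \<open>2 ^ l\<close> of the output, \<open>[1, t]\<close> the instruction
  executed at time \<open>t\<close>, \<open>[2, t]\<close> the state, \<open>[3, t, j]\<close> the position of head \<open>j\<close>,
  \<open>[4, t, j, i]\<close> the content of cell \<open>i\<close> of tape \<open>j\<close>, and \<open>[5]\<close> the length of the output.
  Positions are shifted by \<open>R\<close>.\<close>

definition tab_vars :: "bool \<Rightarrow> nat \<Rightarrow> instruction list \<Rightarrow> nat list \<Rightarrow> nat list \<Rightarrow> nat \<Rightarrow> nat \<Rightarrow> var_domains" where
  "tab_vars mx k IL SL SY T R =
     objective_vars mx (rev [0..<Suc R]) @
     (map (\<lambda>t. ([1, t], [0..<length IL])) [0..<T] @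
      map (\<lambda>t. ([2, t], SL)) [0..<Suc T] @
      concat (map (\<lambda>t. map (\<lambda>j. ([3, t, j], [0..<Suc (2 * R)])) [0..<k]) [0..<Suc T]) @
      concat (map (\<lambda>t. concat (map (\<lambda>j. map (\<lambda>i. ([4, t, j, i], SY)) [0..<Suc (2 * R)]) [0..<k])) [0..<Suc T]) @
      [([5], [0..<Suc R])])"

definition init_symbol :: "nat \<Rightarrow> word \<Rightarrow> nat \<Rightarrow> nat \<Rightarrow> nat" where
  "init_symbol R x j i = (if j = 0 \<and> R \<le> i then (case drop (i - R) x of [] \<Rightarrow> 0 | b # _ \<Rightarrow> if b then 2 else 1) else 0)"

definition cs_init :: "nat \<Rightarrow> nat \<Rightarrow> nat \<Rightarrow> word \<Rightarrow> constraints" where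
  "cs_init k q0 R x = [[[([2, 0], q0)]]] @
     map (\<lambda>j. [[([3, 0, j], R)]]) [0..<k] @
     concat (map (\<lambda>j. map (\<lambda>i. [[([4, 0, j, i], init_symbol R x j i)]]) [0..<Suc (2 * R)]) [0..<k])"

definition cs_state :: "instruction list \<Rightarrow> nat \<Rightarrow> constraints" where
  "cs_state IL T = map (\<lambda>t. map (\<lambda>m. [([1, t], m), ([2, t], fst (IL ! m)), ([2, Suc t], fst (snd (snd (IL ! m))))])
     [0..<length IL]) [0..<T]"

fun shift :: "nat \<Rightarrow> move \<Rightarrow> nat" where
  "shift i Move_Left = i - 1"
| "shift i Stay = i"
| "shift i Move_Right = Suc i"

text \<open>Links the instruction, the head position, the symbol read, the symbol written and the
  next head position: five equations, the widest cube of the tableau.\<close>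

definition head_cube :: "instruction list \<Rightarrow> nat \<Rightarrow> nat \<Rightarrow> nat \<Rightarrow> nat \<Rightarrow> (nat list \<times> nat) list" where
  "head_cube IL t j i m = (case IL ! m of (q, as, q', bs, ms) \<Rightarrow>
     [([1, t], m), ([3, t, j], i), ([4, t, j, i], as ! j), ([4, Suc t, j, i], bs ! j), ([3, Suc t, j], shift i (ms ! j))])"

text \<open>Head positions are restricted to the interior of the window, so that the neighbour
  reached by a move exists and \<open>shift\<close> does not truncate.\<close>

definition cs_head :: "nat \<Rightarrow> instruction list \<Rightarrow> nat \<Rightarrow> nat \<Rightarrow> constraints" where
  "cs_head k IL T R = concat (map (\<lambda>t. map (\<lambda>j. concat (map (\<lambda>i.
     map (\<lambda>m. head_cube IL t j i m) [0..<length IL]) [1..<2 * R])) [0..<k]) [0..<T])"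

text \<open>Cubes can only equate variables with constants. That the head is elsewhere is therefore
  expressed by naming its position \<open>h\<close>, and that a cell keeps its symbol by naming the
  symbol \<open>s\<close>.\<close>

definition cs_inertia :: "nat \<Rightarrow> nat list \<Rightarrow> nat \<Rightarrow> nat \<Rightarrow> constraints" where
  "cs_inertia k SY T R = concat (map (\<lambda>t. concat (map (\<lambda>j. map (\<lambda>i.
     [([3, t, j], i)] # concat (map (\<lambda>h. if h = i then [] else
       map (\<lambda>s. [([3, t, j], h), ([4, t, j, i], s), ([4, Suc t, j, i], s)]) SY) [0..<Suc (2 * R)]))
     [0..<Suc (2 * R)]) [0..<k])) [0..<T])"

text \<open>In an output of \<open>l\<close> symbols the \<open>m\<close>-th one has weight
  \<open>l - 1 - m\<close>, the cell behind the last one is blank, and all bits of weight at least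
  \<open>l\<close> vanish. The index \<open>m\<close> thus serves both as a position and, from
  \<open>l\<close> on, as a weight.\<close>

definition cs_output :: "nat \<Rightarrow> nat \<Rightarrow> nat \<Rightarrow> nat \<Rightarrow> constraints" where
  "cs_output k qa T R = [[[([2, T], qa)]]] @
     map (\<lambda>m. concat (map (\<lambda>l.
       if m < l then
         [[([5], l), ([4, T, k - 1, R + m], 1), ([0, l - 1 - m], 0)],
          [([5], l), ([4, T, k - 1, R + m], 2), ([0, l - 1 - m], 1)]]
       else if m = l then [[([5], l), ([4, T, k - 1, R + m], 0), ([0, m], 0)]]
       else [[([5], l), ([0, m], 0)]]) [0..<Suc R])) [0..<Suc R]"

definition tab_cs :: "nat \<Rightarrow> nat \<Rightarrow> nat \<Rightarrow> instruction list \<Rightarrow> nat list \<Rightarrow> nat \<Rightarrow> nat \<Rightarrow> word \<Rightarrow> constraints" where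
  "tab_cs k q0 qa IL SY T R x =
     cs_init k q0 R x @ cs_state IL T @ cs_head k IL T R @ cs_inertia k SY T R @ cs_output k qa T R"

section \<open>Meaning of the constraints\<close>

definition cube_holds :: "(nat list \<Rightarrow> nat) \<Rightarrow> (nat list \<times> nat) list \<Rightarrow> bool" where
  "cube_holds f cube \<longleftrightarrow> (\<forall>va\<in>set cube. f (fst va) = snd va)"

definition some_cube :: "(nat list \<Rightarrow> nat) \<Rightarrow> (nat list \<times> nat) list list \<Rightarrow> bool" where
  "some_cube f c \<longleftrightarrow> (\<exists>cube\<in>set c. cube_holds f cube)"

lemma cube_holds_simps:
  "cube_holds f []" "cube_holds f ((v, a) # cube) \<longleftrightarrow> f v = a \<and> cube_holds f cube"
  by (auto simp: cube_holds_def)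

lemma some_cube_simps:
  "\<not> some_cube f []" "some_cube f (cube # c) \<longleftrightarrow> cube_holds f cube \<or> some_cube f c"
  "some_cube f (concat (map h xs)) \<longleftrightarrow> (\<exists>x\<in>set xs. some_cube f (h x))"
  "some_cube f (map g xs) \<longleftrightarrow> (\<exists>x\<in>set xs. cube_holds f (g x))"
  by (auto simp: some_cube_def)

lemma holds_simps:
  "holds f []" "holds f (c # cs) \<longleftrightarrow> some_cube f c \<and> holds f cs"
  "holds f (cs @ ds) \<longleftrightarrow> holds f cs \<and> holds f ds"
  "holds f (concat (map h ys)) \<longleftrightarrow> (\<forall>y\<in>set ys. holds f (h y))"
  "holds f (map g xs) \<longleftrightarrow> (\<forall>x\<in>set xs. some_cube f (g x))"
  by (auto simp: holds_def some_cube_def cube_holds_def)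

lemmas holds_rules = cube_holds_simps some_cube_simps holds_simps

lemma in_domains_simps:
  "in_domains f []" "in_domains f ((v, D) # vs) \<longleftrightarrow> f v \<in> set D \<and> in_domains f vs"
  "in_domains f (vs @ ws) \<longleftrightarrow> in_domains f vs \<and> in_domains f ws"
  "in_domains f (concat (map h ys)) \<longleftrightarrow> (\<forall>y\<in>set ys. in_domains f (h y))"
  "in_domains f (map g xs) \<longleftrightarrow> (\<forall>x\<in>set xs. f (fst (g x)) \<in> set (snd (g x)))"
  by (auto simp: in_domains_def)

definition c_all :: "((nat list \<times> nat) list \<Rightarrow> bool) \<Rightarrow> (nat list \<times> nat) list list \<Rightarrow> bool" where
  "c_all P c \<longleftrightarrow> (\<forall>cube\<in>set c. P cube)"

definition cs_all :: "((nat list \<times> nat) list \<Rightarrow> bool) \<Rightarrow> constraints \<Rightarrow> bool" where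
  "cs_all P cs \<longleftrightarrow> (\<forall>c\<in>set cs. c_all P c)"

lemma cs_all_simps:
  "c_all P []" "c_all P (cube # c) \<longleftrightarrow> P cube \<and> c_all P c"
  "c_all P (concat (map h xs)) \<longleftrightarrow> (\<forall>x\<in>set xs. c_all P (h x))"
  "c_all P (map h' xs) \<longleftrightarrow> (\<forall>x\<in>set xs. P (h' x))"
  "cs_all P []" "cs_all P (c # cs) \<longleftrightarrow> c_all P c \<and> cs_all P cs"
  "cs_all P (cs @ ds) \<longleftrightarrow> cs_all P cs \<and> cs_all P ds"
  "cs_all P (concat (map g ys)) \<longleftrightarrow> (\<forall>y\<in>set ys. cs_all P (g y))"
  "cs_all P (map g' ys) \<longleftrightarrow> (\<forall>y\<in>set ys. c_all P (g' y))"
  by (auto simp: cs_all_def c_all_def)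

lemma tab_vars_names:
  fixes mx k IL SL SY T R
  defines "V \<equiv> fst ` set (tab_vars mx k IL SL SY T R)"
  shows "l \<le> R \<Longrightarrow> [0, l] \<in> V" "t < T \<Longrightarrow> [Suc 0, t] \<in> V" "t \<le> T \<Longrightarrow> [2, t] \<in> V"
    "t \<le> T \<Longrightarrow> j < k \<Longrightarrow> [3, t, j] \<in> V" "t \<le> T \<Longrightarrow> j < k \<Longrightarrow> i \<le> 2 * R \<Longrightarrow> [4, t, j, i] \<in> V" "[5] \<in> V"
proof -
  have V: "V = set (map (\<lambda>l. [0, l]) (rev [0..<Suc R])) \<union> (set (map (\<lambda>t. [1, t]) [0..<T]) \<union>
     (set (map (\<lambda>t. [2, t]) [0..<Suc T]) \<union>
     ((\<Union>t\<in>{0..<Suc T}. \<Union>j\<in>{0..<k}. {[3, t, j]}) \<union>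
     ((\<Union>t\<in>{0..<Suc T}. \<Union>j\<in>{0..<k}. \<Union>i\<in>{0..<Suc (2 * R)}. {[4, t, j, i]}) \<union> {[5]}))))"
    unfolding V_def tab_vars_def objective_vars_def set_append image_Un set_concat set_map image_UN
      image_image fst_conv set_upt set_rev
    by (simp add: UNION_singleton_eq_range)
  show "l \<le> R \<Longrightarrow> [0, l] \<in> V" "t < T \<Longrightarrow> [Suc 0, t] \<in> V" "t \<le> T \<Longrightarrow> [2, t] \<in> V"
    "t \<le> T \<Longrightarrow> j < k \<Longrightarrow> [3, t, j] \<in> V" "t \<le> T \<Longrightarrow> j < k \<Longrightarrow> i \<le> 2 * R \<Longrightarrow> [4, t, j, i] \<in> V" "[5] \<in> V"
    unfolding V by (auto simp: less_Suc_eq_le simp del: upt_Suc)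
qed

lemma tab_vars_distinct: "distinct (map fst (tab_vars mx k IL SL SY T R))"
proof -
  have 3: "distinct (concat (map (\<lambda>t. map (\<lambda>j. [3, t, j]) [0..<k]) [0..<n]))" for n :: nat
    by (induction n) (auto simp: distinct_map inj_on_def)
  have 4: "distinct (concat (map (\<lambda>j. map (\<lambda>i. [4, t, j, i]) [0..<n]) [0..<k]))" for n t :: nat
    by (induction k) (auto simp: distinct_map inj_on_def)
  have 5: "distinct (concat (map (\<lambda>t. concat (map (\<lambda>j. map (\<lambda>i. [4, t, j, i]) [0..<n]) [0..<k])) [0..<m]))" for n m :: nat
    by (induction m) (auto simp: 4)
  show ?thesis
    unfolding tab_vars_def objective_vars_def
    using 3[of "Suc T"] 5[of "Suc (2 * R)" "Suc T"]
    by (auto simp: map_concat comp_def distinct_map inj_on_def simp del: upt_Suc)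
qed

lemma in_domains_tab_vars:
  "in_domains f (tab_vars mx k IL SL SY T R) \<longleftrightarrow>
     (\<forall>l\<le>R. f [0, l] \<in> {0, 1}) \<and> (\<forall>t<T. f [1, t] < length IL) \<and> (\<forall>t\<le>T. f [2, t] \<in> set SL) \<and>
     (\<forall>t\<le>T. \<forall>j<k. f [3, t, j] \<le> 2 * R) \<and> (\<forall>t\<le>T. \<forall>j<k. \<forall>i\<le>2 * R. f [4, t, j, i] \<in> set SY) \<and> f [5] \<le> R"
proof -
  have "set (if mx then [1, 0] else [0, 1]) = {0, 1 :: nat}" by auto
  then show ?thesis
    unfolding tab_vars_def objective_vars_def
    by (simp add: in_domains_simps less_Suc_eq_le Ball_def del: upt_Suc)
qed

lemma tab_cs_scope:
  assumes "k > 0"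
  shows "\<forall>c\<in>set (tab_cs k q0 qa IL SY T R x). \<forall>cube\<in>set c. \<forall>va\<in>set cube.
    fst va \<in> fst ` set (tab_vars mx k IL SL SY T R)"
proof -
  let ?V = "fst ` set (tab_vars mx k IL SL SY T R)"
  let ?P = "\<lambda>cube. \<forall>va\<in>set cube. fst va \<in> ?V"
  have H: "?P (head_cube IL t j i m)" if "t < T" "j < k" "i < 2 * R" for t j i m
    using that by (cases "IL ! m") (simp add: head_cube_def tab_vars_names)
  have "cs_all ?P (tab_cs k q0 qa IL SY T R x)"
    unfolding tab_cs_def cs_init_def cs_state_def cs_head_def cs_inertia_def cs_output_def using assms
    by (simp add: cs_all_simps tab_vars_names less_Suc_eq_le del: upt_Suc) (use H in fastforce)
  then show ?thesis unfolding cs_all_def c_all_def .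
qed

lemma tab_cs_width:
  "\<forall>c\<in>set (tab_cs k q0 qa IL SY T R x). \<forall>cube\<in>set c. length cube \<le> 5"
proof -
  have "length (head_cube IL t j i m) \<le> 5" for t j i m
    by (simp add: head_cube_def split: prod.splits)
  then have "cs_all (\<lambda>cube. length cube \<le> 5) (tab_cs k q0 qa IL SY T R x)"
    unfolding tab_cs_def cs_init_def cs_state_def cs_head_def cs_inertia_def cs_output_def
    by (simp add: cs_all_simps del: upt_Suc)
  then show ?thesis unfolding cs_all_def c_all_def .
qed

lemma holds_cs_init: "holds f (cs_init k q0 R x) \<longleftrightarrow> f [2, 0] = q0 \<and> (\<forall>j<k. f [3, 0, j] = R) \<and>
    (\<forall>j<k. \<forall>i\<le>2 * R. f [4, 0, j, i] = init_symbol R x j i)"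
  unfolding cs_init_def by (simp add: holds_rules less_Suc_eq_le Ball_def del: upt_Suc)

lemma holds_cs_state: "holds f (cs_state IL T) \<longleftrightarrow> (\<forall>t<T. f [1, t] < length IL \<and>
    f [2, t] = fst (IL ! f [1, t]) \<and> f [2, Suc t] = fst (snd (snd (IL ! f [1, t]))))"
  unfolding cs_state_def by (auto simp: holds_rules Ball_def Bex_def)

lemma holds_cs_head: "holds f (cs_head k IL T R) \<longleftrightarrow> (\<forall>t<T. \<forall>j<k. \<exists>q as q' bs ms. f [1, t] < length IL \<and>
    IL ! f [1, t] = (q, as, q', bs, ms) \<and> 1 \<le> f [3, t, j] \<and> f [3, t, j] < 2 * R \<and>
    f [4, t, j, f [3, t, j]] = as ! j \<and> f [4, Suc t, j, f [3, t, j]] = bs ! j \<and>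
    f [3, Suc t, j] = shift (f [3, t, j]) (ms ! j))"
proof -
  have "(\<exists>i\<in>{1..<2 * R}. \<exists>m\<in>{0..<length IL}. cube_holds f (head_cube IL t j i m)) \<longleftrightarrow>
    (\<exists>q as q' bs ms. f [1, t] < length IL \<and>
    IL ! f [1, t] = (q, as, q', bs, ms) \<and> 1 \<le> f [3, t, j] \<and> f [3, t, j] < 2 * R \<and>
    f [4, t, j, f [3, t, j]] = as ! j \<and> f [4, Suc t, j, f [3, t, j]] = bs ! j \<and>
    f [3, Suc t, j] = shift (f [3, t, j]) (ms ! j))" (is "?L \<longleftrightarrow> ?R") for t j
  proof
    assume ?L
    then obtain i m where "1 \<le> i" "i < 2 * R" "m < length IL" "cube_holds f (head_cube IL t j i m)"
      by auto
    then show ?R by (cases "IL ! m") (auto simp: head_cube_def holds_rules)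
  next
    assume ?R
    then have "cube_holds f (head_cube IL t j (f [3, t, j]) (f [1, t]))"
      "f [3, t, j] \<in> {1..<2 * R}" "f [1, t] \<in> {0..<length IL}" by (auto simp: head_cube_def holds_rules)
    then show ?L by blast
  qed
  then show ?thesis unfolding cs_head_def by (simp add: holds_simps some_cube_simps Ball_def del: One_nat_def)
qed

lemma holds_cs_inertia: "holds f (cs_inertia k SY T R) \<longleftrightarrow> (\<forall>t<T. \<forall>j<k. \<forall>i\<le>2 * R. f [3, t, j] = i \<or>
    f [3, t, j] \<le> 2 * R \<and> f [4, t, j, i] \<in> set SY \<and> f [4, Suc t, j, i] = f [4, t, j, i])"
proof -
  have "some_cube f (if h = i then [] else map (\<lambda>s. [([3, t, j], h), ([4, t, j, i], s), ([4, Suc t, j, i], s)]) SY)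
    \<longleftrightarrow> h \<noteq> i \<and> f [3, t, j] = h \<and> f [4, t, j, i] \<in> set SY \<and> f [4, Suc t, j, i] = f [4, t, j, i]" for t j i h
    by (auto simp: holds_rules)
  then have "some_cube f ([([3, t, j], i)] # concat (map (\<lambda>h. if h = i then [] else
       map (\<lambda>s. [([3, t, j], h), ([4, t, j, i], s), ([4, Suc t, j, i], s)]) SY) [0..<Suc (2 * R)])) \<longleftrightarrow>
     f [3, t, j] = i \<or> f [3, t, j] \<le> 2 * R \<and> f [4, t, j, i] \<in> set SY \<and> f [4, Suc t, j, i] = f [4, t, j, i]" for t j i
    unfolding some_cube_simps cube_holds_simps
    by (auto simp: less_Suc_eq_le cube_holds_simps simp del: upt_Suc)
  then show ?thesis
    unfolding cs_inertia_def holds_simps by (simp add: less_Suc_eq_le Ball_def del: upt_Suc)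
qed

lemma holds_cs_output: "holds f (cs_output k qa T R) \<longleftrightarrow> f [2, T] = qa \<and> (\<forall>m\<le>R. f [5] \<le> R \<and>
    (if m < f [5] then f [4, T, k - 1, R + m] = 1 \<and> f [0, f [5] - 1 - m] = 0 \<or>
         f [4, T, k - 1, R + m] = 2 \<and> f [0, f [5] - 1 - m] = 1
     else if m = f [5] then f [4, T, k - 1, R + m] = 0 \<and> f [0, m] = 0 else f [0, m] = 0))"
proof -
  let ?cubes = "\<lambda>m l. if m < l then
         [[([5], l), ([4, T, k - 1, R + m], 1), ([0, l - 1 - m], 0)],
          [([5], l), ([4, T, k - 1, R + m], 2), ([0, l - 1 - m], 1)]]
       else if m = l then [[([5], l), ([4, T, k - 1, R + m], 0), ([0, m], 0)]]
       else [[([5], l), ([0, m], 0)]]"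
  have "some_cube f (?cubes m l) \<longleftrightarrow> f [5] = l \<and>
    (if m < l then f [4, T, k - 1, R + m] = 1 \<and> f [0, l - 1 - m] = 0 \<or>
         f [4, T, k - 1, R + m] = 2 \<and> f [0, l - 1 - m] = 1
     else if m = l then f [4, T, k - 1, R + m] = 0 \<and> f [0, m] = 0 else f [0, m] = 0)" for m l
    by (auto simp: holds_rules)
  then have "some_cube f (concat (map (?cubes m) [0..<Suc R])) \<longleftrightarrow> f [5] \<le> R \<and>
    (if m < f [5] then f [4, T, k - 1, R + m] = 1 \<and> f [0, f [5] - 1 - m] = 0 \<or>
         f [4, T, k - 1, R + m] = 2 \<and> f [0, f [5] - 1 - m] = 1
     else if m = f [5] then f [4, T, k - 1, R + m] = 0 \<and> f [0, m] = 0 else f [0, m] = 0)" for m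
    unfolding some_cube_simps by (auto simp: less_Suc_eq_le Bex_def simp del: upt_Suc One_nat_def)
  then show ?thesis
    unfolding cs_output_def holds_simps some_cube_simps cube_holds_simps
    by (simp add: less_Suc_eq_le Ball_def holds_rules del: upt_Suc)
qed


subsection \<open>Correctness of the tableau\<close>

lemma read_tape_fst_snd: "read_tape tp = fst tp (snd tp)"
  by (cases tp) simp

lemma update_tape_fst_snd:
  "fst (update_tape (tp, b, m)) = (fst tp)(snd tp := b)"
  "snd (update_tape (tp, b, m)) = snd tp + move_offset m"
  by (cases tp; simp)+

lemma snd_input_tape: "snd (input_tape w) = 0"
  by (simp add: input_tape_def)

lemma init_symbol: "init_symbol R x j i = fst (input_tape (if j = 0 then x else [])) (int i - int R)"
proof (cases "j = 0 \<and> R \<le> i \<and> i - R < length x")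
  case True
  then have "drop (i - R) x = x ! (i - R) # drop (Suc (i - R)) x" by (simp add: Cons_nth_drop_Suc)
  moreover have "nat (int i - int R) = i - R" by simp
  ultimately show ?thesis using True by (auto simp: init_symbol_def input_tape_def bit_symbol_def)
next
  case False
  then show ?thesis by (auto simp: init_symbol_def input_tape_def blank_def split: list.split)
qed

text \<open>With more than T + |x| cells on either side of the origin, no head leaves the window in
  T steps and the output fits into it.\<close>

locale tableau =
  fixes k q0 qa :: nat and IL :: "instruction list" and x :: word and T R :: nat and SL SY :: "nat list"
  assumes k: "k > 0"
    and IL: "\<And>q as q' bs ms. (q, as, q', bs, ms) \<in> set IL \<Longrightarrow> length as = k \<and> length bs = k \<and> length ms = k"
    and R: "T + length x < R"
begin

abbreviation "M \<equiv> NTM k q0 qa (set IL)"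

definition matches :: "(nat list \<Rightarrow> nat) \<Rightarrow> nat \<Rightarrow> config \<Rightarrow> bool" where
  "matches f t c \<longleftrightarrow> fst c = f [2, t] \<and> length (snd c) = k \<and>
     (\<forall>j<k. snd (snd c ! j) = int (f [3, t, j]) - int R \<and>
       (\<forall>i\<le>2 * R. fst (snd c ! j) (int i - int R) = f [4, t, j, i]))"

lemma initial_tapes:
  "fst (initial_config M [x]) = q0" "length (snd (initial_config M [x])) = k"
  "j < k \<Longrightarrow> snd (initial_config M [x]) ! j = input_tape (if j = 0 then x else [])"
  by (auto simp: initial_config_def)

lemma matches_initial: "holds f (cs_init k q0 R x) \<Longrightarrow> matches f 0 (initial_config M [x])"
  unfolding matches_def holds_cs_init using initial_tapes
  by (auto simp: init_symbol snd_input_tape)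

lemma matches_step:
  assumes m: "matches f t c" and t: "t < T"
    and state: "holds f (cs_state IL T)" and head: "holds f (cs_head k IL T R)"
    and inertia: "holds f (cs_inertia k SY T R)"
  shows "\<exists>c'. tm_step M c c' \<and> matches f (Suc t) c'"
proof -
  obtain q as q' bs ms where ins: "IL ! f [1, t] = (q, as, q', bs, ms)" by (metis prod.collapse)
  have st: "f [1, t] < length IL" "f [2, t] = q" "f [2, Suc t] = q'"
    using state t ins by (auto simp: holds_cs_state)
  have mem: "(q, as, q', bs, ms) \<in> set IL" using nth_mem[OF st(1)] ins by simp
  note len = IL[OF mem]
  have hd: "1 \<le> f [3, t, j]" "f [3, t, j] < 2 * R" "f [4, t, j, f [3, t, j]] = as ! j"
    "f [4, Suc t, j, f [3, t, j]] = bs ! j" "f [3, Suc t, j] = shift (f [3, t, j]) (ms ! j)" if "j < k" for j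
    using head t that ins unfolding holds_cs_head by fastforce+
  define c' where "c' = (q', map update_tape (zip (snd c) (zip bs ms)))"
  have lenc: "length (snd c) = k" using m by (simp add: matches_def)
  have reads: "map read_tape (snd c) = as"
  proof (rule nth_equalityI)
    fix j assume "j < length (map read_tape (snd c))"
    then have j: "j < k" using lenc by simp
    then have "read_tape (snd c ! j) = f [4, t, j, f [3, t, j]]"
      using m hd(2)[OF j] unfolding matches_def read_tape_fst_snd by auto
    then show "map read_tape (snd c) ! j = as ! j" using hd(3)[OF j] j lenc by simp
  qed (use lenc len in simp)
  have "tm_step M c c'"
    unfolding tm_step_def using mem m st reads by (auto simp: c'_def matches_def)
  moreover have "matches f (Suc t) c'"
    unfolding matches_def
  proof (intro conjI allI impI)
    fix j assume j: "j < k"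
    have tape: "snd c' ! j = update_tape (snd c ! j, bs ! j, ms ! j)"
      using j lenc len by (simp add: c'_def)
    have pos: "snd (snd c ! j) = int (f [3, t, j]) - int R"
      using m j by (simp add: matches_def)
    show "snd (snd c' ! j) = int (f [3, Suc t, j]) - int R"
      using hd(1,5)[OF j] unfolding tape update_tape_fst_snd pos by (cases "ms ! j") auto
    fix i assume i: "i \<le> 2 * R"
    show "fst (snd c' ! j) (int i - int R) = f [4, Suc t, j, i]"
    proof (cases "i = f [3, t, j]")
      case True
      then show ?thesis using hd(4)[OF j] unfolding tape update_tape_fst_snd pos by simp
    next
      case False
      then have "f [4, Suc t, j, i] = f [4, t, j, i]"
        using inertia t j i unfolding holds_cs_inertia by auto
      then show ?thesis
        using False m j i unfolding tape update_tape_fst_snd pos by (simp add: matches_def)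
    qed
  qed (use st lenc len in \<open>auto simp: c'_def\<close>)
  ultimately show ?thesis by blast
qed

lemma tableau_sound:
  assumes "holds f (tab_cs k q0 qa IL SY T R x)"
  shows "\<exists>c w. (tm_step M ^^ T) (initial_config M [x]) c \<and> fst c = qa \<and> has_output c w \<and>
    objective (rev [0..<Suc R]) f = bin_val w"
proof -
  have parts: "holds f (cs_init k q0 R x)" "holds f (cs_state IL T)" "holds f (cs_head k IL T R)"
    "holds f (cs_inertia k SY T R)" "holds f (cs_output k qa T R)"
    using assms by (auto simp: tab_cs_def holds_simps)
  have "\<exists>c. (tm_step M ^^ t) (initial_config M [x]) c \<and> matches f t c" if "t \<le> T" for t
    using that
  proof (induction t)
    case 0
    then show ?case using matches_initial[OF parts(1)] by auto
  next
    case (Suc t)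
    then obtain c where c: "(tm_step M ^^ t) (initial_config M [x]) c" "matches f t c" by auto
    obtain c' where "tm_step M c c'" "matches f (Suc t) c'"
      using matches_step[OF c(2) _ parts(2-4)] Suc.prems by auto
    then show ?case using c(1) by (intro exI[of _ c']) auto
  qed
  then obtain c where c: "(tm_step M ^^ T) (initial_config M [x]) c" "matches f T c" by blast
  let ?l = "f [5]"
  have qa: "f [2, T] = qa" and o: "?l \<le> R"
    "\<And>m. m \<le> R \<Longrightarrow> (if m < ?l then f [4, T, k - 1, R + m] = 1 \<and> f [0, ?l - 1 - m] = 0 \<or>
         f [4, T, k - 1, R + m] = 2 \<and> f [0, ?l - 1 - m] = 1
     else if m = ?l then f [4, T, k - 1, R + m] = 0 \<and> f [0, m] = 0 else f [0, m] = 0)"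
    using parts(5) unfolding holds_cs_output by blast+
  have out: "f [2, T] = qa" "?l \<le> R" "f [4, T, k - 1, R + ?l] = 0"
    using qa o(1) o(2)[of ?l] by simp_all
  have out3: "f [4, T, k - 1, R + m] = 1 \<and> f [0, ?l - 1 - m] = 0 \<or>
         f [4, T, k - 1, R + m] = 2 \<and> f [0, ?l - 1 - m] = 1" if "m < ?l" for m
    using o(1) o(2)[of m] that by simp
  have out5: "f [0, m] = 0" if "?l \<le> m" "m \<le> R" for m
    using o(2)[of m] that by (cases "m = ?l") simp_all
  define w where "w = map (\<lambda>m. f [4, T, k - 1, R + m] = 2) [0..<?l]"
  have lenc: "length (snd c) = k" using c(2) by (simp add: matches_def)
  then have last: "last (snd c) = snd c ! (k - 1)" using k by (subst last_conv_nth) auto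
  have cell: "fst (last (snd c)) (int m) = f [4, T, k - 1, R + m]" if "m \<le> R" for m
  proof -
    have "\<forall>j<k. \<forall>i\<le>2 * R. fst (snd c ! j) (int i - int R) = f [4, T, j, i]"
      using c(2) by (simp add: matches_def)
    from this[rule_format, of "k - 1" "R + m"] show ?thesis using k that unfolding last by simp
  qed
  have "has_output c w"
    unfolding has_output_def
  proof (intro conjI allI impI)
    fix i assume "i < length w"
    then have i: "i < ?l" by (simp add: w_def)
    show "fst (last (snd c)) (int i) = bit_symbol (w ! i)"
      using cell[of i] out3[OF i] out(2) i by (auto simp: w_def bit_symbol_def)
  next
    show "fst (last (snd c)) (int (length w)) = blank"
      using cell[of ?l] out(2) out(3) by (simp add: w_def blank_def)
  qed
  \<comment> \<open>There are R + 1 objective bits, most significant first; those above the output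
    are zeros.\<close>
  moreover have "map (\<lambda>l. f [0, l] = 1) (rev [0..<Suc R]) = replicate (Suc R - ?l) False @ w"
  proof (rule nth_equalityI)
    show "length (map (\<lambda>l. f [0, l] = 1) (rev [0..<Suc R])) = length (replicate (Suc R - ?l) False @ w)"
      using out(2) by (simp add: w_def del: upt_Suc)
    fix i assume "i < length (map (\<lambda>l. f [0, l] = 1) (rev [0..<Suc R]))"
    then have i: "i \<le> R" by (simp del: upt_Suc)
    have lhs: "map (\<lambda>l. f [0, l] = 1) (rev [0..<Suc R]) ! i = (f [0, R - i] = 1)"
      using i by (simp add: rev_nth del: upt_Suc)
    show "map (\<lambda>l. f [0, l] = 1) (rev [0..<Suc R]) ! i = (replicate (Suc R - ?l) False @ w) ! i"
    proof (cases "i < Suc R - ?l")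
      case True
      then show ?thesis unfolding lhs using out5[of "R - i"] by (simp add: nth_append)
    next
      case False
      define m where "m = i - (Suc R - ?l)"
      have m: "m < ?l" "R - i = ?l - 1 - m" using False i out(2) by (auto simp: m_def)
      then show ?thesis unfolding lhs using out3[OF m(1)] False
        by (auto simp: nth_append w_def m_def[symmetric])
    qed
  qed
  then have "objective (rev [0..<Suc R]) f = bin_val w"
    unfolding objective_def by (simp only: bin_val_leading_False)
  moreover have "fst c = qa" using c(2) out(1) by (simp add: matches_def)
  ultimately show ?thesis using c(1) by blast
qed

text \<open>Besides keeping states and symbols within the finite lists, this bounds the written part
  of the tapes, so that the output is delimited by a blank inside the window.\<close>

definition bounded_config :: "nat \<Rightarrow> config \<Rightarrow> bool" where
  "bounded_config t c \<longleftrightarrow> fst c \<in> set SL \<and> length (snd c) = k \<and>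
     (\<forall>j<k. \<bar>snd (snd c ! j)\<bar> \<le> int t \<and> (\<forall>p. fst (snd c ! j) p \<in> set SY \<and>
        (p < - int t \<or> p \<ge> int (length x) + int t \<longrightarrow> fst (snd c ! j) p = 0)))"

lemma bounded_config_step:
  assumes b: "bounded_config t c" and step: "tm_step M c c'"
    and SL: "\<And>q as q' bs ms. (q, as, q', bs, ms) \<in> set IL \<Longrightarrow> q' \<in> set SL \<and> set bs \<subseteq> set SY"
  shows "bounded_config (Suc t) c'"
proof -
  obtain bs ms where ins: "(fst c, map read_tape (snd c), fst c', bs, ms) \<in> set IL"
    and c': "snd c' = map update_tape (zip (snd c) (zip bs ms))"
    using step by (auto simp: tm_step_def)
  note len = IL[OF ins] and S = SL[OF ins]
  have lenc: "length (snd c) = k" using b by (simp add: bounded_config_def)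
  show ?thesis
    unfolding bounded_config_def
  proof (intro conjI allI impI)
    fix j assume j: "j < k"
    have tape: "snd c' ! j = update_tape (snd c ! j, bs ! j, ms ! j)"
      using j lenc len by (simp add: c')
    have old: "\<bar>snd (snd c ! j)\<bar> \<le> int t" "\<And>p. fst (snd c ! j) p \<in> set SY"
      "\<And>p. p < - int t \<or> p \<ge> int (length x) + int t \<Longrightarrow> fst (snd c ! j) p = 0"
      using b j by (auto simp: bounded_config_def)
    show "\<bar>snd (snd c' ! j)\<bar> \<le> int (Suc t)"
      using old(1) unfolding tape update_tape_fst_snd by (cases "ms ! j") auto
    fix p
    have bsj: "bs ! j \<in> set SY" using S len j nth_mem[of j bs] by auto
    show "fst (snd c' ! j) p \<in> set SY"
      using old(2) bsj unfolding tape update_tape_fst_snd by auto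
    show "fst (snd c' ! j) p = 0" if "p < - int (Suc t) \<or> p \<ge> int (length x) + int (Suc t)"
      using old(1,3) that unfolding tape update_tape_fst_snd by auto
  qed (use S lenc len in \<open>auto simp: c'\<close>)
qed

lemma tableau_complete:
  assumes run: "(tm_step M ^^ T) (initial_config M [x]) c" "fst c = qa" "has_output c w"
    and SL: "q0 \<in> set SL" "{0, 1, 2} \<subseteq> set SY"
      "\<And>q as q' bs ms. (q, as, q', bs, ms) \<in> set IL \<Longrightarrow> q' \<in> set SL \<and> set bs \<subseteq> set SY"
  shows "\<exists>f. in_domains f (tab_vars mx k IL SL SY T R) \<and> holds f (tab_cs k q0 qa IL SY T R x) \<and>
    objective (rev [0..<Suc R]) f = bin_val w"
proof -
  obtain C where C: "C 0 = initial_config M [x]" "C T = c" "\<And>t. t < T \<Longrightarrow> tm_step M (C t) (C (Suc t))"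
    using run(1) unfolding relpowp_fun_conv by blast
  have b: "bounded_config t (C t)" if "t \<le> T" for t
    using that
  proof (induction t)
    case 0
    show ?case
      unfolding C(1) bounded_config_def using initial_tapes SL(1,2)
      by (auto simp: input_tape_def bit_symbol_def blank_def)
  next
    case (Suc t)
    then show ?case using bounded_config_step[OF _ C(3) SL(3)] by auto
  qed
  have "\<exists>m. m < length IL \<and> (\<exists>bs ms. IL ! m = (fst (C t), map read_tape (snd (C t)), fst (C (Suc t)), bs, ms) \<and>
      snd (C (Suc t)) = map update_tape (zip (snd (C t)) (zip bs ms)))" if "t < T" for t
    using C(3)[OF that] unfolding tm_step_def by (auto simp: in_set_conv_nth)
  then obtain I where I: "\<And>t. t < T \<Longrightarrow> I t < length IL \<and> (\<exists>bs ms. IL ! I t =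
      (fst (C t), map read_tape (snd (C t)), fst (C (Suc t)), bs, ms) \<and>
      snd (C (Suc t)) = map update_tape (zip (snd (C t)) (zip bs ms)))"
    by metis
  \<comment> \<open>The assignment reads all variables off the run \<open>C\<close> and the chosen
    instructions \<open>I\<close>; the first entry of a name tells the kind of variable.\<close>
  define f where "f v = (if v ! 0 = 0 then (if v ! 1 < length w \<and> w ! (length w - 1 - v ! 1) then 1 else 0)
    else if v ! 0 = 1 then I (v ! 1) else if v ! 0 = 2 then fst (C (v ! 1))
    else if v ! 0 = 3 then nat (snd (snd (C (v ! 1)) ! (v ! 2)) + int R)
    else if v ! 0 = 4 then fst (snd (C (v ! 1)) ! (v ! 2)) (int (v ! 3) - int R)
    else length w)" for v :: "nat list"
  have f: "f [0, l] = (if l < length w \<and> w ! (length w - 1 - l) then 1 else 0)" "f [1, t] = I t"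
    "f [2, t] = fst (C t)" "f [3, t, j] = nat (snd (snd (C t) ! j) + int R)"
    "f [4, t, j, i] = fst (snd (C t) ! j) (int i - int R)" "f [5] = length w" for l t j i
    by (simp_all add: f_def)
  have lenC: "length (snd (C t)) = k" if "t \<le> T" for t using b[OF that] by (simp add: bounded_config_def)
  have pos: "\<bar>snd (snd (C t) ! j)\<bar> \<le> int T" if "t \<le> T" "j < k" for t j
    using b[OF that(1)] that by (fastforce simp: bounded_config_def)
  have head_pos: "int (f [3, t, j]) = snd (snd (C t) ! j) + int R" "1 \<le> f [3, t, j]" "f [3, t, j] < 2 * R"
    if "t \<le> T" "j < k" for t j
    using pos[OF that] R unfolding f by linarith+
  have sym: "fst (snd (C t) ! j) p \<in> set SY" if "t \<le> T" "j < k" for t j p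
    using b[OF that(1)] that by (simp add: bounded_config_def)
  have last: "last (snd c) = snd (C T) ! (k - 1)"
    using lenC[of T] k C(2) by (subst last_conv_nth) auto
  have out: "fst (snd (C T) ! (k - 1)) (int i) = bit_symbol (w ! i)" if "i < length w" for i
    using run(3) that unfolding has_output_def last by blast
  have out_end: "fst (snd (C T) ! (k - 1)) (int (length w)) = 0"
    using run(3) unfolding has_output_def last blank_def by blast
  \<comment> \<open>Cell T + |x| of the last tape is still blank, so the output cannot extend beyond
    it.\<close>
  have lw: "length w \<le> R"
  proof (rule ccontr)
    assume "\<not> length w \<le> R"
    then have "bit_symbol (w ! (T + length x)) = 0"
      using out[of "T + length x"] b[of T] R k by (auto simp: bounded_config_def)
    then show False by (simp add: bit_symbol_def split: if_splits)
  qed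
  have init: "holds f (cs_init k q0 R x)"
    unfolding holds_cs_init f C(1) init_symbol using initial_tapes by (auto simp: snd_input_tape)
  have state: "holds f (cs_state IL T)"
    unfolding holds_cs_state f using I by fastforce
  have step: "length bs = k \<and> length ms = k \<and> snd (C (Suc t)) ! j = update_tape (snd (C t) ! j, bs ! j, ms ! j)"
    if t: "t < T" and j: "j < k" and ins: "IL ! I t = (q, as, q', bs, ms)" for t j q as q' bs ms
  proof -
    have "(q, as, q', bs, ms) \<in> set IL" using I[OF t] ins by (metis nth_mem)
    from IL[OF this] show ?thesis using I[OF t] ins j lenC[of t] t by auto
  qed
  have head: "holds f (cs_head k IL T R)"
    unfolding holds_cs_head
  proof (intro allI impI)
    fix t j assume t: "t < T" and j: "j < k"
    obtain bs ms where ins: "IL ! I t = (fst (C t), map read_tape (snd (C t)), fst (C (Suc t)), bs, ms)"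
      using I[OF t] by blast
    have tape: "snd (C (Suc t)) ! j = update_tape (snd (C t) ! j, bs ! j, ms ! j)"
      using step[OF t j ins] by simp
    note hp = head_pos[of t j]
    have p: "int (f [3, t, j]) - int R = snd (snd (C t) ! j)" using hp t j by simp
    have "f [4, t, j, f [3, t, j]] = map read_tape (snd (C t)) ! j"
      using lenC[of t] t j unfolding f(5) p by (simp add: read_tape_fst_snd)
    moreover have "f [4, Suc t, j, f [3, t, j]] = bs ! j"
      unfolding f(5) p tape update_tape_fst_snd by simp
    moreover have "int (f [3, Suc t, j]) = int (shift (f [3, t, j]) (ms ! j))"
      using head_pos(1)[of "Suc t" j] hp t j unfolding tape update_tape_fst_snd by (cases "ms ! j") auto
    ultimately show "\<exists>q as q' bs ms. f [1, t] < length IL \<and> IL ! f [1, t] = (q, as, q', bs, ms) \<and>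
        1 \<le> f [3, t, j] \<and> f [3, t, j] < 2 * R \<and> f [4, t, j, f [3, t, j]] = as ! j \<and>
        f [4, Suc t, j, f [3, t, j]] = bs ! j \<and> f [3, Suc t, j] = shift (f [3, t, j]) (ms ! j)"
      using hp t j I[OF t] ins unfolding f(2) by auto
  qed
  have inertia: "holds f (cs_inertia k SY T R)"
    unfolding holds_cs_inertia
  proof (intro allI impI)
    fix t j i assume t: "t < T" and j: "j < k" and i: "i \<le> 2 * R"
    obtain bs ms where ins: "IL ! I t = (fst (C t), map read_tape (snd (C t)), fst (C (Suc t)), bs, ms)"
      using I[OF t] by blast
    have tape: "snd (C (Suc t)) ! j = update_tape (snd (C t) ! j, bs ! j, ms ! j)"
      using step[OF t j ins] by simp
    have "f [4, Suc t, j, i] = f [4, t, j, i]" if "f [3, t, j] \<noteq> i"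
      using that head_pos(1)[of t j] t j unfolding f(5) tape update_tape_fst_snd by auto
    then show "f [3, t, j] = i \<or> f [3, t, j] \<le> 2 * R \<and> f [4, t, j, i] \<in> set SY \<and>
        f [4, Suc t, j, i] = f [4, t, j, i]"
      using head_pos(3)[of t j] sym[of t j] t j unfolding f(5) by auto
  qed
  have outp: "holds f (cs_output k qa T R)"
    unfolding holds_cs_output f
  proof (intro conjI allI impI)
    show "fst (C T) = qa" using run(2) C(2) by simp
    fix m assume "m \<le> R"
    show "length w \<le> R" by (rule lw)
    have eq: "int (R + m) - int R = int m" by simp
    show "if m < length w then fst (snd (C T) ! (k - 1)) (int (R + m) - int R) = 1 \<and>
           (if length w - 1 - m < length w \<and> w ! (length w - 1 - (length w - 1 - m)) then 1 else 0) = 0 \<or>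
           fst (snd (C T) ! (k - 1)) (int (R + m) - int R) = 2 \<and>
           (if length w - 1 - m < length w \<and> w ! (length w - 1 - (length w - 1 - m)) then 1 else 0) = 1
         else if m = length w then fst (snd (C T) ! (k - 1)) (int (R + m) - int R) = 0 \<and>
           (if m < length w \<and> w ! (length w - 1 - m) then 1 else 0) = 0
         else (if m < length w \<and> w ! (length w - 1 - m) then 1 else 0) = 0"
      unfolding eq using out[of m] out_end by (auto simp: bit_symbol_def)
  qed
  have holds: "holds f (tab_cs k q0 qa IL SY T R x)"
    unfolding tab_cs_def holds_simps using init state head inertia outp by blast
  have "in_domains f (tab_vars mx k IL SL SY T R)"
    unfolding in_domains_tab_vars
  proof (intro conjI allI impI)
    show "f [0, l] \<in> {0, 1}" for l by (simp add: f)
    show "f [1, t] < length IL" if "t < T" for t using I[OF that] unfolding f(2) by blast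
    show "f [2, t] \<in> set SL" if "t \<le> T" for t using b[OF that] by (simp add: f bounded_config_def)
    show "f [3, t, j] \<le> 2 * R" if "t \<le> T" "j < k" for t j using head_pos(3)[OF that] by simp
    show "f [4, t, j, i] \<in> set SY" if "t \<le> T" "j < k" for t j i using sym[OF that] by (simp add: f)
    show "f [5] \<le> R" using lw by (simp add: f)
  qed
  moreover have "map (\<lambda>l. f [0, l] = 1) (rev [0..<Suc R]) = replicate (Suc R - length w) False @ w"
  proof (rule nth_equalityI)
    show "length (map (\<lambda>l. f [0, l] = 1) (rev [0..<Suc R])) = length (replicate (Suc R - length w) False @ w)"
      using lw by (simp del: upt_Suc)
    fix i assume "i < length (map (\<lambda>l. f [0, l] = 1) (rev [0..<Suc R]))"
    then have i: "i \<le> R" by (simp del: upt_Suc)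
    have lhs: "map (\<lambda>l. f [0, l] = 1) (rev [0..<Suc R]) ! i = (R - i < length w \<and> w ! (length w - 1 - (R - i)))"
      using i by (simp add: rev_nth f(1) del: upt_Suc)
    show "map (\<lambda>l. f [0, l] = 1) (rev [0..<Suc R]) ! i = (replicate (Suc R - length w) False @ w) ! i"
    proof (cases "i < Suc R - length w")
      case False
      then have "length w - 1 - (R - i) = i - (Suc R - length w)" "R - i < length w" using i lw by auto
      then show ?thesis unfolding lhs using False by (simp add: nth_append)
    qed (use lhs in \<open>auto simp: nth_append simp del: upt_Suc\<close>)
  qed
  then have "objective (rev [0..<Suc R]) f = bin_val w"
    unfolding objective_def by (simp only: bin_val_leading_False)
  ultimately show ?thesis using holds by blast
qed

end

section \<open>The reduction\<close>

subsection \<open>Writing down the regex\<close>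

lemma enc_nat_gid: "enc_nat (gid k) = concat (map (\<lambda>b. [True, b]) (True # key_word k)) @ [False]"
  by (simp add: enc_nat_def bin_gid)

lemma enc_foldr:
  "enc_regex (foldr Disj rs r0) = concat (map (\<lambda>r. [False, True, False] @ enc_regex r) rs) @ enc_regex r0"
  "enc_regex (foldr Sequ rs r0) = concat (map (\<lambda>r. [False, True, True] @ enc_regex r) rs) @ enc_regex r0"
  by (induction rs) auto

lemma fp_key_word: "fp g \<Longrightarrow> fp (\<lambda>x. key_word (g x))"
  unfolding key_word_def by (intro fp_intros)

lemma fp_enc_gid: "fp g \<Longrightarrow> fp (\<lambda>x. enc_nat (gid (g x)))"
  unfolding enc_nat_gid by (intro fp_intros fp_key_word)

lemma fp_enc_var_regex:
  assumes "fp g"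
  shows "fp (\<lambda>x. enc_regex (var_regex (g x) :: 'c::enum regex))"
proof -
  have eq: "enc_regex (var_regex D :: 'c regex) =
    concat (map (\<lambda>k. [False, True, False, True, False, False] @ enc_nat (gid k) @ enc_regex (any_char :: 'c regex)) D) @
      enc_regex (no_char :: 'c regex)" for D
    by (simp add: var_regex_def enc_foldr comp_def)
  show ?thesis unfolding eq by (intro fp_intros fp_enc_gid assms)
qed

lemma fp_enc_constraint_regex:
  assumes "fp g"
  shows "fp (\<lambda>x. enc_regex (constraint_regex J (g x) :: 'c::enum regex))"
proof -
  have items: "concat (map (\<lambda>r. [False, True, True] @ enc_regex r) (cube_items J c :: 'c regex list)) =
    concat (map (\<lambda>k. [False, True, True, True, False, True] @ enc_nat (gid k)) c) @
    concat (replicate (J - length c) ([False, True, True] @ enc_regex (any_char :: 'c regex)))" for c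
    by (simp add: cube_items_def comp_def map_replicate)
  have eq: "enc_regex (constraint_regex J cubes :: 'c regex) =
    concat (map (\<lambda>c. [False, True, False] @ (concat (map (\<lambda>k. [False, True, True, True, False, True] @ enc_nat (gid k)) c) @
      concat (replicate (J - length c) ([False, True, True] @ enc_regex (any_char :: 'c regex)))) @ enc_regex (Empty :: 'c regex)) cubes) @
      enc_regex (no_char :: 'c regex)" for cubes
    unfolding items[symmetric] by (simp add: constraint_regex_def enc_foldr comp_def)
  show ?thesis unfolding eq by (intro fp_intros fp_enc_gid assms)
qed

text \<open>The 5 is the maximal number of equations in a cube, see
  \<open>tab_cs_width\<close>.\<close>

definition csp_instance :: "'c::enum \<Rightarrow> var_domains \<Rightarrow> constraints \<Rightarrow> word" where
  "csp_instance c0 vs cs = enc_instance (csp_regex 5 (map var_keys vs) (constraint_keys cs))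
     (replicate (csp_length 5 (map var_keys vs) (constraint_keys cs)) c0)"

lemma fp_csp_instance:
  fixes c0 :: "'c::enum"
  assumes "fp vs" "fp cs"
  shows "fp (\<lambda>x. csp_instance c0 (vs x) (cs x))"
proof -
  have eq: "csp_instance c0 vs cs =
    [False, True, True] @ enc_regex (Anchor Input_Start :: 'c regex) @
    (concat (map (\<lambda>D. [False, True, True] @ enc_regex (var_regex (map (\<lambda>a. fst D @ [a]) (snd D)) :: 'c regex)) vs) @
     concat (map (\<lambda>c. [False, True, True] @ enc_regex (constraint_regex 5
       (map (map (\<lambda>va. fst va @ [snd va])) c) :: 'c regex)) cs)) @
    enc_regex (Anchor Input_End :: 'c regex) @
    concat (replicate (length vs + 5 * length cs) (enc_charset {c0}))" for vs cs
    by (simp add: csp_instance_def csp_regex_def csp_length_def enc_instance_def enc_foldr comp_def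
        var_keys_def constraint_keys_def enc_string_def map_replicate)
  show ?thesis unfolding eq
    by (intro fp_intros fp_enc_var_regex fp_enc_constraint_regex assms)
qed

definition nth0 :: "nat list \<Rightarrow> nat \<Rightarrow> nat" where
  "nth0 xs n = (case drop n xs of [] \<Rightarrow> 0 | y # _ \<Rightarrow> y)"

lemma nth0: "n < length xs \<Longrightarrow> nth0 xs n = xs ! n"
  by (simp add: nth0_def Cons_nth_drop_Suc[symmetric])

lemma fp_nth0: "fp l \<Longrightarrow> fp n \<Longrightarrow> fp (\<lambda>x. nth0 (l x) (n x))"
  unfolding nth0_def by (intro fp_nth_default fp_const)

lemma fp_objective_vars: "fp l \<Longrightarrow> fp (\<lambda>x. objective_vars mx (l x))"
  unfolding objective_vars_def by (intro fp_intros)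

lemma fp_tab_vars:
  assumes T: "fp (T :: word \<Rightarrow> nat)" and R: "fp R"
  shows "fp (\<lambda>x. tab_vars mx k IL SL SY (T x) (R x))"
  unfolding tab_vars_def
  by (intro fp_intros fp_objective_vars fp_comp[OF _ T] fp_comp[OF _ R] T R)

fun move_code :: "move \<Rightarrow> nat" where
  "move_code Move_Left = 0" | "move_code Stay = 1" | "move_code Move_Right = 2"

lemma shift_code: "shift i m = (if move_code m = 0 then i - 1 else if move_code m = 1 then i else Suc i)"
  by (cases m) auto

text \<open>The instruction list is a constant of the reduction, but it has to be a value of a
  codable type: moves become numbers, and each instruction carries its index.\<close>

definition coded_instrs :: "instruction list \<Rightarrow> (nat \<times> nat \<times> nat list \<times> nat \<times> nat list \<times> nat list) list" where
  "coded_instrs IL = map (\<lambda>m. case IL ! m of (q, as, q', bs, ms) \<Rightarrow> (m, q, as, q', bs, map move_code ms)) [0..<length IL]"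

definition head_cube_code :: "nat \<Rightarrow> nat \<Rightarrow> nat \<Rightarrow> nat \<times> nat \<times> nat list \<times> nat \<times> nat list \<times> nat list \<Rightarrow> (nat list \<times> nat) list" where
  "head_cube_code t j i e = (case e of (m, q, as, q', bs, ms) \<Rightarrow>
     [([1, t], m), ([3, t, j], i), ([4, t, j, i], nth0 as j), ([4, Suc t, j, i], nth0 bs j),
      ([3, Suc t, j], if nth0 ms j = 0 then i - 1 else if nth0 ms j = 1 then i else Suc i)])"

lemma fp_cs_state:
  assumes T: "fp (T :: word \<Rightarrow> nat)"
  shows "fp (\<lambda>x. cs_state IL (T x))"
proof -
  have eq: "cs_state IL T = map (\<lambda>t. map (\<lambda>e. [([1, t], fst e), ([2, t], fst (snd e)), ([2, Suc t], fst (snd (snd (snd e))))])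
     (coded_instrs IL)) [0..<T]" for T
    unfolding cs_state_def coded_instrs_def by (auto split: prod.splits)
  show ?thesis unfolding eq by (intro fp_intros T)
qed

lemma fp_cs_head:
  assumes IL: "\<And>q as q' bs ms. (q, as, q', bs, ms) \<in> set IL \<Longrightarrow> length as = k \<and> length bs = k \<and> length ms = k"
    and T: "fp (T :: word \<Rightarrow> nat)" and R: "fp R"
  shows "fp (\<lambda>x. cs_head k IL (T x) (R x))"
proof -
  have "head_cube IL t j i m = head_cube_code t j i (case IL ! m of (q, as, q', bs, ms) \<Rightarrow> (m, q, as, q', bs, map move_code ms))"
    if "j < k" "m < length IL" for t j i m
  proof (cases "IL ! m")
    case (fields q as q' bs ms)
    then have "length as = k \<and> length bs = k \<and> length ms = k" using IL nth_mem[OF that(2)] by metis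
    then show ?thesis using that fields by (simp add: head_cube_def head_cube_code_def nth0 shift_code)
  qed
  then have eq: "cs_head k IL T R = concat (map (\<lambda>t. map (\<lambda>j. concat (map (\<lambda>i.
     map (\<lambda>e. head_cube_code t j i e) (coded_instrs IL)) [1..<2 * R])) [0..<k]) [0..<T])" for T R
    unfolding cs_head_def coded_instrs_def map_map comp_def
    by (intro arg_cong[of _ _ concat] map_cong refl) auto
  show ?thesis unfolding eq head_cube_code_def
    by (intro fp_intros fp_nth0 fp_comp[OF _ T] fp_comp[OF _ R] T R)
qed

lemma fp_cs_inertia:
  assumes T: "fp (T :: word \<Rightarrow> nat)" and R: "fp R"
  shows "fp (\<lambda>x. cs_inertia k SY (T x) (R x))"
  unfolding cs_inertia_def by (intro fp_intros fp_comp[OF _ T] fp_comp[OF _ R] T R)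

lemma fp_cs_output:
  assumes T: "fp (T :: word \<Rightarrow> nat)" and R: "fp R"
  shows "fp (\<lambda>x. cs_output k qa (T x) (R x))"
  unfolding cs_output_def by (intro fp_intros fp_comp[OF _ T] fp_comp[OF _ R] T R)

lemma fp_cs_init:
  assumes R: "fp R"
  shows "fp (\<lambda>x. cs_init k q0 (R x) x)"
  unfolding cs_init_def init_symbol_def by (intro fp_intros fp_comp[OF _ R] R)

lemma fp_tab_cs:
  assumes IL: "\<And>q as q' bs ms. (q, as, q', bs, ms) \<in> set IL \<Longrightarrow> length as = k \<and> length bs = k \<and> length ms = k"
    and T: "fp (T :: word \<Rightarrow> nat)" and R: "fp R"
  shows "fp (\<lambda>x. tab_cs k q0 qa IL SY (T x) (R x) x)"
  unfolding tab_cs_def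
  by (intro fp_append fp_cs_init fp_cs_state fp_cs_head[OF IL] fp_cs_inertia fp_cs_output T R) auto

subsection \<open>Reading the answer\<close>

text \<open>Transition table of a finite automaton: entry \<open>m\<close> of the first list is the
  mode after reading 1 in mode \<open>m\<close>, that of the second list the mode after reading 0.
  Mode 8 leads to 0 only for an opened group, a status excluded in
  \<open>scan_statuses\<close>.\<close>

definition scan_next :: "nat \<Rightarrow> bool \<Rightarrow> nat" where
  "scan_next m b = nth0 (if b then [1, 2, 1, 4, 3, 6, 5, 9, 0, 10, 9, 12, 11]
     else [1, 3, 1, 5, 3, 7, 5, 8, 5, 11, 9, 5, 11]) m"

text \<open>Modes: 1, 3 and 5 are in front of the start position, the end position and a group identifier;
  7 is in front of a status, 8 inside the status of an undefined group, 9 and 11 in front of the bounds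
  of a range.  The even modes 2, 4, 6, 10, 12 are inside these numbers.\<close>

definition scan_step :: "nat \<times> word \<Rightarrow> bool \<Rightarrow> nat \<times> word" where
  "scan_step s b = (scan_next (fst s) b,
     snd s @ (if fst s = 7 \<and> b then [True] else if fst s = 8 \<and> \<not> b then [False] else []))"

text \<open>An automaton suffices to read the answer, because only one bit per group is of interest:
  whether the group was captured.\<close>

definition statuses :: "word \<Rightarrow> word" where
  "statuses w = snd (foldl scan_step (0, []) w)"

lemma scan_nat:
  assumes "(m, m', e) \<in> {(1, 2, 3), (3, 4, 5), (5, 6, 7), (9, 10, 11), (11, 12, 5)}"
  shows "foldl scan_step (m, out) (enc_nat n) = (e, out)"
proof -
  have "foldl scan_step (m, out) (concat (map (\<lambda>b. [True, b]) xs)) = (m, out)" for xs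
    using assms by (induction xs) (auto simp: scan_step_def scan_next_def nth0_def split: if_splits)
  then show ?thesis
    using assms by (auto simp: enc_nat_def scan_step_def scan_next_def nth0_def)
qed

lemma scan_statuses:
  assumes "\<And>g. g \<in> set gs \<Longrightarrow> \<gamma> g = Undefd \<or> (\<exists>a b. \<gamma> g = Closed a b)"
  shows "foldl scan_step (5, out) (concat (map (\<lambda>g. enc_nat g @ enc_status (\<gamma> g)) gs)) =
    (5, out @ map (\<lambda>g. \<gamma> g \<noteq> Undefd) gs)"
  using assms
proof (induction gs arbitrary: out)
  case (Cons g gs)
  have "foldl scan_step (7, out) (enc_status (\<gamma> g)) = (5, out @ [\<gamma> g \<noteq> Undefd])"
    using Cons.prems[of g] scan_nat[of 9 10 11] scan_nat[of 11 12 5]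
    by (auto simp: scan_step_def scan_next_def nth0_def)
  then show ?case
    using Cons scan_nat[of 5 6 7] by simp
qed simp

lemma statuses_answer:
  assumes "\<And>g. g \<in> set (groups r) \<Longrightarrow> \<gamma> g = Undefd \<or> (\<exists>a b. \<gamma> g = Closed a b)"
  shows "statuses (bin (enc_answer r (Some (k, p, \<gamma>)))) = map (\<lambda>g. \<gamma> g \<noteq> Undefd) (groups r)"
proof -
  have "scan_step (0, []) True = (1, [])" by (simp add: scan_step_def scan_next_def nth0_def)
  then show ?thesis
    using scan_nat[of 1 2 3] scan_nat[of 3 4 5] scan_statuses[OF assms]
    by (simp add: statuses_def bin_bin_val)
qed

lemma fp_statuses: "fp g \<Longrightarrow> fp (\<lambda>x. statuses (g x))"
proof (rule fp_comp[of g statuses], assumption)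
  have step: "fp (\<lambda>z :: word \<times> (nat \<times> word) \<times> bool. scan_step (fst (snd z)) (snd (snd z)))"
    unfolding scan_step_def scan_next_def by (intro fp_intros fp_nth0)
  have "fp (\<lambda>w. foldl scan_step (0, []) w)"
  proof (rule fp_foldl_additive[OF step fp_const fp_id, where q = "\<lambda>n. n + 30"])
    fix x :: word and a :: "nat \<times> word" and y
    \<comment> \<open>All entries of the table are at most 12, so the size of the mode is bounded by
      a constant.\<close>
    have "nth0 xs n \<le> 12" if "\<forall>m\<in>set xs. m \<le> 12" for xs n
      using that set_drop_subset[of n xs] by (auto simp: nth0_def split: list.split)
    then have "scan_next (fst a) y \<le> 12" by (simp add: scan_next_def)
    then have "csize (scan_next (fst a) y) \<le> 25" by simp
    moreover define v where "v = (if fst a = 7 \<and> y then [True] else if fst a = 8 \<and> \<not> y then [False] else [])"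
    have "csize v \<le> 5" using csize_bool[of True] csize_bool[of False] by (simp add: v_def)
    then have "csize (snd a @ v) \<le> csize (snd a) + 4"
      using csize_append[of "snd a" v] by linarith
    moreover have "csize (scan_step a y) = Suc (csize (scan_next (fst a) y) + csize (snd a @ v))"
      unfolding scan_step_def v_def csize_simps(1) by (rule refl)
    moreover have "csize a = Suc (csize (fst a) + csize (snd a))"
      using csize_simps(1)[of "fst a" "snd a"] by (simp del: csize_simps)
    ultimately show "csize (scan_step a y) \<le> csize a + (csize x + csize y + 30)"
      by linarith
  qed (auto intro!: pbound_intros monoI)
  then show "fp statuses" unfolding statuses_def by (rule fp_snd)
qed

text \<open>The groups of the objective variables come first, two per bit with the preferred value
  leading. So status \<open>2 * i\<close> tells whether bit \<open>i\<close> has its preferred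
  value, and that value is 1 exactly when maximising.\<close>

definition decode_value :: "bool \<Rightarrow> nat \<Rightarrow> word \<Rightarrow> word" where
  "decode_value mx R w = map (\<lambda>i. (case drop (2 * i) (statuses w) of [] \<Rightarrow> False | b # _ \<Rightarrow> b) = mx) [0..<Suc R]"

lemma fp_decode_value: "fp R \<Longrightarrow> fp w \<Longrightarrow> fp (\<lambda>x. decode_value mx (R x) (w x))"
  unfolding decode_value_def
  by (intro fp_intros fp_statuses; (rule fp_comp[where g = fst], rule fp_fst[OF fp_id]; assumption)?)

lemma decode_value:
  assumes g: "groups r = map gid (concat (map var_keys (objective_vars mx (rev [0..<Suc R]) @ rest)))"
    and \<gamma>: "\<And>g. \<gamma> g = Undefd \<or> (\<exists>a. \<gamma> g = Closed a (Suc a))"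
    and f: "\<And>l a. l \<le> R \<Longrightarrow> \<gamma> (gid [0, l, a]) = Undefd \<longleftrightarrow> f [0, l] \<noteq> a"
    and dom: "\<And>l. l \<le> R \<Longrightarrow> f [0, l] \<in> {0, 1 :: nat}"
  shows "bin_val (decode_value mx R (bin (enc_answer r (Some (k, p, \<gamma>))))) = objective (rev [0..<Suc R]) f"
proof -
  let ?D = "\<lambda>l. map (\<lambda>a. \<gamma> (gid [0, l, a]) \<noteq> Undefd) (if mx then [1, 0] else [0, 1])"
  have st: "statuses (bin (enc_answer r (Some (k, p, \<gamma>)))) = concat (map ?D (rev [0..<Suc R])) @
      map (\<lambda>g. \<gamma> g \<noteq> Undefd) (map gid (concat (map var_keys rest)))"
  proof -
    have "statuses (bin (enc_answer r (Some (k, p, \<gamma>)))) = map (\<lambda>g. \<gamma> g \<noteq> Undefd) (groups r)"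
      by (rule statuses_answer) (use \<gamma> in blast)
    also have "\<dots> = concat (map ?D (rev [0..<Suc R])) @
      map (\<lambda>g. \<gamma> g \<noteq> Undefd) (map gid (concat (map var_keys rest)))"
      unfolding g by (simp add: objective_vars_def var_keys_def map_concat comp_def del: upt_Suc)
    finally show ?thesis .
  qed
  have drop: "drop (2 * i) (concat (map ?D ls) @ zs) = ?D (ls ! i) @ concat (map ?D (drop (Suc i) ls)) @ zs"
    if "i < length ls" for i ls zs
    using that
  proof (induction ls arbitrary: i)
    case (Cons l ls)
    then show ?case by (cases i) auto
  qed simp
  have "(case drop (2 * i) (statuses (bin (enc_answer r (Some (k, p, \<gamma>))))) of [] \<Rightarrow> False | b # _ \<Rightarrow> b) = mx
      \<longleftrightarrow> f [0, R - i] = 1" if i: "i \<le> R" for i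
  proof -
    have "i < length (rev [0..<Suc R])" "rev [0..<Suc R] ! i = R - i"
      using i by (simp_all add: rev_nth del: upt_Suc)
    then have "drop (2 * i) (statuses (bin (enc_answer r (Some (k, p, \<gamma>))))) = ?D (R - i) @
       concat (map ?D (drop (Suc i) (rev [0..<Suc R]))) @ map (\<lambda>g. \<gamma> g \<noteq> Undefd) (map gid (concat (map var_keys rest)))"
      unfolding st using drop by metis
    then show ?thesis
      using dom[of "R - i"] by (auto simp: f)
  qed
  then have "decode_value mx R (bin (enc_answer r (Some (k, p, \<gamma>)))) = map (\<lambda>i. f [0, R - i] = 1) [0..<Suc R]"
    unfolding decode_value_def
    by (intro map_cong refl) (simp add: less_Suc_eq_le del: enc_answer.simps upt_Suc)
  also have "\<dots> = map (\<lambda>l. f [0, l] = 1) (rev [0..<Suc R])"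
    by (rule nth_equalityI) (auto simp: rev_nth simp del: upt_Suc)
  finally show ?thesis by (simp add: objective_def)
qed

subsection \<open>Stationary instructions for accepting configurations\<close>

text \<open>The tableau describes runs of exactly T steps, but accepting configurations occur at
  various times. Idle instructions are added only where the machine has none, so only halting
  configurations in the accepting state gain a loop. The finite symbol set \<open>S\<close> keeps
  the instruction set finite.\<close>

definition idle_instrs :: "ntm \<Rightarrow> nat set \<Rightarrow> instruction set" where
  "idle_instrs M S = (\<lambda>v. (accept_state M, v, accept_state M, v, replicate (num_tapes M) Stay)) `
     {v. set v \<subseteq> S \<and> length v = num_tapes M \<and> (\<nexists>y. (accept_state M, v, y) \<in> instrs M)}"

definition idling :: "ntm \<Rightarrow> nat set \<Rightarrow> ntm" where
  "idling M S = NTM (num_tapes M) (start_state M) (accept_state M) (instrs M \<union> idle_instrs M S)"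

lemma stuck_iff: "(\<nexists>c'. tm_step M c c') \<longleftrightarrow> (\<nexists>y. (fst c, map read_tape (snd c), y) \<in> instrs M)"
proof -
  have "(\<exists>c'. tm_step M c c') \<longleftrightarrow> (\<exists>y. (fst c, map read_tape (snd c), y) \<in> instrs M)"
    unfolding tm_step_def by (auto simp del: split_paired_All split_paired_Ex) (metis fst_conv snd_conv prod.collapse)+
  then show ?thesis by blast
qed

lemma zip_idle: "length ts = k \<Longrightarrow> map update_tape (zip ts (zip (map read_tape ts) (replicate k Stay))) = ts"
  by (intro nth_equalityI) (auto simp: update_tape_stay)

lemma idling_step:
  assumes "length (snd c) = num_tapes M"
  shows "tm_step (idling M S) c c' \<longleftrightarrow> tm_step M c c' \<or> c' = c \<and> accepting M c \<and> set (map read_tape (snd c)) \<subseteq> S"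
proof -
  have "tm_step (idling M S) c c' \<longleftrightarrow> tm_step M c c' \<or> (\<exists>bs ms. (fst c, map read_tape (snd c), fst c', bs, ms) \<in> idle_instrs M S \<and>
      snd c' = map update_tape (zip (snd c) (zip bs ms)))"
    unfolding tm_step_def idling_def by auto
  also have "(\<exists>bs ms. (fst c, map read_tape (snd c), fst c', bs, ms) \<in> idle_instrs M S \<and>
      snd c' = map update_tape (zip (snd c) (zip bs ms))) \<longleftrightarrow> c' = c \<and> accepting M c \<and> set (map read_tape (snd c)) \<subseteq> S"
    (is "?L \<longleftrightarrow> ?R")
  proof
    assume ?L
    then obtain bs ms v where v: "set v \<subseteq> S" "\<nexists>y. (accept_state M, v, y) \<in> instrs M"
      and eq: "(fst c, map read_tape (snd c), fst c', bs, ms) =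
        (accept_state M, v, accept_state M, v, replicate (num_tapes M) Stay)"
      and c': "snd c' = map update_tape (zip (snd c) (zip bs ms))"
      unfolding idle_instrs_def by blast
    have e: "map read_tape (snd c) = v" "bs = v" using eq by simp_all
    have L: "fst c = accept_state M" "fst c' = accept_state M" "set (map read_tape (snd c)) \<subseteq> S"
      "snd c' = map update_tape (zip (snd c) (zip (map read_tape (snd c)) (replicate (num_tapes M) Stay)))"
      "\<nexists>y. (accept_state M, map read_tape (snd c), y) \<in> instrs M"
      using v c' eq unfolding e by simp_all
    have "c' = c" using L(1,2,4) unfolding zip_idle[OF assms] by (simp add: prod_eq_iff)
    moreover have "accepting M c" unfolding accepting_def stuck_iff using L(1,5) by simp
    ultimately show ?R using L(3) by blast
  next
    assume ?R
    then have "(fst c, map read_tape (snd c), fst c', map read_tape (snd c), replicate (num_tapes M) Stay) \<in> idle_instrs M S"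
      using assms unfolding accepting_def stuck_iff idle_instrs_def by auto
    moreover have "snd c' = map update_tape (zip (snd c) (zip (map read_tape (snd c)) (replicate (num_tapes M) Stay)))"
      using \<open>?R\<close> zip_idle[OF assms] by simp
    ultimately show ?L by blast
  qed
  finally show ?thesis .
qed

lemma tm_step_length:
  "wf_ntm M \<Longrightarrow> tm_step M c c' \<Longrightarrow> length (snd c) = num_tapes M \<Longrightarrow> length (snd c') = num_tapes M"
  unfolding wf_ntm_def tm_step_def by fastforce

lemma tm_run_length:
  assumes "wf_ntm M" "(tm_step M ^^ t) (initial_config M ws) c"
  shows "length (snd c) = num_tapes M"
  using assms(2)
proof (induction t arbitrary: c)
  case 0
  then show ?case by (auto simp: initial_config_def)
next
  case (Suc t)
  then obtain d where "(tm_step M ^^ t) (initial_config M ws) d" "tm_step M d c"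
    by (blast elim: relpowp_Suc_E)
  then show ?case using tm_step_length[OF assms(1)] Suc.IH by blast
qed

text \<open>A run that idles has reached an accepting configuration of the original machine and
  never leaves it, so cutting off the idle steps gives an original run.\<close>

lemma idling_run:
  assumes "wf_ntm M" "(tm_step (idling M S) ^^ t) (initial_config M ws) c"
  shows "\<exists>u\<le>t. (tm_step M ^^ u) (initial_config M ws) c \<and> (u = t \<or> accepting M c)"
  using assms(2)
proof (induction t arbitrary: c)
  case (Suc t)
  then obtain d where d: "(tm_step (idling M S) ^^ t) (initial_config M ws) d" "tm_step (idling M S) d c"
    by (blast elim: relpowp_Suc_E)
  obtain u where u: "u \<le> t" "(tm_step M ^^ u) (initial_config M ws) d" "u = t \<or> accepting M d"
    using Suc.IH[OF d(1)] by blast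
  note step = idling_step[OF tm_run_length[OF assms(1) u(2)], of S c, THEN iffD1, OF d(2)]
  show ?case
  proof (cases "tm_step M d c")
    case True
    then have "u = t" using u(3) unfolding accepting_def by blast
    then show ?thesis using u(2) True by (intro exI[of _ "Suc t"]) auto
  next
    case False
    then show ?thesis using step u by (intro exI[of _ u]) auto
  qed
qed simp


subsection \<open>Hardness\<close>

lemma wf_idling:
  assumes "wf_ntm M" "finite S"
  shows "wf_ntm (idling M S)"
proof -
  have "finite (idle_instrs M S)"
    unfolding idle_instrs_def
    by (rule finite_imageI, rule finite_subset[OF _ finite_lists_length_eq[OF assms(2), of "num_tapes M"]]) auto
  then show ?thesis using assms(1) by (auto simp: wf_ntm_def idling_def idle_instrs_def)
qed

lemma distinct_var_keys:
  assumes "distinct (map fst vs)" "\<And>vD. vD \<in> set vs \<Longrightarrow> distinct (snd vD)"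
  shows "distinct (concat (map var_keys vs))"
  using assms
proof (induction vs)
  case (Cons vD vs)
  have "distinct (var_keys vD)"
    using Cons.prems(2)[of vD] by (auto simp: var_keys_def distinct_map inj_on_def)
  moreover have "distinct (concat (map var_keys vs))" using Cons by simp
  moreover have "set (var_keys vD) \<inter> set (concat (map var_keys vs)) = {}"
    using Cons.prems(1) by (auto simp: var_keys_def image_iff)
  ultimately show ?case by simp
qed simp

lemma tab_vars_domains_distinct:
  assumes "distinct SL" "distinct SY" "vD \<in> set (tab_vars mx k IL SL SY T R)"
  shows "distinct (snd vD)"
  using assms unfolding tab_vars_def objective_vars_def by (auto simp del: upt_Suc split: if_splits)

lemma bin_bin_val_strip: "bin (bin_val w) = dropWhile Not w"
proof (induction w)
  case (Cons b w)
  then show ?case by (cases b) (auto simp: bin_bin_val, simp add: bin_val_Cons)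
qed simp

lemma initial_idling: "initial_config (idling M S) ws = initial_config M ws"
  by (simp add: initial_config_def idling_def)

theorem OptP_hard_jsregmatch:
  fixes W :: "'c::enum set"
  shows "OptP_hard (jsregmatch W js_regexes_no_lower_bound)"
  unfolding OptP_hard_def
proof
  fix F assume "F \<in> OptP"
  then obtain M where M: "poly_time_ntm M" "\<And>x t c. tm_reaches M [x] t c \<Longrightarrow> accepting M c \<Longrightarrow> \<exists>w. has_output c w"
    "(\<forall>x. F x \<in> ntm_outputs M x \<and> (\<forall>v\<in>ntm_outputs M x. F x \<le> v)) \<or>
      (\<forall>x. F x \<in> ntm_outputs M x \<and> (\<forall>v\<in>ntm_outputs M x. v \<le> F x))"
    unfolding OptP_def by blast
  \<comment> \<open>OptP admits both directions of optimisation; the flag fixes one of them for the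
    whole function.\<close>
  obtain mx where mx: "\<And>x. F x \<in> ntm_outputs M x"
    "\<And>x v. v \<in> ntm_outputs M x \<Longrightarrow> if mx then v \<le> F x else F x \<le> v"
  proof -
    from M(3) show thesis
    proof
      assume "\<forall>x. F x \<in> ntm_outputs M x \<and> (\<forall>v\<in>ntm_outputs M x. F x \<le> v)"
      then show thesis using that[of False] by simp
    next
      assume "\<forall>x. F x \<in> ntm_outputs M x \<and> (\<forall>v\<in>ntm_outputs M x. v \<le> F x)"
      then show thesis using that[of True] by simp
    qed
  qed
  obtain p :: "nat poly" where wf: "wf_ntm M" and p: "\<And>x t c. tm_reaches M [x] t c \<Longrightarrow> t \<le> poly p (length x)"
    using M(1) unfolding poly_time_ntm_def by blast
  define k where "k = num_tapes M"
  have k: "k > 0" using wf by (simp add: wf_ntm_def k_def)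
  have finI: "finite (instrs M)" using wf by (simp add: wf_ntm_def)
  \<comment> \<open>All symbols that can ever appear on a tape: blanks, input bits and what
    instructions write.\<close>
  define S where "S = {0, 1, 2} \<union> (\<Union>(q, as, q', bs, ms)\<in>instrs M. set bs)"
  have finS: "finite S" unfolding S_def using finI by auto
  define M' where "M' = idling M S"
  have wf': "wf_ntm M'" unfolding M'_def by (rule wf_idling[OF wf finS])
  have "finite (instrs M')" using wf' by (simp add: wf_ntm_def)
  from finite_list[OF this] obtain IL where IL: "set IL = instrs M'" by (elim exE)
  obtain SY where SY: "set SY = S" "distinct SY" using finite_distinct_list[OF finS] by blast
  have "finite ({start_state M, accept_state M} \<union> (\<lambda>(q, as, q', bs, ms). q') ` instrs M')"
    using wf' by (simp add: wf_ntm_def)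
  then obtain SL where SL: "set SL = {start_state M, accept_state M} \<union> (\<lambda>(q, as, q', bs, ms). q') ` instrs M'"
    "distinct SL"
    by (elim finite_distinct_list[elim_format] exE conjE)
  have M'_eq: "M' = NTM k (start_state M) (accept_state M) (set IL)"
    by (cases M') (use IL in \<open>auto simp: M'_def idling_def k_def\<close>)
  have ILlen: "length as = k \<and> length bs = k \<and> length ms = k" if "(q, as, q', bs, ms) \<in> set IL" for q as q' bs ms
  proof -
    have "num_tapes M' = k" by (simp add: M'_def idling_def k_def)
    moreover have "(q, as, q', bs, ms) \<in> instrs M'" using that IL by simp
    ultimately show ?thesis using wf' unfolding wf_ntm_def by fastforce
  qed
  have ILsym: "q' \<in> set SL \<and> set bs \<subseteq> set SY" if "(q, as, q', bs, ms) \<in> set IL" for q as q' bs ms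
  proof
    show "q' \<in> set SL" using that unfolding IL SL(1) by force
    show "set bs \<subseteq> set SY"
      using that unfolding IL SY(1) M'_def idling_def S_def by (fastforce simp: idle_instrs_def)
  qed
  define T where "T x = poly p (length x)" for x :: word
  define R where "R x = Suc (T x + length x)" for x :: word
  define vs where "vs x = tab_vars mx k IL SL SY (T x) (R x)" for x
  define cs where "cs x = tab_cs k (start_state M) (accept_state M) IL SY (T x) (R x) x" for x
  have fpT: "fp T" unfolding T_def by (intro fp_intros)
  have fpR: "fp R" unfolding R_def by (intro fp_intros fpT)
  interpret tab: tableau k "start_state M" "accept_state M" IL x "T x" "R x" SL SY for x
    by unfold_locales (use k ILlen in \<open>auto simp: R_def\<close>)
  \<comment> \<open>A run that accepts early is prolonged by idling up to \<open>T x\<close>;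
    conversely, a solution of the constraints gives a run whose idle steps can be cut off.\<close>
  have outs: "v \<in> ntm_outputs M x \<longleftrightarrow> (\<exists>f. in_domains f (vs x) \<and> holds f (cs x) \<and> objective (rev [0..<Suc (R x)]) f = v)" for v x
  proof
    assume "v \<in> ntm_outputs M x"
    then obtain w t c where w: "v = bin_val w" "tm_reaches M [x] t c" "accepting M c" "has_output c w"
      by (auto simp: ntm_outputs_def)
    have t: "t \<le> T x" unfolding T_def by (rule p[OF w(2)])
    have run: "(tm_step M' ^^ u) (initial_config M' [x]) d" if "(tm_step M ^^ u) (initial_config M [x]) d" for u d
      using that
    proof (induction u arbitrary: d)
      case 0
      then show ?case by (simp add: M'_def initial_idling)
    next
      case (Suc u)
      then obtain e where e: "(tm_step M ^^ u) (initial_config M [x]) e" "tm_step M e d"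
        by (blast elim: relpowp_Suc_E)
      have "tm_step M' e d" unfolding M'_def idling_step[OF tm_run_length[OF wf e(1)]] using e(2) by blast
      then show ?case using Suc.IH[OF e(1)] by (rule relpowp_Suc_I[rotated])
    qed
    have reach: "(tm_step M' ^^ t) (initial_config M' [x]) c" using run w(2) by (simp add: tm_reaches_def)
    have len: "length (snd c) = num_tapes M" using tm_run_length[OF wf] w(2) unfolding tm_reaches_def by blast
    have bounded: "tab.bounded_config x u d" if "(tm_step M' ^^ u) (initial_config M' [x]) d" for u d
      using that
    proof (induction u arbitrary: d)
      case 0
      then show ?case unfolding tab.bounded_config_def M'_eq using tab.initial_tapes[where x = x] SY SL
        by (auto simp: input_tape_def bit_symbol_def blank_def S_def)
    next
      case (Suc u)
      then obtain e where e: "(tm_step M' ^^ u) (initial_config M' [x]) e" "tm_step M' e d"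
        by (blast elim: relpowp_Suc_E)
      show ?case by (rule tab.bounded_config_step[OF Suc.IH[OF e(1)] e(2)[unfolded M'_eq] ILsym])
    qed
    have "read_tape (snd c ! j) \<in> S" if "j < k" for j
      using bounded[OF reach] that unfolding tab.bounded_config_def SY(1) read_tape_fst_snd by blast
    then have "set (map read_tape (snd c)) \<subseteq> S"
      unfolding set_conv_nth using len by (auto simp: k_def)
    then have stay: "tm_step M' c c" unfolding M'_def idling_step[OF len] using w(3) by blast
    have "(tm_step M' ^^ n) c c" for n
      by (induction n) (use stay in \<open>auto intro: relcomppI\<close>)
    from relpowp_add[OF reach this[of "T x - t"]] t
    have "(tm_step M' ^^ T x) (initial_config M' [x]) c" by simp
    from tab.tableau_complete[OF this[unfolded M'_eq] _ w(4) _ _ ILsym, where mx = mx]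
    show "\<exists>f. in_domains f (vs x) \<and> holds f (cs x) \<and> objective (rev [0..<Suc (R x)]) f = v"
      using w(1,3) SL SY by (auto simp: accepting_def vs_def cs_def S_def simp del: upt_Suc)
  next
    assume "\<exists>f. in_domains f (vs x) \<and> holds f (cs x) \<and> objective (rev [0..<Suc (R x)]) f = v"
    then obtain f where f: "holds f (cs x)" "objective (rev [0..<Suc (R x)]) f = v" by blast
    obtain c w where c: "(tm_step M' ^^ T x) (initial_config M' [x]) c" "fst c = accept_state M"
      "has_output c w" "v = bin_val w"
      using tab.tableau_sound[OF f(1)[unfolded cs_def]] f(2) unfolding M'_eq by metis
    obtain u where u: "u \<le> T x" "(tm_step M ^^ u) (initial_config M [x]) c" "u = T x \<or> accepting M c"
      using idling_run[OF wf c(1)[unfolded M'_def initial_idling]] by blast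
    \<comment> \<open>If the machine could continue, its run would have \<open>T x + 1\<close> steps
      and exceed the time bound.\<close>
    have "accepting M c"
    proof (rule ccontr)
      assume na: "\<not> accepting M c"
      then obtain d where "tm_step M c d" using c(2) unfolding accepting_def by blast
      moreover have "u = T x" using u(3) na by blast
      ultimately have "tm_reaches M [x] (Suc (T x)) d"
        using u(2) unfolding tm_reaches_def by (auto intro: relcomppI simp del: split_paired_Ex)
      from p[OF this] show False by (simp add: T_def)
    qed
    then show "v \<in> ntm_outputs M x"
      using u(2) c(3,4) unfolding ntm_outputs_def tm_reaches_def by blast
  qed
  \<comment> \<open>Any character will do, since the string consists of copies of it.\<close>
  define c0 :: 'c where "c0 = undefined"
  define T1 where "T1 x = csp_instance c0 (vs x) (cs x)" for x
  define T2 where "T2 x n = bin_val (decode_value mx (R x) (bin n))" for x n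
  have reduction: "F x = T2 x (jsregmatch W js_regexes_no_lower_bound (T1 x))" for x
  proof -
    let ?r = "csp_regex 5 (map var_keys (vs x)) (constraint_keys (cs x)) :: 'c regex"
    let ?N = "csp_length 5 (map var_keys (vs x)) (constraint_keys (cs x))"
    obtain f0 where f0: "in_domains f0 (vs x)" "holds f0 (cs x)"
      using mx(1)[of x] unfolding outs by blast
    have vs_eq: "\<exists>rest. vs x = objective_vars mx (rev [0..<Suc (R x)]) @ rest"
      unfolding vs_def tab_vars_def by blast
    then obtain rest where rest: "vs x = objective_vars mx (rev [0..<Suc (R x)]) @ rest" by blast
    have dist: "distinct (map fst (vs x))" unfolding vs_def by (rule tab_vars_distinct)
    have scope: "\<forall>c\<in>set (cs x). \<forall>cube\<in>set c. \<forall>va\<in>set cube. fst va \<in> fst ` set (vs x)"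
      unfolding vs_def cs_def by (rule tab_cs_scope[OF k])
    have width: "\<forall>c\<in>set (cs x). \<forall>cube\<in>set c. length cube \<le> 5"
      unfolding cs_def by (rule tab_cs_width)
    obtain f \<gamma> where f: "in_domains f (vs x)" "holds f (cs x)"
      "js_match W ?r (replicate ?N c0) = Some (0, ?N, \<gamma>)"
      "\<forall>v\<in>fst ` set (vs x). \<forall>a. \<gamma> (gid (v @ [a])) = Undefd \<longleftrightarrow> f v \<noteq> a"
      "\<forall>g. \<gamma> g = Undefd \<or> (\<exists>a. \<gamma> g = Closed a (Suc a))"
      "\<forall>f'. in_domains f' (vs x) \<longrightarrow> holds f' (cs x) \<longrightarrow>
        (if mx then objective (rev [0..<Suc (R x)]) f' \<le> objective (rev [0..<Suc (R x)]) f
         else objective (rev [0..<Suc (R x)]) f \<le> objective (rev [0..<Suc (R x)]) f')"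
      using csp_optimum[OF rest dist scope width f0 refl, where W = W and ?c0.0 = c0]
      by (elim exE conjE) (rule that; assumption)
    have "objective (rev [0..<Suc (R x)]) f = F x"
    proof -
      have "objective (rev [0..<Suc (R x)]) f \<in> ntm_outputs M x" unfolding outs using f(1,2) by blast
      note 1 = mx(2)[OF this]
      obtain f1 where "in_domains f1 (vs x)" "holds f1 (cs x)" "objective (rev [0..<Suc (R x)]) f1 = F x"
        using mx(1)[of x] unfolding outs by blast
      then have "if mx then F x \<le> objective (rev [0..<Suc (R x)]) f else objective (rev [0..<Suc (R x)]) f \<le> F x"
        using f(6) by metis
      with 1 show ?thesis by (auto split: if_splits)
    qed
    moreover have "distinct (concat (map var_keys (vs x)))"
      by (rule distinct_var_keys[OF dist]) (rule tab_vars_domains_distinct[OF SL(2) SY(2)], simp only: vs_def)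
    then have r: "?r \<in> js_regexes_no_lower_bound" by (rule csp_regex_in)
    have "jsregmatch W js_regexes_no_lower_bound (T1 x) = enc_answer ?r (Some (0, ?N, \<gamma>))"
      unfolding T1_def csp_instance_def jsregmatch_enc_instance[OF r] f(3) by (rule refl)
    moreover have "bin_val (decode_value mx (R x) (bin (enc_answer ?r (Some (0, ?N, \<gamma>))))) =
        objective (rev [0..<Suc (R x)]) f"
    proof (rule decode_value)
      show "groups ?r = map gid (concat (map var_keys (objective_vars mx (rev [0..<Suc (R x)]) @ rest)))"
        unfolding groups_csp_regex rest by (rule refl)
      show "\<gamma> g = Undefd \<or> (\<exists>a. \<gamma> g = Closed a (Suc a))" for g using f(5) by blast
      show "\<gamma> (gid [0, l, a]) = Undefd \<longleftrightarrow> f [0, l] \<noteq> a" if "l \<le> R x" for l a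
        using f(4) tab_vars_names(1)[OF that] unfolding vs_def by fastforce
      show "f [0, l] \<in> {0, 1}" if "l \<le> R x" for l
        using f(1) that unfolding vs_def in_domains_tab_vars by blast
    qed
    ultimately show ?thesis unfolding T2_def by simp
  qed
  have "fp T1" unfolding T1_def vs_def cs_def
    by (intro fp_csp_instance fp_tab_vars fp_tab_cs fpT fpR ILlen)
  then have "fp (\<lambda>z :: word \<times> word. T1 (fst z))"
    by (rule fp_comp[OF fp_fst[OF fp_id]])
  then have 1: "poly_time_computable (\<lambda>x. [x]) (\<lambda>y. y) T1"
    by (rule poly_time_computable_fp[where u = "\<lambda>x. x" and v = "\<lambda>_. []"]) auto

  have fpR1: "fp (\<lambda>z :: word \<times> word. R (fst z))" by (rule fp_comp[OF fp_fst[OF fp_id] fpR])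
  have "fp (\<lambda>z. dropWhile Not (decode_value mx (R (fst z)) (snd z)))"
    by (intro fp_intros fp_decode_value fpR1)
  then have 2: "poly_time_computable (\<lambda>(x, n). [x, bin n]) bin (\<lambda>(x, n). T2 x n)"
    by (rule poly_time_computable_fp[where u = fst and v = "\<lambda>z. bin (snd z)"])
      (auto simp: T2_def bin_bin_val_strip)
  show "metrically_reducible F (jsregmatch W js_regexes_no_lower_bound)"
    unfolding metrically_reducible_def metric_reduction_def using 1 2 reduction by blast
qed

section \<open>Backtracking as a search guided by choice bits\<close>

type_synonym 'c state = "'c action list \<times> nat \<times> group_map"

text \<open>The recursion of \<open>leaves\<close> unfolded by one step, with the children in
  priority order; no node has more than two.\<close>

fun successors :: "'c set \<Rightarrow> 'c list \<Rightarrow> 'c action list \<Rightarrow> nat \<Rightarrow> group_map \<Rightarrow> 'c state list" where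
  "successors W s [] p \<gamma> = []"
| "successors W s (Acheck k # l) p \<gamma> = (if p > k then [(l, p, \<gamma>)] else [])"
| "successors W s (Aclose g # l) p \<gamma> =
     (case \<gamma> g of Opened a \<Rightarrow> [(l, p, \<gamma>(g := Closed a p))] | _ \<Rightarrow> [])"
| "successors W s (Areg Empty # l) p \<gamma> = [(l, p, \<gamma>)]"
| "successors W s (Areg (Char_Descr A) # l) p \<gamma> =
     (if p < length s \<and> s ! p \<in> A then [(l, p + 1, \<gamma>)] else [])"
| "successors W s (Areg (Disj r1 r2) # l) p \<gamma> = [(Areg r1 # l, p, \<gamma>), (Areg r2 # l, p, \<gamma>)]"
| "successors W s (Areg (Sequ r1 r2) # l) p \<gamma> = [(Areg r1 # Areg r2 # l, p, \<gamma>)]"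
| "successors W s (Areg (Quant m \<Delta> greedy r) # l) p \<gamma> =
     (if m \<noteq> 0 then [(Areg r # Areg (Quant (m - 1) \<Delta> greedy r) # l, p, reset_groups \<gamma> r)]
      else if \<Delta> = 0 then [(l, p, \<gamma>)]
      else
        let iterate = (Areg r # Acheck p # Areg (Quant 0 (\<Delta> - 1) greedy r) # l, p, reset_groups \<gamma> r);
            skip = (l, p, \<gamma>)
        in if greedy then [iterate, skip] else [skip, iterate])"
| "successors W s (Areg (Group g r) # l) p \<gamma> = [(Areg r # Aclose g # l, p, \<gamma>(g := Opened p))]"
| "successors W s (Areg (Anchor a) # l) p \<gamma> = (if anchor_sat W s a p then [(l, p, \<gamma>)] else [])"
| "successors W s (Areg (Backref g) # l) p \<gamma> =
     (case \<gamma> g of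
        Closed a b \<Rightarrow>
          (let w = take (b - a) (drop a s)
           in if occurs_at w s p then [(l, p + length w, \<gamma>)] else [])
      | _ \<Rightarrow> [(l, p, \<gamma>)])"

abbreviation state_leaves :: "'c set \<Rightarrow> 'c list \<Rightarrow> 'c state \<Rightarrow> (nat \<times> group_map) list" where
  "state_leaves W s st \<equiv> (case st of (l, p, \<gamma>) \<Rightarrow> leaves W s l p \<gamma>)"

lemma leaves_successors:
  "l \<noteq> [] \<Longrightarrow> leaves W s l p \<gamma> = concat (map (state_leaves W s) (successors W s l p \<gamma>))"
proof (cases "(W, s, l, p, \<gamma>)" rule: successors.cases)
  case (8 W s m \<Delta> greedy r l p \<gamma>)
  then show ?thesis by (cases m) (auto simp: Let_def)
qed (auto simp: Let_def split: group_status.split)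

lemma length_successors: "length (successors W s l p \<gamma>) \<le> 2"
  by (cases "(W, s, l, p, \<gamma>)" rule: successors.cases) (auto simp: Let_def split: group_status.split)

text \<open>Bits are consumed only at binary nodes, where True selects the child of higher priority;
  bits left over at the end are ignored. The number is fuel, used up by every step.\<close>

fun guided :: "'c set \<Rightarrow> 'c list \<Rightarrow> nat \<Rightarrow> 'c state \<Rightarrow> word \<Rightarrow> (nat \<times> group_map) option" where
  "guided W s n ([], p, \<gamma>) cs = Some (p, \<gamma>)"
| "guided W s 0 (a # l, p, \<gamma>) cs = None"
| "guided W s (Suc n) (a # l, p, \<gamma>) cs =
     (case successors W s (a # l) p \<gamma> of
        [] \<Rightarrow> None
      | [x] \<Rightarrow> guided W s n x cs
      | x # y # _ \<Rightarrow> (case cs of [] \<Rightarrow> None | b # cs' \<Rightarrow> guided W s n (if b then x else y) cs'))"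

lemma guided_sound: "guided W s n st cs = Some res \<Longrightarrow> res \<in> set (state_leaves W s st)"
proof (induction W s n st cs rule: guided.induct)
  case (3 W s n a l p \<gamma> cs)
  then show ?case
    by (subst prod.case)+ (subst leaves_successors, auto split: list.splits if_splits)
qed auto

section \<open>A polynomial bound on the length of branches\<close>

fun quant_depth :: "'c regex \<Rightarrow> nat" where
  "quant_depth (Disj r1 r2) = max (quant_depth r1) (quant_depth r2)"
| "quant_depth (Sequ r1 r2) = max (quant_depth r1) (quant_depth r2)"
| "quant_depth (Group g r) = quant_depth r"
| "quant_depth (Quant m \<Delta> greedy r) = Suc (quant_depth r)"
| "quant_depth _ = 0"

fun checks :: "'c action list \<Rightarrow> nat" where
  "checks [] = 0"
| "checks (Acheck k # l) = Suc (checks l)"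
| "checks (_ # l) = checks l"

text \<open>The next iteration of a quantifier, which stands behind a progress check, is not counted before
  the check is passed; it is paid for by the next character.\<close>

fun weight :: "nat \<Rightarrow> 'c action list \<Rightarrow> nat" where
  "weight p [] = 0"
| "weight p (Areg r # l) = regex_size r + weight p l"
| "weight p (Aclose g # l) = 1 + weight p l"
| "weight p (Acheck k # Areg r # l) = 1 + (if k < p then regex_size r else 0) + weight p l"
| "weight p (Acheck k # l) = 1 + weight p l"

text \<open>Upper bound on the size of the token list that will represent the regex, see
  \<open>csize_tokens\<close>. The constants cover tags, flags and list cells; the factor 4 is the
  cost of a bit in a coded word.\<close>

fun token_size :: "'c regex \<Rightarrow> nat" where
  "token_size Empty = 30"
| "token_size (Char_Descr A) = 30 + 4 * card (UNIV :: 'c set)"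
| "token_size (Disj r1 r2) = 30 + token_size r1 + token_size r2"
| "token_size (Sequ r1 r2) = 30 + token_size r1 + token_size r2"
| "token_size (Group g r) = 30 + 4 * length (bin g) + token_size r"
| "token_size (Backref g) = 30 + 4 * length (bin g)"
| "token_size (Quant m \<Delta> greedy r) = 30 + (case \<Delta> of enat n \<Rightarrow> 4 * length (bin n) | \<infinity> \<Rightarrow> 0) + token_size r"
| "token_size (Anchor a) = 40"

text \<open>\<open>D\<close> bounds the quantifier depth of a regex plus the progress checks behind
  it. Starting an iteration trades one level of depth for one check, so the sum does not grow.
  \<open>A\<close> and \<open>B\<close> bound the size and the storage of the regexes on the
  stack.\<close>

fun proper :: "nat \<Rightarrow> nat \<Rightarrow> nat \<Rightarrow> 'c action list \<Rightarrow> bool" where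
  "proper D A B [] \<longleftrightarrow> True"
| "proper D A B (Areg r # l) \<longleftrightarrow> quant_depth r + checks l \<le> D \<and> regex_size r \<le> A \<and> token_size r \<le> B \<and>
     lower_bounded_free r \<and> proper D A B l"
| "proper D A B (Aclose g # l) \<longleftrightarrow> 30 + 4 * length (bin g) \<le> B \<and> proper D A B l"
| "proper D A B (Acheck k # l) \<longleftrightarrow> proper D A B l"

fun stack_size :: "'c action list \<Rightarrow> nat" where
  "stack_size [] = 0"
| "stack_size (Areg r # l) = token_size r + stack_size l"
| "stack_size (Aclose g # l) = 30 + 4 * length (bin g) + stack_size l"
| "stack_size (Acheck k # l) = 30 + 4 * k + stack_size l"

lemma length_bin_mono: "m \<le> n \<Longrightarrow> length (bin m) \<le> length (bin n)"
proof (induction n arbitrary: m rule: less_induct)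
  case (less n)
  show ?case
  proof (cases "m = 0")
    case False
    then have "length (bin (m div 2)) \<le> length (bin (n div 2))" using less by auto
    then show ?thesis using False less.prems by (simp add: bin_pos)
  qed simp
qed

lemma regex_size_pos: "0 < regex_size r"
  by (cases r) auto

lemma weight_pos: "l \<noteq> [] \<Longrightarrow> 0 < weight p l"
  by (cases "(p, l)" rule: weight.cases) (auto simp: regex_size_pos)

text \<open>Moving forward can only enable iterations that wait behind a check, and each of them
  weighs at most \<open>A\<close>.\<close>

lemma weight_mono: "proper D A B l \<Longrightarrow> p \<le> p' \<Longrightarrow> weight p' l \<le> weight p l + checks l * A"
  by (induction p l rule: weight.induct) auto

lemma token_size_decrement: "token_size (Quant 0 (\<Delta> - 1) greedy r) \<le> token_size (Quant m \<Delta> greedy r)"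
  using length_bin_mono[of "n - 1" n for n]
  by (cases \<Delta>) (auto simp: one_enat_def)

text \<open>The last inequality makes branches polynomial. A character is worth
  \<open>D * A\<close>, which pays for all iterations that become enabled by consuming it, since at
  most \<open>D\<close> checks lie behind the consuming regex. A step that consumes nothing
  decreases the weight: starting an iteration replaces the quantifier by its body and a check, and
  the next iteration is not counted yet.\<close>

lemma successors_proper:
  assumes "(l', p', \<gamma>') \<in> set (successors W s l p \<gamma>)" "proper D A B l" "p \<le> length s"
  shows "proper D A B l'" "p' \<le> length s" "stack_size l' \<le> stack_size l + B + 30 + 4 * length s"
    "weight p' l' + D * A * (length s - p') < weight p l + D * A * (length s - p)"
proof -
  have char: "weight q m + D * A * (length s - q) \<le> weight p m + D * A * (length s - p)"
    if "proper D A B m" "checks m \<le> D" "p < q" "q \<le> length s" for q m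
  proof -
    have "weight q m \<le> weight p m + checks m * A" using weight_mono[OF that(1), of p q] that(3) by simp
    also have "\<dots> \<le> weight p m + D * A" using that by simp
    finally have "weight q m \<le> weight p m + D * A" .
    moreover have "D * A * (length s - q) + D * A \<le> D * A * (length s - p)"
    proof -
      have "Suc (length s - q) \<le> length s - p" using that by simp
      then have "D * A * Suc (length s - q) \<le> D * A * (length s - p)" by (rule mult_le_mono2)
      then show ?thesis by simp
    qed
    ultimately show ?thesis by linarith
  qed
  have "proper D A B l' \<and> p' \<le> length s \<and> stack_size l' \<le> stack_size l + B + 30 + 4 * length s \<and>
    weight p' l' + D * A * (length s - p') < weight p l + D * A * (length s - p)"
    using assms
  proof (cases "(W, s, l, p, \<gamma>)" rule: successors.cases)
    case (2 W s k l p \<gamma>)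
    then show ?thesis using assms by (cases l; cases "hd l") (auto split: if_splits)
  next
    case (5 W s C l p \<gamma>)
    then show ?thesis using assms char[of l "Suc p"] by (auto split: if_splits)
  next
    case (8 W s m \<Delta> greedy r l p \<gamma>)
    have "Suc (Suc (quant_depth r + checks m)) \<le> D \<longleftrightarrow> quant_depth r + Suc (Suc (checks m)) \<le> D" for m :: "'a action list" by simp
    then show ?thesis using 8 assms token_size_decrement[of \<Delta> greedy r m]
      by (auto simp: Let_def split: if_splits)
  next
    case (11 W s g l p \<gamma>)
    show ?thesis
    proof (cases "\<gamma> g")
      case (Closed a b)
      define w where "w = take (b - a) (drop a s)"
      have occ: "occurs_at w s p" and eq: "l' = l" "p' = p + length w"
        using 11 assms(1) Closed by (auto simp: Let_def w_def split: if_splits)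
      then show ?thesis
        using 11 assms char[of l "p + length w"] by (cases "length w = 0") (auto simp: occurs_at_def)
    qed (use 11 assms in auto)
  qed (auto split: if_splits group_status.splits)
  then show "proper D A B l'" "p' \<le> length s" "stack_size l' \<le> stack_size l + B + 30 + 4 * length s"
    "weight p' l' + D * A * (length s - p') < weight p l + D * A * (length s - p)" by auto
qed

text \<open>At a binary node the first child is right if it has a leaf, and any word taking it
  exceeds all words taking the second; otherwise no word taking it succeeds. So the largest
  successful word leads to the first leaf. \<open>n \<le> N\<close> guarantees enough bits for every
  branch.\<close>

lemma guided_optimal:
  assumes "proper D A B l" "p \<le> length s" "weight p l + D * A * (length s - p) \<le> n" "n \<le> N"
    and "leaves W s l p \<gamma> \<noteq> []"
  shows "\<exists>cs. length cs = N \<and> guided W s n (l, p, \<gamma>) cs = Some (hd (leaves W s l p \<gamma>)) \<and>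
    (\<forall>cs'. length cs' = N \<longrightarrow> guided W s n (l, p, \<gamma>) cs' \<noteq> None \<longrightarrow> bin_val cs' \<le> bin_val cs)"
  using assms
proof (induction n arbitrary: l p \<gamma> N)
  case 0
  have "l = []"
    using weight_pos[of l p] 0(3) by (cases "l = []") auto
  have "bin_val cs' \<le> bin_val (replicate N True)" if "length cs' = N" for cs'
    using that bin_val_less[of cs'] bin_val_not[of "replicate N False"] bin_val_leading_False[of N "[]"] by simp
  then show ?case using \<open>l = []\<close> by (intro exI[of _ "replicate N True"]) auto
next
  case (Suc n)
  \<comment> \<open>Bits that remain when a run has ended are arbitrary, so the largest choice
    consists of ones.\<close>
  have top: "bin_val cs' \<le> bin_val (replicate N True)" if "length cs' = N" for cs'
    using that bin_val_less[of cs'] bin_val_not[of "replicate N False"] bin_val_leading_False[of N "[]"] by simp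
  show ?case
  proof (cases l)
    case Nil
    then show ?thesis using top by (intro exI[of _ "replicate N True"]) auto
  next
    case (Cons a m)
    have IH: "\<exists>cs. length cs = N' \<and> guided W s n st cs = Some (hd (state_leaves W s st)) \<and>
      (\<forall>cs'. length cs' = N' \<longrightarrow> guided W s n st cs' \<noteq> None \<longrightarrow> bin_val cs' \<le> bin_val cs)"
      if st: "st \<in> set (successors W s l p \<gamma>)" and ne: "state_leaves W s st \<noteq> []" and "n \<le> N'" for st N'
    proof -
      obtain l' p' \<gamma>' where eq: "st = (l', p', \<gamma>')" by (cases st)
      note suc = successors_proper[OF st[unfolded eq] Suc.prems(1,2)]
      show ?thesis
        using Suc.IH[OF suc(1,2) _ that(3), of \<gamma>'] suc(4) Suc.prems(3) ne unfolding eq by simp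
    qed
    have eq: "leaves W s l p \<gamma> = concat (map (state_leaves W s) (successors W s l p \<gamma>))"
      using leaves_successors Cons by blast
    consider (none) "successors W s l p \<gamma> = []" | (one) x where "successors W s l p \<gamma> = [x]"
      | (two) x y where "successors W s l p \<gamma> = [x, y]"
      using length_successors[of W s l p \<gamma>]
      by (cases "successors W s l p \<gamma>"; cases "tl (successors W s l p \<gamma>)") auto
    then show ?thesis
    proof cases
      case none
      then show ?thesis using Suc.prems(5) eq by simp
    next
      case one
      then show ?thesis
        using IH[of x N] Suc.prems(4,5) eq Cons by simp
    next
      case two
      obtain N' where N': "N = Suc N'" using Suc.prems(4) by (cases N) auto
      have step: "guided W s (Suc n) (l, p, \<gamma>) (b # cs) = guided W s n (if b then x else y) cs" for b cs
        using two Cons by simp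
      have len: "\<exists>b ds. cs = b # ds \<and> length ds = N'" if "length cs = N" for cs :: word
        using that N' by (cases cs) auto
      show ?thesis
      proof (cases "state_leaves W s x = []")
        case False
        obtain cs where cs: "length cs = N'" "guided W s n x cs = Some (hd (state_leaves W s x))"
          "\<And>cs'. length cs' = N' \<Longrightarrow> guided W s n x cs' \<noteq> None \<Longrightarrow> bin_val cs' \<le> bin_val cs"
          using IH[of x N'] two False N' Suc.prems(4) by auto
        show ?thesis
        proof (intro exI[of _ "True # cs"] conjI allI impI)
          show "guided W s (Suc n) (l, p, \<gamma>) (True # cs) = Some (hd (leaves W s l p \<gamma>))"
            using False cs(2) unfolding step eq two by simp
          fix cs' assume "length cs' = N" "guided W s (Suc n) (l, p, \<gamma>) cs' \<noteq> None"
          then obtain b ds where "cs' = b # ds" "length ds = N'" "guided W s n (if b then x else y) ds \<noteq> None"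
            using len step by metis
          then show "bin_val cs' \<le> bin_val (True # cs)"
            using cs(1) cs(3)[of ds] bin_val_less[of ds] by (cases b) (auto simp: bin_val_Cons)
        qed (use cs N' in simp)
      next
        case True
        then have "state_leaves W s y \<noteq> []" using Suc.prems(5) unfolding eq two by simp
        then obtain cs where cs: "length cs = N'" "guided W s n y cs = Some (hd (state_leaves W s y))"
          "\<And>cs'. length cs' = N' \<Longrightarrow> guided W s n y cs' \<noteq> None \<Longrightarrow> bin_val cs' \<le> bin_val cs"
          using IH[of y N'] two N' Suc.prems(4) by auto
        show ?thesis
        proof (intro exI[of _ "False # cs"] conjI allI impI)
          show "guided W s (Suc n) (l, p, \<gamma>) (False # cs) = Some (hd (leaves W s l p \<gamma>))"
            using True cs(2) unfolding step eq two by simp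
          fix cs' assume "length cs' = N" "guided W s (Suc n) (l, p, \<gamma>) cs' \<noteq> None"
          then obtain b ds where ds: "cs' = b # ds" "length ds = N'" "guided W s n (if b then x else y) ds \<noteq> None"
            using len step by metis
          \<comment> \<open>A success through the first child would give it a leaf, by
            soundness.\<close>
          moreover have "\<not> b"
          proof
            assume b
            then obtain res where "guided W s n x ds = Some res" using ds(3) by auto
            from guided_sound[OF this] show False using True by simp
          qed
          ultimately show "bin_val cs' \<le> bin_val (False # cs)"
            using cs(1) cs(3)[of ds] by (auto simp: bin_val_Cons)
        qed (use cs N' in simp)
      qed
    qed
  qed
qed

section \<open>Matching on token lists\<close>

text \<open>A token consists of a tag, a word and two flags: an infinite bound, and greediness.  Action
  lists are flattened to token lists in prefix notation; the tags 8 and 9 stand for \<open>Aclose\<close> and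
  \<open>Acheck\<close>.\<close>

type_synonym token = "nat \<times> word \<times> bool \<times> bool"

fun tokens :: "'c::enum regex \<Rightarrow> token list" where
  "tokens Empty = [(0, [], False, False)]"
| "tokens (Char_Descr A) = [(1, enc_charset A, False, False)]"
| "tokens (Disj r1 r2) = (2, [], False, False) # tokens r1 @ tokens r2"
| "tokens (Sequ r1 r2) = (3, [], False, False) # tokens r1 @ tokens r2"
| "tokens (Group g r) = (4, bin g, False, False) # tokens r"
| "tokens (Backref g) = [(5, bin g, False, False)]"
| "tokens (Quant m \<Delta> greedy r) =
     (6, (case \<Delta> of enat n \<Rightarrow> bin n | \<infinity> \<Rightarrow> []), \<Delta> = \<infinity>, greedy) # tokens r"
| "tokens (Anchor a) = [(7, enc_anchor a, False, False)]"

fun action_tokens :: "'c::enum action \<Rightarrow> token list" where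
  "action_tokens (Areg r) = tokens r"
| "action_tokens (Aclose g) = [(8, bin g, False, False)]"
| "action_tokens (Acheck k) = [(9, replicate k True, False, False)]"

definition stack_tokens :: "'c::enum action list \<Rightarrow> token list" where
  "stack_tokens l = concat (map action_tokens l)"

lemma stack_tokens_simps [simp]:
  "stack_tokens [] = []" "stack_tokens (a # l) = action_tokens a @ stack_tokens l"
  by (simp_all add: stack_tokens_def)

definition arity :: "nat \<Rightarrow> nat" where
  "arity n = (if n = 2 \<or> n = 3 then 2 else if n = 4 \<or> n = 6 then 1 else 0)"

text \<open>Reads prefix notation with a counter of the terms still missing; once it is 0, the
  remaining tokens go to the last component.\<close>

definition split_step :: "nat \<times> token list \<times> token list \<Rightarrow> token \<Rightarrow> nat \<times> token list \<times> token list" where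
  "split_step z t = (if fst z = 0 then (0, fst (snd z), snd (snd z) @ [t])
     else (fst z - 1 + arity (fst t), fst (snd z) @ [t], snd (snd z)))"

definition split_tokens :: "token list \<Rightarrow> nat \<times> token list \<times> token list" where
  "split_tokens ts = foldl split_step (1, [], []) ts"

lemma split_rest: "foldl split_step (0, u, v) ts = (0, u, v @ ts)"
  by (induction ts arbitrary: v) (auto simp: split_step_def)

lemma foldl_split: "foldl split_step (Suc n, u, []) (tokens r @ ts) = foldl split_step (n, u @ tokens r, []) ts"
proof (induction r arbitrary: n u ts)
  case (Disj r1 r2)
  have "split_step (Suc n, u, []) (2, [], False, False) = (Suc (Suc n), u @ [(2, [], False, False)], [])"
    by (simp add: split_step_def arity_def)
  then show ?case using Disj by simp
next
  case (Sequ r1 r2)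
  have "split_step (Suc n, u, []) (3, [], False, False) = (Suc (Suc n), u @ [(3, [], False, False)], [])"
    by (simp add: split_step_def arity_def)
  then show ?case using Sequ by simp
qed (simp_all add: split_step_def arity_def)

lemma split_tokens [simp]: "split_tokens (tokens r @ ts) = (0, tokens r, ts)"
  using foldl_split[of 0 "[]" r ts] by (simp add: split_tokens_def split_rest)

type_synonym entries = "(word \<times> nat \<times> nat \<times> nat) list"

text \<open>The group map is an association list with the latest entry first. The statuses 0, 1, 2
  stand for undefined, opened and closed; a missing group is undefined.\<close>

definition lookup :: "entries \<Rightarrow> word \<Rightarrow> nat \<times> nat \<times> nat" where
  "lookup \<Gamma> g = (case filter (\<lambda>e. fst e = g) \<Gamma> of [] \<Rightarrow> (0, 0, 0) | e # _ \<Rightarrow> snd e)"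

fun status_of :: "nat \<times> nat \<times> nat \<Rightarrow> group_status" where
  "status_of (k, a, b) = (if k = 1 then Opened a else if k = 2 then Closed a b else Undefd)"

definition nth_bit :: "word \<Rightarrow> nat \<Rightarrow> bool" where
  "nth_bit w i = (case drop i w of [] \<Rightarrow> False | b # _ \<Rightarrow> b)"

definition nth_word :: "word list \<Rightarrow> nat \<Rightarrow> word" where
  "nth_word ws i = (case drop i ws of [] \<Rightarrow> [] | w # _ \<Rightarrow> w)"

text \<open>A character belongs to a class iff the two bit vectors share a bit. Beyond the end of
  the string \<open>nth_word\<close> gives the empty vector, which meets nothing.\<close>

definition meets :: "word \<Rightarrow> word \<Rightarrow> bool" where
  "meets u v \<longleftrightarrow> (\<exists>i\<in>set [0..<length u]. nth_bit u i \<and> nth_bit v i)"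

text \<open>Subtraction of 1 from the least significant bit on, with the first component as borrow.
  The empty word stays empty, which suits the representation of an infinite bound.\<close>

definition decrement :: "word \<Rightarrow> word" where
  "decrement w = dropWhile Not (rev (snd (foldl (\<lambda>z b. if fst z then (\<not> b, snd z @ [\<not> b]) else (False, snd z @ [b]))
     (True, []) (rev w))))"

definition token_anchor :: "word \<Rightarrow> word list \<Rightarrow> word \<Rightarrow> nat \<Rightarrow> bool" where
  "token_anchor V ch a p =
     (let wb = ((p > 0 \<and> meets V (nth_word ch (p - 1))) \<noteq> meets V (nth_word ch p)) in
      if a = [False, False] then p = 0 else if a = [False, True] then p = length ch
      else if a = [True, False] then wb else \<not> wb)"

type_synonym mstate = "bool \<times> token list \<times> nat \<times> entries \<times> word"

definition failed :: mstate where
  "failed = (False, [], 0, [], [])"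

text \<open>Mirrors \<open>successors\<close> on token lists. The first child of a quantifier is the
  iteration exactly if it is greedy, so a bit equal to the greediness flag means to iterate.
  Progress checks store their position in unary.\<close>

definition token_step :: "word \<Rightarrow> word list \<Rightarrow> token \<Rightarrow> token list \<Rightarrow> nat \<Rightarrow> entries \<Rightarrow> word \<Rightarrow> mstate" where
  "token_step V ch t l p \<Gamma> cs =
     (if fst t = 0 \<or> fst t = 3 then (True, l, p, \<Gamma>, cs)
      else if fst t = 1 then (if p < length ch \<and> meets (fst (snd t)) (nth_word ch p) then (True, l, Suc p, \<Gamma>, cs) else failed)
      else if fst t = 2 then
        (case cs of [] \<Rightarrow> failed | b # cs' \<Rightarrow>
          (let sp = snd (split_tokens l) in
           if b then (True, fst sp @ snd (snd (split_tokens (snd sp))), p, \<Gamma>, cs') else (True, snd sp, p, \<Gamma>, cs')))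
      else if fst t = 4 then
        (let sp = snd (split_tokens l) in
         (True, fst sp @ (8, fst (snd t), False, False) # snd sp, p, (fst (snd t), 1, p, 0) # \<Gamma>, cs))
      else if fst t = 5 then
        (let e = lookup \<Gamma> (fst (snd t)) in
         if fst e = 2 then
           (let w = take (snd (snd e) - fst (snd e)) (drop (fst (snd e)) ch) in
            if p + length w \<le> length ch \<and> take (length w) (drop p ch) = w then (True, l, p + length w, \<Gamma>, cs) else failed)
         else (True, l, p, \<Gamma>, cs))
      else if fst t = 6 then
        (let sp = snd (split_tokens l) in
         if fst (snd t) = [] \<and> \<not> fst (snd (snd t)) then (True, snd sp, p, \<Gamma>, cs)
         else (case cs of [] \<Rightarrow> failed | b # cs' \<Rightarrow>
           if b = snd (snd (snd t)) then
             (True, fst sp @ (9, replicate p True, False, False) #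
                (6, decrement (fst (snd t)), fst (snd (snd t)), snd (snd (snd t))) # fst sp @ snd sp, p,
              filter (\<lambda>e. fst e \<notin> set (map (\<lambda>t. fst (snd t)) (filter (\<lambda>t. fst t = 4) (fst sp)))) \<Gamma>, cs')
           else (True, snd sp, p, \<Gamma>, cs')))
      else if fst t = 7 then (if token_anchor V ch (fst (snd t)) p then (True, l, p, \<Gamma>, cs) else failed)
      else if fst t = 8 then
        (let e = lookup \<Gamma> (fst (snd t)) in
         if fst e = 1 then (True, l, p, (fst (snd t), 2, fst (snd e), p) # \<Gamma>, cs) else failed)
      else (if p > length (fst (snd t)) then (True, l, p, \<Gamma>, cs) else failed))"

definition mstep :: "word \<Rightarrow> word list \<Rightarrow> mstate \<Rightarrow> mstate" where
  "mstep V ch st = (if fst st then (case fst (snd st) of [] \<Rightarrow> st | t # l \<Rightarrow>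
     token_step V ch t l (fst (snd (snd st))) (fst (snd (snd (snd st)))) (snd (snd (snd (snd st))))) else st)"

subsection \<open>The token machine follows the choice bits\<close>

lemma bin_inj [simp]: "bin m = bin n \<longleftrightarrow> m = n"
  by (metis bin_val_bin)

lemma bin_eq_Nil [simp]: "bin n = [] \<longleftrightarrow> n = 0"
  using bin_inj[of n 0] by simp

lemma nth_bit_charset: "i < length (Enum.enum :: 'c list) \<Longrightarrow> nth_bit (enc_charset A) i \<longleftrightarrow> Enum.enum ! i \<in> (A :: 'c::enum set)"
  by (simp add: nth_bit_def enc_charset_def drop_map Cons_nth_drop_Suc[symmetric])

lemma meets_charset: "meets (enc_charset A) (enc_charset B) \<longleftrightarrow> A \<inter> B \<noteq> ({} :: 'c::enum set)"
proof -
  have "meets (enc_charset A) (enc_charset B) \<longleftrightarrow> (\<exists>i<length (Enum.enum :: 'c list). Enum.enum ! i \<in> A \<and> Enum.enum ! i \<in> B)"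
    unfolding meets_def by (auto simp: nth_bit_charset) (auto simp: enc_charset_def nth_bit_charset[unfolded enc_charset_def])
  also have "\<dots> \<longleftrightarrow> (\<exists>c\<in>set (Enum.enum :: 'c list). c \<in> A \<and> c \<in> B)" by (metis in_set_conv_nth)
  finally show ?thesis by (auto simp: enum_UNIV)
qed

definition chars :: "'c::enum list \<Rightarrow> word list" where
  "chars s = map (\<lambda>c. enc_charset {c}) s"

lemma enc_charset_eq: "enc_charset A = enc_charset B \<longleftrightarrow> A = (B :: 'c::enum set)"
  using enc_charset_inj[of A "[]" B "[]"] by simp

lemma chars_eq: "chars s = chars s' \<longleftrightarrow> s = s'"
proof -
  have "inj (\<lambda>c :: 'a. enc_charset {c})" by (simp add: inj_def enc_charset_eq)
  then show ?thesis unfolding chars_def by (simp add: inj_map_eq_map)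
qed

lemma length_chars [simp]: "length (chars s) = length s"
  by (simp add: chars_def)

lemma meets_nth_word: "meets (enc_charset A) (nth_word (chars s) p) \<longleftrightarrow> p < length s \<and> s ! p \<in> A"
proof (cases "p < length s")
  case True
  then have "nth_word (chars s) p = enc_charset {s ! p}"
    by (simp add: nth_word_def chars_def drop_map Cons_nth_drop_Suc[symmetric])
  then show ?thesis using True by (simp add: meets_charset)
next
  case False
  then show ?thesis by (simp add: nth_word_def chars_def meets_def nth_bit_def)
qed

lemma token_anchor: "p \<le> length s \<Longrightarrow> token_anchor (enc_charset W) (chars s) (enc_anchor a) p \<longleftrightarrow> anchor_sat W s a p"
  by (cases a) (auto simp: token_anchor_def meets_nth_word word_boundary_def)

lemma decrement_bin:
  assumes "0 < n"
  shows "decrement (bin n) = bin (n - 1)"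
proof -
  let ?f = "\<lambda>z b. if fst z then (\<not> b, snd z @ [\<not> b]) else (False, snd z @ [b])"
  have nb: "foldl ?f (False, v) u = (False, v @ u)" for u v
    by (induction u arbitrary: v) auto
  have bv: "bin_val (rev (b # u)) = of_bool b + 2 * bin_val (rev u)" for b u
    by (simp add: bin_val_def)
  \<comment> \<open>The borrow survives to the end exactly for the value 0.\<close>
  have "\<exists>w. foldl ?f (True, v) u = (bin_val (rev u) = 0, v @ w) \<and>
      (0 < bin_val (rev u) \<longrightarrow> bin_val (rev w) = bin_val (rev u) - 1)" for u v
  proof (induction u arbitrary: v)
    case (Cons b u)
    show ?case
    proof (cases b)
      case True
      then show ?thesis using nb[of "v @ [False]" u] bv[of True u] bv[of False u]
        by (intro exI[of _ "False # u"]) auto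
    next
      case False
      obtain w where w: "foldl ?f (True, v @ [True]) u = (bin_val (rev u) = 0, (v @ [True]) @ w)"
        "0 < bin_val (rev u) \<longrightarrow> bin_val (rev w) = bin_val (rev u) - 1" using Cons.IH by blast
      then show ?thesis using False bv[of False u] bv[of True w]
        by (intro exI[of _ "True # w"]) auto
    qed
  qed simp
  from this[of "[]" "rev (bin n)"] assms obtain w where "snd (foldl ?f (True, []) (rev (bin n))) = w"
    "bin_val (rev w) = n - 1" by (auto simp: bin_val_bin)
  then show ?thesis unfolding decrement_def by (simp add: bin_bin_val_strip[symmetric])
qed

lemma group_tokens: "map (\<lambda>t. fst (snd t)) (filter (\<lambda>t. fst t = 4) (tokens r)) = map bin (groups r)"
  by (induction r) auto

text \<open>\<open>N\<close> bounds the positions and \<open>k\<close> the number of steps made so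
  far. Old entries are overridden rather than removed, and each step adds at most one, so the
  association list grows linearly in \<open>k\<close>.\<close>

definition represents :: "nat \<Rightarrow> nat \<Rightarrow> nat \<Rightarrow> mstate \<Rightarrow> 'c::enum state \<Rightarrow> word \<Rightarrow> bool" where
  "represents B N k st x cs \<longleftrightarrow> (case x of (l, p, \<gamma>) \<Rightarrow> \<exists>\<Gamma>. st = (True, stack_tokens l, p, \<Gamma>, cs) \<and>
     (\<forall>g. status_of (lookup \<Gamma> (bin g)) = \<gamma> g) \<and>
     (\<forall>e\<in>set \<Gamma>. fst (snd (snd e)) \<le> N \<and> snd (snd (snd e)) \<le> N) \<and> csize \<Gamma> \<le> 1 + k * (B + 4 * N))"

lemma representsI:
  assumes "st = (True, stack_tokens l, p, \<Gamma>, cs)" "\<And>g. status_of (lookup \<Gamma> (bin g)) = \<gamma> g"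
    "\<And>e. e \<in> set \<Gamma> \<Longrightarrow> fst (snd (snd e)) \<le> N \<and> snd (snd (snd e)) \<le> N" "csize \<Gamma> \<le> 1 + k * (B + 4 * N)"
  shows "represents B N k st (l, p, \<gamma>) cs"
  using assms unfolding represents_def by auto

lemma lookup_Cons: "lookup ((g, e) # \<Gamma>) g' = (if g' = g then e else lookup \<Gamma> g')"
  by (simp add: lookup_def)

lemma lookup_filter: "lookup (filter (\<lambda>e. fst e \<notin> S) \<Gamma>) g = (if g \<in> S then (0, 0, 0) else lookup \<Gamma> g)"
proof -
  have "filter (\<lambda>e. fst e = g) (filter (\<lambda>e. fst e \<notin> S) \<Gamma>) = (if g \<in> S then [] else filter (\<lambda>e. fst e = g) \<Gamma>)"
    by (induction \<Gamma>) auto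
  then show ?thesis by (simp add: lookup_def)
qed

lemma lookup_mem: "fst (lookup \<Gamma> g) \<noteq> 0 \<Longrightarrow> \<exists>e\<in>set \<Gamma>. snd e = lookup \<Gamma> g"
  unfolding lookup_def by (auto split: list.splits dest!: filter_eq_ConsD)

lemma csize_filter: "csize (filter P xs) \<le> csize xs"
  by (induction xs) auto

lemma csize_entry:
  fixes g :: word and k :: nat
  assumes "30 + 4 * length g \<le> B" "k \<le> 2" "a \<le> N" "b \<le> N"
  shows "csize ((g, k, a, b) # \<Gamma>) \<le> csize \<Gamma> + (B + 4 * N)"
  using assms csize_word[of g] by simp

text \<open>The simulation step: the token machine fails where \<open>guided\<close> fails and
  otherwise moves to the same child, consuming a choice bit only if there are two.\<close>

lemma mstep_represents:
  fixes s :: "'c::enum list"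
  assumes rep: "represents B N k st (a # l, p, \<gamma>) cs" and proper: "proper D A B (a # l)"
    and p: "p \<le> length s" and N: "N = length s"
  shows "case successors W s (a # l) p \<gamma> of
      [] \<Rightarrow> mstep (enc_charset W) (chars s) st = failed
    | [x] \<Rightarrow> represents B N (Suc k) (mstep (enc_charset W) (chars s) st) x cs
    | x # y # _ \<Rightarrow> (case cs of [] \<Rightarrow> mstep (enc_charset W) (chars s) st = failed
        | b # cs' \<Rightarrow> represents B N (Suc k) (mstep (enc_charset W) (chars s) st) (if b then x else y) cs')"
proof -
  obtain \<Gamma> where st: "st = (True, action_tokens a @ stack_tokens l, p, \<Gamma>, cs)"
    and \<Gamma>: "\<And>g. status_of (lookup \<Gamma> (bin g)) = \<gamma> g"
    "\<And>e. e \<in> set \<Gamma> \<Longrightarrow> fst (snd (snd e)) \<le> N \<and> snd (snd (snd e)) \<le> N" "csize \<Gamma> \<le> 1 + k * (B + 4 * N)"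
    using rep by (auto simp: represents_def)
  have \<Gamma>3: "csize \<Gamma> \<le> 1 + Suc k * (B + 4 * N)" using \<Gamma>(3) by simp
  have same: "represents B N (Suc k) (True, stack_tokens l', p', \<Gamma>, cs') (l', p', \<gamma>) cs'" for l' :: "'c action list" and p' cs'
    by (rule representsI[OF refl \<Gamma>(1,2) \<Gamma>3])
  let ?m = "mstep (enc_charset W) (chars s) st"
  have m: "?m = token_step (enc_charset W) (chars s) t l' p \<Gamma> cs" if "action_tokens a @ stack_tokens l = t # l'" for t l'
    unfolding mstep_def st that by simp
  show ?thesis
  proof (cases a)
    case (Acheck c)
    then show ?thesis using m same[of l p cs] by (auto simp: token_step_def)
  next
    case (Aclose g)
    then have m: "?m = token_step (enc_charset W) (chars s) (8, bin g, False, False) (stack_tokens l) p \<Gamma> cs"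
      using m by simp
    obtain e1 e2 e3 where e: "lookup \<Gamma> (bin g) = (e1, e2, e3)" by (cases "lookup \<Gamma> (bin g)")
    show ?thesis
    proof (cases "e1 = 1")
      case True
      then have \<gamma>: "\<gamma> g = Opened e2" using \<Gamma>(1)[of g] e by simp
      have "e2 \<le> N" using lookup_mem[of \<Gamma> "bin g"] e True \<Gamma>(2) by fastforce
      then have "represents B N (Suc k) (True, stack_tokens l, p, (bin g, 2, e2, p) # \<Gamma>, cs) (l, p, \<gamma>(g := Closed e2 p)) cs"
        using \<Gamma> csize_entry[of "bin g" B 2 e2 N p \<Gamma>] proper Aclose p N
        by (intro representsI[OF refl]) (auto simp: lookup_Cons)
      then show ?thesis using Aclose m e True \<gamma> by (simp add: token_step_def)
    next
      case False
      then have "\<nexists>x. \<gamma> g = Opened x" using \<Gamma>(1)[of g] e by (auto split: if_splits)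
      then show ?thesis using Aclose m e False by (cases "\<gamma> g") (auto simp: token_step_def)
    qed
  next
    case (Areg r)
    show ?thesis
    proof (cases r)
      case Empty
      then show ?thesis using m Areg same by (simp add: token_step_def)
    next
      case (Char_Descr C)
      then show ?thesis using m Areg same[of l "Suc p"] by (auto simp: token_step_def meets_nth_word)
    next
      case (Disj r1 r2)
      then have "?m = token_step (enc_charset W) (chars s) (2, [], False, False)
          (tokens r1 @ tokens r2 @ stack_tokens l) p \<Gamma> cs"
        using m Areg by simp
      then show ?thesis using Areg Disj same[of "Areg r1 # l" p] same[of "Areg r2 # l" p]
        by (auto simp: token_step_def Let_def split: list.split)
    next
      case (Sequ r1 r2)
      then show ?thesis using m Areg same[of "Areg r1 # Areg r2 # l" p] by (simp add: token_step_def)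
    next
      case (Group g r1)
      then have m: "?m = token_step (enc_charset W) (chars s) (4, bin g, False, False) (tokens r1 @ stack_tokens l) p \<Gamma> cs"
        using m Areg by simp
      have "represents B N (Suc k) (True, stack_tokens (Areg r1 # Aclose g # l), p, (bin g, 1, p, 0) # \<Gamma>, cs)
          (Areg r1 # Aclose g # l, p, \<gamma>(g := Opened p)) cs"
        using \<Gamma> csize_entry[of "bin g" B 1 p N 0 \<Gamma>] proper Areg Group p N
        by (intro representsI[OF refl]) (auto simp: lookup_Cons)
      then show ?thesis using Areg Group m by (simp add: token_step_def Let_def)
    next
      case (Backref g)
      then have m: "?m = token_step (enc_charset W) (chars s) (5, bin g, False, False) (stack_tokens l) p \<Gamma> cs"
        using m Areg by simp
      obtain e1 e2 e3 where e: "lookup \<Gamma> (bin g) = (e1, e2, e3)" by (cases "lookup \<Gamma> (bin g)")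
      show ?thesis
      proof (cases "e1 = 2")
        case True
        then have \<gamma>: "\<gamma> g = Closed e2 e3" using \<Gamma>(1)[of g] e by simp
        let ?w = "take (e3 - e2) (drop e2 s)"
        have w: "take (e3 - e2) (drop e2 (chars s)) = chars ?w"
          by (simp add: chars_def take_map drop_map)
        have "take (length ?w) (drop p (chars s)) = chars (take (length ?w) (drop p s))"
          by (simp add: chars_def take_map drop_map)
        then have "p + length (chars ?w) \<le> length (chars s) \<and> take (length (chars ?w)) (drop p (chars s)) = chars ?w
            \<longleftrightarrow> occurs_at ?w s p"
          unfolding occurs_at_def length_chars chars_eq[symmetric] by simp
        then have "?m = (if occurs_at ?w s p then (True, stack_tokens l, p + length ?w, \<Gamma>, cs) else failed)"
          unfolding m using e True w by (simp add: token_step_def Let_def del: length_take length_drop)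
        then show ?thesis using Areg Backref \<gamma> same[of l "p + length ?w" cs] by (simp add: Let_def del: length_take length_drop)
      next
        case False
        then have "\<nexists>x y. \<gamma> g = Closed x y" using \<Gamma>(1)[of g] e by (auto split: if_splits)
        then show ?thesis using Areg Backref m e False same[of l p cs] by (cases "\<gamma> g") (auto simp: token_step_def)
      qed
    next
      case (Quant q \<Delta> greedy r1)
      have q: "q = 0" using proper Areg Quant by simp
      let ?d = "case \<Delta> of enat n \<Rightarrow> bin n | \<infinity> \<Rightarrow> []"
      have m: "?m = token_step (enc_charset W) (chars s) (6, ?d, \<Delta> = \<infinity>, greedy) (tokens r1 @ stack_tokens l) p \<Gamma> cs"
        using m Areg Quant by simp
      show ?thesis
      proof (cases "\<Delta> = 0")
        case True
        then show ?thesis using Areg Quant q m same[of l p cs] by (simp add: token_step_def zero_enat_def Let_def)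
      next
        case False
        then have d: "\<not> (?d = [] \<and> \<Delta> \<noteq> \<infinity>)" by (cases \<Delta>) (auto simp: zero_enat_def)
        have dec: "tokens (Quant 0 (\<Delta> - 1) greedy r1) = (6, decrement ?d, \<Delta> = \<infinity>, greedy) # tokens r1"
        proof (cases \<Delta>)
          case (enat n)
          then show ?thesis using False decrement_bin[of n] by (auto simp: one_enat_def zero_enat_def)
        next
          case infinity
          then show ?thesis by (simp add: decrement_def)
        qed
        let ?\<Gamma> = "filter (\<lambda>e. fst e \<notin> set (map bin (groups r1))) \<Gamma>"
        let ?l = "Areg r1 # Acheck p # Areg (Quant 0 (\<Delta> - 1) greedy r1) # l"
        have it: "represents B N (Suc k) (True, stack_tokens ?l, p, ?\<Gamma>, cs') (?l, p, reset_groups \<gamma> r1) cs'" for cs'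
          using \<Gamma>(1,2) \<Gamma>3 csize_filter[of "\<lambda>e. fst e \<notin> set (map bin (groups r1))" \<Gamma>]
          by (intro representsI[OF refl]) (auto simp: lookup_filter reset_groups_def)
        have tk: "stack_tokens ?l = tokens r1 @ (9, replicate p True, False, False) #
            (6, decrement ?d, \<Delta> = \<infinity>, greedy) # tokens r1 @ stack_tokens l"
          using dec by (simp del: tokens.simps)
        have "?m = (case cs of [] \<Rightarrow> failed | b # cs' \<Rightarrow> if b = greedy then (True, stack_tokens ?l, p, ?\<Gamma>, cs')
            else (True, stack_tokens l, p, \<Gamma>, cs'))"
          unfolding m tk using d
          by (cases "\<Delta> = \<infinity>") (simp_all add: token_step_def Let_def group_tokens del: not_infinity_eq split: list.split)
        then show ?thesis using Areg Quant q False it same[of l p]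
          by (auto simp: Let_def split: list.split)
      qed
    next
      case (Anchor b)
      then show ?thesis using m Areg same[of l p cs] token_anchor[OF p, of W b] by (auto simp: token_step_def)
    qed
  qed
qed


section \<open>Runs of the token machine\<close>

lemma mstep_failed [simp]: "(mstep V ch ^^ n) failed = failed"
  by (induction n) (simp_all add: mstep_def failed_def)

lemma mstep_finished: "fst (snd st) = [] \<Longrightarrow> (mstep V ch ^^ n) st = st"
  by (induction n) (simp_all add: mstep_def)

text \<open>\<open>S\<close> is the initial stack size; every step adds at most the storage of one
  regex, a closing token or a check, so the stack grows linearly in the number of steps.\<close>

definition proper_run :: "nat \<Rightarrow> nat \<Rightarrow> nat \<Rightarrow> 'c::enum list \<Rightarrow> nat \<Rightarrow> nat \<Rightarrow> mstate \<Rightarrow> 'c state \<Rightarrow> word \<Rightarrow> bool" where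
  "proper_run D A B s S k st x cs \<longleftrightarrow> represents B (length s) k st x cs \<and> proper D A B (fst x) \<and>
     fst (snd x) \<le> length s \<and> stack_size (fst x) \<le> S + k * (B + 30 + 4 * length s)"

lemma proper_run_step:
  fixes s :: "'c::enum list"
  assumes run: "proper_run D A B s S k st x cs" and ne: "fst x \<noteq> []"
  shows "(mstep (enc_charset W) (chars s) st = failed \<and> (\<forall>n. guided W s (Suc n) x cs = None)) \<or>
    (\<exists>y cs'. proper_run D A B s S (Suc k) (mstep (enc_charset W) (chars s) st) y cs' \<and> length cs' \<le> length cs \<and>
      (\<forall>n. guided W s (Suc n) x cs = guided W s n y cs'))"
proof -
  obtain a l p \<gamma> where x: "x = (a # l, p, \<gamma>)" using ne by (cases x; cases "fst x") auto
  let ?m = "mstep (enc_charset W) (chars s) st"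
  have *: "represents B (length s) k st (a # l, p, \<gamma>) cs" "proper D A B (a # l)" "p \<le> length s"
    "stack_size (a # l) \<le> S + k * (B + 30 + 4 * length s)" using run unfolding proper_run_def x by auto
  have run': "proper_run D A B s S (Suc k) ?m y cs'"
    if "y \<in> set (successors W s (a # l) p \<gamma>)" "represents B (length s) (Suc k) ?m y cs'" for y cs'
  proof -
    obtain l' p' \<gamma>' where y: "y = (l', p', \<gamma>')" by (cases y)
    show ?thesis using successors_proper[OF that(1)[unfolded y] *(2,3)] that(2) *(4) unfolding proper_run_def y
      by simp
  qed
  note rep = mstep_represents[OF *(1,2,3) refl, of W]
  show ?thesis
  proof (cases "successors W s (a # l) p \<gamma>")
    case Nil
    then show ?thesis using rep x by simp
  next
    case x1: (Cons y1 ys)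
    show ?thesis
    proof (cases ys)
      case Nil
      then show ?thesis using rep x x1 run'[of y1 cs] by (intro disjI2 exI[of _ y1] exI[of _ cs]) auto
    next
      case x2: (Cons y2 ys')
      show ?thesis
      proof (cases cs)
        case Nil
        then show ?thesis using rep x x1 x2 by simp
      next
        case (Cons b cs')
        then show ?thesis using rep x x1 x2 run'[of "if b then y1 else y2" cs']
          by (intro disjI2 exI[of _ "if b then y1 else y2"] exI[of _ cs']) auto
      qed
    qed
  qed
qed

lemma proper_run_steps:
  fixes s :: "'c::enum list" and W :: "'c set"
  assumes "proper_run D A B s S k st x cs"
  shows "(mstep (enc_charset W) (chars s) ^^ n) st = failed \<or>
    (\<exists>k' y cs'. k' \<le> k + n \<and> proper_run D A B s S k' ((mstep (enc_charset W) (chars s) ^^ n) st) y cs' \<and> length cs' \<le> length cs)"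
  using assms
proof (induction n arbitrary: k st x cs)
  case (Suc n)
  show ?case
  proof (cases "fst x = []")
    case True
    then have "fst (snd st) = []" using Suc.prems by (auto simp: proper_run_def represents_def split: prod.splits)
    then show ?thesis using Suc.prems mstep_finished[of st "Suc n" "enc_charset W" "chars s"] by (metis le_add1 order_refl)
  next
    case False
    from proper_run_step[OF Suc.prems this, of W] show ?thesis
    proof (elim disjE exE conjE)
      fix y cs' assume y: "proper_run D A B s S (Suc k) (mstep (enc_charset W) (chars s) st) y cs'" "length cs' \<le> length cs"
      from Suc.IH[OF y(1)] show ?thesis
        using y(2) by (fastforce simp: funpow_Suc_right simp del: funpow.simps)
    qed (simp add: funpow_Suc_right del: funpow.simps)
  qed
next
  case 0
  then show ?case by (metis add_0_right eq_id_iff funpow_0 order_refl)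
qed

lemma action_tokens_neq_Nil [simp]: "action_tokens a \<noteq> []"
proof (cases a)
  case (Areg r)
  then show ?thesis by (cases r) auto
qed auto

text \<open>Finished and failed states are fixed points, so running the machine for exactly the fuel
  of \<open>guided\<close> gives the same outcome; success is recognised by an empty token
  list.\<close>

lemma guided_mstep:
  fixes s :: "'c::enum list" and W :: "'c set" and n :: nat
  assumes "proper_run D A B s S k st x cs"
  defines "st' \<equiv> (mstep (enc_charset W) (chars s) ^^ n) st"
  shows "case guided W s n x cs of None \<Rightarrow> \<not> (fst st' \<and> fst (snd st') = [])
    | Some (p, \<gamma>) \<Rightarrow> \<exists>\<Gamma> cs'. st' = (True, [], p, \<Gamma>, cs') \<and> (\<forall>g. status_of (lookup \<Gamma> (bin g)) = \<gamma> g)"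
  using assms(1) unfolding st'_def
proof (induction n arbitrary: k st x cs)
  case 0
  then show ?case
    by (cases "(W, s, 0 :: nat, x, cs)" rule: guided.cases) (auto simp: proper_run_def represents_def)
next
  case (Suc n)
  show ?case
  proof (cases "fst x = []")
    case True
    then obtain p \<gamma> where x: "x = ([], p, \<gamma>)" by (cases x) auto
    obtain \<Gamma> where \<Gamma>: "st = (True, [], p, \<Gamma>, cs)" "\<forall>g. status_of (lookup \<Gamma> (bin g)) = \<gamma> g"
      using Suc.prems unfolding x by (auto simp: proper_run_def represents_def)
    show ?thesis using mstep_finished[of st "Suc n" "enc_charset W" "chars s"] \<Gamma> unfolding x by auto
  next
    case False
    from proper_run_step[OF Suc.prems this, of W] show ?thesis
    proof (elim disjE exE conjE)
      assume "mstep (enc_charset W) (chars s) st = failed" "\<forall>n. guided W s (Suc n) x cs = None"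
      then show ?thesis by (simp add: funpow_Suc_right del: funpow.simps guided.simps) (simp add: failed_def)
    next
      fix y cs' assume y: "proper_run D A B s S (Suc k) (mstep (enc_charset W) (chars s) st) y cs'"
        "\<forall>n. guided W s (Suc n) x cs = guided W s n y cs'"
      from Suc.IH[OF y(1)] show ?thesis
        using y(2) unfolding funpow_Suc_right o_apply by simp
    qed
  qed
qed

section \<open>Sizes and feasibility of the token machine\<close>

lemma csize_tokens: "csize (tokens r) \<le> 1 + token_size r"
  for r :: "'c::enum regex"
proof (induction r)
  case (Char_Descr A)
  then show ?case using csize_word[of "enc_charset A"] csize_bool[of False] by (simp add: length_enc_charset)
next
  case (Disj r1 r2)
  then show ?case using csize_append[of "tokens r1" "tokens r2"] csize_bool[of False] by simp
next
  case (Sequ r1 r2)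
  then show ?case using csize_append[of "tokens r1" "tokens r2"] csize_bool[of False] by simp
next
  case (Group g r)
  then show ?case using csize_word[of "bin g"] csize_bool[of False] by simp
next
  case (Backref g)
  then show ?case using csize_word[of "bin g"] csize_bool[of False] by simp
next
  case (Quant m \<Delta> greedy r)
  then show ?case using csize_word[of "bin (the_enat \<Delta>)"] csize_bool[of greedy] csize_bool[of False] csize_bool[of True]
    by (cases \<Delta>) simp_all
next
  case (Anchor a)
  then show ?case using csize_bool[of False] csize_bool[of True] by (cases a) auto
qed (use csize_bool[of False] in auto)

lemma csize_stack_tokens: "csize (stack_tokens l) \<le> 1 + stack_size l"
proof (induction l)
  case (Cons a l)
  then show ?case
  proof (cases a)
    case (Areg r)
    then show ?thesis using Cons csize_append[of "tokens r" "stack_tokens l"] csize_tokens[of r] by simp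
  next
    case (Aclose g)
    then show ?thesis using Cons csize_word[of "bin g"] csize_bool[of False] by simp
  next
    case (Acheck k)
    then show ?thesis using Cons csize_word[of "replicate k True"] csize_bool[of False] by simp
  qed
qed simp

lemma proper_run_csize:
  assumes "proper_run D A B s S k st x cs" "k \<le> n"
  shows "csize st \<le> 20 + S + n * (2 * B + 30 + 8 * length s) + 2 * length s + 4 * length cs"
proof -
  obtain l p \<gamma> \<Gamma> where eq: "x = (l, p, \<gamma>)" "st = (True, stack_tokens l, p, \<Gamma>, cs)" and
    \<Gamma>: "csize \<Gamma> \<le> 1 + k * (B + 4 * length s)" "p \<le> length s"
    "stack_size l \<le> S + k * (B + 30 + 4 * length s)"
    using assms(1) unfolding proper_run_def represents_def by (cases x) auto
  have "k * (2 * B + 30 + 8 * length s) \<le> n * (2 * B + 30 + 8 * length s)" using assms(2) by (rule mult_le_mono1)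
  moreover have "k * (B + 4 * length s) + k * (B + 30 + 4 * length s) = k * (2 * B + 30 + 8 * length s)" by algebra
  ultimately show ?thesis using \<Gamma> csize_stack_tokens[of l] csize_word[of cs] csize_bool[of True] unfolding eq csize_simps by linarith
qed


text \<open>The environment is passed along inside the iterated state, so that the step may depend
  on the input.\<close>

lemma fp_funpow_env:
  fixes n :: "'a::codable \<Rightarrow> nat" and h :: "'e::codable \<Rightarrow> 's::codable \<Rightarrow> 's"
  assumes h: "fp (\<lambda>z. h (fst z) (snd z))" and e: "fp e" "fp n" "fp i" and q: "pbound q"
    and bound: "\<And>x k. k \<le> n x \<Longrightarrow> csize ((h (e x) ^^ k) (i x)) \<le> q (csize x)"
  shows "fp (\<lambda>x. (h (e x) ^^ n x) (i x))"
proof -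
  let ?F = "\<lambda>z. (fst z, h (fst z) (snd z))"
  have eq: "(?F ^^ k) (a, b) = (a, (h a ^^ k) b)" for k a b
    by (induction k) auto
  obtain T where T: "pbound T" "\<And>x. csize (e x) \<le> T (csize x)"
    using fp_csize[OF e(1)] by metis
  have "fp (\<lambda>x. (?F ^^ length (replicate (n x) ())) (e x, i x))"
  proof (rule fp_funpow_length[where q = "\<lambda>n. T n + q n + 1"])
    fix x k
    assume "k \<le> length (replicate (n x) ())"
    then show "csize ((?F ^^ k) (e x, i x)) \<le> T (csize x) + q (csize x) + 1"
      using T(2)[of x] bound[of k x] by (simp add: eq)
  qed (use assms T in \<open>auto intro!: fp_basic fp_units pbound_intros\<close>)
  from fp_snd[OF this] show ?thesis by (simp add: eq)
qed

lemma fp_split_tokens: "fp f \<Longrightarrow> fp (\<lambda>x. split_tokens (f x))"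
proof (rule fp_comp[of f split_tokens], assumption)
  have "fp (\<lambda>ts. foldl split_step (1, [], []) ts)"
  proof (rule fp_foldl_additive[where q = "\<lambda>n. n + 10"])
    show "csize (split_step a t) \<le> csize a + (csize x + csize t + 10)" for a t and x :: "token list"
      using csize_append[of "fst (snd a)" "[t]"] csize_append[of "snd (snd a)" "[t]"]
      by (cases a) (auto simp: split_step_def arity_def)
    show "fp (\<lambda>z. split_step (fst (snd z)) (snd (snd z)))"
      unfolding split_step_def arity_def by (intro fp_intros)
  qed (auto intro!: fp_intros pbound_intros monoI)
  then show "fp split_tokens" unfolding split_tokens_def by simp
qed

lemma fp_decrement: "fp f \<Longrightarrow> fp (\<lambda>x. decrement (f x))"
proof (rule fp_comp[of f decrement], assumption)
  let ?h = "\<lambda>z b. if fst z then (\<not> b, snd z @ [\<not> b]) else (False, snd z @ [b])"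
  have "fp (\<lambda>w :: word. foldl ?h (True, []) (rev w))"
  proof (rule fp_foldl_additive[where q = "\<lambda>n. n + 10"])
    show "csize (?h a b) \<le> csize a + (csize x + csize b + 10)" for a b and x :: word
      using csize_append[of "snd a" "[\<not> b]"] csize_append[of "snd a" "[b]"] csize_bool[of "\<not> b"] csize_bool[of False]
      by (cases a) auto
  qed (auto intro!: fp_intros pbound_intros monoI)
  then show "fp decrement" unfolding decrement_def[abs_def] by (intro fp_intros fp_snd)
qed

lemma fp_lookup: "fp f \<Longrightarrow> fp g \<Longrightarrow> fp (\<lambda>x. lookup (f x) (g x))"
  unfolding lookup_def by (intro fp_intros; (rule fp_comp[of fst], intro fp_intros)?)

lemma fp_nth_bit: "fp f \<Longrightarrow> fp g \<Longrightarrow> fp (\<lambda>x. nth_bit (f x) (g x))"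
  unfolding nth_bit_def by (intro fp_intros)

lemma fp_nth_word: "fp f \<Longrightarrow> fp g \<Longrightarrow> fp (\<lambda>x. nth_word (f x) (g x))"
  unfolding nth_word_def by (intro fp_intros)

lemma fp_meets: "fp f \<Longrightarrow> fp g \<Longrightarrow> fp (\<lambda>x. meets (f x) (g x))"
  unfolding meets_def by (intro fp_intros fp_nth_bit; (rule fp_comp[of fst], intro fp_intros)?)

lemma fp_token_anchor:
  "fp V \<Longrightarrow> fp ch \<Longrightarrow> fp a \<Longrightarrow> fp p \<Longrightarrow> fp (\<lambda>x. token_anchor (V x) (ch x) (a x) (p x))"
  unfolding token_anchor_def by (intro fp_intros fp_meets fp_nth_word; (rule fp_comp[of fst], intro fp_intros)?)

lemma fp_token_step: "fp (\<lambda>z. token_step V (fst z) (fst (snd z)) (fst (snd (snd z))) (fst (snd (snd (snd z))))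
    (fst (snd (snd (snd (snd z))))) (snd (snd (snd (snd (snd z))))))"
  unfolding token_step_def
  by (intro fp_intros fp_split_tokens fp_decrement fp_lookup fp_meets fp_nth_word fp_token_anchor)

lemma fp_mstep: "fp (\<lambda>z. mstep V (fst z) (snd z))"
proof -
  have *: "fp (\<lambda>z. token_step V (ch z) (t z) (l z) (p z) (\<Gamma> z) (cs z))"
    if "fp ch" "fp t" "fp l" "fp p" "fp \<Gamma>" "fp cs" for ch t l p \<Gamma> cs
    using fp_comp[OF _ fp_token_step, of "\<lambda>z. (ch z, t z, l z, p z, \<Gamma> z, cs z)"] that by (simp add: fp_basic)
  show ?thesis unfolding mstep_def by (intro fp_basic *)
qed

section \<open>Parsing instances\<close>

text \<open>The number code of instances applied to arbitrary words, which also serves to delimit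
  words in the output.\<close>

definition pairs :: "word \<Rightarrow> word" where
  "pairs a = concat (map (\<lambda>b. [True, b]) a) @ [False]"

lemma enc_nat_pairs: "enc_nat n = pairs (bin n)"
  by (simp add: enc_nat_def pairs_def)

text \<open>Mode 0 is in front of a pair, 1 inside it, and 2 behind the closing 0.\<close>

definition unpair_step :: "nat \<times> word \<times> word \<Rightarrow> bool \<Rightarrow> nat \<times> word \<times> word" where
  "unpair_step z b =
     (if fst z = 0 then (if b then 1 else 2, snd z)
      else if fst z = 1 then (0, fst (snd z) @ [b], snd (snd z))
      else (2, fst (snd z), snd (snd z) @ [b]))"

definition unpair :: "word \<Rightarrow> word \<times> word" where
  "unpair w = snd (foldl unpair_step (0, [], []) w)"

lemma unpair_pairs [simp]: "unpair (pairs a @ u) = (a, u)"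
proof -
  have 1: "foldl unpair_step (2, x, y) u = (2, x, y @ u)" for x y
    by (induction u arbitrary: y) (auto simp: unpair_step_def)
  have "foldl unpair_step (0, x, []) (pairs a @ u) = (2, x @ a, u)" for x
    by (induction a arbitrary: x) (auto simp: pairs_def unpair_step_def 1)
  then show ?thesis by (simp add: unpair_def)
qed

lemma length_unpair: "length (fst (unpair w)) + length (snd (unpair w)) \<le> length w"
proof -
  have "length (fst (snd (foldl unpair_step z w))) + length (snd (snd (foldl unpair_step z w)))
      \<le> length (fst (snd z)) + length (snd (snd z)) + length w" for z
  proof (induction w arbitrary: z)
    case (Cons b w)
    have "length (fst (snd (unpair_step z b))) + length (snd (snd (unpair_step z b)))
        \<le> length (fst (snd z)) + length (snd (snd z)) + 1"
      by (simp add: unpair_step_def)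
    then show ?case using Cons[of "unpair_step z b"] by simp
  qed simp
  from this[of "(0, [], [])"] show ?thesis by (simp add: unpair_def)
qed

text \<open>Total, with arbitrary results on malformed words; for a quantifier the code of the
  minimum is skipped unread. \<open>well_formed\<close> makes up for both by encoding the result
  again.\<close>

definition parse_token :: "nat \<Rightarrow> word \<Rightarrow> token \<times> word" where
  "parse_token K w =
     (let tag = (if nth_bit w 0 then 4 else 0) + (if nth_bit w 1 then 2 else 0) + (if nth_bit w 2 then 1 else 0);
        v = drop 3 w in
      if tag = 1 then ((tag, take K v, False, False), drop K v)
      else if tag = 4 \<or> tag = 5 then ((tag, fst (unpair v), False, False), snd (unpair v))
      else if tag = 6 then
        (let u = snd (unpair v) in
         if nth_bit u 0 then ((tag, [], True, nth_bit u 1), drop 2 u)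
         else let q = unpair (drop 1 u) in ((tag, fst q, False, nth_bit (snd q) 0), drop 1 (snd q)))
      else if tag = 7 then ((tag, take 2 v, False, False), drop 2 v)
      else ((tag, [], False, False), v))"

definition enc_token :: "token \<Rightarrow> word" where
  "enc_token t =
     (if fst t = 0 then [False, False, False]
      else if fst t = 1 then [False, False, True] @ fst (snd t)
      else if fst t = 2 then [False, True, False]
      else if fst t = 3 then [False, True, True]
      else if fst t = 4 then [True, False, False] @ pairs (fst (snd t))
      else if fst t = 5 then [True, False, True] @ pairs (fst (snd t))
      else if fst t = 6 then [True, True, False, False] @
        (if fst (snd (snd t)) then [True] else False # pairs (fst (snd t))) @ [snd (snd (snd t))]
      else [True, True, True] @ fst (snd t))"

text \<open>Makes tokens canonical, so that encoding loses nothing: numerals have no leading zeros,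
  and fields without meaning for the tag have default values.\<close>

definition valid_token :: "nat \<Rightarrow> token \<Rightarrow> bool" where
  "valid_token K t \<longleftrightarrow> fst t \<le> 7 \<and> (fst t \<noteq> 6 \<longrightarrow> snd (snd t) = (False, False)) \<and>
     (if fst t = 1 then length (fst (snd t)) = K else if fst t = 7 then length (fst (snd t)) = 2
      else if fst t = 4 \<or> fst t = 5 \<or> fst t = 6
      then dropWhile Not (fst (snd t)) = fst (snd t) \<and> (fst (snd (snd t)) \<longrightarrow> fst (snd t) = [])
      else fst (snd t) = [])"

definition tokenise_step :: "nat \<Rightarrow> nat \<times> token list \<times> word \<Rightarrow> nat \<times> token list \<times> word" where
  "tokenise_step K z = (if fst z = 0 then z else
     (let q = parse_token K (snd (snd z)) in (fst z - 1 + arity (fst (fst q)), fst (snd z) @ [fst q], snd q)))"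

definition tokenise :: "nat \<Rightarrow> word \<Rightarrow> token list \<times> word" where
  "tokenise K w = snd ((tokenise_step K ^^ length w) (1, [], w))"

definition chunks :: "nat \<Rightarrow> word \<Rightarrow> word list" where
  "chunks K w = filter (\<lambda>v. v \<noteq> []) (map (\<lambda>i. take K (drop (i * K) w)) [0..<length w])"

definition group_ids :: "token list \<Rightarrow> word list" where
  "group_ids ts = map (\<lambda>t. fst (snd t)) (filter (\<lambda>t. fst t = 4) ts)"

text \<open>Membership is tested by parsing and encoding again: the parser does without error
  handling, and comparison with the input rejects whatever it misread, lower bounds
  included.\<close>

definition well_formed :: "nat \<Rightarrow> word list \<Rightarrow> word \<Rightarrow> bool" where
  "well_formed K CH w \<longleftrightarrow> (let ts = fst (tokenise K w); ch = chunks K (snd (tokenise K w)) in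
     concat (map enc_token ts) @ concat ch = w \<and> (\<forall>t\<in>set ts. valid_token K t) \<and> (\<forall>v\<in>set ch. v \<in> set CH) \<and>
     split_tokens ts = (0, ts, []) \<and>
     (\<forall>g\<in>set (group_ids ts). length (filter (\<lambda>h. h = g) (group_ids ts)) = 1))"

section \<open>Correctness of the parser\<close>

lemma bin_val_canonical: "dropWhile Not (bin n) = bin n"
  using bin_bin_val_strip[of "bin n"] by (simp add: bin_val_bin)

lemma valid_tokens: "lower_bounded_free r \<Longrightarrow> \<forall>t\<in>set (tokens r). valid_token (card (UNIV :: 'c set)) t"
  for r :: "'c::enum regex"
proof (induction r)
  case (Quant m \<Delta> greedy r)
  then show ?case by (cases \<Delta>) (auto simp: valid_token_def bin_val_canonical)
next
  case (Anchor a)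
  then show ?case by (cases a) (auto simp: valid_token_def)
qed (auto simp: valid_token_def length_enc_charset bin_val_canonical)

lemma enc_tokens: "lower_bounded_free r \<Longrightarrow> concat (map enc_token (tokens r)) = enc_regex r"
proof (induction r)
  case (Quant m \<Delta> greedy r)
  then show ?case by (cases \<Delta>) (auto simp: enc_token_def enc_nat_pairs pairs_def)
qed (auto simp: enc_token_def enc_nat_pairs)

lemma parse_enc_token:
  assumes "valid_token K t"
  shows "parse_token K (enc_token t @ u) = (t, u)"
proof -
  obtain n a i g where t: "t = (n, a, i, g)" by (cases t)
  have "n \<le> 7" using assms by (simp add: valid_token_def t)
  then consider "n = 0" | "n = 1" | "n = 2" | "n = 3" | "n = 4" | "n = 5" | "n = 6" | "n = 7" by linarith
  moreover have q: "unpair (False # v) = ([], v)" for v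
    using unpair_pairs[of "[]" v] by (simp add: pairs_def)
  ultimately show ?thesis using assms unfolding t
    by cases (auto simp: parse_token_def enc_token_def valid_token_def nth_bit_def q Let_def)
qed

lemma tokenise_step_token:
  "valid_token K t \<Longrightarrow> tokenise_step K (Suc n, ts, enc_token t @ u) = (n + arity (fst t), ts @ [t], u)"
  by (simp add: tokenise_step_def parse_enc_token)

lemma split_neq_0: "foldl split_step (n, u, []) (t # ts) = (0, u', []) \<Longrightarrow> n \<noteq> 0"
proof
  assume "foldl split_step (n, u, []) (t # ts) = (0, u', [])" "n = 0"
  moreover have "split_step (0, u, []) t = (0, u, [t])" by (simp add: split_step_def)
  ultimately show False by (simp add: split_rest)
qed

text \<open>Each token takes at least one bit, so as many rounds as the word has bits suffice;
  surplus rounds idle with the counter at 0.\<close>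

lemma tokenise_tokens:
  assumes valid: "\<forall>t\<in>set ts. valid_token K t" and split: "split_tokens ts = (0, ts, [])"
  shows "tokenise K (concat (map enc_token ts) @ v) = (ts, v)"
proof -
  have "(tokenise_step K ^^ length ts) (n, u, concat (map enc_token ts) @ v) = (0, u', v)"
    if "foldl split_step (n, u, []) ts = (0, u', [])" for n u u'
    using that valid
  proof (induction ts arbitrary: n u)
    case (Cons t ts)
    obtain m where n: "n = Suc m" using split_neq_0[OF Cons.prems(1)] not0_implies_Suc by blast
    have "foldl split_step (m + arity (fst t), u @ [t], []) ts = (0, u', [])"
      using Cons.prems(1) by (simp add: n split_step_def[of "(Suc m, u, [])"])
    from Cons.IH[OF this] Cons.prems(2) show ?case
      using tokenise_step_token[of K t m u "concat (map enc_token ts) @ v"]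
      by (simp add: n funpow_Suc_right del: funpow.simps)
  qed simp
  then have 1: "(tokenise_step K ^^ length ts) (1, [], concat (map enc_token ts) @ v) = (0, ts, v)"
    using split by (simp add: split_tokens_def)
  have idle: "(tokenise_step K ^^ k) (0, ts, v) = (0, ts, v)" for k
    by (induction k) (auto simp: tokenise_step_def)
  have "1 \<le> length (enc_token t)" for t by (simp add: enc_token_def)
  then have "length ts \<le> length (concat (map enc_token ts))"
  proof (induction ts)
    case (Cons t ts)
    have "1 + length ts \<le> length (enc_token t) + length (concat (map enc_token ts))"
      by (rule add_mono[OF Cons.prems Cons.IH[OF Cons.prems]])
    then show ?case by simp
  qed simp
  then obtain k where "length (concat (map enc_token ts) @ v) = k + length ts"
    by (metis add.commute le_Suc_ex length_append trans_le_add1)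
  then show ?thesis unfolding tokenise_def by (simp only: funpow_add o_apply 1 idle snd_conv)
qed

text \<open>Prefix notation is read from the right: the tokens behind \<open>t\<close> form a
  forest, and \<open>t\<close> takes as many trees from its front as its arity says. Validity
  supplies the contents of the new root.\<close>

lemma regex_of_tokens:
  assumes "\<forall>t\<in>set ts. valid_token (card (UNIV :: 'c::enum set)) t" "split_tokens ts = (0, ts, [])"
  shows "\<exists>r :: 'c regex. lower_bounded_free r \<and> tokens r = ts"
proof -
  have charset: "\<exists>A :: 'c set. enc_charset A = a" if "length a = card (UNIV :: 'c set)" for a
  proof
    show "enc_charset {c :: 'c. (c, True) \<in> set (zip Enum.enum a)} = a"
    proof (rule nth_equalityI)
      fix i assume "i < length (enc_charset {c :: 'c. (c, True) \<in> set (zip Enum.enum a)})"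
      then have i: "i < length (Enum.enum :: 'c list)" "i < length a"
        using that by (auto simp: enc_charset_def card_UNIV_length_enum)
      then show "enc_charset {c :: 'c. (c, True) \<in> set (zip Enum.enum a)} ! i = a ! i"
        using nth_eq_iff_index_eq[OF enum_distinct, of i] by (auto simp: enc_charset_def set_zip)
    qed (use that in \<open>simp add: length_enc_charset\<close>)
  qed
  have number: "\<exists>n. bin n = a" if "dropWhile Not a = a" for a
    using that bin_bin_val_strip[of a] by auto
  have anchor: "\<exists>b. enc_anchor b = a" if two: "length a = 2" for a
  proof -
    obtain x y where a: "a = [x, y]" using two by (auto simp: numeral_2_eq_2 length_Suc_conv)
    show ?thesis unfolding a
      by (rule exI[of _ "if x then if y then Non_Word_Boundary else Word_Boundary else if y then Input_End else Input_Start"])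
        simp
  qed
  have "\<exists>rs :: 'c regex list. length rs = n \<and> (\<forall>r\<in>set rs. lower_bounded_free r) \<and> concat (map tokens rs) = ts"
    if "foldl split_step (n, u, []) ts = (0, u', [])" for n u u'
    using that assms(1)
  proof (induction ts arbitrary: n u)
    case (Cons t ts)
    obtain m where n: "n = Suc m" using split_neq_0[OF Cons.prems(1)] not0_implies_Suc by blast
    have "foldl split_step (m + arity (fst t), u @ [t], []) ts = (0, u', [])"
      using Cons.prems(1) by (simp add: n split_step_def[of "(Suc m, u, [])"])
    from Cons.IH[OF this] Cons.prems(2) obtain rs :: "'c regex list" where rs: "length rs = m + arity (fst t)"
      "\<forall>r\<in>set rs. lower_bounded_free r" "concat (map tokens rs) = ts" by auto
    obtain k a i g where t: "t = (k, a, i, g)" by (cases t)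
    have v: "valid_token (card (UNIV :: 'c set)) (k, a, i, g)" using Cons.prems(2) by (simp add: t)
    have leaf: ?case if "arity k = 0" "lower_bounded_free r" "tokens r = [t]" for r :: "'c regex"
      using that rs by (intro exI[of _ "r # rs"]) (auto simp: n t)
    have unary: ?case if "arity k = 1" "\<And>r :: 'c regex. lower_bounded_free (f r) = lower_bounded_free r"
      "\<And>r. tokens (f r) = t # tokens r" for f :: "'c regex \<Rightarrow> 'c regex"
      using that rs by (cases rs) (auto simp: n t intro!: exI[of _ "f (hd rs) # tl rs"])
    have binary: ?case if "arity k = 2" "\<And>r s :: 'c regex. lower_bounded_free (f r s) = (lower_bounded_free r \<and> lower_bounded_free s)"
      "\<And>r s. tokens (f r s) = t # tokens r @ tokens s" for f :: "'c regex \<Rightarrow> 'c regex \<Rightarrow> 'c regex"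
      using that rs by (cases rs; cases "tl rs") (auto simp: n t intro!: exI[of _ "f (hd rs) (hd (tl rs)) # tl (tl rs)"])
    have "k \<le> 7" using v by (simp add: valid_token_def)
    then consider "k = 0" | "k = 1" | "k = 2" | "k = 3" | "k = 4" | "k = 5" | "k = 6" | "k = 7" by linarith
    then show ?case
    proof cases
      case 1
      then show ?thesis using leaf[of Empty] v by (auto simp: t arity_def valid_token_def)
    next
      case 2
      then obtain A :: "'c set" where "enc_charset A = a" using charset[of a] v by (auto simp: valid_token_def)
      then show ?thesis using 2 leaf[of "Char_Descr A"] v by (auto simp: t arity_def valid_token_def)
    next
      case 3
      then show ?thesis using binary[of Disj] v by (auto simp: t arity_def valid_token_def)
    next
      case 4
      then show ?thesis using binary[of Sequ] v by (auto simp: t arity_def valid_token_def)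
    next
      case 5
      then obtain x where "bin x = a" using number[of a] v by (auto simp: valid_token_def)
      then show ?thesis using 5 unary[of "Group x"] v by (auto simp: t arity_def valid_token_def)
    next
      case 6
      then obtain x where "bin x = a" using number[of a] v by (auto simp: valid_token_def)
      then show ?thesis using 6 leaf[of "Backref x"] v by (auto simp: t arity_def valid_token_def)
    next
      case 7
      then obtain x where "bin x = a" using number[of a] v by (auto simp: valid_token_def)
      then show ?thesis using 7 unary[of "Quant 0 (if i then \<infinity> else enat x) g"] v by (auto simp: t arity_def valid_token_def)
    next
      case 8
      then obtain x where "enc_anchor x = a" using anchor[of a] v by (auto simp: valid_token_def)
      then show ?thesis using 8 leaf[of "Anchor x"] v by (auto simp: t arity_def valid_token_def)
    qed
  qed auto
  from this[of 1 "[]" ts] assms(2) obtain rs :: "'c regex list"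
    where "length rs = 1" "\<forall>r\<in>set rs. lower_bounded_free r" "concat (map tokens rs) = ts" by (auto simp: split_tokens_def)
  then show ?thesis by (auto simp: length_Suc_conv)
qed

lemma chunks_concat:
  assumes "\<forall>v\<in>set ws. length v = K" "0 < K"
  shows "chunks K (concat ws) = ws"
proof -
  have nth: "take K (drop (i * K) (concat ws)) = ws ! i" if "i < length ws" for i
    using that assms(1)
  proof (induction ws arbitrary: i)
    case (Cons v ws)
    then show ?case by (cases i) auto
  qed simp
  have len: "length (concat ws) = length ws * K" using assms(1) by (induction ws) auto
  then have "[0..<length (concat ws)] = [0..<length ws] @ [length ws..<length (concat ws)]"
    using assms(2) upt_add_eq_append[of 0 "length ws" "length ws * K - length ws"] by simp
  moreover have "map (\<lambda>i. take K (drop (i * K) (concat ws))) [0..<length ws] = ws"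
    by (rule nth_equalityI) (auto simp: nth)
  moreover have "filter (\<lambda>v. v \<noteq> []) ws = ws" using assms by (auto simp: filter_id_conv)
  moreover have "filter (\<lambda>v. v \<noteq> []) (map (\<lambda>i. take K (drop (i * K) (concat ws))) [length ws..<length (concat ws)]) = []"
    using len by (auto simp: filter_empty_conv)
  ultimately show ?thesis unfolding chunks_def by (simp only: map_append filter_append append_Nil2)
qed

text \<open>Brings distinctness into a form covered by the closure properties.\<close>

lemma distinct_count: "distinct xs \<longleftrightarrow> (\<forall>x\<in>set xs. length (filter (\<lambda>y. y = x) xs) = 1)"
proof (induction xs)
  case (Cons a xs)
  have "length (filter (\<lambda>y. y = x) xs) = 0 \<longleftrightarrow> x \<notin> set xs" for x by (auto simp: filter_empty_conv)
  then show ?case using Cons by auto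
qed simp

lemma distinct_group_ids: "distinct (groups r) \<longleftrightarrow>
    (\<forall>g\<in>set (group_ids (tokens r)). length (filter (\<lambda>h. h = g) (group_ids (tokens r))) = 1)"
  unfolding group_ids_def group_tokens distinct_count[symmetric] by (simp add: distinct_map inj_on_def)

abbreviation char_codes :: "'c::enum itself \<Rightarrow> word list" where
  "char_codes _ \<equiv> map (\<lambda>c :: 'c. enc_charset {c}) Enum.enum"

lemma well_formed_instance:
  fixes r :: "'c::enum regex"
  assumes "r \<in> js_regexes_no_lower_bound"
  shows "well_formed (card (UNIV :: 'c set)) (char_codes TYPE('c)) (enc_instance r s)"
    "tokenise (card (UNIV :: 'c set)) (enc_instance r s) = (tokens r, enc_string s)"
    "chunks (card (UNIV :: 'c set)) (enc_string s) = chars s"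
proof -
  have lbf: "lower_bounded_free r" and dist: "distinct (groups r)"
    using assms by (auto simp: js_regexes_no_lower_bound_def js_regexes_def)
  show ch: "chunks (card (UNIV :: 'c set)) (enc_string s) = chars s"
    unfolding enc_string_def chars_def[symmetric]
    by (rule chunks_concat) (auto simp: chars_def length_enc_charset card_gt_0_iff)
  have split: "split_tokens (tokens r) = (0, tokens r, [])"
    using split_tokens[of r "[]"] by simp
  show tk: "tokenise (card (UNIV :: 'c set)) (enc_instance r s) = (tokens r, enc_string s)"
    unfolding enc_instance_def enc_tokens[OF lbf, symmetric]
    by (rule tokenise_tokens[OF valid_tokens[OF lbf] split])
  have "concat (chars s) = enc_string s" by (simp add: chars_def enc_string_def)
  moreover have "v \<in> set (char_codes TYPE('c))" if "v \<in> set (chars s)" for v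
    using that by (auto simp: chars_def enum_UNIV)
  ultimately show "well_formed (card (UNIV :: 'c set)) (char_codes TYPE('c)) (enc_instance r s)"
    using dist valid_tokens[OF lbf] unfolding well_formed_def Let_def distinct_group_ids
    by (simp add: enc_tokens[OF lbf] split enc_instance_def tk[unfolded enc_instance_def] ch)
qed

text \<open>Words that encode no instance must be answered by 0, so whatever the parser accepts has
  to come from an instance.\<close>

lemma well_formed_sound:
  assumes "well_formed (card (UNIV :: 'c::enum set)) (char_codes TYPE('c)) w"
  shows "\<exists>r\<in>js_regexes_no_lower_bound :: 'c regex set. \<exists>s. w = enc_instance r s"
proof -
  define ts where "ts = fst (tokenise (card (UNIV :: 'c set)) w)"
  define ch where "ch = chunks (card (UNIV :: 'c set)) (snd (tokenise (card (UNIV :: 'c set)) w))"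
  note wf = assms[unfolded well_formed_def, folded ts_def ch_def, unfolded Let_def]
  obtain r :: "'c regex" where r: "lower_bounded_free r" "tokens r = ts"
    using regex_of_tokens[of ts] wf by metis
  have "\<forall>v\<in>set ch. \<exists>c :: 'c. v = enc_charset {c}" using wf by auto
  then obtain s :: "'c list" where "ch = chars s"
    unfolding chars_def by (metis ex_map_conv)
  then have "concat ch = enc_string s" by (simp add: chars_def enc_string_def)
  moreover have "r \<in> js_regexes_no_lower_bound"
    using wf r distinct_group_ids[of r] by (simp add: js_regexes_no_lower_bound_def js_regexes_def)
  moreover have "enc_regex r @ concat ch = w" using wf enc_tokens[OF r(1)] r(2) by simp
  ultimately show ?thesis unfolding enc_instance_def by blast
qed


section \<open>Feasibility of the parser\<close>

lemma fp_pairs: "fp f \<Longrightarrow> fp (\<lambda>x. pairs (f x))"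
  unfolding pairs_def by (intro fp_intros)

lemma fp_unpair: "fp f \<Longrightarrow> fp (\<lambda>x. unpair (f x))"
proof (rule fp_comp[of f unpair], assumption)
  have "fp (\<lambda>w. foldl unpair_step (0, [], []) w)"
  proof (rule fp_foldl_additive[where q = "\<lambda>n. n + 10"])
    show "csize (unpair_step a t) \<le> csize a + (csize x + csize t + 10)" for a t and x :: word
      using csize_append[of "fst (snd a)" "[t]"] csize_append[of "snd (snd a)" "[t]"]
      by (cases a) (auto simp: unpair_step_def)
    show "fp (\<lambda>z. unpair_step (fst (snd z)) (snd (snd z)))"
      unfolding unpair_step_def by (intro fp_intros)
  qed (auto intro!: fp_intros pbound_intros monoI)
  then show "fp unpair" unfolding unpair_def[abs_def] by (rule fp_snd)
qed

lemma fp_parse_token: "fp f \<Longrightarrow> fp (\<lambda>x. parse_token K (f x))"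
proof (rule fp_comp[of f "parse_token K"], assumption)
  show "fp (parse_token K)"
    unfolding parse_token_def[abs_def] by (intro fp_intros fp_unpair fp_nth_bit; (rule fp_comp[of fst], intro fp_intros)?)
qed

lemma length_parse_token:
  "length (fst (snd (fst (parse_token K w)))) + length (snd (parse_token K w)) \<le> length w"
  using length_unpair[of "drop 3 w"] length_unpair[of "drop 1 (snd (unpair (drop 3 w)))"]
  by (auto simp: parse_token_def Let_def)

lemma fp_tokenise: "fp f \<Longrightarrow> fp (\<lambda>x. tokenise K (f x))"
proof (rule fp_comp[of f "tokenise K"], assumption)
  have F: "fp (tokenise_step K)"
    unfolding tokenise_step_def[abs_def] arity_def by (intro fp_intros fp_parse_token)
  \<comment> \<open>The word in a token is cut out of the unread input, so every token has size
    linear in the input, and the counter grows by a bounded amount per round.\<close>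
  have inv: "length (snd (snd ((tokenise_step K ^^ k) (1, [], w)))) \<le> length w \<and>
    fst ((tokenise_step K ^^ k) (1, [], w)) \<le> 1 + 2 * k \<and>
    csize (fst (snd ((tokenise_step K ^^ k) (1, [], w)))) \<le> 1 + k * (40 + 4 * length w)" for k w
  proof (induction k)
    case (Suc k)
    obtain n ts v where z: "(tokenise_step K ^^ k) (1, [], w) = (n, ts, v)"
      by (cases "(tokenise_step K ^^ k) (1, [], w)")
    obtain t a i g u where q: "parse_token K v = ((t, a, i, g), u)" by (cases "parse_token K v") auto
    have "t \<le> 7" using q by (auto simp: parse_token_def Let_def split: if_splits)
    then have "csize (t, a, i, g) \<le> 30 + 4 * length a"
      using csize_word[of a] csize_bool[of i] csize_bool[of g] by simp
    moreover have "length a + length u \<le> length v" using length_parse_token[of K v] by (simp add: q)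
    moreover have "tokenise_step K (n, ts, v) =
        (if n = 0 then (n, ts, v) else (n - 1 + arity t, ts @ [(t, a, i, g)], u))"
      by (simp add: tokenise_step_def q)
    ultimately show ?case using Suc[unfolded z] csize_append[of ts "[(t, a, i, g)]"]
      unfolding funpow.simps o_apply z by (auto simp: arity_def simp del: funpow.simps)
  qed simp
  have "fp (\<lambda>w. (tokenise_step K ^^ length w) (1, [], w))"
  proof (rule fp_funpow_length[where q = "\<lambda>n. 10 + 9 * n + n * (40 + 4 * n)"])
    fix w :: word and k
    assume k: "k \<le> length w"
    obtain n ts v where z: "(tokenise_step K ^^ k) (1, [], w) = (n, ts, v)"
      by (cases "(tokenise_step K ^^ k) (1, [], w)")
    have "k * (40 + 4 * length w) \<le> csize w * (40 + 4 * csize w)"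
      using k length_le_csize[of w] by (intro mult_le_mono) auto
    then show "csize ((tokenise_step K ^^ k) (1, [], w)) \<le> 10 + 9 * csize w + csize w * (40 + 4 * csize w)"
      using inv[of k w] k length_le_csize[of w] csize_word[of v] unfolding z csize_simps fst_conv snd_conv by linarith
  qed (auto intro!: F fp_intros pbound_intros)
  then show "fp (tokenise K)" unfolding tokenise_def[abs_def] by (rule fp_snd)
qed

lemma fp_chunks: "fp f \<Longrightarrow> fp (\<lambda>x. chunks K (f x))"
proof (rule fp_comp[of f "chunks K"], assumption)
  show "fp (chunks K)" unfolding chunks_def[abs_def]
    by (intro fp_intros; (rule fp_comp[of fst], intro fp_intros)?)
qed

lemma fp_group_ids: "fp f \<Longrightarrow> fp (\<lambda>x. group_ids (f x))"
  unfolding group_ids_def by (intro fp_intros)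

lemma fp_enc_token: "fp f \<Longrightarrow> fp (\<lambda>x. enc_token (f x))"
  unfolding enc_token_def by (intro fp_intros fp_pairs)

lemma fp_valid_token: "fp f \<Longrightarrow> fp (\<lambda>x. valid_token K (f x))"
  unfolding valid_token_def by (intro fp_intros)

lemma fp_well_formed: "fp f \<Longrightarrow> fp (\<lambda>x. well_formed K CH (f x))"
proof (rule fp_comp[of f "well_formed K CH"], assumption)
  show "fp (well_formed K CH)" unfolding well_formed_def[abs_def]
    by (intro fp_intros fp_tokenise fp_chunks fp_enc_token fp_valid_token fp_split_tokens fp_group_ids;
        (rule fp_comp[of fst], intro fp_intros)?)
qed

section \<open>Matching is solvable in OptP\<close>

definition status_word :: "nat \<times> nat \<times> nat \<Rightarrow> word" where
  "status_word e = (if fst e = 1 then [False, True] @ pairs (bin (fst (snd e)))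
     else if fst e = 2 then True # pairs (bin (fst (snd e))) @ pairs (bin (snd (snd e)))
     else [False, False])"

lemma status_word: "status_word e = enc_status (status_of e)"
  by (cases e) (auto simp: status_word_def enc_nat_pairs)

text \<open>The initial measure of \<open>successors_proper\<close> with D = A = n: at most
  \<open>n\<close> for the regex, and \<open>n * n\<close> for each of at most \<open>n\<close>
  characters.\<close>

definition fuel :: "nat \<Rightarrow> nat" where
  "fuel n = n + n * n * n"

text \<open>A choice word consists of \<open>k\<close> zeros, a 1 and the choice bits, where
  \<open>k\<close> is the start position: the earlier the start, the larger the number.\<close>

definition start_state_of :: "nat \<Rightarrow> word list \<Rightarrow> word \<times> word \<Rightarrow> mstate" where
  "start_state_of K CH z =
     (let c = dropWhile Not (snd z); k = length (snd z) - length c in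
      if well_formed K CH (fst z) \<and> c \<noteq> [] \<and> k \<le> length (chunks K (snd (tokenise K (fst z))))
      then (True, fst (tokenise K (fst z)), k, [], tl c) else failed)"

definition final_state :: "nat \<Rightarrow> word list \<Rightarrow> word \<Rightarrow> word \<times> word \<Rightarrow> mstate" where
  "final_state K CH V z = (mstep V (chunks K (snd (tokenise K (fst z)))) ^^ fuel (length (fst z))) (start_state_of K CH z)"

text \<open>The choice word is preceded by its length in unary, so that the result can be decoded
  without knowing the instance.\<close>

definition result_word :: "nat \<Rightarrow> word list \<Rightarrow> word \<Rightarrow> word \<times> word \<Rightarrow> word" where
  "result_word K CH V z =
     (let st = final_state K CH V z in
      if fst st \<and> fst (snd st) = [] then
        replicate (length (snd z)) True @ False # snd z @
        pairs (True # pairs (bin (length (snd z) - length (dropWhile Not (snd z)))) @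
          pairs (bin (fst (snd (snd st)))) @
          concat (map (\<lambda>a. pairs a @ status_word (lookup (fst (snd (snd (snd st)))) a))
            (group_ids (fst (tokenise K (fst z))))))
      else [])"

text \<open>The unary length tells how many choice bits to skip; the padding behind the pair code is
  cut off by \<open>unpair\<close>.\<close>

definition unwrap :: "word \<Rightarrow> word" where
  "unwrap w = (let v = dropWhile (\<lambda>b. b) w in fst (unpair (drop (Suc (length w - length v)) v)))"

lemma unwrap: "unwrap (replicate (length c) True @ False # c @ pairs a @ u) = a"
proof -
  have "dropWhile (\<lambda>b. b) (replicate m True @ False # v) = False # v" for m v
    by (induction m) auto
  then show ?thesis by (simp add: unwrap_def Let_def)
qed

lemma token_size_le: "token_size r \<le> (40 + 4 * card (UNIV :: 'c set)) * regex_size r + 4 * number_bits r"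
  for r :: "'c regex"
proof (induction r)
  case (Quant m \<Delta> k r)
  then show ?case by (cases \<Delta>) (auto simp: algebra_simps)
qed (auto simp: algebra_simps)

lemma quant_depth_le: "quant_depth r \<le> regex_size r"
  by (induction r) auto

text \<open>The 44 is 40 + 4, the storage per unit of size and per bit of a number in
  \<open>token_size_le\<close>; the remaining part of the factor accounts for character
  sets.\<close>

lemma initial_run:
  fixes r :: "'c::enum regex"
  assumes "lower_bounded_free r" "length (enc_instance r s) \<le> n" "k \<le> length s"
  defines "B \<equiv> (44 + 4 * card (UNIV :: 'c set)) * n"
  shows "proper_run n n B s B 0 (True, tokens r, k, [], cs) ([Areg r], k, \<lambda>_. Undefd) cs"
    and "weight k [Areg r] + n * n * (length s - k) \<le> fuel n"
proof -
  have n: "regex_size r + number_bits r + length s \<le> n"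
    using length_enc_instance(1)[of r s] assms(2) by simp
  have "token_size r \<le> (44 + 4 * card (UNIV :: 'c set)) * (regex_size r + number_bits r)"
    using token_size_le[of r] by (simp add: algebra_simps)
  also have "\<dots> \<le> B" unfolding B_def using n by (intro mult_le_mono2) simp
  finally have B: "token_size r \<le> B" .
  show "proper_run n n B s B 0 (True, tokens r, k, [], cs) ([Areg r], k, \<lambda>_. Undefd) cs"
    unfolding proper_run_def
    using B n quant_depth_le[of r] assms(1,3) by (auto intro!: representsI simp: lookup_def)
  have "n * n * (length s - k) \<le> n * n * n" using n by (intro mult_le_mono2) simp
  then show "weight k [Areg r] + n * n * (length s - k) \<le> fuel n"
    using n unfolding fuel_def weight.simps by linarith
qed

lemma dropWhile_leading: "dropWhile Not (replicate k False @ True # cs) = True # cs"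
  by (induction k) auto

lemma start_state_of_instance:
  fixes r :: "'c::enum regex"
  assumes "r \<in> js_regexes_no_lower_bound"
  shows "start_state_of (card (UNIV :: 'c set)) (char_codes TYPE('c)) (enc_instance r s, replicate k False @ True # cs) =
    (if k \<le> length s then (True, tokens r, k, [], cs) else failed)"
  using well_formed_instance[OF assms, of s] by (simp add: start_state_of_def dropWhile_leading)

lemma start_state_of_failed:
  "\<not> well_formed K CH x \<or> dropWhile Not c = [] \<Longrightarrow> start_state_of K CH (x, c) = failed"
  by (auto simp: start_state_of_def Let_def)

lemma leading_False: "dropWhile Not c = [] \<or> (\<exists>k cs. c = replicate k False @ True # cs)"
proof (cases "dropWhile Not c")
  case (Cons b cs)
  then have "b" by (auto simp: dropWhile_eq_Cons_conv)
  moreover have "takeWhile Not c = replicate (length (takeWhile Not c)) False"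
    by (rule replicate_eqI[OF refl]) (auto dest: set_takeWhileD)
  ultimately show ?thesis using takeWhile_dropWhile_id[of Not c] Cons by metis
next
  case Nil
  then show ?thesis by (rule disjI1)
qed

definition answer_bits :: "'c regex \<Rightarrow> nat \<Rightarrow> nat \<Rightarrow> group_map \<Rightarrow> word" where
  "answer_bits r k p \<gamma> = True # enc_nat k @ enc_nat p @ concat (map (\<lambda>g. enc_nat g @ enc_status (\<gamma> g)) (groups r))"

lemma result_word_failed: "start_state_of K CH z = failed \<Longrightarrow> result_word K CH V z = []"
  by (simp add: result_word_def final_state_def Let_def) (simp add: failed_def)

lemma result_word_instance:
  fixes r :: "'c::enum regex" and k :: nat and cs :: word
  assumes r: "r \<in> js_regexes_no_lower_bound"
  defines "c \<equiv> replicate k False @ True # cs"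
  shows "result_word (card (UNIV :: 'c set)) (char_codes TYPE('c)) (enc_charset W) (enc_instance r s, c) =
    (if k \<le> length s then
      (case guided W s (fuel (length (enc_instance r s))) ([Areg r], k, \<lambda>_. Undefd) cs of
         None \<Rightarrow> []
       | Some (p, \<gamma>) \<Rightarrow> replicate (length c) True @ False # c @ pairs (answer_bits r k p \<gamma>))
     else [])"
proof (cases "k \<le> length s")
  case False
  then show ?thesis using result_word_failed[of "card (UNIV :: 'c set)" "char_codes TYPE('c)"]
      start_state_of_instance[OF r, of s k cs] by (simp add: c_def)
next
  case True
  let ?K = "card (UNIV :: 'c set)" and ?CH = "char_codes TYPE('c)" and ?x = "enc_instance r s"
  have lbf: "lower_bounded_free r" using r by (simp add: js_regexes_no_lower_bound_def)
  have k: "length c - length (dropWhile Not c) = k"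
    by (simp add: c_def dropWhile_leading)
  let ?st = "final_state ?K ?CH (enc_charset W) (?x, c)"
  have st: "?st = (mstep (enc_charset W) (chars s) ^^ fuel (length ?x)) (True, tokens r, k, [], cs)"
    using True start_state_of_instance[OF r, of s k cs]
    by (simp add: final_state_def well_formed_instance[OF r] c_def)
  note run = guided_mstep[OF initial_run(1)[OF lbf order_refl True, of cs], where W = W and n = "fuel (length ?x)",
      folded st]
  have ids: "group_ids (fst (tokenise ?K ?x)) = map bin (groups r)"
    by (simp add: well_formed_instance[OF r] group_ids_def group_tokens)
  show ?thesis
  proof (cases "guided W s (fuel (length ?x)) ([Areg r], k, \<lambda>_. Undefd) cs")
    case None
    then show ?thesis using run True by (simp add: result_word_def Let_def)
  next
    case (Some res)
    obtain p \<gamma> where res: "res = (p, \<gamma>)" by (cases res)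
    obtain \<Gamma> cs' where "?st = (True, [], p, \<Gamma>, cs')" "\<forall>g. status_of (lookup \<Gamma> (bin g)) = \<gamma> g"
      using run Some res by auto
    then show ?thesis using Some res True
      by (simp add: result_word_def Let_def k ids answer_bits_def enc_nat_pairs status_word o_def)
  qed
qed

text \<open>A quantifier step copies its operand, so the invariant of proper runs is called for to
  bound the sizes. It is available on all inputs, because every start state is \<open>failed\<close>
  or stems from an instance.\<close>

lemma csize_final_state:
  fixes z :: "word \<times> word"
  assumes "k \<le> fuel (length (fst z))"
  defines "K \<equiv> card (UNIV :: 'c::enum set)" and "m \<equiv> csize z"
  shows "csize ((mstep (enc_charset (W :: 'c set)) (chunks K (snd (tokenise K (fst z)))) ^^ k) (start_state_of K (char_codes TYPE('c)) z))
    \<le> 20 + (44 + 4 * K) * m + fuel m * (2 * ((44 + 4 * K) * m) + 30 + 8 * m) + 6 * m + csize failed"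
proof (cases "start_state_of K (char_codes TYPE('c)) z = failed")
  case True
  then show ?thesis by simp
next
  case False
  obtain x c where z: "z = (x, c)" by (cases z)
  obtain j cs where c: "c = replicate j False @ True # cs"
    using leading_False[of c] start_state_of_failed[of K "char_codes TYPE('c)" x c] False z by blast
  have "well_formed K (char_codes TYPE('c)) x" using start_state_of_failed False z by blast
  then obtain r :: "'c regex" and s where r: "r \<in> js_regexes_no_lower_bound" "x = enc_instance r s"
    using well_formed_sound unfolding K_def by blast
  have lbf: "lower_bounded_free r" using r by (simp add: js_regexes_no_lower_bound_def)
  have j: "j \<le> length s" and start: "start_state_of K (char_codes TYPE('c)) z = (True, tokens r, j, [], cs)"
    using False start_state_of_instance[OF r(1), of s j cs] unfolding z c r(2) K_def by (auto split: if_splits)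
  have ch: "chunks K (snd (tokenise K (fst z))) = chars s"
    unfolding z r(2) K_def using well_formed_instance[OF r(1)] by simp
  have len: "length x \<le> m" "length cs \<le> m" "length s \<le> m"
    using length_le_csize[of x] length_le_csize[of c] length_enc_instance(1)[of r s] r(2) unfolding m_def z by (auto simp: c)
  have "fuel (length x) \<le> fuel m" unfolding fuel_def using len by (intro add_mono mult_le_mono) auto
  then have k: "0 + k \<le> fuel m" using assms(1) z by simp
  have "length (enc_instance r s) \<le> m" using len r(2) by simp
  note run = initial_run(1)[OF lbf this j, of cs, folded K_def]
  from proper_run_steps[OF run, of k W] show ?thesis
  proof (elim disjE exE conjE)
    assume "(mstep (enc_charset W) (chars s) ^^ k) (True, tokens r, j, [], cs) = failed"
    then show ?thesis by (simp add: ch start)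
  next
    fix k' y cs' assume k': "k' \<le> 0 + k" "length cs' \<le> length cs"
      and *: "proper_run m m ((44 + 4 * K) * m) s ((44 + 4 * K) * m) k'
        ((mstep (enc_charset W) (chars s) ^^ k) (True, tokens r, j, [], cs)) y cs'"
    have "fuel m * (2 * ((44 + 4 * K) * m) + 30 + 8 * length s) \<le> fuel m * (2 * ((44 + 4 * K) * m) + 30 + 8 * m)"
      using len by (intro mult_le_mono2) simp
    then show ?thesis using proper_run_csize[OF * order_trans[OF k'(1) k]] k'(2) len unfolding ch start by linarith
  qed
qed

lemma fp_fuel: "fp f \<Longrightarrow> fp (\<lambda>x. fuel (f x))"
  unfolding fuel_def by (intro fp_intros)

lemma fp_final_state:
  fixes W :: "'c::enum set"
  shows "fp (final_state (card (UNIV :: 'c set)) (char_codes TYPE('c)) (enc_charset W))"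
  unfolding final_state_def[abs_def]
proof (rule fp_funpow_env)
  show "fp (\<lambda>z. mstep (enc_charset W) (fst z) (snd z))" by (rule fp_mstep)
  show "fp (start_state_of (card (UNIV :: 'c set)) (char_codes TYPE('c)))"
    unfolding start_state_of_def[abs_def] failed_def
    by (intro fp_intros fp_well_formed fp_tokenise fp_chunks)
  let ?K = "card (UNIV :: 'c set)"
  show "pbound (\<lambda>m. 20 + (44 + 4 * ?K) * m + fuel m * (2 * ((44 + 4 * ?K) * m) + 30 + 8 * m) + 6 * m + csize failed)"
    unfolding fuel_def by (intro pbound_intros)
qed (rule csize_final_state, assumption | intro fp_intros fp_chunks fp_tokenise fp_fuel)+

lemma fp_result_word:
  fixes W :: "'c::enum set"
  shows "fp (result_word (card (UNIV :: 'c set)) (char_codes TYPE('c)) (enc_charset W))"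
  unfolding result_word_def[abs_def] status_word_def
  by (intro fp_intros fp_bin fp_pairs fp_lookup fp_group_ids fp_tokenise fp_final_state;
      (rule fp_comp[of fst], intro fp_intros fp_final_state)?)

section \<open>Optimality of the output\<close>

lemma bin_val_append: "bin_val (u @ v) = bin_val u * 2 ^ length v + bin_val v"
  by (induction u) (auto simp: bin_val_Cons power_add algebra_simps)

lemma bin_val_inj: "length u = length v \<Longrightarrow> bin_val u = bin_val v \<Longrightarrow> u = v"
proof (induction u v rule: list_induct2)
  case (Cons a u b v)
  then show ?case using bin_val_less[of u] bin_val_less[of v] by (cases a; cases b) (auto simp: bin_val_Cons)
qed simp

text \<open>The choice word \<open>u\<close> decides the comparison before the payload
  \<open>a\<close> is reached, and on equal choices the payloads agree.\<close>

lemma bin_val_infix_le: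
  assumes "length u = length v" "bin_val u \<le> bin_val v" "length a = length b" "u = v \<Longrightarrow> a = b"
  shows "bin_val (w @ u @ a) \<le> bin_val (w @ v @ b)"
proof (cases "u = v")
  case False
  then have "bin_val u < bin_val v" using assms(1,2) bin_val_inj[of u v] by linarith
  then have "(bin_val u + 1) * 2 ^ length b \<le> bin_val v * 2 ^ length b" by (intro mult_le_mono1) simp
  then show ?thesis using assms(1,3) bin_val_less[of a] by (simp add: bin_val_append)
qed (use assms in simp)

text \<open>Room for at most |x| leading zeros and the 1, and then still \<open>fuel\<close> choice
  bits.\<close>

definition num_choices :: "word \<Rightarrow> nat" where
  "num_choices x = fuel (length x) + length x + 1"

text \<open>Zeros up to a common length make the comparison of numbers a lexicographic one.\<close>

definition padded :: "(word \<times> word \<Rightarrow> word) \<Rightarrow> (word \<Rightarrow> nat) \<Rightarrow> word \<times> word \<Rightarrow> word" where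
  "padded R l z = R z @ replicate (l (fst z) - length (R z)) False"

text \<open>A failing guess outputs 0 and so loses against every successful one, whose output starts
  with a 1.\<close>

lemma padded_Nil: "R z = [] \<Longrightarrow> bin_val (padded R l z) = 0"
  using bin_val_leading_False[of _ "[]"] by (simp add: padded_def)

lemma bin_val_choices_mono:
  assumes "length cs' + k' = length cs + k" "k < k' \<or> k = k' \<and> bin_val cs' \<le> bin_val cs"
  shows "bin_val (replicate k' False @ True # cs') \<le> bin_val (replicate k False @ True # cs)"
proof (cases "k < k'")
  case True
  then have "Suc (length cs') \<le> length cs" using assms by linarith
  then have "(2 :: nat) ^ Suc (length cs') \<le> 2 ^ length cs" by (rule power_increasing) simp
  then show ?thesis using bin_val_less[of cs'] by (simp add: bin_val_leading_False bin_val_Cons)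
qed (use assms in \<open>auto simp: bin_val_leading_False bin_val_Cons\<close>)

lemma result_word_optimal:
  fixes W :: "'c::enum set"
  defines "R \<equiv> result_word (card (UNIV :: 'c set)) (char_codes TYPE('c)) (enc_charset W)"
  assumes l: "\<And>x c. length c = num_choices x \<Longrightarrow> length (R (x, c)) \<le> l x"
  shows "\<exists>c. length c = num_choices x \<and>
    (\<forall>c'. length c' = num_choices x \<longrightarrow> bin_val (padded R l (x, c')) \<le> bin_val (padded R l (x, c))) \<and>
    jsregmatch W js_regexes_no_lower_bound x = bin_val (unwrap (bin (bin_val (padded R l (x, c)))))"
proof -
  \<comment> \<open>If no guess succeeds, every output is 0, which decodes to the answer for no
    match.\<close>
  have trivial: ?thesis if R: "\<And>c. R (x, c) = []" and 0: "jsregmatch W js_regexes_no_lower_bound x = 0"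
  proof -
    have "unwrap [] = []" by (simp add: unwrap_def unpair_def)
    then show ?thesis using 0 padded_Nil[of R "(x, c)" l for c, OF R]
      by (intro exI[of _ "replicate (num_choices x) False"]) simp
  qed
  show ?thesis
  proof (cases "\<exists>r \<in> js_regexes_no_lower_bound :: 'c regex set. \<exists>s. x = enc_instance r s")
    case False
    then have "R (x, c) = []" for c
      unfolding R_def using well_formed_sound start_state_of_failed result_word_failed by blast
    moreover have "jsregmatch W js_regexes_no_lower_bound x = 0"
      using False by (simp add: jsregmatch_def)
    ultimately show ?thesis by (rule trivial)
  next
    case True
    then obtain r :: "'c regex" and s where r: "r \<in> js_regexes_no_lower_bound" and x: "x = enc_instance r s" by blast
    have lbf: "lower_bounded_free r" using r by (simp add: js_regexes_no_lower_bound_def)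
    define m where "m k = leaves W s [Areg r] k (\<lambda>_. Undefd)" for k
    have f: "jsregmatch W js_regexes_no_lower_bound x = enc_answer r (js_match W r s)"
      unfolding x by (rule jsregmatch_enc_instance[OF r])
    have success: "\<exists>k cs p \<gamma>. c = replicate k False @ True # cs \<and> k \<le> length s \<and> m k \<noteq> [] \<and>
        guided W s (fuel (length x)) ([Areg r], k, \<lambda>_. Undefd) cs = Some (p, \<gamma>)" if ne: "R (x, c) \<noteq> []" for c
    proof -
      obtain k cs where c: "c = replicate k False @ True # cs"
        using leading_False[of c] start_state_of_failed result_word_failed ne unfolding R_def by blast
      obtain res where k: "k \<le> length s"
        "guided W s (fuel (length x)) ([Areg r], k, \<lambda>_. Undefd) cs = Some res"
        using result_word_instance[OF r, of W s k cs] ne unfolding R_def x c by (auto split: if_splits option.splits)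
      moreover have "m k \<noteq> []" using guided_sound[OF k(2)] by (auto simp: m_def)
      ultimately show ?thesis using c by (cases res) blast
    qed
    show ?thesis
    proof (cases "\<exists>k\<le>length s. m k \<noteq> []")
      case False
      then have "R (x, c) = []" for c using success[of c] by blast
      moreover have "js_match W r s = None" using False unfolding js_match_def m_def Let_def by simp
      ultimately show ?thesis using trivial f by simp
    next
      case True
      define k where "k = (LEAST k. m k \<noteq> [])"
      obtain k1 where "k1 \<le> length s" "m k1 \<noteq> []" using True by blast
      then have k: "m k \<noteq> []" "k \<le> length s" and least: "\<And>k'. m k' \<noteq> [] \<Longrightarrow> k \<le> k'"
        unfolding k_def using Least_le[of "\<lambda>k. m k \<noteq> []"] LeastI[of "\<lambda>k. m k \<noteq> []" k1]
        by (auto intro: order_trans)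
      obtain p \<gamma> where hd: "hd (m k) = (p, \<gamma>)" by (cases "hd (m k)")
      have match: "js_match W r s = Some (k, p, \<gamma>)"
        using True hd unfolding js_match_def m_def[symmetric] k_def Let_def by simp
      \<comment> \<open>The choice bits behind the \<open>k\<close> zeros and the 1; there are at
        least \<open>fuel\<close> many, since \<open>k\<close> is at most |x|.\<close>
      define n where "n = fuel (length x) + length x - k"
      have len: "k \<le> length x" using k(2) length_enc_instance(1)[of r s] unfolding x by simp
      then have n: "fuel (length x) \<le> n" "num_choices x = k + 1 + n" by (simp_all add: n_def num_choices_def)
      note run = initial_run[OF lbf _ k(2), of "length x", OF eq_refl[OF arg_cong[OF x[symmetric]]]]
      have "proper (length x) (length x) ((44 + 4 * card (UNIV :: 'c set)) * length x) [Areg r]"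
        using run(1) unfolding proper_run_def by simp
      then obtain cs where cs: "length cs = n"
        "guided W s (fuel (length x)) ([Areg r], k, \<lambda>_. Undefd) cs = Some (p, \<gamma>)"
        "\<And>cs'. length cs' = n \<Longrightarrow> guided W s (fuel (length x)) ([Areg r], k, \<lambda>_. Undefd) cs' \<noteq> None \<Longrightarrow>
          bin_val cs' \<le> bin_val cs"
        using guided_optimal[OF _ k(2) run(2) n(1), where \<gamma> = "\<lambda>_. Undefd" and W = W] k(1) hd unfolding m_def by metis
      define c where "c = replicate k False @ True # cs"
      have lc: "length c = num_choices x" using cs(1) n(2) by (simp add: c_def)
      have Rc: "R (x, c) = replicate (num_choices x) True @ False # c @ pairs (answer_bits r k p \<gamma>)"
        unfolding R_def x c_def result_word_instance[OF r] using k(2) cs(2) lc by (simp add: x c_def)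
      have "bin_val (padded R l (x, c')) \<le> bin_val (padded R l (x, c))" if lc': "length c' = num_choices x" for c'
      proof (cases "R (x, c') = []")
        case True
        then show ?thesis by (simp add: padded_Nil)
      next
        case False
        obtain k' cs' p' \<gamma>' where c': "c' = replicate k' False @ True # cs'" "k' \<le> length s" "m k' \<noteq> []"
          "guided W s (fuel (length x)) ([Areg r], k', \<lambda>_. Undefd) cs' = Some (p', \<gamma>')"
          using success[OF False] by blast
        have Rc': "R (x, c') = replicate (num_choices x) True @ False # c' @ pairs (answer_bits r k' p' \<gamma>')"
          unfolding R_def x c'(1) result_word_instance[OF r] using c'(2,4) lc' by (simp add: x c'(1))
        have "bin_val c' \<le> bin_val c"
          unfolding c'(1) c_def
        proof (rule bin_val_choices_mono)
          show sum: "length cs' + k' = length cs + k" using lc lc' by (simp add: c'(1) c_def)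
          show "k < k' \<or> k = k' \<and> bin_val cs' \<le> bin_val cs"
            using least[OF c'(3)] cs(1,3) c'(4) sum by (cases "k = k'") auto
        qed
        moreover define a b where "a = pairs (answer_bits r k' p' \<gamma>') @ replicate (l x - length (R (x, c'))) False"
          and "b = pairs (answer_bits r k p \<gamma>) @ replicate (l x - length (R (x, c))) False"
        have V: "padded R l (x, c') = (replicate (num_choices x) True @ [False]) @ c' @ a"
          "padded R l (x, c) = (replicate (num_choices x) True @ [False]) @ c @ b"
          by (simp_all add: padded_def a_def b_def Rc Rc')
        moreover have "length (padded R l (x, c')) = length (padded R l (x, c))"
          using l[OF lc] l[OF lc'] by (simp add: padded_def)
        then have "length a = length b" using lc lc' by (simp add: V)
        moreover have "a = b" if "c' = c"
          using Rc Rc' that by (simp add: a_def b_def)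
        ultimately show ?thesis using lc lc' unfolding V by (intro bin_val_infix_le) auto
      qed
      \<comment> \<open>The word starts with a 1, so it can be recovered from its value.\<close>
      moreover have "bin (bin_val (padded R l (x, c))) = padded R l (x, c)"
        unfolding bin_bin_val_strip padded_def Rc by (simp add: num_choices_def)
      then have "unwrap (bin (bin_val (padded R l (x, c)))) = answer_bits r k p \<gamma>"
        using unwrap[of c "answer_bits r k p \<gamma>"] by (simp add: padded_def Rc lc)
      then have "jsregmatch W js_regexes_no_lower_bound x = bin_val (unwrap (bin (bin_val (padded R l (x, c)))))"
        unfolding f match by (simp add: answer_bits_def)
      ultimately show ?thesis using lc by blast
    qed
  qed
qed

lemma fp_num_choices: "fp f \<Longrightarrow> fp (\<lambda>x. num_choices (f x))"
proof (rule fp_comp[of f num_choices], assumption)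
  show "fp num_choices" unfolding num_choices_def[abs_def]
    by (intro fp_intros fp_fuel; (rule fp_comp[of fst], intro fp_intros)?)
qed

lemma fp_unwrap: "fp f \<Longrightarrow> fp (\<lambda>x. unwrap (f x))"
proof (rule fp_comp[of f unwrap], assumption)
  show "fp unwrap" unfolding unwrap_def[abs_def]
    by (intro fp_intros fp_unpair; (rule fp_comp[of fst], intro fp_intros)?)
qed

theorem solvable_jsregmatch:
  fixes W :: "'c::enum set"
  shows "solvable_in_OptP (jsregmatch W js_regexes_no_lower_bound)"
proof -
  let ?f = "jsregmatch W js_regexes_no_lower_bound"
  define R where "R = result_word (card (UNIV :: 'c set)) (char_codes TYPE('c)) (enc_charset W)"
  have R: "fp R" unfolding R_def by (rule fp_result_word)
  then obtain p :: "nat poly" where p: "\<And>z. csize (R z) \<le> poly p (csize z)"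
    unfolding fp_def by blast
  \<comment> \<open>All guesses for \<open>x\<close> have the same length, hence the outputs share a
    length bound; the constants come from the size of a coded pair of words.\<close>
  define l where "l x = poly p (3 + 4 * length x + 4 * num_choices x)" for x :: word
  have l: "length (R (x, c)) \<le> l x" if "length c = num_choices x" for x c
  proof -
    have "csize (x, c) \<le> 3 + 4 * length x + 4 * num_choices x"
      using csize_word[of x] csize_word[of c] that by simp
    then show ?thesis
      using length_le_csize[of "R (x, c)"] p[of "(x, c)"] poly_mono_nat[of "csize (x, c)" _ p] unfolding l_def by fastforce
  qed
  obtain c where c: "\<And>x. length (c x) = num_choices x"
    "\<And>x c'. length c' = num_choices x \<Longrightarrow> bin_val (padded R l (x, c')) \<le> bin_val (padded R l (x, c x))"
    "\<And>x. ?f x = bin_val (unwrap (bin (bin_val (padded R l (x, c x)))))"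
    using result_word_optimal[of W l, folded R_def, OF l] by metis
  have "(\<lambda>x. bin_val (padded R l (x, c x))) \<in> OptP"
  proof (rule OptP_guess_max[where V = "padded R l" and B = num_choices])
    show "fp (padded R l)" unfolding padded_def[abs_def] l_def
      by (intro fp_intros R fp_num_choices)
    show "fp num_choices" by (rule fp_num_choices[OF fp_id])
  qed (use c in auto)
  moreover have "poly_time_computable (\<lambda>n. [bin n]) bin (\<lambda>n. bin_val (unwrap (bin n)))"
  proof (rule poly_time_computable_fp[where u = bin and v = "\<lambda>_. []"])
    show "fp (\<lambda>z :: word \<times> word. dropWhile Not (unwrap (fst z)))" by (intro fp_intros fp_unwrap)
  qed (simp_all add: bin_bin_val_strip)
  ultimately show ?thesis unfolding solvable_in_OptP_def
    by (intro bexI[of _ "\<lambda>x. bin_val (padded R l (x, c x))"] exI[of _ "\<lambda>n. bin_val (unwrap (bin n))"] conjI allI c(3))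
qed

theorem mainTheorem5:
  fixes W :: "'c::enum set"
  shows "OptP_complete (jsregmatch W js_regexes_no_lower_bound)"
  unfolding OptP_complete_def by (intro conjI solvable_jsregmatch OptP_hard_jsregmatch)

end
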